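(* Let $P$ be a submonoid of a group $G$, with group of units $P^*=P\cap P^{-1}$. The following are equivalent: (1) the partial action of $G$ on $\Omega_P$ is topologically free; (2) the action of $P^*$ on $\Omega_P$ is topologically free; (3) if $u\in P^*\setminus\{e\}$ and $\mathcal C$ is a finite collection of proper constructible right ideals of $P$, then there exists $t\in P\setminus\bigcup_{R\in\mathcal C}R$ such that $utP\neq tP$ (or, equivalently, such that $ut\notin tP^*$); (4) every ideal of $\mathcal T_u(P)$ that has trivial intersection with $D_u$ is contained in the kernel of the left regular representation $\lambda^+\colon\mathcal T_u(P)\to\mathcal T_\lambda(P)$.
   Context: $P$ is a submonoid of a group $G$ with identity $e$. Ideals of $\mathrm C^*$-algebras are closed and two-sided. A word is a finite sequence $\alpha=(p_1,p_2,\ldots,p_{2k-1},p_{2k})$ of even length $2k\ge 0$ with entries in $P$; $\mathcal W$ is the set of all words (including the empty word). Put $\dot\alpha:=p_1^{-1}p_2\cdots p_{2k-1}^{-1}p_{2k}\in G$ (equal to $e$ for the empty word); $\alpha$ is neutral if $\dot\alpha=e$. Put $\tilde\alpha:=(p_{2k},p_{2k-1},\ldots,p_2,p_1)$ and $K(\alpha):=P\cap p_{2k}^{-1}p_{2k-1}P\cap p_{2k}^{-1}p_{2k-1}p_{2k-2}^{-1}p_{2k-3}P\cap\cdots\cap p_{2k}^{-1}p_{2k-1}\cdots p_2^{-1}p_1P$ (equal to $P$ for the empty word). The constructible right ideals of $P$ are the members of $\mathfrak J:=\{K(\alpha):\alpha\in\mathcal W\}$, which is closed under finite intersections. For a map $w\colon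 P\to B$ into a unital $\mathrm C^*$-algebra, $\dot w_\alpha:=w_{p_1}^*w_{p_2}\cdots w_{p_{2k-1}}^*w_{p_{2k}}$ ($=1$ for the empty word). $\mathcal T_u(P)$ is the universal $\mathrm C^*$-algebra with generators $\{t_p:p\in P\}$ subject to: (T1) $t_e=1$; (T2) $\dot t_\alpha=0$ if $\alpha$ is neutral and $K(\alpha)=\emptyset$; (T3) $\dot t_\alpha=\dot t_\beta$ if $\alpha,\beta$ are neutral and $K(\alpha)=K(\beta)$; (T4) $\prod_{\beta\in F}(\dot t_\alpha-\dot t_\beta)=0$ if $\alpha$ is neutral and $F$ is a finite set of neutral words with $K(\alpha)=\bigcup_{\beta\in F}K(\beta)$. $D_u:=\overline{\mathrm{span}}\{\dot t_\alpha:\dot\alpha=e\}\subseteq\mathcal T_u(P)$. $\mathcal T_\lambda(P)$ is the $\mathrm C^*$-algebra generated by the isometries $L_p\delta_q=\delta_{pq}$ on $\ell^2(P)$, and $\lambda^+\colon\mathcal T_u(P)\to\mathcal T_\lambda(P)$ is the canonical surjection $t_p\mapsto L_p$. $\Omega_P$ is the compact Hausdorff space (with the topology of pointwise convergence) of all nonzero functions $\chi\colon\mathfrak J\to\{0,1\}$ with $\chi(R\cap S)=\chi(R)\chi(S)$ for $R,S\in\mathfrak J$, $\chi(\emptyset)=0$ if $\emptyset\in\mathfrak J$, and such that whenever $S=\bigcup_{i=1}^nS_i$ with $S,S_i\in\mathfrak J$ and $\chi(S)=1$, then $\chi(S_i)=1$ for some $i$. It is the spectrum of $D_r=\overline{\mathrm{span}}\{\mathbb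 1_S:S\in\mathfrak J\}\subseteq\ell^\infty(P)$. The partial action $\hat\gamma$ of $G$ on $\Omega_P$: for $g\in G$, $U_{g^{-1}}:=\{\chi\in\Omega_P:\chi(K(\alpha))=1\text{ for some }\alpha\in\mathcal W\text{ with }\dot\alpha=g\}$ is open and $\hat\gamma_g\colon U_{g^{-1}}\to U_g$ is the homeomorphism induced by the bijection $K(\alpha)\mapsto gK(\alpha)=K(\tilde\alpha)$ from $\{K(\alpha):\dot\alpha=g\}$ onto $\{K(\beta):\dot\beta=g^{-1}\}$, so that $\hat\gamma_g(\chi)(K(\beta))=\chi(g^{-1}K(\beta))$ for $\dot\beta=g^{-1}$ (equivalently, it is dual to the partial action $\mathbb 1_{K(\alpha)}\mapsto\mathbb 1_{gK(\alpha)}$, $\dot\alpha=g$, on $D_r$). For $u\in P^*$, $U_u=\Omega_P$, so $P^*$ acts on $\Omega_P$ by homeomorphisms. A partial action of a discrete group $H$ by partial homeomorphisms $\theta_h\colon U_{h^{-1}}\to U_h$ is topologically free if for every $h\neq e$ the set $\{\chi\in U_{h^{-1}}:\theta_h(\chi)=\chi\}$ has empty interior. *)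

theory Defs
  imports
    "HOL-Analysis.Analysis"
    "HOL-Algebra.Ideal"
    "HOL-Algebra.Module"
    "HOL-Library.Poly_Mapping"
begin

section \<open>Words and constructible right ideals\<close>

text \<open>
  A word \<open>(p\<^sub>1, p\<^sub>2, \<dots>, p\<^sub>2\<^sub>k\<^sub>-\<^sub>1, p\<^sub>2\<^sub>k)\<close> is encoded as the list of consecutive pairs
  \<open>[(p\<^sub>1, p\<^sub>2), \<dots>, (p\<^sub>2\<^sub>k\<^sub>-\<^sub>1, p\<^sub>2\<^sub>k)]\<close>, which makes the even length automatic.
\<close>

type_synonym 'g word = "('g \<times> 'g) list"

definition words :: "'g set \<Rightarrow> 'g word set"
  where "words P = lists (P \<times> P)"

fun word_val :: "('g, 'm) monoid_scheme \<Rightarrow> 'g word \<Rightarrow> 'g"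
  where
    "word_val G [] = \<one>\<^bsub>G\<^esub>"
  | "word_val G ((p, q) # \<alpha>) = inv\<^bsub>G\<^esub> p \<otimes>\<^bsub>G\<^esub> q \<otimes>\<^bsub>G\<^esub> word_val G \<alpha>"

definition neutral_words :: "('g, 'm) monoid_scheme \<Rightarrow> 'g set \<Rightarrow> 'g word set"
  where "neutral_words G P = {\<alpha> \<in> words P. word_val G \<alpha> = \<one>\<^bsub>G\<^esub>}"

text \<open>
  The translates of \<open>P\<close> occurring in \<open>K(\<alpha>)\<close> are \<open>\<sigma>\<^sup>-\<^sup>1P\<close>, where \<open>\<sigma>\<close> runs through the
  values \<open>p\<^sub>2\<^sub>i\<^sub>-\<^sub>1\<^sup>-\<^sup>1p\<^sub>2\<^sub>i \<dots> p\<^sub>2\<^sub>k\<^sub>-\<^sub>1\<^sup>-\<^sup>1p\<^sub>2\<^sub>k\<close> of the even suffixes of \<open>\<alpha>\<close>.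
\<close>

fun K_ideal :: "('g, 'm) monoid_scheme \<Rightarrow> 'g set \<Rightarrow> 'g word \<Rightarrow> 'g set"
  where
    "K_ideal G P [] = P"
  | "K_ideal G P ((p, q) # \<alpha>) =
       K_ideal G P \<alpha> \<inter> (inv\<^bsub>G\<^esub> (word_val G ((p, q) # \<alpha>)) <#\<^bsub>G\<^esub> P)"

definition constructible :: "('g, 'm) monoid_scheme \<Rightarrow> 'g set \<Rightarrow> 'g set set"
  where "constructible G P = K_ideal G P ` words P"

definition unit_group :: "('g, 'm) monoid_scheme \<Rightarrow> 'g set \<Rightarrow> 'g set"
  where "unit_group G P = P \<inter> m_inv G ` P"


section \<open>The space of characters and the partial action\<close>

definition Omega :: "('g, 'm) monoid_scheme \<Rightarrow> 'g set \<Rightarrow> ('g set \<Rightarrow> nat) set"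
  where "Omega G P = {\<xi> \<in> constructible G P \<rightarrow>\<^sub>E {0, 1}.
     (\<exists>S\<in>constructible G P. \<xi> S \<noteq> 0) \<and>
     (\<forall>R\<in>constructible G P. \<forall>S\<in>constructible G P. \<xi> (R \<inter> S) = \<xi> R * \<xi> S) \<and>
     ({} \<in> constructible G P \<longrightarrow> \<xi> {} = 0) \<and>
     (\<forall>S\<in>constructible G P. \<forall>\<F>. finite \<F> \<and> \<F> \<subseteq> constructible G P \<and> S = \<Union>\<F> \<and> \<xi> S = 1
        \<longrightarrow> (\<exists>R\<in>\<F>. \<xi> R = 1))}"

definition Omega_topology :: "('g, 'm) monoid_scheme \<Rightarrow> 'g set \<Rightarrow> ('g set \<Rightarrow> nat) topology"
  where "Omega_topology G P =
    subtopology (product_topology (\<lambda>_. discrete_topology {0, 1}) (constructible G P)) (Omega G P)"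

text \<open>\<open>gamma_dom G P g\<close> is \<open>U\<^sub>g\<close>, so the domain of \<open>\<gamma>\<^sub>g\<close> is \<open>gamma_dom G P (inv g)\<close>.\<close>

definition gamma_dom :: "('g, 'm) monoid_scheme \<Rightarrow> 'g set \<Rightarrow> 'g \<Rightarrow> ('g set \<Rightarrow> nat) set"
  where "gamma_dom G P g =
    {\<xi> \<in> Omega G P. \<exists>\<alpha>\<in>words P. word_val G \<alpha> = inv\<^bsub>G\<^esub> g \<and> \<xi> (K_ideal G P \<alpha>) = 1}"

text \<open>
  An element of \<open>U\<^sub>g\<close> is determined by its values on the \<open>K(\<beta>)\<close> with \<open>\<beta>\<close> of value \<open>g\<^sup>-\<^sup>1\<close>: it
  takes the value 1 at some such \<open>K(\<beta>)\<close>, and these sets are stable under intersection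
  with arbitrary constructible ideals.
\<close>

definition gamma_hat ::
    "('g, 'm) monoid_scheme \<Rightarrow> 'g set \<Rightarrow> 'g \<Rightarrow> ('g set \<Rightarrow> nat) \<Rightarrow> ('g set \<Rightarrow> nat)"
  where "gamma_hat G P g \<xi> =
    (THE \<psi>. \<psi> \<in> gamma_dom G P g \<and>
       (\<forall>\<beta>\<in>words P. word_val G \<beta> = inv\<^bsub>G\<^esub> g
          \<longrightarrow> \<psi> (K_ideal G P \<beta>) = \<xi> (inv\<^bsub>G\<^esub> g <#\<^bsub>G\<^esub> K_ideal G P \<beta>)))"

definition topologically_free ::
    "('h, 'm) monoid_scheme \<Rightarrow> 'x topology \<Rightarrow> ('h \<Rightarrow> 'x set) \<Rightarrow> ('h \<Rightarrow> 'x \<Rightarrow> 'x) \<Rightarrow> bool"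
  where "topologically_free H X U \<theta> \<longleftrightarrow>
    (\<forall>h\<in>carrier H. h \<noteq> \<one>\<^bsub>H\<^esub> \<longrightarrow> X interior_of {x \<in> U (inv\<^bsub>H\<^esub> h). \<theta> h x = x} = {})"


section \<open>Normed complex *-algebras\<close>

record 'b star_algebra = "(complex, 'b) module" +
  star :: "'b \<Rightarrow> 'b"

record 'b normed_star_algebra = "'b star_algebra" +
  cnorm :: "'b \<Rightarrow> real"

definition star_homs ::
    "('a, 'm) star_algebra_scheme \<Rightarrow> ('b, 'n) star_algebra_scheme \<Rightarrow> ('a \<Rightarrow> 'b) set"
  where "star_homs A B = {h \<in> ring_hom A B.
     (\<forall>c. \<forall>x\<in>carrier A. h (c \<odot>\<^bsub>A\<^esub> x) = c \<odot>\<^bsub>B\<^esub> h x) \<and>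
     (\<forall>x\<in>carrier A. h (star A x) = star B (h x))}"

definition norm_closure :: "('b, 'm) normed_star_algebra_scheme \<Rightarrow> 'b set \<Rightarrow> 'b set"
  where "norm_closure A S = {x \<in> carrier A. \<forall>e>0. \<exists>y\<in>S. cnorm A (x \<ominus>\<^bsub>A\<^esub> y) < e}"

definition norm_closed :: "('b, 'm) normed_star_algebra_scheme \<Rightarrow> 'b set \<Rightarrow> bool"
  where "norm_closed A S \<longleftrightarrow> S \<subseteq> carrier A \<and> norm_closure A S \<subseteq> S"

definition linear_subspace :: "('b, 'm) star_algebra_scheme \<Rightarrow> 'b set \<Rightarrow> bool"
  where "linear_subspace A V \<longleftrightarrow> V \<subseteq> carrier A \<and> \<zero>\<^bsub>A\<^esub> \<in> V \<and>
     (\<forall>x\<in>V. \<forall>y\<in>V. x \<oplus>\<^bsub>A\<^esub> y \<in> V) \<and> (\<forall>c. \<forall>x\<in>V. c \<odot>\<^bsub>A\<^esub> x \<in> V)"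

definition linear_span :: "('b, 'm) star_algebra_scheme \<Rightarrow> 'b set \<Rightarrow> 'b set"
  where "linear_span A S = \<Inter>{V. linear_subspace A V \<and> S \<subseteq> V}"

definition star_subalgebra :: "('b, 'm) star_algebra_scheme \<Rightarrow> 'b set \<Rightarrow> bool"
  where "star_subalgebra A B \<longleftrightarrow> linear_subspace A B \<and>
     (\<forall>x\<in>B. \<forall>y\<in>B. x \<otimes>\<^bsub>A\<^esub> y \<in> B) \<and> (\<forall>x\<in>B. star A x \<in> B)"

definition cstar_generated ::
    "('b, 'm) normed_star_algebra_scheme \<Rightarrow> 'b set \<Rightarrow> ('b, 'm) normed_star_algebra_scheme"
  where "cstar_generated A S =
    A\<lparr>carrier := \<Inter>{B. star_subalgebra A B \<and> norm_closed A B \<and> S \<subseteq> B}\<rparr>"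

text \<open>The product \<open>w(p\<^sub>1)\<^sup>* w(p\<^sub>2) \<dots> w(p\<^sub>2\<^sub>k\<^sub>-\<^sub>1)\<^sup>* w(p\<^sub>2\<^sub>k)\<close>.\<close>

fun word_prod :: "('b, 'm) star_algebra_scheme \<Rightarrow> ('g \<Rightarrow> 'b) \<Rightarrow> 'g word \<Rightarrow> 'b"
  where
    "word_prod A w [] = \<one>\<^bsub>A\<^esub>"
  | "word_prod A w ((p, q) # \<alpha>) = star A (w p) \<otimes>\<^bsub>A\<^esub> w q \<otimes>\<^bsub>A\<^esub> word_prod A w \<alpha>"


section \<open>Universal C*-algebras\<close>

text \<open>
  Free unital *-algebra: finitely supported complex functions on the free monoid in the
  letters \<open>x\<close>, \<open>x\<^sup>*\<close>, with convolution as multiplication. The free monoid is written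
  additively because \<^theory>\<open>HOL-Library.Poly_Mapping\<close> convolves along \<open>+\<close>.
\<close>

datatype 'x letter = Gen 'x | Gen_star 'x

datatype 'x monomial = Monomial (letters: "'x letter list")

instantiation monomial :: (type) monoid_add
begin

definition zero_monomial :: "'x monomial"
  where "zero_monomial = Monomial []"

definition plus_monomial :: "'x monomial \<Rightarrow> 'x monomial \<Rightarrow> 'x monomial"
  where "plus_monomial v w = Monomial (letters v @ letters w)"

instance
  by standard (simp_all add: zero_monomial_def plus_monomial_def)

end

type_synonym 'x free_elem = "('x monomial, complex) poly_mapping"

fun letter_star :: "'x letter \<Rightarrow> 'x letter"
  where
    "letter_star (Gen x) = Gen_star x"
  | "letter_star (Gen_star x) = Gen x"

definition monomial_star :: "'x monomial \<Rightarrow> 'x monomial"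
  where "monomial_star w = Monomial (rev (map letter_star (letters w)))"

definition free_star_algebra :: "'x set \<Rightarrow> 'x free_elem star_algebra"
  where "free_star_algebra X =
    \<lparr>carrier = {a. \<forall>w\<in>Poly_Mapping.keys a. set (letters w) \<subseteq> Gen ` X \<union> Gen_star ` X},
     mult = (*), one = 1, zero = 0, add = (+),
     smult = (\<lambda>c a. Poly_Mapping.single 0 c * a),
     star = (\<lambda>a. \<Sum>w\<in>Poly_Mapping.keys a.
       Poly_Mapping.single (monomial_star w) (cnj (Poly_Mapping.lookup a w)))\<rparr>"

definition free_gen :: "'x \<Rightarrow> 'x free_elem"
  where "free_gen x = Poly_Mapping.single (Monomial [Gen x]) 1"

text \<open>
  The C*-seminorms on a *-algebra that vanish on \<open>R\<close> are exactly the functions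
  \<open>a \<mapsto> \<parallel>\<pi>(a)\<parallel>\<close> with \<open>\<pi>\<close> a *-homomorphism into a C*-algebra annihilating \<open>R\<close>. Hence
  \<open>universal_seminorm\<close> is the supremum of \<open>\<parallel>\<pi>(a)\<parallel>\<close> over all representations \<open>\<pi>\<close> of the
  relations, without a quantification over types. As always for universal C*-algebras,
  it is meaningful only if this supremum is finite, as it is when the relations make the
  generators isometries.
\<close>

definition cstar_seminorms :: "('b, 'm) star_algebra_scheme \<Rightarrow> 'b set \<Rightarrow> ('b \<Rightarrow> real) set"
  where "cstar_seminorms A R = {q.
     (\<forall>x\<in>carrier A. \<forall>y\<in>carrier A. q (x \<oplus>\<^bsub>A\<^esub> y) \<le> q x + q y) \<and>
     (\<forall>c. \<forall>x\<in>carrier A. q (c \<odot>\<^bsub>A\<^esub> x) = cmod c * q x) \<and>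
     (\<forall>x\<in>carrier A. \<forall>y\<in>carrier A. q (x \<otimes>\<^bsub>A\<^esub> y) \<le> q x * q y) \<and>
     (\<forall>x\<in>carrier A. q (star A x \<otimes>\<^bsub>A\<^esub> x) = (q x)\<^sup>2) \<and>
     (\<forall>r\<in>R. q r = 0)}"

definition universal_seminorm :: "('b, 'm) star_algebra_scheme \<Rightarrow> 'b set \<Rightarrow> 'b \<Rightarrow> real"
  where "universal_seminorm A R a = (SUP q\<in>cstar_seminorms A R. q a)"

text \<open>The Hausdorff completion of \<open>A\<close> with respect to a seminorm \<open>q\<close>: Cauchy sequences
  modulo sequences whose difference tends to zero.\<close>

definition cauchy_seqs :: "('b, 'm) star_algebra_scheme \<Rightarrow> ('b \<Rightarrow> real) \<Rightarrow> (nat \<Rightarrow> 'b) set"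
  where "cauchy_seqs A q = {x. (\<forall>n. x n \<in> carrier A) \<and>
     (\<forall>e>0. \<exists>N. \<forall>m\<ge>N. \<forall>n\<ge>N. q (x m \<ominus>\<^bsub>A\<^esub> x n) < e)}"

definition cauchy_rel :: "('b, 'm) star_algebra_scheme \<Rightarrow> ('b \<Rightarrow> real) \<Rightarrow> (nat \<Rightarrow> 'b) rel"
  where "cauchy_rel A q = {(x, y). x \<in> cauchy_seqs A q \<and> y \<in> cauchy_seqs A q \<and>
     (\<lambda>n. q (x n \<ominus>\<^bsub>A\<^esub> y n)) \<longlonglongrightarrow> 0}"

definition completion ::
    "('b, 'm) star_algebra_scheme \<Rightarrow> ('b \<Rightarrow> real) \<Rightarrow> (nat \<Rightarrow> 'b) set normed_star_algebra"
  where "completion A q =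
    \<lparr>carrier = cauchy_seqs A q // cauchy_rel A q,
     mult = (\<lambda>C D. \<Union>x\<in>C. \<Union>y\<in>D. cauchy_rel A q `` {\<lambda>n. x n \<otimes>\<^bsub>A\<^esub> y n}),
     one = cauchy_rel A q `` {\<lambda>_. \<one>\<^bsub>A\<^esub>},
     zero = cauchy_rel A q `` {\<lambda>_. \<zero>\<^bsub>A\<^esub>},
     add = (\<lambda>C D. \<Union>x\<in>C. \<Union>y\<in>D. cauchy_rel A q `` {\<lambda>n. x n \<oplus>\<^bsub>A\<^esub> y n}),
     smult = (\<lambda>c C. \<Union>x\<in>C. cauchy_rel A q `` {\<lambda>n. c \<odot>\<^bsub>A\<^esub> x n}),
     star = (\<lambda>C. \<Union>x\<in>C. cauchy_rel A q `` {\<lambda>n. star A (x n)}),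
     cnorm = (\<lambda>C. THE r. \<exists>x\<in>C. (\<lambda>n. q (x n)) \<longlonglongrightarrow> r)\<rparr>"

definition universal_cstar ::
    "'x set \<Rightarrow> 'x free_elem set \<Rightarrow> (nat \<Rightarrow> 'x free_elem) set normed_star_algebra"
  where "universal_cstar X R =
    completion (free_star_algebra X) (universal_seminorm (free_star_algebra X) R)"

definition universal_gen :: "'x set \<Rightarrow> 'x free_elem set \<Rightarrow> 'x \<Rightarrow> (nat \<Rightarrow> 'x free_elem) set"
  where "universal_gen X R x =
    cauchy_rel (free_star_algebra X) (universal_seminorm (free_star_algebra X) R)
      `` {\<lambda>_. free_gen x}"


section \<open>The universal Toeplitz algebra\<close>

text \<open>
  (T4): the factors commute modulo (T3), so the product over a finite set may be written
  along any enumeration. The finite set has to be nonempty: for \<open>K(\<alpha>) = \<emptyset>\<close> the empty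
  product would impose \<open>1 = 0\<close>.
\<close>

definition toeplitz_relations ::
    "('g, 'm) monoid_scheme \<Rightarrow> 'g set \<Rightarrow> 'g free_elem set"
  where "toeplitz_relations G P =
    (let N = neutral_words G P; K = K_ideal G P;
         t = word_prod (free_star_algebra P) free_gen in
       {free_gen \<one>\<^bsub>G\<^esub> - 1} \<union>
       {t \<alpha> |\<alpha>. \<alpha> \<in> N \<and> K \<alpha> = {}} \<union>
       {t \<alpha> - t \<beta> |\<alpha> \<beta>. \<alpha> \<in> N \<and> \<beta> \<in> N \<and> K \<alpha> = K \<beta>} \<union>
       {prod_list (map (\<lambda>\<beta>. t \<alpha> - t \<beta>) \<beta>s) |\<alpha> \<beta>s.
          \<alpha> \<in> N \<and> set \<beta>s \<subseteq> N \<and> distinct \<beta>s \<and> \<beta>s \<noteq> [] \<and> K \<alpha> = (\<Union>\<beta>\<in>set \<beta>s. K \<beta>)})"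

definition Toeplitz_u ::
    "('g, 'm) monoid_scheme \<Rightarrow> 'g set \<Rightarrow> (nat \<Rightarrow> 'g free_elem) set normed_star_algebra"
  where "Toeplitz_u G P = universal_cstar P (toeplitz_relations G P)"

definition toeplitz_gen ::
    "('g, 'm) monoid_scheme \<Rightarrow> 'g set \<Rightarrow> 'g \<Rightarrow> (nat \<Rightarrow> 'g free_elem) set"
  where "toeplitz_gen G P = universal_gen P (toeplitz_relations G P)"

definition D_u ::
    "('g, 'm) monoid_scheme \<Rightarrow> 'g set \<Rightarrow> (nat \<Rightarrow> 'g free_elem) set set"
  where "D_u G P = norm_closure (Toeplitz_u G P) (linear_span (Toeplitz_u G P)
    (word_prod (Toeplitz_u G P) (toeplitz_gen G P) ` neutral_words G P))"


section \<open>The reduced Toeplitz algebra\<close>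

text \<open>Vectors in \<open>\<ell>\<^sup>2(X)\<close> are functions on the ambient type that vanish outside \<open>X\<close>;
  operators on \<open>\<ell>\<^sup>2(X)\<close> are extensional functions.\<close>

definition ell2 :: "'x set \<Rightarrow> ('x \<Rightarrow> complex) set"
  where "ell2 X = {f. (\<forall>x. x \<notin> X \<longrightarrow> f x = 0) \<and> (\<lambda>x. (cmod (f x))\<^sup>2) summable_on X}"

definition ell2_norm :: "'x set \<Rightarrow> ('x \<Rightarrow> complex) \<Rightarrow> real"
  where "ell2_norm X f = sqrt (\<Sum>\<^sub>\<infinity>x\<in>X. (cmod (f x))\<^sup>2)"

definition ell2_inner :: "'x set \<Rightarrow> ('x \<Rightarrow> complex) \<Rightarrow> ('x \<Rightarrow> complex) \<Rightarrow> complex"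
  where "ell2_inner X f g = (\<Sum>\<^sub>\<infinity>x\<in>X. f x * cnj (g x))"

definition bounded_operators ::
    "'x set \<Rightarrow> (('x \<Rightarrow> complex) \<Rightarrow> ('x \<Rightarrow> complex)) normed_star_algebra"
  where "bounded_operators X =
    \<lparr>carrier = {T \<in> ell2 X \<rightarrow>\<^sub>E ell2 X.
       (\<forall>f\<in>ell2 X. \<forall>g\<in>ell2 X. T (\<lambda>x. f x + g x) = (\<lambda>x. T f x + T g x)) \<and>
       (\<forall>c. \<forall>f\<in>ell2 X. T (\<lambda>x. c * f x) = (\<lambda>x. c * T f x)) \<and>
       (\<exists>C. \<forall>f\<in>ell2 X. ell2_norm X (T f) \<le> C * ell2_norm X f)},
     mult = (\<lambda>S T. \<lambda>f\<in>ell2 X. S (T f)),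
     one = (\<lambda>f\<in>ell2 X. f),
     zero = (\<lambda>f\<in>ell2 X. \<lambda>_. 0),
     add = (\<lambda>S T. \<lambda>f\<in>ell2 X. \<lambda>x. S f x + T f x),
     smult = (\<lambda>c T. \<lambda>f\<in>ell2 X. \<lambda>x. c * T f x),
     star = (\<lambda>T. \<lambda>g\<in>ell2 X. THE h. h \<in> ell2 X \<and>
       (\<forall>f\<in>ell2 X. ell2_inner X (T f) g = ell2_inner X f h)),
     cnorm = (\<lambda>T. SUP f\<in>{f \<in> ell2 X. ell2_norm X f \<le> 1}. ell2_norm X (T f))\<rparr>"

text \<open>The isometry with \<open>L\<^sub>p \<delta>\<^sub>q = \<delta>\<^sub>p\<^sub>q\<close>.\<close>

definition left_regular ::
    "('g, 'm) monoid_scheme \<Rightarrow> 'g set \<Rightarrow> 'g \<Rightarrow> ('g \<Rightarrow> complex) \<Rightarrow> ('g \<Rightarrow> complex)"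
  where "left_regular G P p =
    (\<lambda>f\<in>ell2 P. \<lambda>r. if r \<in> p <#\<^bsub>G\<^esub> P then f (inv\<^bsub>G\<^esub> p \<otimes>\<^bsub>G\<^esub> r) else 0)"

definition Toeplitz_lambda ::
    "('g, 'm) monoid_scheme \<Rightarrow> 'g set
      \<Rightarrow> (('g \<Rightarrow> complex) \<Rightarrow> ('g \<Rightarrow> complex)) normed_star_algebra"
  where "Toeplitz_lambda G P = cstar_generated (bounded_operators P) (left_regular G P ` P)"

text \<open>The unique unital *-homomorphism sending \<open>t\<^sub>p\<close> to \<open>L\<^sub>p\<close>.\<close>

definition lambda_plus ::
    "('g, 'm) monoid_scheme \<Rightarrow> 'g set
      \<Rightarrow> (nat \<Rightarrow> 'g free_elem) set \<Rightarrow> ('g \<Rightarrow> complex) \<Rightarrow> ('g \<Rightarrow> complex)"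
  where "lambda_plus G P =
    (THE h. h \<in> star_homs (Toeplitz_u G P) (Toeplitz_lambda G P) \<and>
       h \<in> extensional (carrier (Toeplitz_u G P)) \<and>
       (\<forall>p\<in>P. h (toeplitz_gen G P p) = left_regular G P p))"

end

theory Submission
  imports Defs
begin

text \<open>
  The characters of the points of \<open>P\<close> are dense in \<open>\<Omega>\<^sub>P\<close>, and a group element \<open>g\<close> fixes the
  character of \<open>s\<close> only if \<open>s\<^sup>-\<^sup>1gs\<close> is a unit. Condition (3) therefore allows us to move any point
  within a basic neighbourhood of its character to a point whose character is moved by each
  one of finitely many prescribed elements. This gives (1).

  It also gives (4). If \<open>a\<close> lies in a closed ideal \<open>I\<close> but not in the kernel of \<open>\<lambda>\<^sup>+\<close>, approximate
  \<open>a\<^sup>*a\<close> by a finite combination \<open>b\<close> of words and compress it by a projection \<open>f\<close> of \<open>D\<^sub>u\<close>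
  concentrated near such a point: the non-neutral words vanish and \<open>fbf = cf\<close> with \<open>c\<close> bounded
  away from zero. Hence \<open>f\<close> is at distance less than 1 from an element of \<open>I\<close> in its corner, which
  forces \<open>f \<in> I \<inter> D\<^sub>u\<close>.

  Conversely, the representation on \<open>\<ell>\<^sup>2(P/P\<^sup>*)\<close> is isometric on \<open>D\<^sub>u\<close>. If (3) fails for \<open>u\<close> and \<open>\<C>\<close>,
  it kills \<open>(t\<^sub>u - 1) \<Prod>(1 - e\<^sub>R)\<close>, where \<open>R\<close> runs through \<open>\<C>\<close> and \<open>e\<^sub>R\<close> is the projection of \<open>R\<close>,
  but \<open>\<lambda>\<^sup>+\<close> does not.
\<close>

section \<open>Words and constructible ideals\<close>

text \<open>All statements about D_u rest on one inequality. By (T4), a C*-seminorm that respects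
  the relations is, on a combination of neutral words, at most the supremum over P of the function
  obtained by replacing each word with the indicator of its ideal K (\<open>D0_bound\<close>). A
  representation on cosets of units attains every value of that function, because right ideals are
  unions of such cosets. So these representations have the same norm on the diagonal as the
  universal algebra, and the kernel of each of them meets D_u trivially. An element of the universal
  algebra is a class of Cauchy sequences in the free *-algebra. Identities are therefore proved in
  the free algebra up to elements of seminorm 0 (\<open>eqv\<close>) and pass to classes term by
  term. The map \<open>lambda_plus\<close> is specified by algebraic properties alone, so its
  uniqueness needs automatic continuity of *-homomorphisms. The Neumann series supplies it without
  spectral theory.\<close>

locale group_submonoid = group G + P: submonoid P G
  for G :: "('g, 'm) monoid_scheme" (structure) and P :: "'g set"
begin

abbreviation "val \<equiv> word_val G"
abbreviation "K \<equiv> K_ideal G P"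
abbreviation "J \<equiv> constructible G P"
abbreviation "U\<^sub>P \<equiv> unit_group G P"

definition word_tilde :: "'g word \<Rightarrow> 'g word"
  where "word_tilde \<alpha> = rev (map (\<lambda>(p, q). (q, p)) \<alpha>)"

lemma P_carrier [simp]: "p \<in> P \<Longrightarrow> p \<in> carrier G"
  using P.subset by blast

lemma l_coset_iff: "x \<in> g <# A \<longleftrightarrow> inv g \<otimes> x \<in> A"
  if "A \<subseteq> carrier G" "g \<in> carrier G" "x \<in> carrier G"
proof -
  have "inv g \<otimes> (g \<otimes> a) = a" if "a \<in> A" for a
    using that \<open>A \<subseteq> carrier G\<close> \<open>g \<in> carrier G\<close> by (simp add: m_assoc [symmetric] subset_iff)
  moreover have "g \<otimes> (inv g \<otimes> x) = x"
    using that by (simp add: m_assoc [symmetric])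
  ultimately show ?thesis
    unfolding l_coset_def by force
qed

lemma inv_mult_cancel [simp]:
  "g \<in> carrier G \<Longrightarrow> x \<in> carrier G \<Longrightarrow> inv g \<otimes> (g \<otimes> x) = x"
  "g \<in> carrier G \<Longrightarrow> x \<in> carrier G \<Longrightarrow> g \<otimes> (inv g \<otimes> x) = x"
  by (simp_all add: m_assoc [symmetric])

lemma words_simps [simp]:
  "[] \<in> words P" "(p, q) # \<alpha> \<in> words P \<longleftrightarrow> p \<in> P \<and> q \<in> P \<and> \<alpha> \<in> words P"
  "\<alpha> @ \<beta> \<in> words P \<longleftrightarrow> \<alpha> \<in> words P \<and> \<beta> \<in> words P"
  by (auto simp: words_def)

lemma word_induct [consumes 1, case_names Nil Cons]:
  assumes "\<alpha> \<in> words P" "Q []"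
    and "\<And>p q \<alpha>. p \<in> P \<Longrightarrow> q \<in> P \<Longrightarrow> \<alpha> \<in> words P \<Longrightarrow> Q \<alpha> \<Longrightarrow> Q ((p, q) # \<alpha>)"
  shows "Q \<alpha>"
  using assms(1) by (induction \<alpha>) (use assms(2,3) in auto)

lemma val_carrier [simp]: "\<alpha> \<in> words P \<Longrightarrow> val \<alpha> \<in> carrier G"
  by (induction \<alpha> rule: word_induct) auto

lemma K_subset: "K \<alpha> \<subseteq> P"
  by (induction \<alpha>) auto

lemma K_in_P: "x \<in> K \<alpha> \<Longrightarrow> x \<in> P"
  using K_subset by blast

text \<open>Moving each even suffix to the other side turns the translates of P in K(\<alpha>) into
  conditions on x: every even suffix of \<alpha> must carry x into P. This form replaces the
  recursive equation, which leaves the simp set below.\<close>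

lemma K_Cons: "x \<in> K ((p, q) # \<alpha>) \<longleftrightarrow> x \<in> K \<alpha> \<and> val ((p, q) # \<alpha>) \<otimes> x \<in> P"
  if "p \<in> P" "q \<in> P" "\<alpha> \<in> words P"
  using that K_in_P l_coset_iff [of P "inv (val ((p, q) # \<alpha>))" x]
  by (auto simp: P.subset simp del: word_val.simps(2))

declare K_ideal.simps(2) [simp del] word_val.simps(2) [simp del]

lemma val_append: "val (\<alpha> @ \<beta>) = val \<alpha> \<otimes> val \<beta>" if "\<alpha> \<in> words P" "\<beta> \<in> words P"
  using that by (induction \<alpha> rule: word_induct) (simp_all add: m_assoc word_val.simps(2))

lemma val_single: "val [(p, q)] = inv p \<otimes> q" if "p \<in> P" "q \<in> P"
  using that by (simp add: word_val.simps(2))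

text \<open>A suffix of \<alpha> @ \<beta> that is longer than \<beta> acts on x by first applying
  all of \<beta>, so its condition is one of \<alpha> at the point
  \<open>val \<beta> \<otimes> x\<close>. Words thus behave as partial maps composed from the
  right.\<close>

lemma K_append: "x \<in> K (\<alpha> @ \<beta>) \<longleftrightarrow> x \<in> K \<beta> \<and> val \<beta> \<otimes> x \<in> K \<alpha>"
  if "\<alpha> \<in> words P" "\<beta> \<in> words P"
  using that(1)
proof (induction \<alpha> rule: word_induct)
  case Nil
  have "x \<in> K \<beta> \<Longrightarrow> val \<beta> \<otimes> x \<in> P"
    using that(2)
  proof (induction \<beta> arbitrary: x rule: word_induct)
    case Nil then show ?case by simp
  next
    case (Cons p q \<alpha>) then show ?case by (simp add: K_Cons)
  qed
  then show ?case by auto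
next
  case (Cons p q \<alpha>)
  have "val ((p, q) # \<alpha>) \<otimes> (val \<beta> \<otimes> x) = val ((p, q) # \<alpha> @ \<beta>) \<otimes> x" if "x \<in> P"
    using Cons that \<open>\<beta> \<in> words P\<close> by (simp add: word_val.simps(2) val_append m_assoc)
  then show ?case
    using Cons \<open>\<beta> \<in> words P\<close> by (auto simp: K_Cons dest: K_in_P)
qed

lemma K_val_in_P: "x \<in> K \<alpha> \<Longrightarrow> \<alpha> \<in> words P \<Longrightarrow> val \<alpha> \<otimes> x \<in> P"
  using K_append [of "[]" \<alpha> x] by simp

lemma K_single: "x \<in> K [(p, q)] \<longleftrightarrow> x \<in> P \<and> inv p \<otimes> q \<otimes> x \<in> P" if "p \<in> P" "q \<in> P"
  using that by (simp add: K_Cons val_single)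

lemma K_right_ideal: "x \<in> K \<alpha> \<Longrightarrow> t \<in> P \<Longrightarrow> x \<otimes> t \<in> K \<alpha>" if "\<alpha> \<in> words P"
  using that
proof (induction \<alpha> rule: word_induct)
  case (Cons p q \<alpha>)
  then show ?case
    using K_in_P [of x \<alpha>] by (auto simp: K_Cons m_assoc [symmetric])
qed auto

lemma tilde_words [simp]: "word_tilde \<alpha> \<in> words P \<longleftrightarrow> \<alpha> \<in> words P"
  by (auto simp: word_tilde_def words_def)

lemma tilde_simps [simp]:
  "word_tilde [] = []" "word_tilde ((p, q) # \<alpha>) = word_tilde \<alpha> @ [(q, p)]"
  "word_tilde (\<alpha> @ \<beta>) = word_tilde \<beta> @ word_tilde \<alpha>" "word_tilde (word_tilde \<alpha>) = \<alpha>"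
  by (auto simp: word_tilde_def rev_map comp_def case_prod_unfold)

lemma val_tilde [simp]: "val (word_tilde \<alpha>) = inv (val \<alpha>)" if "\<alpha> \<in> words P"
  using that
  by (induction \<alpha> rule: word_induct)
    (simp_all add: val_append val_single word_val.simps(2) inv_mult_group m_assoc)

text \<open>Along \<alpha> the point x is moved by longer and longer suffixes, and membership in K
  says that all these points lie in P. The reversed word, started at the endpoint, runs through the
  same points backwards.\<close>

lemma K_tilde: "val \<alpha> \<otimes> x \<in> K (word_tilde \<alpha>) \<longleftrightarrow> x \<in> K \<alpha>"
  if "\<alpha> \<in> words P" "x \<in> carrier G"
  using that(1)
proof (induction \<alpha> rule: word_induct)
  case Nil
  then show ?case using that by simp
next
  case (Cons p q \<alpha>)
  have "inv q \<otimes> p \<otimes> (val ((p, q) # \<alpha>) \<otimes> x) = val \<alpha> \<otimes> x"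
    using Cons that by (simp add: word_val.simps(2) m_assoc)
  then show ?case
    using Cons that K_val_in_P [of x \<alpha>] K_in_P
    by (auto simp: K_append K_single K_Cons val_single)
qed

lemma K_tilde': "y \<in> K (word_tilde \<alpha>) \<longleftrightarrow> inv (val \<alpha>) \<otimes> y \<in> K \<alpha>"
  if "\<alpha> \<in> words P" "y \<in> carrier G"
  using K_tilde [of \<alpha> "inv (val \<alpha>) \<otimes> y"] that by simp

text \<open>The way back along \<open>word_tilde \<alpha>\<close> passes through points already
  known to lie in P and adds no condition. So every constructible ideal comes from a neutral word,
  and \<open>word_tilde \<alpha> @ \<alpha>\<close> plays the part of the support projection of
  \<alpha>.\<close>

lemma K_neutralize: "K (word_tilde \<alpha> @ \<alpha>) = K \<alpha>" if "\<alpha> \<in> words P"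
  using that K_tilde K_in_P by (auto simp: K_append)

lemma neutralize_neutral: "word_tilde \<alpha> @ \<alpha> \<in> neutral_words G P" if "\<alpha> \<in> words P"
  using that by (simp add: neutral_words_def val_append)

lemma neutral_word: "\<alpha> \<in> neutral_words G P \<Longrightarrow> \<alpha> \<in> words P"
  "\<alpha> \<in> neutral_words G P \<Longrightarrow> val \<alpha> = \<one>"
  by (simp_all add: neutral_words_def)

lemma neutral_append [simp]:
  "\<alpha> \<in> neutral_words G P \<Longrightarrow> \<beta> \<in> neutral_words G P \<Longrightarrow> \<alpha> @ \<beta> \<in> neutral_words G P"
  by (simp add: neutral_words_def val_append)

lemma neutral_tilde [simp]:
  "\<alpha> \<in> neutral_words G P \<Longrightarrow> word_tilde \<alpha> \<in> neutral_words G P"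
  by (simp add: neutral_words_def)

lemma Nil_neutral [simp]: "[] \<in> neutral_words G P"
  by (simp add: neutral_words_def)

lemma neutralI: "\<alpha> \<in> words P \<Longrightarrow> val \<alpha> = \<one> \<Longrightarrow> \<alpha> \<in> neutral_words G P"
  by (simp add: neutral_words_def)

declare neutral_word [simp]

lemma constructible_neutral:
  assumes "S \<in> J"
  obtains \<alpha> where "\<alpha> \<in> neutral_words G P" "K \<alpha> = S"
  using assms K_neutralize neutralize_neutral unfolding constructible_def by blast

lemma K_constructible [simp]: "\<alpha> \<in> words P \<Longrightarrow> K \<alpha> \<in> J"
  by (auto simp: constructible_def)

lemma P_constructible [simp]: "P \<in> J"
  using K_constructible [of "[]"] by simp

lemma constructible_subset: "S \<in> J \<Longrightarrow> S \<subseteq> P"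
  using K_subset by (auto simp: constructible_def)

lemma constructible_right_ideal: "S \<in> J \<Longrightarrow> x \<in> S \<Longrightarrow> t \<in> P \<Longrightarrow> x \<otimes> t \<in> S"
  using K_right_ideal by (auto simp: constructible_def)

lemma K_append_neutral: "K (\<alpha> @ \<beta>) = K \<alpha> \<inter> K \<beta>"
  if "\<alpha> \<in> words P" "\<beta> \<in> neutral_words G P"
  using that K_in_P by (auto simp: K_append)

lemma K_tilde_neutral: "K (word_tilde \<alpha>) = K \<alpha>" if "\<alpha> \<in> neutral_words G P"
  using that K_in_P K_tilde [of \<alpha>] by fastforce

lemma constructible_Int [simp]: "R \<in> J \<Longrightarrow> S \<in> J \<Longrightarrow> R \<inter> S \<in> J"
  by (metis K_append_neutral K_constructible constructible_neutral neutral_append neutral_word(1))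

lemma constructible_preimage: "{t \<in> P. s \<otimes> t \<in> S} \<in> J" if "S \<in> J" "s \<in> P"
proof -
  obtain \<alpha> where \<alpha>: "\<alpha> \<in> words P" "K \<alpha> = S"
    using \<open>S \<in> J\<close> by (auto simp: constructible_def)
  \<comment> \<open>The last pair acts first: (e, s) moves t to s t before \<alpha> tests membership
    in S.\<close>
  have "K (\<alpha> @ [(\<one>, s)]) = {t \<in> P. s \<otimes> t \<in> S}"
    using \<alpha> that K_in_P by (auto simp: K_append K_single val_single)
  with \<alpha> that show ?thesis
    by (metis K_constructible words_simps P.one_closed)
qed

lemma constructible_image: "{y \<in> P. inv s \<otimes> y \<in> S} \<in> J" if "S \<in> J" "s \<in> P"
proof -
  obtain \<alpha> where \<alpha>: "\<alpha> \<in> words P" "K \<alpha> = S"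
    using \<open>S \<in> J\<close> by (auto simp: constructible_def)
  have "K (\<alpha> @ [(s, \<one>)]) = {y \<in> P. inv s \<otimes> y \<in> S}"
    using \<alpha> that K_in_P by (auto simp: K_append K_single val_single)
  with \<alpha> that show ?thesis
    by (metis K_constructible words_simps P.one_closed)
qed

text \<open>A right ideal containing e contains eP. Properness becomes a condition at the single
  point e, so an ideal avoiding s turns into a proper one when pulled back along s.\<close>

lemma constructible_no_one: "S \<in> J \<Longrightarrow> \<one> \<in> S \<longleftrightarrow> S = P"
  using constructible_right_ideal [of S \<one>] constructible_subset [of S] P.one_closed by fastforce

section \<open>Units and left cosets\<close>

lemma unit_iff: "u \<in> U\<^sub>P \<longleftrightarrow> u \<in> P \<and> inv u \<in> P"
proof
  assume "u \<in> P \<and> inv u \<in> P"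
  then have "u = inv (inv u)" "inv u \<in> P" "u \<in> P"
    by auto
  then show "u \<in> U\<^sub>P"
    unfolding unit_group_def by blast
qed (auto simp: unit_group_def)

lemma unit_subgroup: "subgroup U\<^sub>P G"
proof (rule subgroupI)
  have "\<one> \<in> U\<^sub>P" by (simp add: unit_iff)
  then show "U\<^sub>P \<noteq> {}" by blast
qed (auto simp: unit_iff inv_mult_group)

lemma coset_eq_iff: "a <# P = b <# P \<longleftrightarrow> inv a \<otimes> b \<in> U\<^sub>P"
  if "a \<in> carrier G" "b \<in> carrier G"
proof
  assume eq: "a <# P = b <# P"
  have "a \<in> a <# P" "b \<in> b <# P"
    using that by (auto simp: l_coset_iff P.subset)
  with eq show "inv a \<otimes> b \<in> U\<^sub>P"
    using that l_coset_iff [of P a b] l_coset_iff [of P b a]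
    by (simp add: unit_iff inv_mult_group P.subset)
next
  assume u: "inv a \<otimes> b \<in> U\<^sub>P"
  have "x \<in> a <# P \<longleftrightarrow> x \<in> b <# P" if "x \<in> carrier G" for x
  proof -
    have "inv a \<otimes> x = inv a \<otimes> b \<otimes> (inv b \<otimes> x)" "inv b \<otimes> x = inv (inv a \<otimes> b) \<otimes> (inv a \<otimes> x)"
      using that \<open>a \<in> carrier G\<close> \<open>b \<in> carrier G\<close> by (simp_all add: m_assoc inv_mult_group)
    then have "inv a \<otimes> x \<in> P \<longleftrightarrow> inv b \<otimes> x \<in> P"
      using u P.m_closed unfolding unit_iff by metis
    then show ?thesis
      using that \<open>a \<in> carrier G\<close> \<open>b \<in> carrier G\<close> by (simp add: l_coset_iff P.subset)
  qed
  moreover have "a <# P \<subseteq> carrier G" "b <# P \<subseteq> carrier G"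
    using that by (simp_all add: l_coset_subset_G P.subset)
  ultimately show "a <# P = b <# P"
    by blast
qed

text \<open>The partial homeomorphism of the value of \<open>\<alpha>\<close> fixes the character of \<open>s\<close> precisely if
  \<open>\<alpha>\<close> is bad at \<open>s\<close>.\<close>

definition bad :: "'g word \<Rightarrow> 'g \<Rightarrow> bool"
  where "bad \<alpha> s \<longleftrightarrow> s \<in> K \<alpha> \<and> inv s \<otimes> (val \<alpha> \<otimes> s) \<in> U\<^sub>P"

text \<open>Either s is outside K(\<alpha>), which then serves as R. Or v = s^{-1} g s is not a
  unit, where g is the value of \<alpha>. Badness at s t says that t^{-1} v t is a unit, so v t and
  v^{-1} t lie in P. The t with this property form a constructible ideal without e, and R is its
  translate by s.\<close>

lemma not_bad_persists:
  assumes "\<alpha> \<in> words P" "s \<in> P" "\<not> bad \<alpha> s"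
  obtains R where "R \<in> J" "s \<notin> R" "\<And>t. t \<in> P \<Longrightarrow> s \<otimes> t \<notin> R \<Longrightarrow> \<not> bad \<alpha> (s \<otimes> t)"
proof (cases "s \<in> K \<alpha>")
  case False
  then show ?thesis
    using that [of "K \<alpha>"] assms by (auto simp: bad_def)
next
  case True
  define q where "q = val \<alpha> \<otimes> s"
  have q: "q \<in> P"
    using True assms K_val_in_P by (simp add: q_def)
  define v where "v = inv s \<otimes> q"
  have v: "v \<in> carrier G" "v \<notin> U\<^sub>P"
    using True assms q by (auto simp: v_def q_def bad_def)
  \<comment> \<open>The words with the single pair (s, q) or (q, s) have the values v and its
    inverse.\<close>
  let ?M = "K [(s, q)] \<inter> K [(q, s)]"
  let ?R = "{y \<in> P. inv s \<otimes> y \<in> ?M}"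
  have M: "t \<in> ?M \<longleftrightarrow> t \<in> P \<and> v \<otimes> t \<in> P \<and> inv v \<otimes> t \<in> P" for t
    using q assms by (auto simp: K_single v_def inv_mult_group)
  have "\<not> bad \<alpha> (s \<otimes> t)" if t: "t \<in> P" "s \<otimes> t \<notin> ?R" for t
  proof
    assume "bad \<alpha> (s \<otimes> t)"
    then have "inv (s \<otimes> t) \<otimes> (val \<alpha> \<otimes> (s \<otimes> t)) \<in> U\<^sub>P"
      by (simp add: bad_def)
    moreover have "inv (s \<otimes> t) \<otimes> (val \<alpha> \<otimes> (s \<otimes> t)) = inv t \<otimes> (v \<otimes> t)"
      using t assms by (simp add: v_def q_def inv_mult_group m_assoc)
    ultimately have w: "inv t \<otimes> (v \<otimes> t) \<in> P" "inv (inv t \<otimes> (v \<otimes> t)) \<in> P"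
      by (simp_all add: unit_iff)
    have "t \<otimes> (inv t \<otimes> (v \<otimes> t)) = v \<otimes> t"
      "t \<otimes> inv (inv t \<otimes> (v \<otimes> t)) = inv v \<otimes> t"
      using t v by (simp_all add: inv_mult_group m_assoc)
    moreover have "t \<otimes> (inv t \<otimes> (v \<otimes> t)) \<in> P" "t \<otimes> inv (inv t \<otimes> (v \<otimes> t)) \<in> P"
      using w t by blast+
    ultimately have "t \<in> ?M"
      using t M by simp
    then show False
      using t assms by auto
  qed
  moreover have "?R \<in> J"
    using q assms by (intro constructible_image) auto
  moreover have "s \<notin> ?R"
    using v assms M by (auto simp: unit_iff)
  ultimately show ?thesis
    using that by blast
qed

text \<open>
  Being bad is destroyed one word at a time: once a word is not bad at \<open>s\<close>, it stays so
  on all of \<open>sP\<close> outside a single constructible ideal avoiding \<open>s\<close>.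
\<close>

lemma avoid_bad:
  assumes c3: "\<And>u \<C>. u \<in> U\<^sub>P - {\<one>} \<Longrightarrow> finite \<C> \<Longrightarrow> \<C> \<subseteq> J - {P} \<Longrightarrow>
      \<exists>t\<in>P - \<Union>\<C>. inv t \<otimes> (u \<otimes> t) \<notin> U\<^sub>P"
    and "finite W" "W \<subseteq> words P" "\<And>\<alpha>. \<alpha> \<in> W \<Longrightarrow> val \<alpha> \<noteq> \<one>"
    and "p \<in> P" "finite \<C>" "\<C> \<subseteq> J" "p \<notin> \<Union>\<C>"
  obtains r where "r \<in> P" "p \<otimes> r \<notin> \<Union>\<C>" "\<And>\<alpha>. \<alpha> \<in> W \<Longrightarrow> \<not> bad \<alpha> (p \<otimes> r)"
proof -
  have "\<exists>r\<in>P. p \<otimes> r \<notin> \<Union>\<C> \<and> (\<forall>\<alpha>\<in>W. \<not> bad \<alpha> (p \<otimes> r))"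
    using \<open>finite W\<close> \<open>W \<subseteq> words P\<close> assms(4)
  proof (induction W)
    case empty
    then show ?case
      using assms by (intro bexI [of _ \<one>]) auto
  next
    case (insert \<alpha> W)
    then obtain r where r: "r \<in> P" "p \<otimes> r \<notin> \<Union>\<C>" "\<forall>\<beta>\<in>W. \<not> bad \<beta> (p \<otimes> r)"
      by auto
    define s where "s = p \<otimes> r"
    have s: "s \<in> P"
      using r \<open>p \<in> P\<close> by (simp add: s_def)
    show ?case
    proof (cases "bad \<alpha> s")
      case False
      then show ?thesis
        using r by (auto simp: s_def)
    next
      case True
      \<comment> \<open>If \<alpha> is bad at s, it moves s by a unit u on the right, and u is
        nontrivial because the value of \<alpha> is. This is where (3) enters, for this u.\<close>
      define u where "u = inv s \<otimes> (val \<alpha> \<otimes> s)"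
      have \<alpha>: "\<alpha> \<in> words P" "val \<alpha> \<noteq> \<one>"
        using insert by auto
      have u: "u \<in> U\<^sub>P"
        using True by (simp add: u_def bad_def)
      have su: "s \<otimes> u = val \<alpha> \<otimes> s"
        using s \<alpha> by (simp add: u_def)
      have "u \<noteq> \<one>"
      proof
        assume "u = \<one>"
        then have "val \<alpha> \<otimes> s = s" using su s by simp
        then show False using s \<alpha> by (metis P_carrier val_carrier r_cancel_one)
      qed
      have "\<exists>R. R \<in> J \<and> s \<notin> R \<and> (\<forall>t\<in>P. s \<otimes> t \<notin> R \<longrightarrow> \<not> bad \<beta> (s \<otimes> t))" if "\<beta> \<in> W" for \<beta>
      proof -
        have \<beta>: "\<beta> \<in> words P" "\<not> bad \<beta> s"
          using that insert.prems r by (auto simp: s_def)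
        obtain R where "R \<in> J" "s \<notin> R" "\<And>t. t \<in> P \<Longrightarrow> s \<otimes> t \<notin> R \<Longrightarrow> \<not> bad \<beta> (s \<otimes> t)"
          using not_bad_persists [OF \<beta>(1) s \<beta>(2)] by blast
        then show ?thesis by blast
      qed
      then obtain R where R: "\<And>\<beta>. \<beta> \<in> W \<Longrightarrow> R \<beta> \<in> J" "\<And>\<beta>. \<beta> \<in> W \<Longrightarrow> s \<notin> R \<beta>"
        "\<And>\<beta> t. \<beta> \<in> W \<Longrightarrow> t \<in> P \<Longrightarrow> s \<otimes> t \<notin> R \<beta> \<Longrightarrow> \<not> bad \<beta> (s \<otimes> t)"
        by metis
      \<comment> \<open>Pulled back along s, the ideals of \<C> and the ideals protecting the words
        already treated become proper, since none of them contains s. Together they form the finite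
        collection to which (3) is applied.\<close>
      define \<D> where "\<D> = (\<lambda>S. {t \<in> P. s \<otimes> t \<in> S}) ` (\<C> \<union> R ` W)"
      have "finite \<D>"
        using \<open>finite \<C>\<close> insert.hyps by (simp add: \<D>_def)
      moreover have "\<D> \<subseteq> J - {P}"
      proof
        fix D assume "D \<in> \<D>"
        then obtain S where S: "S \<in> \<C> \<union> R ` W" "D = {t \<in> P. s \<otimes> t \<in> S}"
          by (auto simp: \<D>_def)
        then have "S \<in> J" "s \<notin> S"
          using R \<open>\<C> \<subseteq> J\<close> r by (auto simp: s_def)
        then show "D \<in> J - {P}"
          using S s constructible_preimage [of S s] constructible_no_one [of D] by auto
      qed
      ultimately obtain t where t: "t \<in> P - \<Union>\<D>" "inv t \<otimes> (u \<otimes> t) \<notin> U\<^sub>P"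
        using c3 [of u \<D>] u \<open>u \<noteq> \<one>\<close> by auto
      have tP: "t \<in> P"
        using t by simp
      have avoid: "s \<otimes> t \<notin> S" if "S \<in> \<C> \<union> R ` W" for S
        using t that tP unfolding \<D>_def by blast
      have "inv (s \<otimes> t) \<otimes> (val \<alpha> \<otimes> (s \<otimes> t)) = inv t \<otimes> (u \<otimes> t)"
        using s tP \<alpha> by (simp add: u_def inv_mult_group m_assoc)
      then have "\<not> bad \<alpha> (s \<otimes> t)"
        using t by (simp add: bad_def)
      moreover have "\<not> bad \<beta> (s \<otimes> t)" if "\<beta> \<in> W" for \<beta>
        using that R tP avoid by blast
      moreover have "s \<otimes> t = p \<otimes> (r \<otimes> t)"
        using r tP \<open>p \<in> P\<close> by (simp add: s_def m_assoc)
      ultimately show ?thesis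
        using avoid r tP by (intro bexI [of _ "r \<otimes> t"]) auto
    qed
  qed
  then show ?thesis
    by (elim bexE conjE) (rule that, auto)
qed

section \<open>Topological freeness\<close>

lemma coset_neq_iff: "(u \<otimes> t) <# P \<noteq> t <# P \<longleftrightarrow> inv t \<otimes> (u \<otimes> t) \<notin> U\<^sub>P"
  "u \<otimes> t \<notin> t <# U\<^sub>P \<longleftrightarrow> inv t \<otimes> (u \<otimes> t) \<notin> U\<^sub>P" if "u \<in> U\<^sub>P" "t \<in> P"
proof -
  have "u \<in> P"
    using that by (simp add: unit_iff)
  then show "(u \<otimes> t) <# P \<noteq> t <# P \<longleftrightarrow> inv t \<otimes> (u \<otimes> t) \<notin> U\<^sub>P"
    using coset_eq_iff [of t "u \<otimes> t"] that by auto
  show "u \<otimes> t \<notin> t <# U\<^sub>P \<longleftrightarrow> inv t \<otimes> (u \<otimes> t) \<notin> U\<^sub>P"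
    using \<open>u \<in> P\<close> that subgroup.subset [OF unit_subgroup] by (simp add: l_coset_iff)
qed

section \<open>Characters and the characters of points\<close>

lemma Omega_01: "\<xi> \<in> Omega G P \<Longrightarrow> S \<in> J \<Longrightarrow> \<xi> S = 0 \<or> \<xi> S = 1"
  unfolding Omega_def by (auto simp: PiE_iff)

lemma Omega_Int: "\<xi> \<in> Omega G P \<Longrightarrow> R \<in> J \<Longrightarrow> S \<in> J \<Longrightarrow> \<xi> (R \<inter> S) = \<xi> R * \<xi> S"
  unfolding Omega_def by simp

lemma Omega_cover:
  assumes "\<xi> \<in> Omega G P" "S \<in> J" "finite \<F>" "\<F> \<subseteq> J" "S = \<Union>\<F>" "\<xi> S = 1"
  obtains R where "R \<in> \<F>" "\<xi> R = 1"
proof -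
  have "\<forall>S\<in>J. \<forall>\<F>. finite \<F> \<and> \<F> \<subseteq> J \<and> S = \<Union>\<F> \<and> \<xi> S = 1 \<longrightarrow> (\<exists>R\<in>\<F>. \<xi> R = 1)"
    using assms(1) unfolding Omega_def mem_Collect_eq by (elim conjE)
  from bspec [OF this assms(2), THEN spec, of \<F>] have "\<exists>R\<in>\<F>. \<xi> R = 1"
    using assms(3-6) by simp
  with that show ?thesis by auto
qed

lemma Omega_mono:
  assumes "\<xi> \<in> Omega G P" "R \<in> J" "S \<in> J" "R \<subseteq> S" "\<xi> R = 1"
  shows "\<xi> S = 1"
  using Omega_Int [OF assms(1-3)] assms(4,5) by (simp add: Int_absorb2)

lemma Omega_P: "\<xi> \<in> Omega G P \<Longrightarrow> \<xi> P = 1"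
proof -
  assume \<xi>: "\<xi> \<in> Omega G P"
  then obtain S where "S \<in> J" "\<xi> S \<noteq> 0"
    by (auto simp: Omega_def)
  then show "\<xi> P = 1"
    using Omega_mono [OF \<xi>, of S P] Omega_01 [OF \<xi>, of S] constructible_subset by simp
qed

lemma Omega_eqI: "\<xi> \<in> Omega G P \<Longrightarrow> \<psi> \<in> Omega G P \<Longrightarrow> (\<And>S. S \<in> J \<Longrightarrow> \<xi> S = \<psi> S) \<Longrightarrow> \<xi> = \<psi>"
  unfolding Omega_def by (auto simp: PiE_iff intro: extensionalityI)

definition point_char :: "'g \<Rightarrow> 'g set \<Rightarrow> nat"
  where "point_char p = (\<lambda>S\<in>J. if p \<in> S then 1 else 0)"

lemma point_char_Omega: "point_char p \<in> Omega G P" if "p \<in> P"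
proof -
  have "\<exists>S\<in>J. point_char p S \<noteq> 0"
    using that by (intro bexI [of _ P]) (auto simp: point_char_def)
  moreover have "\<exists>R\<in>\<F>. point_char p R = 1" if "\<F> \<subseteq> J" "point_char p (\<Union>\<F>) = 1" "\<Union>\<F> \<in> J" for \<F>
    using that by (auto simp: point_char_def subset_iff split: if_splits)
  ultimately show ?thesis
    unfolding Omega_def by (auto simp: PiE_iff) (auto simp: point_char_def)
qed

lemma point_char_eq_1 [simp]: "S \<in> J \<Longrightarrow> point_char p S = 1 \<longleftrightarrow> p \<in> S"
  "S \<in> J \<Longrightarrow> point_char p S = Suc 0 \<longleftrightarrow> p \<in> S" "S \<in> J \<Longrightarrow> point_char p S = 0 \<longleftrightarrow> p \<notin> S"
  by (simp_all add: point_char_def)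

text \<open>The principal ideal aP is constructible and contains a, so equality of the characters
  forces b into it.\<close>

lemma point_char_eqD: "inv a \<otimes> b \<in> P"
  if "a \<in> P" "b \<in> P" "point_char a = point_char b"
proof -
  let ?S = "{y \<in> P. inv a \<otimes> y \<in> P}"
  have S: "?S \<in> J"
    using that by (simp add: constructible_image)
  have "point_char a ?S = 1"
    by (rule point_char_eq_1(1) [OF S, THEN iffD2]) (use that in simp)
  then have "point_char b ?S = 1"
    by (simp only: that(3))
  then have "b \<in> ?S"
    by (rule point_char_eq_1(1) [OF S, THEN iffD1])
  then show ?thesis by simp
qed

section \<open>The partial action on characters\<close>

lemma shift_eq_K_tilde: "inv (val \<beta>) <# K (word_tilde \<beta>) = K \<beta>" if "\<beta> \<in> words P"
proof -
  have "K (word_tilde \<beta>) \<subseteq> carrier G"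
    using K_subset P.subset by blast
  moreover from this have "inv (val \<beta>) <# K (word_tilde \<beta>) \<subseteq> carrier G"
    using that by (simp add: l_coset_subset_G)
  moreover have "K \<beta> \<subseteq> carrier G"
    using K_subset P.subset by blast
  moreover have "x \<in> inv (val \<beta>) <# K (word_tilde \<beta>) \<longleftrightarrow> x \<in> K \<beta>" if "x \<in> carrier G" for x
    using \<open>\<beta> \<in> words P\<close> that K_tilde [of \<beta> x] \<open>K (word_tilde \<beta>) \<subseteq> carrier G\<close>
    by (simp add: l_coset_iff)
  ultimately show ?thesis
    by blast
qed

lemma shift_constructible: "val \<beta> <# K \<beta> \<in> J" "val \<beta> <# K \<beta> = K (word_tilde \<beta>)"
  if "\<beta> \<in> words P"
  using shift_eq_K_tilde [of "word_tilde \<beta>"] that by simp_all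

text \<open>The definite description needs uniqueness. To test a character of
  \<open>gamma_dom G P g\<close> on S, intersect S with some K(\<beta>) on which the character is 1.
  Appending to \<beta> a neutral word for S realises this intersection without changing the value of
  \<beta>.\<close>

lemma gamma_hat_eqI:
  assumes "g \<in> carrier G" "\<psi> \<in> gamma_dom G P g"
    and "\<And>\<beta>. \<beta> \<in> words P \<Longrightarrow> val \<beta> = inv g \<Longrightarrow> \<psi> (K \<beta>) = \<xi> (K (word_tilde \<beta>))"
  shows "gamma_hat G P g \<xi> = \<psi>"
  unfolding gamma_hat_def
proof (rule the_equality)
  have *: "inv g <# K \<beta> = K (word_tilde \<beta>)" if "\<beta> \<in> words P" "val \<beta> = inv g" for \<beta>
    using shift_constructible [of \<beta>] that by simp
  show "\<psi> \<in> gamma_dom G P g \<and>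
    (\<forall>\<beta>\<in>words P. val \<beta> = inv g \<longrightarrow> \<psi> (K \<beta>) = \<xi> (inv g <# K \<beta>))"
    using assms * by simp
  have determined: "\<psi>' S = 1"
    if \<psi>': "\<psi>' \<in> gamma_dom G P g" and \<psi>'': "\<psi>'' \<in> gamma_dom G P g"
      and eq: "\<And>\<beta>. \<beta> \<in> words P \<Longrightarrow> val \<beta> = inv g \<Longrightarrow> \<psi>' (K \<beta>) = \<psi>'' (K \<beta>)"
      and S: "S \<in> J" "\<psi>'' S = 1" for \<psi>' \<psi>'' S
  proof -
    obtain \<beta> where \<beta>: "\<beta> \<in> words P" "val \<beta> = inv g" "\<psi>'' (K \<beta>) = 1"
      using \<psi>'' by (auto simp: gamma_dom_def)
    obtain \<sigma> where \<sigma>: "\<sigma> \<in> neutral_words G P" "K \<sigma> = S"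
      using S constructible_neutral by blast
    have K: "K (\<beta> @ \<sigma>) = K \<beta> \<inter> S"
      using \<beta> \<sigma> by (simp add: K_append_neutral)
    have "\<psi>'' (K (\<beta> @ \<sigma>)) = 1"
      unfolding K using \<beta> S \<psi>'' by (simp add: gamma_dom_def Omega_Int)
    then have "\<psi>' (K (\<beta> @ \<sigma>)) = 1"
      using eq [of "\<beta> @ \<sigma>"] \<beta> \<sigma> assms by (simp add: val_append)
    then show ?thesis
      unfolding K using \<psi>' \<beta> S Omega_mono [of \<psi>' "K \<beta> \<inter> S" S] by (simp add: gamma_dom_def)
  qed
  fix \<psi>'
  assume \<psi>': "\<psi>' \<in> gamma_dom G P g \<and>
    (\<forall>\<beta>\<in>words P. val \<beta> = inv g \<longrightarrow> \<psi>' (K \<beta>) = \<xi> (inv g <# K \<beta>))"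
  then have eq: "\<psi>' (K \<beta>) = \<psi> (K \<beta>)" if "\<beta> \<in> words P" "val \<beta> = inv g" for \<beta>
    using that assms * by simp
  show "\<psi>' = \<psi>"
  proof (rule Omega_eqI)
    show O: "\<psi>' \<in> Omega G P" "\<psi> \<in> Omega G P"
      using \<psi>' assms by (auto simp: gamma_dom_def)
    fix S assume "S \<in> J"
    moreover have "\<psi>' S = 1 \<longleftrightarrow> \<psi> S = 1"
      using determined [of \<psi> \<psi>' S] determined [of \<psi>' \<psi> S] eq \<psi>' assms \<open>S \<in> J\<close> by auto
    ultimately show "\<psi>' S = \<psi> S"
      using O Omega_01 by metis
  qed
qed

lemma gamma_point_char:
  assumes "\<alpha> \<in> words P" "p \<in> K \<alpha>"
  shows "gamma_hat G P (val \<alpha>) (point_char p) = point_char (val \<alpha> \<otimes> p)"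
proof (rule gamma_hat_eqI)
  have p: "p \<in> P" "val \<alpha> \<otimes> p \<in> P"
    using assms K_val_in_P K_in_P by auto
  show "point_char (val \<alpha> \<otimes> p) \<in> gamma_dom G P (val \<alpha>)"
  proof -
    have "point_char (val \<alpha> \<otimes> p) (K (word_tilde \<alpha>)) = 1"
      using assms p K_tilde [of \<alpha> p] by simp
    moreover have "word_tilde \<alpha> \<in> words P" "val (word_tilde \<alpha>) = inv (val \<alpha>)"
      using assms by simp_all
    ultimately show ?thesis
      unfolding gamma_dom_def using point_char_Omega [OF p(2)] by blast
  qed
  show "point_char (val \<alpha> \<otimes> p) (K \<beta>) = point_char p (K (word_tilde \<beta>))"
    if "\<beta> \<in> words P" "val \<beta> = inv (val \<alpha>)" for \<beta>
    using that p assms K_tilde' [of \<beta> p] by (simp add: point_char_def)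
qed (use assms in simp)

section \<open>Neighbourhoods in the character space\<close>

lemma Omega_topology_space: "topspace (Omega_topology G P) = Omega G P"
proof -
  have "Omega G P \<subseteq> (\<Pi>\<^sub>E S\<in>J. {0, 1})"
    by (auto simp: Omega_def)
  then show ?thesis
    unfolding Omega_topology_def topspace_subtopology topspace_product_topology
      o_def topspace_discrete_topology by blast
qed

lemma openin_Omega_value: "openin (Omega_topology G P) {\<xi> \<in> Omega G P. \<xi> S = n}"
  if "S \<in> J" "n \<in> {0, 1}"
proof -
  have "continuous_map (product_topology (\<lambda>_. discrete_topology {0, 1}) J)
      (discrete_topology {0, 1}) (\<lambda>\<xi>. \<xi> S)"
    using that by (rule_tac continuous_map_product_projection)
  then have "openin (product_topology (\<lambda>_. discrete_topology {0, 1::nat}) J)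
      {\<xi> \<in> topspace (product_topology (\<lambda>_. discrete_topology {0, 1}) J). \<xi> S \<in> {n}}"
    by (rule openin_continuous_map_preimage) (use that in auto)
  moreover have "{\<xi> \<in> Omega G P. \<xi> S = n} =
      {\<xi> \<in> topspace (product_topology (\<lambda>_. discrete_topology {0, 1}) J). \<xi> S \<in> {n}} \<inter> Omega G P"
    by (auto simp: Omega_def)
  ultimately show ?thesis
    unfolding Omega_topology_def openin_subtopology by (intro exI conjI)
qed

text \<open>The points of \<open>P\<close> are dense in \<open>\<Omega>\<^sub>P\<close>, by the covering condition on characters.\<close>

lemma Omega_open_contains_point:
  assumes "openin (Omega_topology G P) V" "\<xi> \<in> V" "S\<^sub>0 \<in> J" "\<xi> S\<^sub>0 = 1"
  obtains p \<C> where "p \<in> S\<^sub>0" "finite \<C>" "\<C> \<subseteq> J" "p \<notin> \<Union>\<C>"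
    and "\<And>t. t \<in> P \<Longrightarrow> p \<otimes> t \<notin> \<Union>\<C> \<Longrightarrow> p \<otimes> t \<in> S\<^sub>0 \<and> point_char (p \<otimes> t) \<in> V"
proof -
  obtain V' where V': "openin (product_topology (\<lambda>_. discrete_topology {0, 1}) J) V'"
      "V = V' \<inter> Omega G P"
    using assms(1) unfolding Omega_topology_def openin_subtopology by blast
  with assms(2) obtain W where W: "finite {S \<in> J. W S \<noteq> {0, 1}}" "\<xi> \<in> Pi\<^sub>E J W" "Pi\<^sub>E J W \<subseteq> V'"
    unfolding openin_product_topology_alt topspace_discrete_topology by blast
  have \<xi>: "\<xi> \<in> Omega G P"
    using assms(2) V' by simp
  define A where "A = {S \<in> J. W S \<noteq> {0, 1}}"
  \<comment> \<open>The finitely many ideals on which the basic neighbourhood prescribes the value 1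
    are replaced by a single ideal inside \<open>S\<^sub>0\<close> on which \<xi> is still
    1.\<close>
  have inter: "\<exists>S\<in>J. S \<subseteq> S\<^sub>0 \<and> \<xi> S = 1 \<and> (\<forall>R\<in>B. S \<subseteq> R)"
    if "finite B" "B \<subseteq> {R \<in> J. \<xi> R = 1}" for B
    using that
  proof (induction B)
    case empty
    then show ?case using assms by blast
  next
    case (insert R B)
    then obtain S where "S \<in> J" "S \<subseteq> S\<^sub>0" "\<xi> S = 1" "\<forall>R\<in>B. S \<subseteq> R"
      by auto
    with insert.prems show ?case
      by (intro bexI [of _ "R \<inter> S"]) (auto simp: Omega_Int [OF \<xi>])
  qed
  obtain S where S: "S \<in> J" "S \<subseteq> S\<^sub>0" "\<xi> S = 1" "\<And>R. R \<in> A \<Longrightarrow> \<xi> R = 1 \<Longrightarrow> S \<subseteq> R"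
  proof -
    have "finite {R \<in> A. \<xi> R = 1}" "{R \<in> A. \<xi> R = 1} \<subseteq> {R \<in> J. \<xi> R = 1}"
      using finite_subset [OF _ W(1), of "{R \<in> A. \<xi> R = 1}"] by (auto simp: A_def)
    from inter [OF this] that show ?thesis
      by (elim bexE conjE) (rule that, auto)
  qed
  define \<C> where "\<C> = {R \<in> A. \<xi> R = 0}"
  have \<C>: "finite \<C>" "\<C> \<subseteq> J"
    using finite_subset [OF _ W(1), of \<C>] by (auto simp: \<C>_def A_def)
  \<comment> \<open>Otherwise S would be the union of its intersections with members of \<C>. The
    covering condition would make \<xi> equal to 1 on one of them, although \<xi> vanishes on
    \<C>.\<close>
  have "\<not> S \<subseteq> \<Union>\<C>"
  proof
    assume "S \<subseteq> \<Union>\<C>"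
    then have "S = \<Union>((\<inter>) S ` \<C>)"
      by auto
    moreover have "(\<inter>) S ` \<C> \<subseteq> J" "finite ((\<inter>) S ` \<C>)"
      using S \<C> by auto
    ultimately obtain Q where "Q \<in> (\<inter>) S ` \<C>" "\<xi> Q = 1"
      using Omega_cover [OF \<xi> S(1), of "(\<inter>) S ` \<C>"] S(3) by metis
    then obtain R where "R \<in> \<C>" "\<xi> (S \<inter> R) = 1"
      by blast
    then show False
      using Omega_Int [OF \<xi>, of S R] S \<C> by (auto simp: \<C>_def)
  qed
  then obtain p where p: "p \<in> S" "p \<notin> \<Union>\<C>"
    by blast
  \<comment> \<open>The values 1 survive on all of pP because S is a right ideal. Only the values 0,
    that is \<C>, can be lost, which leaves room to move p inside the neighbourhood.\<close>
  have "p \<otimes> t \<in> S\<^sub>0 \<and> point_char (p \<otimes> t) \<in> V" if t: "t \<in> P" "p \<otimes> t \<notin> \<Union>\<C>" for t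
  proof
    have pt: "p \<otimes> t \<in> S"
      using S(1) p(1) t(1) by (rule constructible_right_ideal)
    then have ptP: "p \<otimes> t \<in> P"
      using S(1) constructible_subset by blast
    show "p \<otimes> t \<in> S\<^sub>0"
      using pt S by blast
    have "point_char (p \<otimes> t) R \<in> W R" if R: "R \<in> J" for R
    proof (cases "R \<in> A")
      case False
      then show ?thesis
        using R Omega_01 [OF point_char_Omega [OF ptP] R] by (auto simp: A_def)
    next
      case True
      then have "point_char (p \<otimes> t) R = \<xi> R"
        using Omega_01 [OF \<xi> R] S(4) [OF True] pt t R by (auto simp: \<C>_def point_char_def)
      then show ?thesis
        using W(2) R by (simp add: PiE_iff)
    qed
    then have "point_char (p \<otimes> t) \<in> Pi\<^sub>E J W"
      by (auto simp: PiE_iff point_char_def)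
    then show "point_char (p \<otimes> t) \<in> V"
      using V' W(3) point_char_Omega [OF ptP] by blast
  qed
  with that [of p \<C>] p S \<C> show ?thesis
    by blast
qed

section \<open>Condition (3) and topological freeness\<close>

lemma topologically_free_if:
  assumes c3: "\<And>u \<C>. u \<in> U\<^sub>P - {\<one>} \<Longrightarrow> finite \<C> \<Longrightarrow> \<C> \<subseteq> J - {P} \<Longrightarrow>
      \<exists>t\<in>P - \<Union>\<C>. inv t \<otimes> (u \<otimes> t) \<notin> U\<^sub>P"
  shows "topologically_free G (Omega_topology G P) (gamma_dom G P) (gamma_hat G P)"
  unfolding topologically_free_def
proof (intro ballI impI)
  fix g assume g: "g \<in> carrier G" "g \<noteq> \<one>"
  define F where "F = {\<xi> \<in> gamma_dom G P (inv g). gamma_hat G P g \<xi> = \<xi>}"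
  have False if VF: "openin (Omega_topology G P) V" "V \<subseteq> F" "\<xi> \<in> V" for V \<xi>
  proof -
    have "\<xi> \<in> F"
      using VF by blast
    then obtain \<alpha> where \<alpha>: "\<alpha> \<in> words P" "val \<alpha> = g" "\<xi> (K \<alpha>) = 1"
      using g by (auto simp: F_def gamma_dom_def)
    obtain p \<C> where p: "p \<in> K \<alpha>" and \<C>: "finite \<C>" "\<C> \<subseteq> J" "p \<notin> \<Union>\<C>"
      and V: "\<And>t. t \<in> P \<Longrightarrow> p \<otimes> t \<notin> \<Union>\<C> \<Longrightarrow> p \<otimes> t \<in> K \<alpha> \<and> point_char (p \<otimes> t) \<in> V"
      using Omega_open_contains_point [OF VF(1,3) K_constructible [OF \<alpha>(1)] \<alpha>(3)] by metis
    \<comment> \<open>One word suffices: all points in question lie in K(\<alpha>), so \<alpha>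
      computes the action of g on their characters.\<close>
    have "\<exists>t\<in>P. p \<otimes> t \<notin> \<Union>\<C> \<and> \<not> bad \<alpha> (p \<otimes> t)"
    proof (rule avoid_bad [OF c3 _ _ _ K_in_P [OF p] \<C>, of "{\<alpha>}"])
      show "\<exists>t\<in>P. p \<otimes> t \<notin> \<Union>\<C> \<and> \<not> bad \<alpha> (p \<otimes> t)"
        if "r \<in> P" "p \<otimes> r \<notin> \<Union>\<C>" "\<And>\<beta>. \<beta> \<in> {\<alpha>} \<Longrightarrow> \<not> bad \<beta> (p \<otimes> r)" for r
        using that by (intro bexI [of _ r]) simp_all
    qed (use \<alpha> g in auto)
    then obtain t where t: "t \<in> P" "p \<otimes> t \<notin> \<Union>\<C>" "\<not> bad \<alpha> (p \<otimes> t)"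
      by auto
    define s where "s = p \<otimes> t"
    have s: "s \<in> K \<alpha>" "point_char s \<in> V"
      using V [OF t(1,2)] by (auto simp: s_def)
    then have sP: "s \<in> P" "g \<otimes> s \<in> P"
      using K_in_P K_val_in_P \<alpha> by blast+
    have "gamma_hat G P g (point_char s) = point_char (g \<otimes> s)"
      using gamma_point_char [of \<alpha> s] s \<alpha> by simp
    moreover have "gamma_hat G P g (point_char s) = point_char s"
      using s VF(2) unfolding F_def by blast
    ultimately have eq: "point_char (g \<otimes> s) = point_char s"
      by simp
    have "inv (g \<otimes> s) \<otimes> s \<in> P" "inv s \<otimes> (g \<otimes> s) \<in> P"
      using point_char_eqD [OF sP eq [symmetric]] point_char_eqD [OF sP(2,1) eq] by simp_all
    then have "inv s \<otimes> (g \<otimes> s) \<in> U\<^sub>P"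
      using sP g by (simp add: unit_iff inv_mult_group m_assoc)
    then show False
      using t(3) s(1) \<alpha> by (simp add: bad_def s_def)
  qed
  then show "Omega_topology G P interior_of F = {}"
    unfolding interior_of_def by blast
qed

lemma topologically_free_units:
  assumes "topologically_free G (Omega_topology G P) (gamma_dom G P) (gamma_hat G P)"
  shows "topologically_free (G\<lparr>carrier := U\<^sub>P\<rparr>) (Omega_topology G P)
    (gamma_dom G P) (gamma_hat G P)"
  using assms m_inv_consistent [OF unit_subgroup] subgroup.subset [OF unit_subgroup]
  unfolding topologically_free_def by auto

text \<open>By contradiction: suppose u preserves the coset of every t outside \<C>. Then u fixes
  every character vanishing on \<C>. These characters form an open set, which contains the character
  of e because proper ideals do not contain e.\<close>

lemma moves_if_topologically_free:
  assumes "topologically_free (G\<lparr>carrier := U\<^sub>P\<rparr>) (Omega_topology G P)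
      (gamma_dom G P) (gamma_hat G P)"
    and u: "u \<in> U\<^sub>P - {\<one>}" and \<C>: "finite \<C>" "\<C> \<subseteq> J - {P}"
  shows "\<exists>t\<in>P - \<Union>\<C>. inv t \<otimes> (u \<otimes> t) \<notin> U\<^sub>P"
proof (rule ccontr)
  assume "\<not> ?thesis"
  then have fixed: "inv t \<otimes> (u \<otimes> t) \<in> U\<^sub>P" if "t \<in> P" "t \<notin> \<Union>\<C>" for t
    using that by blast
  have uP: "u \<in> P" "inv u \<in> P"
    using u by (auto simp: unit_iff)
  define V where "V = {\<xi> \<in> Omega G P. \<forall>R\<in>\<C>. \<xi> R = 0}"
  have "openin (Omega_topology G P) V"
  proof -
    have "openin (Omega_topology G P) (\<Inter>R\<in>\<C>. {\<xi> \<in> Omega G P. \<xi> R = 0})" if "\<C> \<noteq> {}"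
      using that \<C> openin_Omega_value by (intro openin_INT2) auto
    moreover have "V = (\<Inter>R\<in>\<C>. {\<xi> \<in> Omega G P. \<xi> R = 0})" if "\<C> \<noteq> {}"
      using that by (auto simp: V_def)
    moreover have "V = topspace (Omega_topology G P)" if "\<C> = {}"
      using that by (simp add: V_def Omega_topology_space)
    ultimately show ?thesis
      by (cases "\<C> = {}") auto
  qed
  moreover have "V \<subseteq> {\<xi> \<in> gamma_dom G P (inv u). gamma_hat G P u \<xi> = \<xi>}"
  proof
    fix \<xi> assume "\<xi> \<in> V"
    then have \<xi>: "\<xi> \<in> Omega G P" "\<And>R. R \<in> \<C> \<Longrightarrow> \<xi> R = 0"
      by (auto simp: V_def)
    have dom: "\<xi> \<in> gamma_dom G P g" if "g \<in> P" "inv g \<in> P" for g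
    proof -
      have "K [(g, \<one>)] = P"
        using that K_in_P by (auto simp: K_single)
      then show ?thesis
        using that \<xi> Omega_P by (auto simp: gamma_dom_def val_single intro!: bexI [of _ "[(g, \<one>)]"])
    qed
    \<comment> \<open>R is covered by R \<inter> S and its intersections with members of \<C>. On
      the latter \<xi> vanishes, so the covering condition gives the value 1 on R \<inter> S: such a
      character sees ideals only outside \<C>.\<close>
    have implied: "\<xi> S = 1"
      if R: "R \<in> J" and S: "S \<in> J" "\<And>t. t \<in> R \<Longrightarrow> t \<notin> \<Union>\<C> \<Longrightarrow> t \<in> S" "\<xi> R = 1" for R S
    proof -
      have "R = \<Union>(insert (R \<inter> S) ((\<inter>) R ` \<C>))"
        using S(2) by auto
      moreover have "insert (R \<inter> S) ((\<inter>) R ` \<C>) \<subseteq> J" "finite (insert (R \<inter> S) ((\<inter>) R ` \<C>))"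
        using R S \<C> by auto
      ultimately obtain Q where "Q \<in> insert (R \<inter> S) ((\<inter>) R ` \<C>)" "\<xi> Q = 1"
        using Omega_cover [OF \<xi>(1) R, of "insert (R \<inter> S) ((\<inter>) R ` \<C>)"] S(3) by metis
      then have "\<xi> (R \<inter> S) = 1"
        using Omega_Int [OF \<xi>(1) R] \<xi>(2) \<C> by auto
      then show ?thesis
        using Omega_mono [OF \<xi>(1), of "R \<inter> S" S] R S by auto
    qed
    have "gamma_hat G P u \<xi> = \<xi>"
    proof (rule gamma_hat_eqI)
      fix \<beta> assume \<beta>: "\<beta> \<in> words P" "val \<beta> = inv u"
      have tilde: "t \<in> K (word_tilde \<beta>) \<longleftrightarrow> u \<otimes> t \<in> K \<beta>" if "t \<in> P" for t
        using K_tilde' [of \<beta> t] \<beta> uP that by simp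
      \<comment> \<open>Outside \<C> the points t and u t differ by a unit on the right, so they lie
        in the same right ideals.\<close>
      have orbit: "t \<in> S \<longleftrightarrow> u \<otimes> t \<in> S" if S: "S \<in> J" and t: "t \<in> P" "t \<notin> \<Union>\<C>" for S t
      proof -
        let ?v = "inv t \<otimes> (u \<otimes> t)"
        have v: "?v \<in> P" "inv ?v \<in> P"
          using fixed [OF t] by (simp_all add: unit_iff)
        have "t \<otimes> ?v = u \<otimes> t" "(u \<otimes> t) \<otimes> inv ?v = t"
          using t uP by (simp_all add: inv_mult_group m_assoc)
        then show ?thesis
          using constructible_right_ideal [OF S _ v(1), of t]
            constructible_right_ideal [OF S _ v(2), of "u \<otimes> t"] by auto
      qed
      have "\<xi> (K \<beta>) = 1 \<longleftrightarrow> \<xi> (K (word_tilde \<beta>)) = 1"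
        using implied [of "K \<beta>" "K (word_tilde \<beta>)"] implied [of "K (word_tilde \<beta>)" "K \<beta>"]
          orbit [of "K \<beta>"] tilde \<beta> K_in_P by (metis K_constructible tilde_words)
      then show "\<xi> (K \<beta>) = \<xi> (K (word_tilde \<beta>))"
        using Omega_01 [OF \<xi>(1)] \<beta> by (metis K_constructible tilde_words)
    qed (use uP dom in auto)
    then show "\<xi> \<in> {\<xi> \<in> gamma_dom G P (inv u). gamma_hat G P u \<xi> = \<xi>}"
      using dom uP by simp
  qed
  moreover have "point_char \<one> \<in> V"
  proof -
    have "point_char \<one> R = 0" if "R \<in> \<C>" for R
    proof -
      have "R \<in> J" "R \<noteq> P"
        using that \<C> by auto
      then show ?thesis
        using constructible_no_one by simp
    qed
    then show ?thesis
      unfolding V_def using point_char_Omega by simp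
  qed
  ultimately have "Omega_topology G P interior_of {\<xi> \<in> gamma_dom G P (inv u). gamma_hat G P u \<xi> = \<xi>} \<noteq> {}"
    unfolding interior_of_def by blast
  moreover have "inv\<^bsub>G\<lparr>carrier := U\<^sub>P\<rparr>\<^esub> u = inv u"
    using u m_inv_consistent [OF unit_subgroup] by blast
  ultimately show False
    using assms(1) u unfolding topologically_free_def by auto
qed

end

section \<open>Square-summable functions and bounded operators\<close>

context
  fixes X :: "'x set"
begin

lemma ell2_supp: "f \<in> ell2 X \<Longrightarrow> x \<notin> X \<Longrightarrow> f x = 0"
  by (simp add: ell2_def)

lemma ell2_summable: "f \<in> ell2 X \<Longrightarrow> (\<lambda>x. (cmod (f x))\<^sup>2) summable_on X"
  by (simp add: ell2_def)

lemma ell2I: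
  assumes "\<And>x. x \<notin> X \<Longrightarrow> f x = 0"
    and "\<And>F. finite F \<Longrightarrow> F \<subseteq> X \<Longrightarrow> (\<Sum>x\<in>F. (cmod (f x))\<^sup>2) \<le> C"
  shows "f \<in> ell2 X"
  unfolding ell2_def
  using assms
  by (auto intro!: nonneg_bounded_partial_sums_imp_summable_on [where C = C]
      eventually_finite_subsets_at_top_weakI)

lemma ell2_norm_nonneg [simp]: "0 \<le> ell2_norm X f"
  by (simp add: ell2_norm_def infsum_nonneg)

lemma ell2_norm_sq: "(ell2_norm X f)\<^sup>2 = (\<Sum>\<^sub>\<infinity>x\<in>X. (cmod (f x))\<^sup>2)"
  by (simp add: ell2_norm_def infsum_nonneg)

lemma ell2_norm_leI:
  assumes "f \<in> ell2 X" "0 \<le> c"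
    and "\<And>F. finite F \<Longrightarrow> F \<subseteq> X \<Longrightarrow> (\<Sum>x\<in>F. (cmod (f x))\<^sup>2) \<le> c\<^sup>2"
  shows "ell2_norm X f \<le> c"
proof -
  have "(ell2_norm X f)\<^sup>2 \<le> c\<^sup>2"
    unfolding ell2_norm_sq using assms by (intro infsum_le_finite_sums ell2_summable) auto
  then show ?thesis
    using assms(2) by (rule power2_le_imp_le)
qed

lemma ell2_finite_sum_le:
  assumes "f \<in> ell2 X" "finite F" "F \<subseteq> X"
  shows "(\<Sum>x\<in>F. (cmod (f x))\<^sup>2) \<le> (ell2_norm X f)\<^sup>2"
  unfolding ell2_norm_sq using assms by (intro finite_sum_le_infsum ell2_summable) auto

lemma ell2_bound: "cmod (f x) \<le> ell2_norm X f" if "f \<in> ell2 X"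
proof (cases "x \<in> X")
  case True
  then have "(cmod (f x))\<^sup>2 \<le> (ell2_norm X f)\<^sup>2"
    using ell2_finite_sum_le [OF that, of "{x}"] by simp
  then show ?thesis
    by (rule power2_le_imp_le) simp
next
  case False
  then show ?thesis
    using ell2_supp [OF that] by simp
qed

lemma ell2_norm_eq_0: "ell2_norm X f = 0 \<Longrightarrow> f \<in> ell2 X \<Longrightarrow> f = (\<lambda>_. 0)"
  using ell2_bound [of f] by fastforce

lemma ell2_zero [simp]: "(\<lambda>_. 0) \<in> ell2 X" "ell2_norm X (\<lambda>_. 0) = 0"
  by (simp_all add: ell2_def ell2_norm_def)

lemma cmod_add_sq_le: "(cmod (a + b))\<^sup>2 \<le> 2 * (cmod a)\<^sup>2 + 2 * (cmod b)\<^sup>2"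
proof -
  have "(cmod (a + b))\<^sup>2 \<le> (cmod a + cmod b)\<^sup>2"
    by (intro power_mono norm_triangle_ineq) simp
  also have "\<dots> \<le> 2 * (cmod a)\<^sup>2 + 2 * (cmod b)\<^sup>2"
    using zero_le_power2 [of "cmod a - cmod b"] by (simp add: power2_sum power2_diff)
  finally show ?thesis .
qed

lemma ell2_add [simp]: "(\<lambda>x. f x + g x) \<in> ell2 X" if "f \<in> ell2 X" "g \<in> ell2 X"
proof (rule ell2I)
  show "(\<Sum>x\<in>F. (cmod (f x + g x))\<^sup>2) \<le> 2 * (ell2_norm X f)\<^sup>2 + 2 * (ell2_norm X g)\<^sup>2"
    if F: "finite F" "F \<subseteq> X" for F
  proof -
    have "(\<Sum>x\<in>F. (cmod (f x + g x))\<^sup>2) \<le> (\<Sum>x\<in>F. 2 * (cmod (f x))\<^sup>2 + 2 * (cmod (g x))\<^sup>2)"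
      by (intro sum_mono cmod_add_sq_le)
    also have "\<dots> = 2 * (\<Sum>x\<in>F. (cmod (f x))\<^sup>2) + 2 * (\<Sum>x\<in>F. (cmod (g x))\<^sup>2)"
      by (simp add: sum.distrib sum_distrib_left)
    also have "\<dots> \<le> 2 * (ell2_norm X f)\<^sup>2 + 2 * (ell2_norm X g)\<^sup>2"
      using ell2_finite_sum_le F \<open>f \<in> ell2 X\<close> \<open>g \<in> ell2 X\<close> by (intro add_mono mult_left_mono) auto
    finally show ?thesis .
  qed
qed (use that in \<open>auto simp: ell2_supp\<close>)

lemma ell2_scale [simp]: "(\<lambda>x. c * f x) \<in> ell2 X" if "f \<in> ell2 X"
proof -
  have "(\<lambda>x. (cmod c)\<^sup>2 * (cmod (f x))\<^sup>2) summable_on X"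
    using that by (intro summable_on_cmult_right ell2_summable)
  then show ?thesis
    using that by (auto simp: ell2_def norm_mult power_mult_distrib)
qed

lemma ell2_minus [simp]: "(\<lambda>x. - f x) \<in> ell2 X" if "f \<in> ell2 X"
  using ell2_scale [OF that, of "-1"] by simp

lemma ell2_diff [simp]: "(\<lambda>x. f x - g x) \<in> ell2 X" if "f \<in> ell2 X" "g \<in> ell2 X"
  using ell2_add [OF that(1) ell2_minus [OF that(2)]] by simp

lemma ell2_norm_scale: "ell2_norm X (\<lambda>x. c * f x) = cmod c * ell2_norm X f"
proof -
  have "(\<Sum>\<^sub>\<infinity>x\<in>X. (cmod (c * f x))\<^sup>2) = (cmod c)\<^sup>2 * (\<Sum>\<^sub>\<infinity>x\<in>X. (cmod (f x))\<^sup>2)"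
    unfolding norm_mult power_mult_distrib by (rule infsum_cmult_right')
  then show ?thesis
    by (simp add: ell2_norm_def real_sqrt_mult)
qed

lemma ell2_inner_summable: "(\<lambda>x. f x * cnj (g x)) summable_on X"
  if "f \<in> ell2 X" "g \<in> ell2 X"
proof -
  have "(\<lambda>x. (cmod (f x))\<^sup>2 + (cmod (g x))\<^sup>2) summable_on X"
    using that by (intro summable_on_add ell2_summable)
  then have "(\<lambda>x. cmod (f x * cnj (g x))) summable_on X"
  proof (rule summable_on_comparison_test)
    fix x
    show "norm (f x * cnj (g x)) \<le> (cmod (f x))\<^sup>2 + (cmod (g x))\<^sup>2"
    proof -
      have "0 \<le> cmod (f x) * cmod (g x)"
        by simp
      then have "cmod (f x) * cmod (g x) \<le> (cmod (f x))\<^sup>2 + (cmod (g x))\<^sup>2"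
        using sum_squares_bound [of "cmod (f x)" "cmod (g x)"] by linarith
      then show ?thesis
        by (simp add: norm_mult)
    qed
  qed auto
  then show ?thesis
    by (rule abs_summable_summable)
qed

lemma ell2_inner_add_left: "ell2_inner X (\<lambda>x. f x + g x) h = ell2_inner X f h + ell2_inner X g h"
  if "f \<in> ell2 X" "g \<in> ell2 X" "h \<in> ell2 X"
  unfolding ell2_inner_def distrib_right
  using that by (intro infsum_add ell2_inner_summable)

lemma ell2_inner_scale_left: "ell2_inner X (\<lambda>x. c * f x) h = c * ell2_inner X f h"
  unfolding ell2_inner_def mult.assoc by (rule infsum_cmult_right')

lemma ell2_inner_commute: "ell2_inner X g f = cnj (ell2_inner X f g)"
  unfolding ell2_inner_def infsum_cnj [symmetric] by (simp add: mult.commute)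

lemma ell2_inner_add_right: "ell2_inner X h (\<lambda>x. f x + g x) = ell2_inner X h f + ell2_inner X h g"
  if "f \<in> ell2 X" "g \<in> ell2 X" "h \<in> ell2 X"
  using that by (simp add: ell2_inner_commute [of h] ell2_inner_add_left)

lemma ell2_inner_scale_right: "ell2_inner X h (\<lambda>x. c * f x) = cnj c * ell2_inner X h f"
  by (simp add: ell2_inner_commute [of h] ell2_inner_scale_left)

lemma ell2_inner_self: "ell2_inner X f f = of_real ((ell2_norm X f)\<^sup>2)" if "f \<in> ell2 X"
proof -
  have "((\<lambda>x. (cmod (f x))\<^sup>2) has_sum (ell2_norm X f)\<^sup>2) X"
    unfolding ell2_norm_sq using that by (intro has_sum_infsum ell2_summable)
  then have "((\<lambda>x. complex_of_real ((cmod (f x))\<^sup>2)) has_sum of_real ((ell2_norm X f)\<^sup>2)) X"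
    by (rule has_sum_of_real)
  then show ?thesis
    unfolding ell2_inner_def complex_norm_square by (rule infsumI)
qed

lemma ell2_norm_add_sq:
  "(ell2_norm X (\<lambda>x. f x + g x))\<^sup>2 = (ell2_norm X f)\<^sup>2 + 2 * Re (ell2_inner X f g) + (ell2_norm X g)\<^sup>2"
  if "f \<in> ell2 X" "g \<in> ell2 X"
proof -
  have "complex_of_real ((ell2_norm X (\<lambda>x. f x + g x))\<^sup>2) = ell2_inner X (\<lambda>x. f x + g x) (\<lambda>x. f x + g x)"
    using that by (simp add: ell2_inner_self del: of_real_power)
  also have "\<dots> = of_real ((ell2_norm X f)\<^sup>2) + (ell2_inner X f g + cnj (ell2_inner X f g))
      + of_real ((ell2_norm X g)\<^sup>2)"
    using that by (simp add: ell2_inner_add_left ell2_inner_add_right ell2_inner_self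
        ell2_inner_commute [of g f] del: of_real_power)
  also have "\<dots> = of_real ((ell2_norm X f)\<^sup>2 + 2 * Re (ell2_inner X f g) + (ell2_norm X g)\<^sup>2)"
    by (simp add: complex_add_cnj)
  finally show ?thesis
    unfolding of_real_eq_iff .
qed

lemma ell2_Cauchy_Schwarz: "cmod (ell2_inner X f g) \<le> ell2_norm X f * ell2_norm X g"
  if "f \<in> ell2 X" "g \<in> ell2 X"
proof (cases "ell2_norm X g = 0")
  case True
  then have "g = (\<lambda>_. 0)"
    using that ell2_norm_eq_0 by blast
  then show ?thesis
    by (simp add: ell2_inner_def)
next
  case False
  \<comment> \<open>The multiple of g for which f + c g has least norm.\<close>
  define c where "c = - ell2_inner X f g / of_real ((ell2_norm X g)\<^sup>2)"
  let ?s = "(cmod (ell2_inner X f g))\<^sup>2 / (ell2_norm X g)\<^sup>2"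
  have "cnj c * ell2_inner X f g = of_real (- ?s)"
    using False by (simp add: c_def complex_norm_square [symmetric] mult.commute)
  then have "Re (cnj c * ell2_inner X f g) = - ?s"
    by simp
  moreover have "(cmod c * ell2_norm X g)\<^sup>2 = ?s"
    using False by (simp add: c_def norm_divide norm_mult power2_eq_square norm_power)
  ultimately have "(ell2_norm X (\<lambda>x. f x + c * g x))\<^sup>2 = (ell2_norm X f)\<^sup>2 - ?s"
    using that by (simp add: ell2_norm_add_sq ell2_norm_scale ell2_inner_scale_right)
  then have "?s \<le> (ell2_norm X f)\<^sup>2"
    by (metis diff_ge_0_iff_ge zero_le_power2)
  then have "(cmod (ell2_inner X f g))\<^sup>2 \<le> (ell2_norm X f * ell2_norm X g)\<^sup>2"
    using False by (simp add: field_simps power_mult_distrib)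
  then show ?thesis
    by (rule power2_le_imp_le) simp
qed

lemma ell2_norm_triangle: "ell2_norm X (\<lambda>x. f x + g x) \<le> ell2_norm X f + ell2_norm X g"
  if "f \<in> ell2 X" "g \<in> ell2 X"
proof (rule power2_le_imp_le)
  have "Re (ell2_inner X f g) \<le> ell2_norm X f * ell2_norm X g"
    using complex_Re_le_cmod ell2_Cauchy_Schwarz [OF that] by (rule order_trans)
  then show "(ell2_norm X (\<lambda>x. f x + g x))\<^sup>2 \<le> (ell2_norm X f + ell2_norm X g)\<^sup>2"
    using that by (simp add: ell2_norm_add_sq power2_sum)
qed simp

definition ell2_delta :: "'x \<Rightarrow> 'x \<Rightarrow> complex"
  where "ell2_delta y = (\<lambda>x. if x = y then 1 else 0)"

lemma ell2_delta: "ell2_delta y \<in> ell2 X" "ell2_norm X (ell2_delta y) = 1" if "y \<in> X"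
proof -
  have "((\<lambda>x. (cmod (ell2_delta y x))\<^sup>2) has_sum 1) X"
    by (rule has_sum_finite_neutralI [of "{y}"]) (use that in \<open>auto simp: ell2_delta_def\<close>)
  then show "ell2_delta y \<in> ell2 X" "ell2_norm X (ell2_delta y) = 1"
    using that by (auto simp: ell2_def ell2_norm_def ell2_delta_def infsumI has_sum_imp_summable)
qed

lemma ell2_inner_delta: "ell2_inner X f (ell2_delta y) = f y" "ell2_inner X (ell2_delta y) f = cnj (f y)"
  if "y \<in> X"
proof -
  have "((\<lambda>x. f x * cnj (ell2_delta y x)) has_sum f y) X" for f
    by (rule has_sum_finite_neutralI [of "{y}"]) (use that in \<open>auto simp: ell2_delta_def\<close>)
  then show *: "ell2_inner X f (ell2_delta y) = f y" for f
    unfolding ell2_inner_def by (rule infsumI)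
  show "ell2_inner X (ell2_delta y) f = cnj (f y)"
    by (subst ell2_inner_commute) (simp add: *)
qed

lemma ell2_eqI:
  assumes "f \<in> ell2 X" "g \<in> ell2 X" "\<And>h. h \<in> ell2 X \<Longrightarrow> ell2_inner X h f = ell2_inner X h g"
  shows "f = g"
proof
  fix x show "f x = g x"
    using assms ell2_supp [of _ x] ell2_inner_delta(2) [of x] ell2_delta(1) [of x]
    by (cases "x \<in> X") (metis complex_cnj_cancel_iff)+
qed

lemma ell2_truncation:
  assumes "f \<in> ell2 X" "e > 0"
  obtains F where "finite F" "F \<subseteq> X" "ell2_norm X (\<lambda>x. if x \<in> F then 0 else f x) < e"
proof -
  \<comment> \<open>With half of the square of e the tail has norm at most e / sqrt 2, strictly
    below e.\<close>
  obtain F where F: "finite F" "F \<subseteq> X"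
    "dist (\<Sum>x\<in>F. (cmod (f x))\<^sup>2) (\<Sum>\<^sub>\<infinity>x\<in>X. (cmod (f x))\<^sup>2) \<le> e\<^sup>2 / 2"
    using infsum_finite_approximation [OF ell2_summable [OF assms(1)], of "e\<^sup>2 / 2"] assms(2) by auto
  define g where "g = (\<lambda>x. if x \<in> F then 0 else f x)"
  have "g \<in> ell2 X"
  proof (rule ell2I)
    show "(\<Sum>x\<in>H. (cmod (g x))\<^sup>2) \<le> (ell2_norm X f)\<^sup>2" if "finite H" "H \<subseteq> X" for H
    proof -
      have "(\<Sum>x\<in>H. (cmod (g x))\<^sup>2) \<le> (\<Sum>x\<in>H. (cmod (f x))\<^sup>2)"
        by (rule sum_mono) (simp add: g_def)
      also have "\<dots> \<le> (ell2_norm X f)\<^sup>2"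
        using that by (rule ell2_finite_sum_le [OF assms(1)])
      finally show ?thesis .
    qed
  qed (use assms ell2_supp in \<open>auto simp: g_def\<close>)
  have "ell2_norm X g \<le> e / sqrt 2"
  proof (rule ell2_norm_leI [OF \<open>g \<in> ell2 X\<close>])
    fix H assume H: "finite H" "H \<subseteq> X"
    have "(\<Sum>x\<in>H. (cmod (g x))\<^sup>2) = (\<Sum>x\<in>H - F. (cmod (f x))\<^sup>2)"
      by (rule sum.mono_neutral_cong_right) (use H in \<open>auto simp: g_def\<close>)
    also have "\<dots> = (\<Sum>x\<in>F \<union> (H - F). (cmod (f x))\<^sup>2) - (\<Sum>x\<in>F. (cmod (f x))\<^sup>2)"
      using F H by (subst sum.union_disjoint) auto
    also have "\<dots> \<le> (ell2_norm X f)\<^sup>2 - (\<Sum>x\<in>F. (cmod (f x))\<^sup>2)"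
      using F H ell2_finite_sum_le [OF assms(1), of "F \<union> (H - F)"] by auto
    also have "\<dots> \<le> (e / sqrt 2)\<^sup>2"
    proof -
      have "(e / sqrt 2)\<^sup>2 = e\<^sup>2 / 2"
        by (simp add: power_divide)
      then show ?thesis
        using F(3) unfolding ell2_norm_sq dist_real_def by linarith
    qed
    finally show "(\<Sum>x\<in>H. (cmod (g x))\<^sup>2) \<le> (e / sqrt 2)\<^sup>2" .
  qed (use assms in simp)
  also have "\<dots> < e"
    using assms(2) by (simp add: field_simps)
  finally show ?thesis
    using F that by (simp add: g_def)
qed

lemma ell2_finite_combination:
  assumes "finite F" "F \<subseteq> X"
  shows "(\<lambda>x. if x \<in> F then c x else 0) \<in> ell2 X"
    and "(\<lambda>x. if x \<in> F then c x else 0) = (\<lambda>x. \<Sum>y\<in>F. c y * ell2_delta y x)"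
proof -
  show "(\<lambda>x. if x \<in> F then c x else 0) = (\<lambda>x. \<Sum>y\<in>F. c y * ell2_delta y x)"
    using assms(1) by (auto simp: ell2_delta_def if_distrib [of "(*) _"] cong: if_cong)
  have "(\<lambda>x. (cmod (if x \<in> F then c x else 0))\<^sup>2) summable_on X"
    by (rule has_sum_imp_summable [where S = "\<Sum>x\<in>F. (cmod (c x))\<^sup>2"],
        rule has_sum_finite_neutralI [of F]) (use assms in auto)
  then show "(\<lambda>x. if x \<in> F then c x else 0) \<in> ell2 X"
    using assms by (auto simp: ell2_def)
qed

text \<open>Riesz representation: the representing vector is read off on the standard basis.\<close>

lemma ell2_Riesz:
  fixes \<phi> :: "('x \<Rightarrow> complex) \<Rightarrow> complex"
  assumes add: "\<And>f g. f \<in> ell2 X \<Longrightarrow> g \<in> ell2 X \<Longrightarrow> \<phi> (\<lambda>x. f x + g x) = \<phi> f + \<phi> g"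
    and scale: "\<And>c f. f \<in> ell2 X \<Longrightarrow> \<phi> (\<lambda>x. c * f x) = c * \<phi> f"
    and bound: "\<And>f. f \<in> ell2 X \<Longrightarrow> cmod (\<phi> f) \<le> C * ell2_norm X f"
  obtains h where "h \<in> ell2 X" "\<And>f. f \<in> ell2 X \<Longrightarrow> \<phi> f = ell2_inner X f h"
proof -
  define h where "h x = (if x \<in> X then cnj (\<phi> (ell2_delta x)) else 0)" for x
  have comb: "\<phi> (\<lambda>x. if x \<in> F then c x else 0) = (\<Sum>y\<in>F. c y * cnj (h y))"
    if "finite F" "F \<subseteq> X" for F c
    using that
  proof (induction F)
    case empty
    show ?case using scale [of "\<lambda>_. 0" 0] by simp
  next
    case (insert a F)
    have "(\<lambda>x. if x \<in> insert a F then c x else 0)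
        = (\<lambda>x. c a * ell2_delta a x + (if x \<in> F then c x else 0))"
      using insert.hyps by (auto simp: ell2_delta_def)
    then have "\<phi> (\<lambda>x. if x \<in> insert a F then c x else 0)
        = c a * \<phi> (ell2_delta a) + \<phi> (\<lambda>x. if x \<in> F then c x else 0)"
      using insert add [OF ell2_scale [OF ell2_delta(1)] ell2_finite_combination(1)]
      by (simp add: scale ell2_delta)
    then show ?case
      using insert by (simp add: h_def)
  qed
  \<comment> \<open>Test \<phi> on the part k of h supported in F. Both \<phi> k and the squared
    norm of k equal the sum s, so the bound on \<phi> reads s \<le> C times the square root of
    s.\<close>
  have fin: "(\<Sum>x\<in>F. (cmod (h x))\<^sup>2) \<le> C\<^sup>2" if F: "finite F" "F \<subseteq> X" for F
  proof -
    define k where "k = (\<lambda>x. if x \<in> F then h x else 0)"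
    define s where "s = (\<Sum>x\<in>F. (cmod (h x))\<^sup>2)"
    have k: "k \<in> ell2 X"
      using ell2_finite_combination(1) [OF F] by (simp add: k_def)
    have "((\<lambda>x. (cmod (k x))\<^sup>2) has_sum s) X"
      unfolding s_def by (rule has_sum_finite_neutralI [of F]) (use F in \<open>auto simp: k_def\<close>)
    then have nk: "(ell2_norm X k)\<^sup>2 = s"
      unfolding ell2_norm_sq by (rule infsumI)
    have "\<phi> k = of_real s"
      unfolding k_def s_def comb [OF F, of h] of_real_sum complex_norm_square by simp
    then have "s \<le> C * ell2_norm X k"
      using bound [OF k] nk by (metis abs_of_nonneg norm_of_real zero_le_power2)
    then have "s\<^sup>2 \<le> (C * ell2_norm X k)\<^sup>2"
      using nk by (intro power_mono) auto
    then have "s * s \<le> C\<^sup>2 * s"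
      unfolding power_mult_distrib nk by (simp add: power2_eq_square)
    moreover have "s \<ge> 0"
      using nk by (metis zero_le_power2)
    ultimately show ?thesis
      unfolding s_def [symmetric] by (cases "s = 0") auto
  qed
  have h: "h \<in> ell2 X"
    by (rule ell2I [OF _ fin]) (auto simp: h_def)
  have "\<phi> f = ell2_inner X f h" if f: "f \<in> ell2 X" for f
  proof (rule ccontr)
    define d where "d = cmod (\<phi> f - ell2_inner X f h)"
    assume "\<phi> f \<noteq> ell2_inner X f h"
    then have "d > 0"
      by (simp add: d_def)
    \<comment> \<open>A tail of norm below e causes an error below e times the sum of \<bar>C\<bar>
      and the norm of h; the summand 1 keeps the denominator positive.\<close>
    define e where "e = d / (\<bar>C\<bar> + ell2_norm X h + 1)"
    have pos: "\<bar>C\<bar> + ell2_norm X h + 1 > 0"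
      using ell2_norm_nonneg [of h] by linarith
    then have "e > 0"
      using \<open>d > 0\<close> by (simp add: e_def)
    then obtain F where F: "finite F" "F \<subseteq> X" "ell2_norm X (\<lambda>x. if x \<in> F then 0 else f x) < e"
      using ell2_truncation [OF f] by blast
    define a b where "a = (\<lambda>x. if x \<in> F then f x else 0)" and "b = (\<lambda>x. if x \<in> F then 0 else f x)"
    have a: "a \<in> ell2 X"
      unfolding a_def by (rule ell2_finite_combination(1) [OF F(1,2)])
    have fab: "f = (\<lambda>x. a x + b x)"
      by (auto simp: a_def b_def)
    have "b = (\<lambda>x. f x + (-1) * a x)"
      by (auto simp: a_def b_def)
    then have b: "b \<in> ell2 X"
      using f a ell2_add ell2_scale by metis
    have "ell2_inner X a h = (\<Sum>y\<in>F. f y * cnj (h y))"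
      unfolding ell2_inner_def
      by (rule infsumI, rule has_sum_finite_neutralI [of F]) (use F in \<open>auto simp: a_def\<close>)
    also have "\<dots> = \<phi> a"
      using comb [OF F(1,2), of f] by (simp add: a_def)
    finally have "\<phi> f - ell2_inner X f h = \<phi> b - ell2_inner X b h"
      unfolding fab using a b h by (simp add: add ell2_inner_add_left)
    then have "d \<le> cmod (\<phi> b) + cmod (ell2_inner X b h)"
      unfolding d_def by (metis norm_triangle_ineq4)
    also have "\<dots> \<le> C * ell2_norm X b + ell2_norm X b * ell2_norm X h"
      using bound [OF b] ell2_Cauchy_Schwarz [OF b h] by simp
    also have "\<dots> \<le> (\<bar>C\<bar> + ell2_norm X h + 1) * ell2_norm X b"
    proof -
      have "C * ell2_norm X b \<le> \<bar>C\<bar> * ell2_norm X b"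
        by (intro mult_right_mono) auto
      moreover have "0 \<le> ell2_norm X b"
        by simp
      ultimately show ?thesis
        unfolding distrib_right mult_1 mult.commute [of "ell2_norm X b"] by linarith
    qed
    also have "\<dots> < (\<bar>C\<bar> + ell2_norm X h + 1) * e"
      using F(3) pos by (simp add: b_def)
    also have "\<dots> = d"
      using pos by (simp add: e_def)
    finally show False by simp
  qed
  with h show ?thesis
    by (rule that)
qed

end

section \<open>Bounded operators and their adjoints\<close>

context
  fixes X :: "'x set"
begin

abbreviation (input) "BO \<equiv> bounded_operators X"

lemma BO_simps [simp]:
  "mult BO = (\<lambda>S T. \<lambda>f\<in>ell2 X. S (T f))" "one BO = (\<lambda>f\<in>ell2 X. f)"
  "zero BO = (\<lambda>f\<in>ell2 X. \<lambda>_. 0)" "add BO = (\<lambda>S T. \<lambda>f\<in>ell2 X. \<lambda>x. S f x + T f x)"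
  "smult BO = (\<lambda>c T. \<lambda>f\<in>ell2 X. \<lambda>x. c * T f x)"
  by (simp_all add: bounded_operators_def)

lemma BO_carrier_iff: "T \<in> carrier BO \<longleftrightarrow> T \<in> extensional (ell2 X) \<and>
    (\<forall>f\<in>ell2 X. T f \<in> ell2 X) \<and>
    (\<forall>f\<in>ell2 X. \<forall>g\<in>ell2 X. T (\<lambda>x. f x + g x) = (\<lambda>x. T f x + T g x)) \<and>
    (\<forall>c. \<forall>f\<in>ell2 X. T (\<lambda>x. c * f x) = (\<lambda>x. c * T f x)) \<and>
    (\<exists>C. \<forall>f\<in>ell2 X. ell2_norm X (T f) \<le> C * ell2_norm X f)"
  by (auto simp: bounded_operators_def PiE_iff)

lemma BO_I:
  assumes "T \<in> extensional (ell2 X)" "\<And>f. f \<in> ell2 X \<Longrightarrow> T f \<in> ell2 X"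
    and "\<And>f g. f \<in> ell2 X \<Longrightarrow> g \<in> ell2 X \<Longrightarrow> T (\<lambda>x. f x + g x) = (\<lambda>x. T f x + T g x)"
    and "\<And>c f. f \<in> ell2 X \<Longrightarrow> T (\<lambda>x. c * f x) = (\<lambda>x. c * T f x)"
    and "\<And>f. f \<in> ell2 X \<Longrightarrow> ell2_norm X (T f) \<le> C * ell2_norm X f"
  shows "T \<in> carrier BO"
  using assms unfolding BO_carrier_iff by (intro conjI ballI allI exI [of _ C]) auto

lemma BO_ext: "T \<in> carrier BO \<Longrightarrow> T \<in> extensional (ell2 X)"
  and BO_ell2 [simp]: "T \<in> carrier BO \<Longrightarrow> f \<in> ell2 X \<Longrightarrow> T f \<in> ell2 X"
  and BO_add: "T \<in> carrier BO \<Longrightarrow> f \<in> ell2 X \<Longrightarrow> g \<in> ell2 X \<Longrightarrow>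
      T (\<lambda>x. f x + g x) = (\<lambda>x. T f x + T g x)"
  and BO_scale: "T \<in> carrier BO \<Longrightarrow> f \<in> ell2 X \<Longrightarrow> T (\<lambda>x. c * f x) = (\<lambda>x. c * T f x)"
  by (simp_all add: BO_carrier_iff)

lemma BO_bounded:
  assumes "T \<in> carrier BO"
  obtains C where "C \<ge> 0" "\<And>f. f \<in> ell2 X \<Longrightarrow> ell2_norm X (T f) \<le> C * ell2_norm X f"
proof -
  obtain C where C: "\<And>f. f \<in> ell2 X \<Longrightarrow> ell2_norm X (T f) \<le> C * ell2_norm X f"
    using assms unfolding BO_carrier_iff by blast
  show ?thesis
  proof (rule that [of "\<bar>C\<bar>"])
    fix f assume "f \<in> ell2 X"
    with C have "ell2_norm X (T f) \<le> C * ell2_norm X f"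
      by blast
    also have "\<dots> \<le> \<bar>C\<bar> * ell2_norm X f"
      by (intro mult_right_mono) auto
    finally show "ell2_norm X (T f) \<le> \<bar>C\<bar> * ell2_norm X f" .
  qed simp
qed

abbreviation (input) "opnorm \<equiv> cnorm BO"

lemma opnorm_def: "opnorm T = (SUP f\<in>{f \<in> ell2 X. ell2_norm X f \<le> 1}. ell2_norm X (T f))"
  by (simp add: bounded_operators_def)

lemma opnorm_bdd:
  "bdd_above ((\<lambda>f. ell2_norm X (T f)) ` {f \<in> ell2 X. ell2_norm X f \<le> 1})" if T: "T \<in> carrier BO"
proof -
  obtain C where C: "C \<ge> 0" "\<And>f. f \<in> ell2 X \<Longrightarrow> ell2_norm X (T f) \<le> C * ell2_norm X f"
    using BO_bounded [OF T] by blast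
  then have "ell2_norm X (T f) \<le> C" if "f \<in> ell2 X" "ell2_norm X f \<le> 1" for f
    using C(2) [OF that(1)] mult_left_mono [OF that(2) C(1)] by simp
  then show ?thesis
    by (intro bdd_aboveI2) auto
qed

lemma opnorm_nonneg: "0 \<le> opnorm T" if "T \<in> carrier BO"
proof -
  have "ell2_norm X (T (\<lambda>_. 0)) \<le> opnorm T"
    unfolding opnorm_def by (rule cSUP_upper [OF _ opnorm_bdd [OF that]]) simp
  then show ?thesis
    using ell2_norm_nonneg order_trans by blast
qed

lemma opnorm_bound: "ell2_norm X (T f) \<le> opnorm T * ell2_norm X f"
  if T: "T \<in> carrier BO" and f: "f \<in> ell2 X"
proof (cases "ell2_norm X f = 0")
  case True
  obtain C where C: "\<And>f. f \<in> ell2 X \<Longrightarrow> ell2_norm X (T f) \<le> C * ell2_norm X f"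
    using BO_bounded [OF T] by blast
  show ?thesis
    using C [OF f] True by simp
next
  case False
  define c where "c = complex_of_real (inverse (ell2_norm X f))"
  have c: "cmod c = inverse (ell2_norm X f)"
    by (simp add: c_def norm_inverse)
  have "ell2_norm X (T (\<lambda>x. c * f x)) \<le> opnorm T"
    unfolding opnorm_def
    by (rule cSUP_upper [OF _ opnorm_bdd [OF T]]) (use f c False in \<open>simp add: ell2_norm_scale\<close>)
  then have "inverse (ell2_norm X f) * ell2_norm X (T f) \<le> opnorm T"
    using T f c by (simp add: BO_scale ell2_norm_scale)
  then show ?thesis
    using False ell2_norm_nonneg [of X f] by (simp add: field_simps)
qed

lemma opnorm_leI: "opnorm T \<le> C"
  if "0 \<le> C" "\<And>f. f \<in> ell2 X \<Longrightarrow> ell2_norm X (T f) \<le> C * ell2_norm X f"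
proof -
  have "ell2_norm X (T f) \<le> C" if "f \<in> ell2 X" "ell2_norm X f \<le> 1" for f
    using \<open>0 \<le> C\<close> that(2) \<open>\<And>f. f \<in> ell2 X \<Longrightarrow> ell2_norm X (T f) \<le> C * ell2_norm X f\<close> [OF that(1)]
      mult_left_mono [OF that(2) \<open>0 \<le> C\<close>] by simp
  moreover have "(\<lambda>_. 0) \<in> {f \<in> ell2 X. ell2_norm X f \<le> 1}"
    by simp
  ultimately show ?thesis
    unfolding opnorm_def by (intro cSUP_least) blast+
qed

lemma BO_ops_ext:
  "S \<otimes>\<^bsub>BO\<^esub> T \<in> extensional (ell2 X)" "S \<oplus>\<^bsub>BO\<^esub> T \<in> extensional (ell2 X)"
  "c \<odot>\<^bsub>BO\<^esub> T \<in> extensional (ell2 X)"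
  by (simp_all only: BO_simps restrict_extensional)

lemma BO_zero_closed: "zero BO \<in> carrier BO"
  by (rule BO_I [where C = 1]) auto

lemma BO_mult_closed: "S \<otimes>\<^bsub>BO\<^esub> T \<in> carrier BO"
  and opnorm_mult: "opnorm (S \<otimes>\<^bsub>BO\<^esub> T) \<le> opnorm S * opnorm T"
  if S: "S \<in> carrier BO" and T: "T \<in> carrier BO"
proof -
  have *: "ell2_norm X ((S \<otimes>\<^bsub>BO\<^esub> T) f) \<le> opnorm S * opnorm T * ell2_norm X f" if "f \<in> ell2 X" for f
  proof -
    have "ell2_norm X (S (T f)) \<le> opnorm S * ell2_norm X (T f)"
      using that S T by (intro opnorm_bound) auto
    also have "\<dots> \<le> opnorm S * (opnorm T * ell2_norm X f)"
      using that S T by (intro mult_left_mono opnorm_bound opnorm_nonneg)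
    finally show ?thesis
      using that by simp
  qed
  show "S \<otimes>\<^bsub>BO\<^esub> T \<in> carrier BO"
    by (rule BO_I [OF BO_ops_ext(1) _ _ _ *]) (use S T in \<open>auto simp: BO_add BO_scale\<close>)
  show "opnorm (S \<otimes>\<^bsub>BO\<^esub> T) \<le> opnorm S * opnorm T"
    by (rule opnorm_leI [OF _ *]) (use S T in \<open>auto simp: opnorm_nonneg\<close>)
qed

lemma BO_add_closed: "S \<oplus>\<^bsub>BO\<^esub> T \<in> carrier BO"
  and opnorm_add: "opnorm (S \<oplus>\<^bsub>BO\<^esub> T) \<le> opnorm S + opnorm T"
  if S: "S \<in> carrier BO" and T: "T \<in> carrier BO"
proof -
  have *: "ell2_norm X ((S \<oplus>\<^bsub>BO\<^esub> T) f) \<le> (opnorm S + opnorm T) * ell2_norm X f" if f: "f \<in> ell2 X" for f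
  proof -
    have "ell2_norm X (\<lambda>x. S f x + T f x) \<le> ell2_norm X (S f) + ell2_norm X (T f)"
      using f S T by (intro ell2_norm_triangle) auto
    also have "\<dots> \<le> opnorm S * ell2_norm X f + opnorm T * ell2_norm X f"
      using f S T by (intro add_mono opnorm_bound)
    finally show ?thesis
      using f by (simp add: distrib_right)
  qed
  show "S \<oplus>\<^bsub>BO\<^esub> T \<in> carrier BO"
    by (rule BO_I [OF BO_ops_ext(2) _ _ _ *]) (use S T in \<open>auto simp: BO_add BO_scale algebra_simps\<close>)
  show "opnorm (S \<oplus>\<^bsub>BO\<^esub> T) \<le> opnorm S + opnorm T"
    by (rule opnorm_leI [OF _ *]) (use S T in \<open>auto simp: opnorm_nonneg\<close>)
qed

lemma BO_smult_closed: "c \<odot>\<^bsub>BO\<^esub> T \<in> carrier BO"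
  and opnorm_smult_le: "opnorm (c \<odot>\<^bsub>BO\<^esub> T) \<le> cmod c * opnorm T"
  if T: "T \<in> carrier BO"
proof -
  have *: "ell2_norm X ((c \<odot>\<^bsub>BO\<^esub> T) f) \<le> (cmod c * opnorm T) * ell2_norm X f" if f: "f \<in> ell2 X" for f
    using opnorm_bound [OF T f] mult_left_mono [of _ _ "cmod c"] f
    by (simp add: ell2_norm_scale mult.assoc)
  show "c \<odot>\<^bsub>BO\<^esub> T \<in> carrier BO"
    by (rule BO_I [OF BO_ops_ext(3) _ _ _ *]) (use T in \<open>auto simp: BO_add BO_scale algebra_simps\<close>)
  show "opnorm (c \<odot>\<^bsub>BO\<^esub> T) \<le> cmod c * opnorm T"
    by (rule opnorm_leI [OF _ *]) (use T in \<open>auto simp: opnorm_nonneg\<close>)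
qed

lemma opnorm_smult: "opnorm (c \<odot>\<^bsub>BO\<^esub> T) = cmod c * opnorm T" if T: "T \<in> carrier BO"
proof (cases "c = 0")
  case True
  then show ?thesis
    using opnorm_smult_le [OF T, of 0] opnorm_nonneg [OF BO_smult_closed [OF T, of 0]] by simp
next
  case False
  have "inverse c \<odot>\<^bsub>BO\<^esub> (c \<odot>\<^bsub>BO\<^esub> T) = T"
    using False T by (intro extensionalityI [OF _ BO_ext]) (auto simp: BO_smult_closed)
  then have "opnorm T \<le> inverse (cmod c) * opnorm (c \<odot>\<^bsub>BO\<^esub> T)"
    using opnorm_smult_le [OF BO_smult_closed [OF T, of c], of "inverse c"]
    by (simp add: norm_inverse del: BO_simps)
  then show ?thesis
    using False opnorm_smult_le [OF T, of c] by (simp add: field_simps del: BO_simps)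
qed

text \<open>The additive inverse is computed straight from its definition as a unique solution; the
  bounded operators are handled without ring axioms throughout.\<close>

lemma BO_minus: "S \<ominus>\<^bsub>BO\<^esub> T = (\<lambda>f\<in>ell2 X. \<lambda>x. S f x - T f x)"
  if S: "S \<in> carrier BO" and T: "T \<in> carrier BO"
proof -
  have "\<ominus>\<^bsub>BO\<^esub> T = (-1) \<odot>\<^bsub>BO\<^esub> T"
    unfolding a_inv_def m_inv_def
  proof (rule the_equality)
    show "(-1) \<odot>\<^bsub>BO\<^esub> T \<in> carrier (add_monoid BO) \<and>
      T \<otimes>\<^bsub>add_monoid BO\<^esub> ((-1) \<odot>\<^bsub>BO\<^esub> T) = \<one>\<^bsub>add_monoid BO\<^esub> \<and>
      ((-1) \<odot>\<^bsub>BO\<^esub> T) \<otimes>\<^bsub>add_monoid BO\<^esub> T = \<one>\<^bsub>add_monoid BO\<^esub>"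
      using BO_smult_closed [OF T, of "-1"] by (auto simp: fun_eq_iff)
  next
    fix Y
    assume Y: "Y \<in> carrier (add_monoid BO) \<and> T \<otimes>\<^bsub>add_monoid BO\<^esub> Y = \<one>\<^bsub>add_monoid BO\<^esub> \<and>
      Y \<otimes>\<^bsub>add_monoid BO\<^esub> T = \<one>\<^bsub>add_monoid BO\<^esub>"
    have Y': "Y \<in> carrier BO" "(\<lambda>f\<in>ell2 X. \<lambda>x. Y f x + T f x) = (\<lambda>f\<in>ell2 X. \<lambda>_. 0)"
      using Y by simp_all
    show "Y = (-1) \<odot>\<^bsub>BO\<^esub> T"
    proof (rule extensionalityI)
      show "Y \<in> extensional (ell2 X)" "(-1) \<odot>\<^bsub>BO\<^esub> T \<in> extensional (ell2 X)"
        using Y' BO_ext by auto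
      fix f assume f: "f \<in> ell2 X"
      have "(\<lambda>x. Y f x + T f x) = (\<lambda>_. 0)"
        using fun_cong [OF Y'(2), of f] f by simp
      then have "Y f x + T f x = 0" for x
        by (rule fun_cong)
      then show "Y f = ((-1) \<odot>\<^bsub>BO\<^esub> T) f"
        using f by (auto simp: fun_eq_iff eq_neg_iff_add_eq_0)
    qed
  qed
  then show ?thesis
    by (auto simp: a_minus_def fun_eq_iff)
qed

lemma BO_minus_closed: "S \<ominus>\<^bsub>BO\<^esub> T \<in> carrier BO"
  if S: "S \<in> carrier BO" and T: "T \<in> carrier BO"
proof -
  have "S \<ominus>\<^bsub>BO\<^esub> T = S \<oplus>\<^bsub>BO\<^esub> ((-1) \<odot>\<^bsub>BO\<^esub> T)"
    using that by (auto simp: BO_minus fun_eq_iff)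
  then show ?thesis
    using that by (simp add: BO_add_closed BO_smult_closed del: BO_simps)
qed

lemma opnorm_minus_commute: "opnorm (S \<ominus>\<^bsub>BO\<^esub> T) = opnorm (T \<ominus>\<^bsub>BO\<^esub> S)"
  if S: "S \<in> carrier BO" and T: "T \<in> carrier BO"
proof -
  have "S \<ominus>\<^bsub>BO\<^esub> T = (-1) \<odot>\<^bsub>BO\<^esub> (T \<ominus>\<^bsub>BO\<^esub> S)"
    using that by (auto simp: BO_minus fun_eq_iff)
  then show ?thesis
    using opnorm_smult [OF BO_minus_closed [OF T S], of "-1"] by simp
qed

lemma ell2_inner_bound_imp:
  assumes "h \<in> ell2 X" "0 \<le> C" "\<And>f. f \<in> ell2 X \<Longrightarrow> cmod (ell2_inner X f h) \<le> C * ell2_norm X f"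
  shows "ell2_norm X h \<le> C"
proof -
  have "ell2_norm X h * ell2_norm X h \<le> C * ell2_norm X h"
    using assms(3) [OF assms(1)]
    by (simp add: ell2_inner_self [OF assms(1)] power2_eq_square norm_mult)
  then show ?thesis
    using assms(2) ell2_norm_nonneg [of X h] by (cases "ell2_norm X h = 0") auto
qed

text \<open>The adjoint is a definite description. Riesz representation of the functional pairing T
  f with g gives existence, and testing against all vectors gives uniqueness.\<close>

lemma BO_star:
  assumes T: "T \<in> carrier BO" and g: "g \<in> ell2 X"
  shows BO_star_ell2: "star BO T g \<in> ell2 X"
    and BO_star_inner: "f \<in> ell2 X \<Longrightarrow> ell2_inner X (T f) g = ell2_inner X f (star BO T g)"
proof -
  obtain h where h: "h \<in> ell2 X" "\<And>f. f \<in> ell2 X \<Longrightarrow> ell2_inner X (T f) g = ell2_inner X f h"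
  proof (rule ell2_Riesz [where \<phi> = "\<lambda>f. ell2_inner X (T f) g" and C = "opnorm T * ell2_norm X g"])
    fix f assume f: "f \<in> ell2 X"
    have "cmod (ell2_inner X (T f) g) \<le> ell2_norm X (T f) * ell2_norm X g"
      using f g T by (intro ell2_Cauchy_Schwarz) auto
    also have "\<dots> \<le> opnorm T * ell2_norm X f * ell2_norm X g"
      using f g T by (intro mult_right_mono opnorm_bound) auto
    finally show "cmod (ell2_inner X (T f) g) \<le> opnorm T * ell2_norm X g * ell2_norm X f"
      by (simp add: mult_ac)
  qed (use T g in \<open>auto simp: BO_add BO_scale ell2_inner_add_left ell2_inner_scale_left\<close>)
  have "star BO T g = (THE h. h \<in> ell2 X \<and> (\<forall>f\<in>ell2 X. ell2_inner X (T f) g = ell2_inner X f h))"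
    using g by (simp add: bounded_operators_def)
  also have "\<dots> = h"
  proof (rule the_equality)
    fix k assume k: "k \<in> ell2 X \<and> (\<forall>f\<in>ell2 X. ell2_inner X (T f) g = ell2_inner X f k)"
    then show "k = h"
      using h by (intro ell2_eqI [of k X h]) auto
  qed (use h in auto)
  finally show "star BO T g \<in> ell2 X"
    "f \<in> ell2 X \<Longrightarrow> ell2_inner X (T f) g = ell2_inner X f (star BO T g)"
    using h by auto
qed

lemma BO_star_ext: "star BO T \<in> extensional (ell2 X)"
  by (simp add: bounded_operators_def)

lemma BO_star_unique:
  assumes "T \<in> carrier BO" "S \<in> extensional (ell2 X)" "\<And>g. g \<in> ell2 X \<Longrightarrow> S g \<in> ell2 X"
    and "\<And>f g. f \<in> ell2 X \<Longrightarrow> g \<in> ell2 X \<Longrightarrow> ell2_inner X (T f) g = ell2_inner X f (S g)"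
  shows "star BO T = S"
proof (rule extensionalityI [OF BO_star_ext assms(2)])
  fix g assume "g \<in> ell2 X"
  then show "star BO T g = S g"
    using assms BO_star [OF assms(1)] by (intro ell2_eqI [of _ X]) (auto simp flip: assms(4))
qed

lemma BO_star_closed: "star BO T \<in> carrier BO"
  and opnorm_star_le: "opnorm (star BO T) \<le> opnorm T" if T: "T \<in> carrier BO"
proof -
  note star = BO_star [OF T]
  have *: "ell2_norm X (star BO T g) \<le> opnorm T * ell2_norm X g" if g: "g \<in> ell2 X" for g
  proof (rule ell2_inner_bound_imp)
    fix f assume f: "f \<in> ell2 X"
    have "cmod (ell2_inner X (T f) g) \<le> ell2_norm X (T f) * ell2_norm X g"
      using f g T by (intro ell2_Cauchy_Schwarz) auto
    also have "\<dots> \<le> opnorm T * ell2_norm X f * ell2_norm X g"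
      using f g T by (intro mult_right_mono opnorm_bound) auto
    finally show "cmod (ell2_inner X f (star BO T g)) \<le> opnorm T * ell2_norm X g * ell2_norm X f"
      using star f g by (simp add: mult_ac)
  qed (use g star T in \<open>auto simp: opnorm_nonneg\<close>)
  show "star BO T \<in> carrier BO"
  proof (rule BO_I [OF BO_star_ext _ _ _ *])
    fix f g assume f: "f \<in> ell2 X" and g: "g \<in> ell2 X"
    show "star BO T (\<lambda>x. f x + g x) = (\<lambda>x. star BO T f x + star BO T g x)"
      by (rule ell2_eqI [of _ X])
        (use f g T star in \<open>auto simp: ell2_inner_add_right simp flip: BO_star_inner\<close>)
  next
    fix c f assume f: "f \<in> ell2 X"
    show "star BO T (\<lambda>x. c * f x) = (\<lambda>x. c * star BO T f x)"
      by (rule ell2_eqI [of _ X])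
        (use f T star in \<open>auto simp: ell2_inner_scale_right simp flip: BO_star_inner\<close>)
  qed (use star in auto)
  show "opnorm (star BO T) \<le> opnorm T"
    by (rule opnorm_leI [OF _ *]) (use T in \<open>auto simp: opnorm_nonneg\<close>)
qed

lemma opnorm_star_mult: "opnorm (star BO T \<otimes>\<^bsub>BO\<^esub> T) = (opnorm T)\<^sup>2" if T: "T \<in> carrier BO"
proof (rule antisym)
  have "opnorm (star BO T \<otimes>\<^bsub>BO\<^esub> T) \<le> opnorm (star BO T) * opnorm T"
    using T by (intro opnorm_mult BO_star_closed)
  also have "\<dots> \<le> opnorm T * opnorm T"
    using T by (intro mult_right_mono opnorm_star_le opnorm_nonneg)
  finally show "opnorm (star BO T \<otimes>\<^bsub>BO\<^esub> T) \<le> (opnorm T)\<^sup>2"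
    by (simp add: power2_eq_square)
  let ?N = "opnorm (star BO T \<otimes>\<^bsub>BO\<^esub> T)"
  have closed: "star BO T \<otimes>\<^bsub>BO\<^esub> T \<in> carrier BO"
    using T by (intro BO_mult_closed BO_star_closed)
  have "ell2_norm X (T f) \<le> sqrt ?N * ell2_norm X f" if f: "f \<in> ell2 X" for f
  proof (rule power2_le_imp_le)
    have "complex_of_real ((ell2_norm X (T f))\<^sup>2) = ell2_inner X f (star BO T (T f))"
      using T f by (simp add: ell2_inner_self BO_star_inner del: of_real_power flip: BO_star_inner)
    then have "(ell2_norm X (T f))\<^sup>2 = cmod (ell2_inner X f (star BO T (T f)))"
      by (metis abs_of_nonneg norm_of_real zero_le_power2)
    also have "\<dots> \<le> ell2_norm X f * ell2_norm X (star BO T (T f))"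
      using T f by (intro ell2_Cauchy_Schwarz BO_star) auto
    also have "\<dots> \<le> ell2_norm X f * (?N * ell2_norm X f)"
      using opnorm_bound [OF closed f] f by (intro mult_left_mono) simp_all
    also have "\<dots> = (sqrt ?N * ell2_norm X f)\<^sup>2"
      using opnorm_nonneg [OF closed] by (simp add: power_mult_distrib power2_eq_square mult_ac)
    finally show "(ell2_norm X (T f))\<^sup>2 \<le> (sqrt ?N * ell2_norm X f)\<^sup>2" .
  qed (use opnorm_nonneg [OF closed] in simp)
  then have "opnorm T \<le> sqrt ?N"
    using opnorm_nonneg [OF closed] by (intro opnorm_leI) auto
  then show "(opnorm T)\<^sup>2 \<le> ?N"
    using opnorm_nonneg [OF T] opnorm_nonneg [OF closed]
    by (metis real_sqrt_le_iff real_sqrt_pow2 power_mono)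
qed

text \<open>Completeness of the bounded operators. Coordinates converge in the complex numbers.
  Every norm estimate is passed to the limit on a finite set of coordinates, where it concerns a
  finite sum, and only then extended to the whole norm.\<close>

lemma BO_limit:
  assumes T: "\<And>n. T n \<in> carrier BO"
    and Cauchy: "\<And>e. e > 0 \<Longrightarrow> \<exists>N. \<forall>m\<ge>N. \<forall>n\<ge>N. opnorm (T m \<ominus>\<^bsub>BO\<^esub> T n) < e"
  defines "L \<equiv> \<lambda>f\<in>ell2 X. \<lambda>x. lim (\<lambda>n. T n f x)"
  shows "L \<in> carrier BO" "\<And>f x. f \<in> ell2 X \<Longrightarrow> (\<lambda>n. T n f x) \<longlonglongrightarrow> L f x"
    and "\<And>e. e > 0 \<Longrightarrow> \<exists>N. \<forall>n\<ge>N. opnorm (T n \<ominus>\<^bsub>BO\<^esub> L) \<le> e"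
proof -
  have diff: "ell2_norm X (\<lambda>x. T m f x - T n f x) \<le> opnorm (T m \<ominus>\<^bsub>BO\<^esub> T n) * ell2_norm X f"
    if "f \<in> ell2 X" for m n f
    using opnorm_bound [OF BO_minus_closed [OF T T] that] that by (simp add: BO_minus T)
  have "Cauchy (\<lambda>n. T n f x)" if f: "f \<in> ell2 X" for f x
  proof (rule metric_CauchyI)
    fix e :: real assume "e > 0"
    define d where "d = e / (ell2_norm X f + 1)"
    have pos: "ell2_norm X f + 1 > 0"
      using ell2_norm_nonneg [of X f] by linarith
    have "d > 0"
      using \<open>e > 0\<close> pos by (simp add: d_def)
    obtain N where N: "\<forall>m\<ge>N. \<forall>n\<ge>N. opnorm (T m \<ominus>\<^bsub>BO\<^esub> T n) < d"
      using Cauchy [OF \<open>d > 0\<close>] by blast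
    have "dist (T m f x) (T n f x) < e" if "m \<ge> N" "n \<ge> N" for m n
    proof -
      have "dist (T m f x) (T n f x) \<le> ell2_norm X (\<lambda>x. T m f x - T n f x)"
        unfolding dist_norm using T f by (intro ell2_bound [of "\<lambda>x. T m f x - T n f x"]) auto
      also have "\<dots> \<le> opnorm (T m \<ominus>\<^bsub>BO\<^esub> T n) * ell2_norm X f"
        using f by (rule diff)
      also have "\<dots> \<le> d * ell2_norm X f"
        using N that by (intro mult_right_mono) (auto intro: less_imp_le)
      also have "\<dots> < d * (ell2_norm X f + 1)"
        using \<open>d > 0\<close> by simp
      also have "\<dots> = e"
        using pos by (simp add: d_def)
      finally show ?thesis .
    qed
    then show "\<exists>M. \<forall>m\<ge>M. \<forall>n\<ge>M. dist (T m f x) (T n f x) < e"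
      by blast
  qed
  then show lim: "(\<lambda>n. T n f x) \<longlonglongrightarrow> L f x" if "f \<in> ell2 X" for f x
    using that by (simp add: L_def Cauchy_convergent_iff convergent_LIMSEQ_iff)
  have est: "(\<Sum>x\<in>F. (cmod (T n f x - L f x))\<^sup>2) \<le> (e * ell2_norm X f)\<^sup>2"
    if F: "finite F" "F \<subseteq> X" and f: "f \<in> ell2 X"
      and N: "\<forall>m\<ge>N. opnorm (T n \<ominus>\<^bsub>BO\<^esub> T m) < e" for F f n e N
  proof (rule LIMSEQ_le_const2)
    show "(\<lambda>m. \<Sum>x\<in>F. (cmod (T n f x - T m f x))\<^sup>2) \<longlonglongrightarrow> (\<Sum>x\<in>F. (cmod (T n f x - L f x))\<^sup>2)"
      by (intro tendsto_intros lim f)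
    have "(\<Sum>x\<in>F. (cmod (T n f x - T m f x))\<^sup>2) \<le> (e * ell2_norm X f)\<^sup>2" if "m \<ge> N" for m
    proof -
      have "(\<Sum>x\<in>F. (cmod (T n f x - T m f x))\<^sup>2) \<le> (ell2_norm X (\<lambda>x. T n f x - T m f x))\<^sup>2"
        using T f F by (intro ell2_finite_sum_le) auto
      also have "\<dots> \<le> (e * ell2_norm X f)\<^sup>2"
      proof (rule power_mono)
        have "ell2_norm X (\<lambda>x. T n f x - T m f x) \<le> opnorm (T n \<ominus>\<^bsub>BO\<^esub> T m) * ell2_norm X f"
          using f by (rule diff)
        also have "\<dots> \<le> e * ell2_norm X f"
          using N that by (intro mult_right_mono) (auto intro: less_imp_le)
        finally show "ell2_norm X (\<lambda>x. T n f x - T m f x) \<le> e * ell2_norm X f" .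
      qed simp
      finally show ?thesis .
    qed
    then show "\<exists>N. \<forall>m\<ge>N. (\<Sum>x\<in>F. (cmod (T n f x - T m f x))\<^sup>2) \<le> (e * ell2_norm X f)\<^sup>2"
      by blast
  qed
  have supp: "L f x = 0" if "f \<in> ell2 X" "x \<notin> X" for f x
    using LIMSEQ_unique [OF lim [OF that(1), of x], of 0] ell2_supp [OF BO_ell2 [OF T that(1)] that(2)]
    by simp
  have dL: "(\<lambda>x. T n f x - L f x) \<in> ell2 X" "ell2_norm X (\<lambda>x. T n f x - L f x) \<le> e * ell2_norm X f"
    if f: "f \<in> ell2 X" and N: "\<forall>m\<ge>N. opnorm (T n \<ominus>\<^bsub>BO\<^esub> T m) < e" for f n e N
  proof -
    show *: "(\<lambda>x. T n f x - L f x) \<in> ell2 X"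
      by (rule ell2I [OF _ est [OF _ _ f N]]) (use supp [OF f] ell2_supp [OF BO_ell2 [OF T f]] in auto)
    have "0 \<le> e"
      using N opnorm_nonneg [OF BO_minus_closed [OF T T]] by (meson less_imp_le order.trans order_refl)
    then show "ell2_norm X (\<lambda>x. T n f x - L f x) \<le> e * ell2_norm X f"
      by (intro ell2_norm_leI [OF *] est [OF _ _ f N]) auto
  qed
  \<comment> \<open>One operator within distance 1 of all later ones: L inherits boundedness from it
    and from the bounded difference.\<close>
  obtain N where N: "\<forall>m\<ge>N. opnorm (T N \<ominus>\<^bsub>BO\<^esub> T m) < 1"
    using Cauchy [of 1] by auto
  have L: "L f = (\<lambda>x. T N f x - (T N f x - L f x))" for f
    by simp
  show LBO: "L \<in> carrier BO"
  proof (rule BO_I)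
    fix f assume f: "f \<in> ell2 X"
    show Lf: "L f \<in> ell2 X"
      by (subst L, rule ell2_diff) (use f T dL(1) [OF f N] in auto)
    have "ell2_norm X (L f) = ell2_norm X (\<lambda>x. T N f x + (-1) * (T N f x - L f x))"
      by simp
    also have "\<dots> \<le> ell2_norm X (T N f) + ell2_norm X (\<lambda>x. (-1) * (T N f x - L f x))"
      using f T dL(1) [OF f N] by (intro ell2_norm_triangle ell2_scale) auto
    also have "\<dots> \<le> (opnorm (T N) + 1) * ell2_norm X f"
      using opnorm_bound [OF T f, of N] dL(2) [OF f N]
      unfolding ell2_norm_scale by (simp add: distrib_right)
    finally show "ell2_norm X (L f) \<le> (opnorm (T N) + 1) * ell2_norm X f" .
    fix g assume g: "g \<in> ell2 X"
    show "L (\<lambda>x. f x + g x) = (\<lambda>x. L f x + L g x)"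
    proof
      fix x
      have "(\<lambda>n. T n (\<lambda>x. f x + g x) x) \<longlonglongrightarrow> L f x + L g x"
        using tendsto_add [OF lim [OF f, of x] lim [OF g, of x]] by (simp add: BO_add [OF T f g])
      then show "L (\<lambda>x. f x + g x) x = L f x + L g x"
        using LIMSEQ_unique lim [OF ell2_add [OF f g], of x] by blast
    qed
  next
    fix c f assume f: "f \<in> ell2 X"
    show "L (\<lambda>x. c * f x) = (\<lambda>x. c * L f x)"
    proof
      fix x
      have "(\<lambda>n. T n (\<lambda>x. c * f x) x) \<longlonglongrightarrow> c * L f x"
        using tendsto_mult_left [OF lim [OF f, of x]] by (simp add: BO_scale [OF T f])
      then show "L (\<lambda>x. c * f x) x = c * L f x"
        using LIMSEQ_unique lim [OF ell2_scale [OF f]] by blast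
    qed
  qed (simp add: L_def)
  show "\<exists>N. \<forall>n\<ge>N. opnorm (T n \<ominus>\<^bsub>BO\<^esub> L) \<le> e" if "0 < e" for e
  proof -
    obtain N where N: "\<forall>n\<ge>N. \<forall>m\<ge>N. opnorm (T n \<ominus>\<^bsub>BO\<^esub> T m) < e"
      using Cauchy [OF \<open>0 < e\<close>] by blast
    have "opnorm (T n \<ominus>\<^bsub>BO\<^esub> L) \<le> e" if "n \<ge> N" for n
    proof (rule opnorm_leI)
      fix f assume f: "f \<in> ell2 X"
      show "ell2_norm X ((T n \<ominus>\<^bsub>BO\<^esub> L) f) \<le> e * ell2_norm X f"
        using dL(2) [OF f, of N n e] N that f by (simp add: BO_minus T LBO)
    qed (use \<open>e > 0\<close> in simp)
    then show ?thesis by blast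
  qed
qed

end

section \<open>Completion of a seminormed *-algebra\<close>

text \<open>The operations of the ring type serve as the algebra operations; only the carrier is
  restricted.\<close>

locale star_alg =
  fixes A :: "('b::ring_1, 'm) star_algebra_scheme"
  assumes ops [simp]: "mult A = (*)" "one A = 1" "add A = (+)" "zero A = 0"
    and closed [simp, intro]: "1 \<in> carrier A" "0 \<in> carrier A"
      "x \<in> carrier A \<Longrightarrow> y \<in> carrier A \<Longrightarrow> x + y \<in> carrier A"
      "x \<in> carrier A \<Longrightarrow> y \<in> carrier A \<Longrightarrow> x * y \<in> carrier A"
      "x \<in> carrier A \<Longrightarrow> smult A c x \<in> carrier A"
      "x \<in> carrier A \<Longrightarrow> star A x \<in> carrier A"
    and smult: "x \<in> carrier A \<Longrightarrow> y \<in> carrier A \<Longrightarrow> smult A c (x + y) = smult A c x + smult A c y"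
      "x \<in> carrier A \<Longrightarrow> smult A (c + d) x = smult A c x + smult A d x"
      "x \<in> carrier A \<Longrightarrow> smult A c (smult A d x) = smult A (c * d) x"
      "x \<in> carrier A \<Longrightarrow> smult A 1 x = x"
      "x \<in> carrier A \<Longrightarrow> y \<in> carrier A \<Longrightarrow> smult A c x * y = smult A c (x * y)"
      "x \<in> carrier A \<Longrightarrow> y \<in> carrier A \<Longrightarrow> x * smult A c y = smult A c (x * y)"
    and star: "x \<in> carrier A \<Longrightarrow> y \<in> carrier A \<Longrightarrow> star A (x + y) = star A x + star A y"
      "x \<in> carrier A \<Longrightarrow> y \<in> carrier A \<Longrightarrow> star A (x * y) = star A y * star A x"
      "x \<in> carrier A \<Longrightarrow> star A (smult A c x) = smult A (cnj c) (star A x)"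
      "x \<in> carrier A \<Longrightarrow> star A (star A x) = x"
begin

lemma smult_0: "x \<in> carrier A \<Longrightarrow> smult A 0 x = 0"
  using smult(2) [of x 0 0] by simp

lemma smult_minus: "x \<in> carrier A \<Longrightarrow> smult A (-1) x = - x"
  using smult(2) [of x 1 "-1"] smult_0 [of x] smult(4) [of x] by (simp add: eq_neg_iff_add_eq_0 add.commute)

lemma uminus_closed [simp, intro]: "x \<in> carrier A \<Longrightarrow> - x \<in> carrier A"
  using closed(5) [of x "-1"] smult_minus by simp

lemma minus_closed [simp, intro]: "x \<in> carrier A \<Longrightarrow> y \<in> carrier A \<Longrightarrow> x - y \<in> carrier A"
  using closed(3) [of x "- y"] by simp

lemma power_closed [simp, intro]: "x \<in> carrier A \<Longrightarrow> x ^ n \<in> carrier A"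
  by (induction n) auto

lemma sum_closed [simp, intro]: "(\<And>i. i \<in> I \<Longrightarrow> f i \<in> carrier A) \<Longrightarrow> sum f I \<in> carrier A"
  by (induction I rule: infinite_finite_induct) auto

lemma star_minus: "x \<in> carrier A \<Longrightarrow> star A (- x) = - star A x"
  using star(3) [of x "-1"] by (simp add: smult_minus)

lemma star_diff: "x \<in> carrier A \<Longrightarrow> y \<in> carrier A \<Longrightarrow> star A (x - y) = star A x - star A y"
  using star(1) [of x "- y"] by (simp add: star_minus)

lemma star_one [simp]: "star A 1 = 1"
  using star(2) [of 1 "star A 1"] star(4) [of 1] by simp

lemma smult_diff: "x \<in> carrier A \<Longrightarrow> y \<in> carrier A \<Longrightarrow> smult A c (x - y) = smult A c x - smult A c y"
  using smult(1) [of "x - y" y c] by (simp add: eq_diff_eq)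

lemma minus_A [simp]: "x \<ominus>\<^bsub>A\<^esub> y = x - y" if "x \<in> carrier A" "y \<in> carrier A"
proof -
  have "\<ominus>\<^bsub>A\<^esub> y = - y"
    unfolding a_inv_def m_inv_def
    by (rule the_equality) (use that in \<open>auto simp: eq_neg_iff_add_eq_0\<close>)
  then show ?thesis
    by (simp add: a_minus_def)
qed

end

section \<open>Algebra of a C*-seminorm\<close>

locale cstar_seminormed = star_alg A
  for A :: "('b::ring_1, 'm) star_algebra_scheme" +
  fixes q :: "'b \<Rightarrow> real" and R :: "'b set"
  assumes q: "q \<in> cstar_seminorms A R"
begin

lemma q_add: "x \<in> carrier A \<Longrightarrow> y \<in> carrier A \<Longrightarrow> q (x + y) \<le> q x + q y"
  and q_smult: "x \<in> carrier A \<Longrightarrow> q (smult A c x) = cmod c * q x"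
  and q_mult: "x \<in> carrier A \<Longrightarrow> y \<in> carrier A \<Longrightarrow> q (x * y) \<le> q x * q y"
  and q_star_mult: "x \<in> carrier A \<Longrightarrow> q (star A x * x) = (q x)\<^sup>2"
  and q_relation: "r \<in> R \<Longrightarrow> q r = 0"
  using q by (simp_all add: cstar_seminorms_def)

lemma q_0 [simp]: "q 0 = 0"
  using q_smult [of 0 0] by (simp add: smult_0)

lemma q_minus [simp]: "x \<in> carrier A \<Longrightarrow> q (- x) = q x"
  using q_smult [of x "-1"] by (simp add: smult_minus)

lemma q_nonneg: "x \<in> carrier A \<Longrightarrow> 0 \<le> q x"
  using q_add [of x "- x"] by simp

lemma q_diff: "x \<in> carrier A \<Longrightarrow> y \<in> carrier A \<Longrightarrow> q (x - y) \<le> q x + q y"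
  using q_add [of x "- y"] by simp

lemma q_diff_commute: "x \<in> carrier A \<Longrightarrow> y \<in> carrier A \<Longrightarrow> q (x - y) = q (y - x)"
  using q_minus [of "x - y"] by simp

lemma q_diff_triangle:
  "x \<in> carrier A \<Longrightarrow> y \<in> carrier A \<Longrightarrow> z \<in> carrier A \<Longrightarrow> q (x - z) \<le> q (x - y) + q (y - z)"
  using q_add [of "x - y" "y - z"] by simp

lemma q_abs_diff: "x \<in> carrier A \<Longrightarrow> y \<in> carrier A \<Longrightarrow> \<bar>q x - q y\<bar> \<le> q (x - y)"
  using q_add [of "x - y" y] q_add [of "y - x" x] q_diff_commute [of x y] by simp

lemma q_star: "q (star A x) = q x" if "x \<in> carrier A"
proof -
  have "q x \<le> q (star A x)" if "x \<in> carrier A" for x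
  proof (cases "q x = 0")
    case True
    then show ?thesis using that q_nonneg by simp
  next
    case False
    have "q x * q x \<le> q (star A x) * q x"
      using q_mult [of "star A x" x] q_star_mult [of x] that by (simp add: power2_eq_square)
    then show ?thesis
      using False q_nonneg [OF that] by simp
  qed
  from this [of x] this [of "star A x"] that show ?thesis
    by (simp add: star)
qed

text \<open>The C*-identity makes q 1 idempotent. The value 0 does occur, for the zero seminorm, so
  equality cannot be claimed.\<close>

lemma q_one: "q 1 \<le> 1"
proof -
  have "q 1 = q 1 * q 1"
    using q_star_mult [of 1] by (simp add: power2_eq_square)
  then show ?thesis
    by (metis mult_cancel_left1 order.refl zero_le_one)
qed

lemma q_power: "x \<in> carrier A \<Longrightarrow> q (x ^ n) \<le> (q x) ^ n"
proof (induction n)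
  case 0
  then show ?case using q_one by simp
next
  case (Suc n)
  have "q (x ^ Suc n) \<le> q x * q (x ^ n)"
    using q_mult [of x "x ^ n"] Suc by simp
  also have "\<dots> \<le> q x * (q x) ^ n"
    using Suc by (intro mult_left_mono q_nonneg) auto
  finally show ?case by simp
qed

text \<open>Orthogonal summands: squaring both repeatedly separates their seminorms.\<close>

lemma q_orthogonal_sum:
  assumes "x \<in> carrier A" "y \<in> carrier A" "q (star A x * y) = 0" "q (x * star A y) = 0"
  shows "q (x + y) \<le> max (q x) (q y)"
proof -
  \<comment> \<open>Orthogonality removes both cross terms in the product of x + y with its adjoint,
    so the C*-identity replaces x and y by the products of each with its adjoint. These are
    orthogonal again.\<close>
  have step: "q (star A x * x + star A y * y) = (q (x + y))\<^sup>2"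
    if "x \<in> carrier A" "y \<in> carrier A" "q (star A x * y) = 0" "q (x * star A y) = 0" for x y
  proof -
    have *: "star A (x + y) * (x + y) - (star A x * x + star A y * y) = star A x * y + star A y * x"
      using that by (simp add: star algebra_simps)
    have "q (star A y * x) = q (star A (star A y * x))"
      using that by (simp add: q_star)
    then have "q (star A y * x) = 0"
      using that by (simp add: star)
    then have "q (star A x * y + star A y * x) \<le> 0"
      using q_add [of "star A x * y" "star A y * x"] that by simp
    then have "q (star A (x + y) * (x + y)) = q (star A x * x + star A y * y)"
      using q_abs_diff [of "star A (x + y) * (x + y)" "star A x * x + star A y * y"] that
      unfolding * by (simp add: star)
    then show ?thesis
      using q_star_mult [of "x + y"] that by simp
  qed
  define m where "m = max (q x) (q y)"
  have m: "0 \<le> m"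
    using q_nonneg assms by (simp add: m_def le_max_iff_disj)
  \<comment> \<open>After n squarings the factor 2 of the triangle inequality stands against an
    exponent 2^n, so it disappears as n grows.\<close>
  have *: "(q (x + y)) ^ (2 ^ n) \<le> 2 * max (q x) (q y) ^ (2 ^ n)"
    if "x \<in> carrier A" "y \<in> carrier A" "q (star A x * y) = 0" "q (x * star A y) = 0" for x y n
    using that
  proof (induction n arbitrary: x y)
    case 0
    then show ?case using q_add [of x y] by simp
  next
    case (Suc n)
    let ?x = "star A x * x" and ?y = "star A y * y"
    have xy: "?x \<in> carrier A" "?y \<in> carrier A"
      using Suc.prems by auto
    have zero: "q (?x * ?y) = 0"
    proof -
      have "q ((star A x * (x * star A y)) * y) \<le> q (star A x * (x * star A y)) * q y"
        using Suc.prems by (intro q_mult) auto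
      also have "q (star A x * (x * star A y)) \<le> q (star A x) * q (x * star A y)"
        using Suc.prems by (intro q_mult) auto
      finally have "q (?x * ?y) \<le> 0"
        using Suc.prems q_nonneg [of y] by (simp add: mult.assoc mult_right_mono)
      then show ?thesis
        using q_nonneg [of "?x * ?y"] xy by simp
    qed
    have sq: "(q ?x) = (q x)\<^sup>2" "(q ?y) = (q y)\<^sup>2"
      using Suc.prems by (auto simp: q_star_mult)
    have "(q (x + y)) ^ (2 ^ Suc n) = (q (?x + ?y)) ^ (2 ^ n)"
      using step [OF Suc.prems] by (simp add: power_mult)
    also have "\<dots> \<le> 2 * max (q ?x) (q ?y) ^ (2 ^ n)"
      by (rule Suc.IH [OF xy]) (use zero Suc.prems in \<open>auto simp: star\<close>)
    also have "max (q ?x) (q ?y) = (max (q x) (q y))\<^sup>2"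
      using q_nonneg [OF Suc.prems(1)] q_nonneg [OF Suc.prems(2)]
      unfolding sq by (auto simp: max_def power2_le_iff_abs_le abs_le_square_iff [symmetric])
    finally show ?case
      by (simp add: power_mult)
  qed
  show ?thesis
  proof (rule ccontr)
    assume "\<not> ?thesis"
    then have less: "m < q (x + y)"
      unfolding m_def by (simp only: not_le)
    show False
    proof (cases "m = 0")
      case True
      then show False
        using * [OF assms, of 1] less by (simp add: m_def [symmetric])
    next
      case False
      then have "1 < q (x + y) / m"
        using less m by simp
      then obtain N where N: "2 < (q (x + y) / m) ^ N"
        using real_arch_pow by blast
      have "N \<le> 2 ^ N"
        by (rule less_imp_le) (rule less_exp)
      then have "(q (x + y) / m) ^ N \<le> (q (x + y) / m) ^ (2 ^ N)"
        using \<open>1 < q (x + y) / m\<close> by (intro power_increasing) auto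
      also have "\<dots> \<le> 2"
        using * [OF assms, of N] False m by (simp add: m_def [symmetric] power_divide field_simps)
      finally show False
        using N by simp
    qed
  qed
qed

section \<open>Cauchy sequences and the operations on their classes\<close>

abbreviation "CS \<equiv> cauchy_seqs A q"
abbreviation "T \<equiv> completion A q"

definition cls :: "(nat \<Rightarrow> 'b) \<Rightarrow> (nat \<Rightarrow> 'b) set"
  where "cls x = cauchy_rel A q `` {x}"

abbreviation "cst a \<equiv> cls (\<lambda>_. a)"

lemma CS_iff: "x \<in> CS \<longleftrightarrow> (\<forall>n. x n \<in> carrier A) \<and>
    (\<forall>e>0. \<exists>N. \<forall>m\<ge>N. \<forall>n\<ge>N. q (x m - x n) < e)"
  by (auto simp: cauchy_seqs_def)

lemma CS_carrier [simp]: "x \<in> CS \<Longrightarrow> x n \<in> carrier A"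
  by (simp add: CS_iff)

lemma CS_I:
  assumes "\<And>n. x n \<in> carrier A"
    and "\<And>e. e > 0 \<Longrightarrow> \<exists>N. \<forall>m\<ge>N. \<forall>n\<ge>N. q (x m - x n) \<le> e"
  shows "x \<in> CS"
  unfolding CS_iff
proof (intro conjI allI impI)
  fix e :: real assume "e > 0"
  then obtain N where "\<forall>m\<ge>N. \<forall>n\<ge>N. q (x m - x n) \<le> e / 2"
    using assms(2) [of "e / 2"] by auto
  moreover have "e / 2 < e"
    using \<open>e > 0\<close> by simp
  ultimately have "\<forall>m\<ge>N. \<forall>n\<ge>N. q (x m - x n) < e"
    by (meson le_less_trans)
  then show "\<exists>N. \<forall>m\<ge>N. \<forall>n\<ge>N. q (x m - x n) < e"
    by blast
qed (rule assms)

lemma CS_const [simp]: "a \<in> carrier A \<Longrightarrow> (\<lambda>_. a) \<in> CS"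
  by (auto simp: CS_iff)

lemma CS_bounded:
  assumes "x \<in> CS"
  obtains B where "B > 0" "\<And>n. q (x n) \<le> B"
proof -
  obtain N where N: "\<forall>m\<ge>N. \<forall>n\<ge>N. q (x m - x n) < 1"
    using assms unfolding CS_iff by (meson zero_less_one)
  define B where "B = Max ((\<lambda>n. q (x n)) ` {..N}) + 1"
  have le: "q (x n) \<le> Max ((\<lambda>n. q (x n)) ` {..N})" if "n \<le> N" for n
    using that by (intro Max_ge) auto
  have "q (x n) \<le> B" for n
  proof (cases "n \<le> N")
    case True
    then show ?thesis using le [OF True] unfolding B_def by linarith
  next
    case False
    then have "q (x n - x N) < 1"
      using N by simp
    then show ?thesis
      using q_abs_diff [OF CS_carrier CS_carrier, OF assms assms, of n N] le [OF order_refl]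
      unfolding B_def by linarith
  qed
  moreover have "B > 0"
    using q_nonneg [OF CS_carrier, OF assms, of 0] le [OF le0] unfolding B_def by linarith
  ultimately show ?thesis
    using that by blast
qed

lemma rel_iff: "(x, y) \<in> cauchy_rel A q \<longleftrightarrow> x \<in> CS \<and> y \<in> CS \<and> (\<lambda>n. q (x n - y n)) \<longlonglongrightarrow> 0"
  by (auto simp: cauchy_rel_def)

lemma tendsto_0_le:
  fixes f :: "nat \<Rightarrow> real"
  assumes "g \<longlonglongrightarrow> 0" "\<And>n. 0 \<le> f n" "\<And>n. f n \<le> g n"
  shows "f \<longlonglongrightarrow> 0"
  by (rule tendsto_sandwich [OF _ _ tendsto_const assms(1)]) (use assms in auto)

lemma equiv_rel: "equiv CS (cauchy_rel A q)"
proof (rule equivI)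
  show "cauchy_rel A q \<subseteq> CS \<times> CS"
    by (auto simp: cauchy_rel_def)
  show "refl_on CS (cauchy_rel A q)"
    by (auto simp: refl_on_def rel_iff)
  show "sym (cauchy_rel A q)"
    by (rule symI) (auto simp: rel_iff q_diff_commute)
  show "trans (cauchy_rel A q)"
  proof (rule transI)
    fix x y z assume "(x, y) \<in> cauchy_rel A q" "(y, z) \<in> cauchy_rel A q"
    then have *: "x \<in> CS" "y \<in> CS" "z \<in> CS" "(\<lambda>n. q (x n - y n)) \<longlonglongrightarrow> 0" "(\<lambda>n. q (y n - z n)) \<longlonglongrightarrow> 0"
      by (auto simp: rel_iff)
    have "(\<lambda>n. q (x n - z n)) \<longlonglongrightarrow> 0"
      by (rule tendsto_0_le [OF tendsto_add_zero [OF *(4,5)]])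
        (use * in \<open>auto intro: q_nonneg q_diff_triangle\<close>)
    with * show "(x, z) \<in> cauchy_rel A q"
      by (auto simp: rel_iff)
  qed
qed

lemma cls_eq_iff: "cls x = cls y \<longleftrightarrow> (\<lambda>n. q (x n - y n)) \<longlonglongrightarrow> 0" if "x \<in> CS" "y \<in> CS"
  using eq_equiv_class_iff [OF equiv_rel that] that by (simp add: cls_def rel_iff)

lemma mem_cls: "y \<in> cls x \<longleftrightarrow> x \<in> CS \<and> y \<in> CS \<and> (\<lambda>n. q (x n - y n)) \<longlonglongrightarrow> 0"
  by (simp add: cls_def rel_iff)

lemma cls_self: "x \<in> CS \<Longrightarrow> x \<in> cls x"
  by (simp add: mem_cls)

lemma cls_eqI: "y \<in> cls x \<Longrightarrow> cls y = cls x"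
  using cls_eq_iff [of x y] by (auto simp: mem_cls)

lemma carrier_T: "carrier T = cls ` CS"
  by (auto simp: completion_def quotient_def cls_def)

lemma carrier_TE:
  assumes "a \<in> carrier T"
  obtains x where "x \<in> CS" "a = cls x"
  using assms by (auto simp: carrier_T)

lemma cls_carrier [simp]: "x \<in> CS \<Longrightarrow> cls x \<in> carrier T"
  by (simp add: carrier_T)

lemma CS_add [simp]: "(\<lambda>n. x n + y n) \<in> CS" if xy: "x \<in> CS" "y \<in> CS"
proof (rule CS_I)
  fix e :: real assume "e > 0"
  then obtain M N where M: "\<forall>m\<ge>M. \<forall>n\<ge>M. q (x m - x n) < e / 2"
    and N: "\<forall>m\<ge>N. \<forall>n\<ge>N. q (y m - y n) < e / 2"
    using xy unfolding CS_iff by (meson half_gt_zero)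
  have "q (x m + y m - (x n + y n)) \<le> e" if "m \<ge> max M N" "n \<ge> max M N" for m n
  proof -
    have "q (x m + y m - (x n + y n)) \<le> q (x m - x n) + q (y m - y n)"
      using q_add [of "x m - x n" "y m - y n"] xy by (simp add: algebra_simps)
    also have "\<dots> \<le> e / 2 + e / 2"
      using M N that by (intro add_mono) (auto intro: less_imp_le)
    finally show ?thesis by simp
  qed
  then show "\<exists>N. \<forall>m\<ge>N. \<forall>n\<ge>N. q (x m + y m - (x n + y n)) \<le> e"
    by blast
qed (use xy in simp)

lemma q_mult_diff:
  assumes "a \<in> carrier A" "b \<in> carrier A" "c \<in> carrier A" "d \<in> carrier A" "q a \<le> B" "q d \<le> B"
  shows "q (a * b - c * d) \<le> B * q (b - d) + q (a - c) * B"
proof -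
  have "q (a * b - c * d) = q (a * (b - d) + (a - c) * d)"
    by (simp add: algebra_simps)
  also have "\<dots> \<le> q (a * (b - d)) + q ((a - c) * d)"
    using assms by (intro q_add) auto
  also have "\<dots> \<le> q a * q (b - d) + q (a - c) * q d"
    using assms by (intro add_mono q_mult) auto
  also have "\<dots> \<le> B * q (b - d) + q (a - c) * B"
    using assms by (intro add_mono mult_right_mono mult_left_mono q_nonneg) auto
  finally show ?thesis .
qed

lemma CS_mult [simp]: "(\<lambda>n. x n * y n) \<in> CS" if xy: "x \<in> CS" "y \<in> CS"
proof (rule CS_I)
  obtain B1 where B1: "B1 > 0" "\<And>n. q (x n) \<le> B1"
    using CS_bounded [OF xy(1)] by blast
  obtain B2 where B2: "B2 > 0" "\<And>n. q (y n) \<le> B2"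
    using CS_bounded [OF xy(2)] by blast
  define B where "B = max B1 B2"
  have B: "B > 0" "\<And>n. q (x n) \<le> B" "\<And>n. q (y n) \<le> B"
    using B1 B2 by (auto simp: B_def le_max_iff_disj)
  fix e :: real assume "e > 0"
  then have "e / (2 * B) > 0"
    using B by simp
  then obtain M N where M: "\<forall>m\<ge>M. \<forall>n\<ge>M. q (x m - x n) < e / (2 * B)"
    and N: "\<forall>m\<ge>N. \<forall>n\<ge>N. q (y m - y n) < e / (2 * B)"
    using xy unfolding CS_iff by meson
  have "q (x m * y m - x n * y n) \<le> e" if "m \<ge> max M N" "n \<ge> max M N" for m n
  proof -
    have "q (x m * y m - x n * y n) \<le> B * q (y m - y n) + q (x m - x n) * B"
      using xy B by (intro q_mult_diff) auto
    also have "\<dots> \<le> B * (e / (2 * B)) + e / (2 * B) * B"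
      using M N that B(1) by (intro add_mono mult_left_mono mult_right_mono) (auto intro: less_imp_le)
    also have "\<dots> = e"
      using B(1) by simp
    finally show ?thesis .
  qed
  then show "\<exists>N. \<forall>m\<ge>N. \<forall>n\<ge>N. q (x m * y m - x n * y n) \<le> e"
    by blast
qed (use xy in simp)

lemma CS_smult [simp]: "(\<lambda>n. smult A c (x n)) \<in> CS" if x: "x \<in> CS"
proof -
  have "smult A c (x n) = smult A c 1 * x n" for n
    using x by (simp add: smult)
  then show ?thesis
    using CS_mult [OF CS_const x, of "smult A c 1"] by simp
qed

lemma CS_star [simp]: "(\<lambda>n. star A (x n)) \<in> CS" if "x \<in> CS"
proof -
  have "q (star A (x m) - star A (x n)) = q (x m - x n)" for m n
    using that by (simp add: star_diff [symmetric] q_star)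
  then show ?thesis
    using that by (simp add: CS_iff)
qed

lemma CS_minus [simp]: "(\<lambda>n. x n - y n) \<in> CS" if "x \<in> CS" "y \<in> CS"
proof -
  have "(\<lambda>n. x n + smult A (-1) (y n)) \<in> CS"
    using that by (intro CS_add CS_smult)
  then show ?thesis
    using that by (simp add: smult_minus)
qed

lemma CS_uminus [simp]: "(\<lambda>n. - x n) \<in> CS" if "x \<in> CS"
  using CS_minus [OF CS_const that, of 0] by simp

text \<open>Each operation is a union over representatives. All classes in the union coincide, by
  continuity of the operation in q, and the union is nonempty since a sequence represents its own
  class.\<close>

lemma T_ops [simp]:
  assumes x: "x \<in> CS"
  shows T_smult: "smult T c (cls x) = cls (\<lambda>n. smult A c (x n))"
    and T_star: "star T (cls x) = cls (\<lambda>n. star A (x n))"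
    and T_mult: "y \<in> CS \<Longrightarrow> cls x \<otimes>\<^bsub>T\<^esub> cls y = cls (\<lambda>n. x n * y n)"
    and T_add: "y \<in> CS \<Longrightarrow> cls x \<oplus>\<^bsub>T\<^esub> cls y = cls (\<lambda>n. x n + y n)"
proof -

  have "cls (\<lambda>n. smult A c (x' n)) = cls (\<lambda>n. smult A c (x n))" if "x' \<in> cls x" for x'
  proof -
    have "(\<lambda>n. cmod c * q (x n - x' n)) \<longlonglongrightarrow> cmod c * 0"
      using that by (intro tendsto_mult_left) (simp add: mem_cls)
    then show ?thesis
      using that by (intro cls_eqI) (simp add: mem_cls smult_diff [symmetric] q_smult)
  qed
  then have "(\<Union>x'\<in>cls x. cls (\<lambda>n. smult A c (x' n))) = cls (\<lambda>n. smult A c (x n))"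
    using cls_self [OF x] by blast
  then show "smult T c (cls x) = cls (\<lambda>n. smult A c (x n))"
    by (simp add: completion_def flip: cls_def)
  have "cls (\<lambda>n. star A (x' n)) = cls (\<lambda>n. star A (x n))" if "x' \<in> cls x" for x'
    using that by (intro cls_eqI) (simp add: mem_cls star_diff [symmetric] q_star)
  then have "(\<Union>x'\<in>cls x. cls (\<lambda>n. star A (x' n))) = cls (\<lambda>n. star A (x n))"
    using cls_self [OF x] by blast
  then show "star T (cls x) = cls (\<lambda>n. star A (x n))"
    by (simp add: completion_def flip: cls_def)
  assume y: "y \<in> CS"
  have "cls (\<lambda>n. x' n + y' n) = cls (\<lambda>n. x n + y n)" if "x' \<in> cls x" "y' \<in> cls y" for x' y'
  proof (rule cls_eqI)
    have "(\<lambda>n. q (x n - x' n) + q (y n - y' n)) \<longlonglongrightarrow> 0"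
      using that by (intro tendsto_add_zero) (auto simp: mem_cls)
    then have "(\<lambda>n. q (x n + y n - (x' n + y' n))) \<longlonglongrightarrow> 0"
    proof (rule tendsto_0_le)
      show "q (x n + y n - (x' n + y' n)) \<le> q (x n - x' n) + q (y n - y' n)" for n
        using q_add [of "x n - x' n" "y n - y' n"] that by (simp add: mem_cls algebra_simps)
    qed (use that in \<open>auto simp: mem_cls intro!: q_nonneg\<close>)
    then show "(\<lambda>n. x' n + y' n) \<in> cls (\<lambda>n. x n + y n)"
      using that by (simp add: mem_cls)
  qed
  then have "(\<Union>y'\<in>cls y. cls (\<lambda>n. x' n + y' n)) = cls (\<lambda>n. x n + y n)" if "x' \<in> cls x" for x'
    using that cls_self [OF y] by blast
  then have "(\<Union>x'\<in>cls x. \<Union>y'\<in>cls y. cls (\<lambda>n. x' n + y' n)) = cls (\<lambda>n. x n + y n)"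
    using cls_self [OF x] by blast
  then show "cls x \<oplus>\<^bsub>T\<^esub> cls y = cls (\<lambda>n. x n + y n)"
    by (simp add: completion_def flip: cls_def)
  have "cls (\<lambda>n. x' n * y' n) = cls (\<lambda>n. x n * y n)" if "x' \<in> cls x" "y' \<in> cls y" for x' y'
  proof (rule cls_eqI)
    have x'y': "x' \<in> CS" "y' \<in> CS"
      using that by (auto simp: mem_cls)
    obtain B1 where B1: "B1 > 0" "\<And>n. q (x n) \<le> B1"
      using CS_bounded [OF x] by blast
    obtain B2 where B2: "B2 > 0" "\<And>n. q (y' n) \<le> B2"
      using CS_bounded [OF x'y'(2)] by blast
    define B where "B = max B1 B2"
    have B: "\<And>n. q (x n) \<le> B" "\<And>n. q (y' n) \<le> B"
      using B1 B2 by (auto simp: B_def le_max_iff_disj)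
    have "(\<lambda>n. B * q (y n - y' n) + q (x n - x' n) * B) \<longlonglongrightarrow> B * 0 + 0 * B"
      using that by (intro tendsto_intros) (auto simp: mem_cls)
    then have lim: "(\<lambda>n. B * q (y n - y' n) + q (x n - x' n) * B) \<longlonglongrightarrow> 0"
      by simp
    have "(\<lambda>n. q (x n * y n - x' n * y' n)) \<longlonglongrightarrow> 0"
    proof (rule tendsto_0_le [OF lim])
      show "0 \<le> q (x n * y n - x' n * y' n)" for n
        using x y x'y' by (intro q_nonneg) simp
      show "q (x n * y n - x' n * y' n) \<le> B * q (y n - y' n) + q (x n - x' n) * B" for n
        using x y x'y' B by (intro q_mult_diff) simp_all
    qed
    then show "(\<lambda>n. x' n * y' n) \<in> cls (\<lambda>n. x n * y n)"
      using that by (simp add: mem_cls)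
  qed
  then have "(\<Union>y'\<in>cls y. cls (\<lambda>n. x' n * y' n)) = cls (\<lambda>n. x n * y n)" if "x' \<in> cls x" for x'
    using that cls_self [OF y] by blast
  then have "(\<Union>x'\<in>cls x. \<Union>y'\<in>cls y. cls (\<lambda>n. x' n * y' n)) = cls (\<lambda>n. x n * y n)"
    using cls_self [OF x] by blast
  then show "cls x \<otimes>\<^bsub>T\<^esub> cls y = cls (\<lambda>n. x n * y n)"
    by (simp add: completion_def flip: cls_def)
qed

lemma T_const [simp]: "\<one>\<^bsub>T\<^esub> = cst 1" "\<zero>\<^bsub>T\<^esub> = cst 0"
  by (simp_all add: completion_def cls_def)

lemma T_ring: "ring T"
proof (rule ringI)
  show "abelian_group T"
  proof (rule abelian_groupI)
    fix a assume "a \<in> carrier T"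
    then obtain x where x: "x \<in> CS" "a = cls x"
      by (rule carrier_TE)
    then have "cls (\<lambda>n. smult A (-1) (x n)) \<oplus>\<^bsub>T\<^esub> a = \<zero>\<^bsub>T\<^esub>"
      by (simp add: smult_minus)
    then show "\<exists>y\<in>carrier T. y \<oplus>\<^bsub>T\<^esub> a = \<zero>\<^bsub>T\<^esub>"
      using x by (metis CS_smult cls_carrier)
  qed (auto elim!: carrier_TE simp: algebra_simps)
  show "monoid T"
    by (rule monoidI) (auto elim!: carrier_TE simp: algebra_simps)
qed (auto elim!: carrier_TE simp: algebra_simps)

lemma T_uminus: "\<ominus>\<^bsub>T\<^esub> cls x = cls (\<lambda>n. - x n)" if "x \<in> CS"
proof -
  interpret T: ring T by (rule T_ring)
  show ?thesis
    using that by (intro T.minus_equality) simp_all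
qed

lemma T_minus: "cls x \<ominus>\<^bsub>T\<^esub> cls y = cls (\<lambda>n. x n - y n)" if "x \<in> CS" "y \<in> CS"
  using that by (simp add: a_minus_def T_uminus)

section \<open>The norm of the completion\<close>

lemma q_Cauchy: "convergent (\<lambda>n. q (x n))" if x: "x \<in> CS"
proof -
  have "Cauchy (\<lambda>n. q (x n))"
  proof (rule metric_CauchyI)
    fix e :: real assume "e > 0"
    then obtain N where N: "\<forall>m\<ge>N. \<forall>n\<ge>N. q (x m - x n) < e"
      using x unfolding CS_iff by meson
    have "dist (q (x m)) (q (x n)) < e" if "m \<ge> N" "n \<ge> N" for m n
      using q_abs_diff [of "x m" "x n"] N that x unfolding dist_real_def
      by (meson CS_carrier le_less_trans)
    then show "\<exists>M. \<forall>m\<ge>M. \<forall>n\<ge>M. dist (q (x m)) (q (x n)) < e"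
      by blast
  qed
  then show ?thesis
    by (simp add: Cauchy_convergent_iff)
qed

lemma T_norm: "(\<lambda>n. q (x n)) \<longlonglongrightarrow> cnorm T (cls x)" if x: "x \<in> CS"
proof -
  obtain r where r: "(\<lambda>n. q (x n)) \<longlonglongrightarrow> r"
    using q_Cauchy [OF x] by (auto simp: convergent_def)
  have "cnorm T (cls x) = (THE r. \<exists>y\<in>cls x. (\<lambda>n. q (y n)) \<longlonglongrightarrow> r)"
    by (simp add: completion_def)
  also have "\<dots> = r"
  proof (rule the_equality)
    show "\<exists>y\<in>cls x. (\<lambda>n. q (y n)) \<longlonglongrightarrow> r"
      using r cls_self [OF x] by blast
    fix s assume "\<exists>y\<in>cls x. (\<lambda>n. q (y n)) \<longlonglongrightarrow> s"
    then obtain y where y: "y \<in> cls x" "(\<lambda>n. q (y n)) \<longlonglongrightarrow> s"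
      by blast
    have "(\<lambda>n. \<bar>q (x n) - q (y n)\<bar>) \<longlonglongrightarrow> 0"
      by (rule tendsto_0_le [of "\<lambda>n. q (x n - y n)"]) (use y x in \<open>auto simp: mem_cls q_abs_diff\<close>)
    then have "(\<lambda>n. q (x n) - q (y n)) \<longlonglongrightarrow> 0"
      by (simp only: tendsto_rabs_zero_iff)
    moreover have "(\<lambda>n. q (x n) - q (y n)) \<longlonglongrightarrow> r - s"
      by (rule tendsto_diff [OF r y(2)])
    ultimately have "r - s = 0"
      using LIMSEQ_unique by blast
    then show "s = r" by simp
  qed
  finally show ?thesis
    using r by simp
qed

lemma T_norm_cst: "cnorm T (cst a) = q a" if "a \<in> carrier A"
  using LIMSEQ_unique [OF T_norm [OF CS_const [OF that]] tendsto_const] .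

lemma T_norm_eq_0: "cnorm T (cls x) = 0 \<longleftrightarrow> cls x = \<zero>\<^bsub>T\<^esub>" if "x \<in> CS"
proof
  assume "cnorm T (cls x) = 0"
  then show "cls x = \<zero>\<^bsub>T\<^esub>"
    using T_norm [OF that] that by (simp add: cls_eq_iff)
next
  assume "cls x = \<zero>\<^bsub>T\<^esub>"
  then show "cnorm T (cls x) = 0"
    using T_norm_cst [of 0] by simp
qed

lemma T_norm_nonneg: "0 \<le> cnorm T (cls x)" if "x \<in> CS"
  by (rule LIMSEQ_le_const [OF T_norm [OF that]]) (use that q_nonneg in auto)

lemma cst_dense:
  assumes "x \<in> CS" "e > 0"
  obtains N where "\<And>n. n \<ge> N \<Longrightarrow> cnorm T (cls x \<ominus>\<^bsub>T\<^esub> cst (x n)) < e"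
proof -
  obtain N where N: "\<forall>m\<ge>N. \<forall>n\<ge>N. q (x m - x n) < e / 2"
    using assms unfolding CS_iff by (meson half_gt_zero)
  have "cnorm T (cls x \<ominus>\<^bsub>T\<^esub> cst (x n)) < e" if "n \<ge> N" for n
  proof -
    have "cnorm T (cls x \<ominus>\<^bsub>T\<^esub> cst (x n)) \<le> e / 2"
    proof (rule LIMSEQ_le_const2)
      show "(\<lambda>m. q (x m - x n)) \<longlonglongrightarrow> cnorm T (cls x \<ominus>\<^bsub>T\<^esub> cst (x n))"
        using T_norm [OF CS_minus [OF assms(1) CS_const]] assms(1) by (simp add: T_minus)
      show "\<exists>N. \<forall>m\<ge>N. q (x m - x n) \<le> e / 2"
        using N that by (intro exI [of _ N]) (auto intro: less_imp_le)
    qed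
    then show ?thesis
      using assms(2) by simp
  qed
  then show ?thesis
    by (rule that)
qed

text \<open>Neumann series, read off on representatives.\<close>

lemma T_neumann:
  assumes x: "x \<in> CS" and less: "cnorm T (cls x) < 1"
  obtains y where "y \<in> CS" "cls y \<otimes>\<^bsub>T\<^esub> (\<one>\<^bsub>T\<^esub> \<ominus>\<^bsub>T\<^esub> cls x) = \<one>\<^bsub>T\<^esub>"
proof -
  obtain r where r: "cnorm T (cls x) < r" "r < 1"
    using dense [OF less] by blast
  have r0: "0 < r"
    using T_norm_nonneg [OF x] r(1) by simp
  have "\<forall>\<^sub>F n in sequentially. q (x n) < r"
    using T_norm [OF x] r(1) by (rule order_tendstoD)
  then obtain N where N: "\<And>n. n \<ge> N \<Longrightarrow> q (x n) < r"
    by (auto simp: eventually_sequentially)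
  \<comment> \<open>The k-th term is the partial sum of length k for the k-th representative. On
    this diagonal the limit of the representatives and the limit of the series become one, with
    remainder \<open>x k ^ k\<close>.\<close>
  define y where "y k = (\<Sum>i<k. x k ^ i)" for k
  have yc: "y k \<in> carrier A" for k
    using x by (auto simp: y_def)
  have y1: "y k * (1 - x k) = 1 - x k ^ k" and y2: "(1 - x k) * y k = 1 - x k ^ k" for k
  proof -
    have "(1 - a) * (\<Sum>i<n. a ^ i) = 1 - a ^ n \<and> (\<Sum>i<n. a ^ i) * (1 - a) = 1 - a ^ n" for a :: 'b and n
    proof (induction n)
      case (Suc n)
      then show ?case
        by (simp add: distrib_left distrib_right) (simp add: algebra_simps power_commutes)
    qed simp
    then show "y k * (1 - x k) = 1 - x k ^ k" "(1 - x k) * y k = 1 - x k ^ k"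
      by (auto simp: y_def)
  qed
  have qpow: "q (x k ^ i) \<le> r ^ i" if "k \<ge> N" for i k
  proof -
    have "q (x k ^ i) \<le> q (x k) ^ i"
      using x by (simp add: q_power)
    also have "\<dots> \<le> r ^ i"
      using N [OF that] x q_nonneg by (intro power_mono) auto
    finally show ?thesis .
  qed
  define B where "B = 1 / (1 - r)"
  have B: "B > 0"
    using r by (simp add: B_def)
  have qy: "q (y k) \<le> B" if "k \<ge> N" for k
  proof -
    have "q (\<Sum>i\<in>I. x k ^ i) \<le> (\<Sum>i\<in>I. r ^ i)" if "finite I" for I
      using that
    proof (induction I)
      case (insert i I)
      have "q (x k ^ i + (\<Sum>i\<in>I. x k ^ i)) \<le> q (x k ^ i) + q (\<Sum>i\<in>I. x k ^ i)"
        using x by (intro q_add) auto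
      then show ?case
        using insert qpow [OF \<open>k \<ge> N\<close>, of i] by simp
    qed simp
    then have "q (y k) \<le> (\<Sum>i<k. r ^ i)"
      by (simp add: y_def)
    also have "\<dots> = (1 - r ^ k) / (1 - r)"
      using r by (simp add: sum_gp_strict)
    also have "\<dots> \<le> B"
      using r r0 by (simp add: B_def divide_right_mono)
    finally show ?thesis .
  qed
  have rk: "(\<lambda>k. r ^ k) \<longlonglongrightarrow> 0"
    using r r0 by (intro LIMSEQ_realpow_zero) auto
  have "y \<in> CS"
  proof (rule CS_I)
    fix e :: real assume "e > 0"
    then have e: "e / (3 * B) > 0" "e / (3 * B * B) > 0"
      using B by auto
    obtain M1 where M1: "\<forall>m\<ge>M1. \<forall>n\<ge>M1. q (x m - x n) < e / (3 * B * B)"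
      using x e(2) unfolding CS_iff by meson
    have "\<forall>\<^sub>F k in sequentially. r ^ k < e / (3 * B)"
      using rk e(1) by (rule order_tendstoD)
    then obtain M2 where M2: "\<And>k. k \<ge> M2 \<Longrightarrow> r ^ k < e / (3 * B)"
      by (auto simp: eventually_sequentially)
    have "q (y k - y l) \<le> e" if k: "k \<ge> max N (max M1 M2)" and l: "l \<ge> max N (max M1 M2)" for k l
    proof -
      \<comment> \<open>A resolvent identity with remainders. Its three summands receive e / 3 each,
        with B bounding the partial sums and powers of r the remainders.\<close>
      have "y k - y l = y k * (x k - x l) * y l + (y k * x l ^ l - x k ^ k * y l)"
      proof -
        have "y k * (x k - x l) * y l = y k * ((1 - x l) * y l) - (y k * (1 - x k)) * y l"
          by (simp add: algebra_simps)
        also have "\<dots> = y k - y k * x l ^ l - (y l - x k ^ k * y l)"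
          unfolding y1 y2 by (simp add: algebra_simps)
        finally show ?thesis by simp
      qed
      also have "q \<dots> \<le> q (y k * (x k - x l) * y l) + q (y k * x l ^ l - x k ^ k * y l)"
        using x yc by (intro q_add) auto
      also have "\<dots> \<le> q (y k * (x k - x l) * y l) + (q (y k * x l ^ l) + q (x k ^ k * y l))"
        using x yc by (intro add_left_mono q_diff) auto
      also have "\<dots> \<le> (B * (e / (3 * B * B))) * B + (B * (e / (3 * B)) + e / (3 * B) * B)"
      proof (intro add_mono)
        have "q (y k * (x k - x l)) \<le> q (y k) * q (x k - x l)"
          using x yc by (intro q_mult) auto
        also have "\<dots> \<le> B * (e / (3 * B * B))"
          using qy [of k] M1 k l x yc by (intro mult_mono q_nonneg) (auto intro: less_imp_le simp: B less_imp_le)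
        finally have "q (y k * (x k - x l)) * q (y l) \<le> (B * (e / (3 * B * B))) * B"
          using qy [of l] l x yc B \<open>e > 0\<close> by (intro mult_mono q_nonneg) auto
        then show "q (y k * (x k - x l) * y l) \<le> (B * (e / (3 * B * B))) * B"
          using q_mult [of "y k * (x k - x l)" "y l"] x yc by (auto intro: order_trans)
        have "q (y k) * q (x l ^ l) \<le> B * (e / (3 * B))"
          using qy [of k] qpow [of l l] M2 [of l] k l x yc B by (intro mult_mono q_nonneg) auto
        then show "q (y k * x l ^ l) \<le> B * (e / (3 * B))"
          using q_mult [of "y k" "x l ^ l"] x yc by (auto intro: order_trans)
        have "q (x k ^ k) * q (y l) \<le> e / (3 * B) * B"
          using qy [of l] qpow [of k k] M2 [of k] k l x yc B e by (intro mult_mono q_nonneg) auto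
        then show "q (x k ^ k * y l) \<le> e / (3 * B) * B"
          using q_mult [of "x k ^ k" "y l"] x yc by (auto intro: order_trans)
      qed
      also have "\<dots> = e"
        using B by simp
      finally show ?thesis .
    qed
    then show "\<exists>N. \<forall>m\<ge>N. \<forall>n\<ge>N. q (y m - y n) \<le> e"
      by blast
  qed (rule yc)
  moreover have "cls y \<otimes>\<^bsub>T\<^esub> (\<one>\<^bsub>T\<^esub> \<ominus>\<^bsub>T\<^esub> cls x) = \<one>\<^bsub>T\<^esub>"
  proof -
    have "(\<lambda>k. q (1 - x k ^ k - 1)) \<longlonglongrightarrow> 0"
    proof (rule tendsto_sandwich [OF _ _ tendsto_const rk])
      show "\<forall>\<^sub>F k in sequentially. 0 \<le> q (1 - x k ^ k - 1)"
        using x by (intro always_eventually allI q_nonneg) auto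
      have "q (1 - x k ^ k - 1) \<le> r ^ k" if "k \<ge> N" for k
        using qpow [OF that, of k] x by simp
      then show "\<forall>\<^sub>F k in sequentially. q (1 - x k ^ k - 1) \<le> r ^ k"
        by (auto simp: eventually_sequentially)
    qed
    moreover have "(\<lambda>k. 1 - x k ^ k) \<in> CS"
      using CS_mult [OF \<open>y \<in> CS\<close> CS_minus [OF CS_const x], of 1] by (simp add: y1)
    ultimately have "cls (\<lambda>k. 1 - x k ^ k) = cst 1"
      by (subst cls_eq_iff) simp_all
    then show ?thesis
      using \<open>y \<in> CS\<close> x by (simp add: T_minus y1)
  qed
  ultimately show ?thesis
    by (rule that)
qed

end

section \<open>The free *-algebra and the universal seminorm\<close>

abbreviation "alphabet X \<equiv> Gen ` X \<union> Gen_star ` X"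

lemma free_carrier_iff:
  "a \<in> carrier (free_star_algebra X) \<longleftrightarrow> (\<forall>w\<in>Poly_Mapping.keys a. set (letters w) \<subseteq> alphabet X)"
  by (simp add: free_star_algebra_def)

lemma letters_plus [simp]: "letters (v + w) = letters v @ letters w" "letters 0 = []"
  by (simp_all add: plus_monomial_def zero_monomial_def)

lemma free_elem_sum_singles:
  "a = (\<Sum>w\<in>Poly_Mapping.keys a. Poly_Mapping.single w (Poly_Mapping.lookup a w))"
  by (rule poly_mapping_eqI)
    (auto simp: lookup_sum lookup_single when_def in_keys_iff cong: if_cong)

lemma free_induct [consumes 1, case_names single add]:
  assumes "a \<in> carrier (free_star_algebra X)"
    and single: "\<And>w c. set (letters w) \<subseteq> alphabet X \<Longrightarrow> Q (Poly_Mapping.single w c)"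
    and add: "\<And>a b. a \<in> carrier (free_star_algebra X) \<Longrightarrow> b \<in> carrier (free_star_algebra X) \<Longrightarrow>
      Q a \<Longrightarrow> Q b \<Longrightarrow> Q (a + b)"
  shows "Q a"
proof -
  have "Q (\<Sum>w\<in>W. Poly_Mapping.single w (Poly_Mapping.lookup a w)) \<and>
      (\<Sum>w\<in>W. Poly_Mapping.single w (Poly_Mapping.lookup a w)) \<in> carrier (free_star_algebra X)"
    if "finite W" "W \<subseteq> Poly_Mapping.keys a" for W
    using that
  proof (induction W)
    case empty
    then show ?case
      using single [of 0 0] by (simp add: free_carrier_iff)
  next
    case (insert w W)
    have w: "set (letters w) \<subseteq> alphabet X"
      using insert assms(1) by (auto simp: free_carrier_iff)
    then have "Poly_Mapping.single w (Poly_Mapping.lookup a w) \<in> carrier (free_star_algebra X)"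
      by (simp add: free_carrier_iff)
    moreover have "x + y \<in> carrier (free_star_algebra X)"
      if "x \<in> carrier (free_star_algebra X)" "y \<in> carrier (free_star_algebra X)" for x y
      using that Poly_Mapping.keys_add [of x y] unfolding free_carrier_iff by blast
    ultimately show ?case
      using insert add single [OF w] by auto
  qed
  from this [of "Poly_Mapping.keys a"] show ?thesis
    using free_elem_sum_singles [of a] by simp
qed

lemma letter_star_invol [simp]: "letter_star (letter_star l) = l"
  by (cases l) auto

lemma monomial_star_invol [simp]: "monomial_star (monomial_star w) = w"
  by (simp add: monomial_star_def rev_map comp_def)

lemma monomial_star_plus: "monomial_star (v + w) = monomial_star w + monomial_star v"
  by (simp add: monomial_star_def plus_monomial_def)

lemma alphabet_star: "set (letters (monomial_star w)) \<subseteq> alphabet X \<longleftrightarrow> set (letters w) \<subseteq> alphabet X"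
proof -
  have "letter_star l \<in> alphabet X \<longleftrightarrow> l \<in> alphabet X" for l
    by (cases l) auto
  then show ?thesis
    unfolding monomial_star_def by (simp add: image_subset_iff del: Un_iff) (simp only: subset_iff Ball_def)
qed

lemma monomial_star_0 [simp]: "monomial_star 0 = 0"
  by (simp add: monomial_star_def zero_monomial_def)

lemma lookup_free_star:
  "Poly_Mapping.lookup (star (free_star_algebra X) a) w = cnj (Poly_Mapping.lookup a (monomial_star w))"
proof -
  have eq: "monomial_star v = w \<longleftrightarrow> v = monomial_star w" for v
    by (metis monomial_star_invol)
  show ?thesis
    by (auto simp: free_star_algebra_def lookup_sum lookup_single when_def eq in_keys_iff cong: if_cong)
qed

lemma free_star_single:
  "star (free_star_algebra X) (Poly_Mapping.single w c) = Poly_Mapping.single (monomial_star w) (cnj c)"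
  by (simp add: free_star_algebra_def)

lemma free_star_add: "star (free_star_algebra X) (a + b)
    = star (free_star_algebra X) a + star (free_star_algebra X) b"
  by (rule poly_mapping_eqI) (simp add: lookup_free_star lookup_add)

lemma free_algebra_ops:
  "mult (free_star_algebra X) = (*)" "one (free_star_algebra X) = 1"
  "add (free_star_algebra X) = (+)" "zero (free_star_algebra X) = 0"
  "smult (free_star_algebra X) c a = Poly_Mapping.single 0 c * a"
  by (simp_all add: free_star_algebra_def)

lemma free_algebra_closed:
  "1 \<in> carrier (free_star_algebra X)" "0 \<in> carrier (free_star_algebra X)"
  "a \<in> carrier (free_star_algebra X) \<Longrightarrow> b \<in> carrier (free_star_algebra X) \<Longrightarrow>
    a + b \<in> carrier (free_star_algebra X)"
  "a \<in> carrier (free_star_algebra X) \<Longrightarrow> b \<in> carrier (free_star_algebra X) \<Longrightarrow>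
    a * b \<in> carrier (free_star_algebra X)"
  "set (letters w) \<subseteq> alphabet X \<Longrightarrow> Poly_Mapping.single w c \<in> carrier (free_star_algebra X)"
  "a \<in> carrier (free_star_algebra X) \<Longrightarrow> star (free_star_algebra X) a \<in> carrier (free_star_algebra X)"
proof -
  show "1 \<in> carrier (free_star_algebra X)" "0 \<in> carrier (free_star_algebra X)"
    by (simp_all add: free_carrier_iff flip: single_one)
  show "a + b \<in> carrier (free_star_algebra X)"
    if "a \<in> carrier (free_star_algebra X)" "b \<in> carrier (free_star_algebra X)"
    using that Poly_Mapping.keys_add [of a b] unfolding free_carrier_iff by blast
  show "a * b \<in> carrier (free_star_algebra X)"
    if "a \<in> carrier (free_star_algebra X)" "b \<in> carrier (free_star_algebra X)"
    unfolding free_carrier_iff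
  proof
    fix w assume "w \<in> Poly_Mapping.keys (a * b)"
    then obtain u v where "w = u + v" "u \<in> Poly_Mapping.keys a" "v \<in> Poly_Mapping.keys b"
      using Poly_Mapping.keys_mult [of a b] by blast
    then show "set (letters w) \<subseteq> alphabet X"
      using that by (simp add: free_carrier_iff del: Un_iff)
  qed
  show "Poly_Mapping.single w c \<in> carrier (free_star_algebra X)" if "set (letters w) \<subseteq> alphabet X"
    using that by (simp add: free_carrier_iff)
  show "star (free_star_algebra X) a \<in> carrier (free_star_algebra X)"
    if "a \<in> carrier (free_star_algebra X)"
    unfolding free_carrier_iff
  proof
    fix w assume "w \<in> Poly_Mapping.keys (star (free_star_algebra X) a)"
    then have "monomial_star w \<in> Poly_Mapping.keys a"
      by (simp add: in_keys_iff lookup_free_star)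
    then show "set (letters w) \<subseteq> alphabet X"
      using that alphabet_star [of w X] by (simp add: free_carrier_iff)
  qed
qed

text \<open>Scalar multiplication is left multiplication by a constant, so moving a scalar past a
  factor requires constants to be central.\<close>

lemma free_scalar_central: "a * Poly_Mapping.single 0 c = Poly_Mapping.single 0 c * (a :: 'x free_elem)"
proof -
  have "(\<Sum>w\<in>W. Poly_Mapping.single w (f w)) * Poly_Mapping.single 0 c
      = Poly_Mapping.single 0 c * (\<Sum>w\<in>W. Poly_Mapping.single w (f w))" for W f
    by (simp add: sum_distrib_left sum_distrib_right Poly_Mapping.mult_single mult.commute)
  then show ?thesis
    by (subst (1 2) free_elem_sum_singles [of a])
qed

lemma free_star_mult: "star (free_star_algebra X) (a * b)
    = star (free_star_algebra X) b * star (free_star_algebra X) a"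
proof -
  let ?s = "star (free_star_algebra X)"
  have zero: "?s 0 = 0"
    by (rule poly_mapping_eqI) (simp add: lookup_free_star)
  have sum: "?s (sum f W) = (\<Sum>w\<in>W. ?s (f w))" for f and W :: "'c set"
    by (induction W rule: infinite_finite_induct) (simp_all add: zero free_star_add)
  have "?s ((\<Sum>v\<in>V. Poly_Mapping.single v (f v)) * (\<Sum>w\<in>W. Poly_Mapping.single w (g w)))
      = ?s (\<Sum>w\<in>W. Poly_Mapping.single w (g w)) * ?s (\<Sum>v\<in>V. Poly_Mapping.single v (f v))" for V W f g
    unfolding sum_product sum free_star_single
    by (subst sum.swap) (simp add: sum Poly_Mapping.mult_single free_star_single monomial_star_plus mult.commute)
  then show ?thesis
    by (subst (1 2) free_elem_sum_singles [of a], subst (1 2) free_elem_sum_singles [of b])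
qed

lemma free_algebra_induct [consumes 1, case_names one gen star mult smult add]:
  assumes "a \<in> carrier (free_star_algebra X)" and one: "Q 1"
    and gen: "\<And>x. x \<in> X \<Longrightarrow> Q (free_gen x)"
    and star: "\<And>a. a \<in> carrier (free_star_algebra X) \<Longrightarrow> Q a \<Longrightarrow> Q (star (free_star_algebra X) a)"
    and mult: "\<And>a b. a \<in> carrier (free_star_algebra X) \<Longrightarrow> b \<in> carrier (free_star_algebra X) \<Longrightarrow>
      Q a \<Longrightarrow> Q b \<Longrightarrow> Q (a * b)"
    and smult: "\<And>c a. a \<in> carrier (free_star_algebra X) \<Longrightarrow> Q a \<Longrightarrow> Q (smult (free_star_algebra X) c a)"
    and add: "\<And>a b. a \<in> carrier (free_star_algebra X) \<Longrightarrow> b \<in> carrier (free_star_algebra X) \<Longrightarrow>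
      Q a \<Longrightarrow> Q b \<Longrightarrow> Q (a + b)"
  shows "Q a"
  using assms(1)
proof (induction rule: free_induct)
  case (single w c)
  have "Q (Poly_Mapping.single (Monomial ls) 1)" if "set ls \<subseteq> alphabet X" for ls
    using that
  proof (induction ls)
    case Nil
    then show ?case
      using one by (simp flip: zero_monomial_def)
  next
    case (Cons l ls)
    have "Q (Poly_Mapping.single (Monomial [l]) 1)"
    proof (cases l)
      case (Gen x)
      then show ?thesis
        using gen [of x] Cons.prems by (auto simp: free_gen_def)
    next
      case (Gen_star x)
      then have "x \<in> X"
        using Cons.prems by auto
      then have "Q (star (free_star_algebra X) (free_gen x))"
        unfolding free_gen_def
        by (intro star free_algebra_closed gen [unfolded free_gen_def]) auto
      then show ?thesis
        using Gen_star by (simp add: free_gen_def free_star_single monomial_star_def)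
    qed
    then have "Q (Poly_Mapping.single (Monomial [l]) 1 * Poly_Mapping.single (Monomial ls) 1)"
      using Cons by (intro mult free_algebra_closed) auto
    then show ?case
      by (simp add: Poly_Mapping.mult_single plus_monomial_def)
  qed
  then have "Q (smult (free_star_algebra X) c (Poly_Mapping.single w 1))"
    using single by (intro smult free_algebra_closed) (metis monomial.collapse)+
  then show ?case
    by (simp add: free_algebra_ops Poly_Mapping.mult_single)
qed (rule add)

lemma star_alg_free: "star_alg (free_star_algebra X)"
proof
  fix a b :: "'a free_elem" and c d :: complex
  let ?A = "free_star_algebra X"
  show "star ?A (smult ?A c a) = smult ?A (cnj c) (star ?A a)"
    by (simp add: free_algebra_ops free_star_mult free_star_single free_scalar_central)
  show "star ?A (star ?A a) = a"
    by (rule poly_mapping_eqI) (simp add: lookup_free_star)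
  show "a \<in> carrier ?A \<Longrightarrow> smult ?A c a \<in> carrier ?A"
    by (simp add: free_algebra_ops free_algebra_closed)
  show "a * smult ?A c b = smult ?A c (a * b)"
    by (simp add: free_algebra_ops mult.assoc [symmetric] free_scalar_central)
qed (simp_all add: free_algebra_ops free_algebra_closed free_star_add free_star_mult
    distrib_left distrib_right single_add mult.assoc [symmetric] Poly_Mapping.mult_single)

section \<open>Suprema of C*-seminorms\<close>

context star_alg
begin

lemma zero_seminorm: "(\<lambda>_. 0) \<in> cstar_seminorms A R"
  by (simp add: cstar_seminorms_def)

text \<open>Subadditivity and submultiplicativity survive suprema, and so does the C*-identity,
  because squaring is increasing on nonnegative reals. The zero seminorm makes the index set
  nonempty, and pointwise boundedness makes the suprema meaningful.\<close>

lemma universal_seminorm: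
  assumes bdd: "\<And>x. x \<in> carrier A \<Longrightarrow> \<exists>B. \<forall>q\<in>cstar_seminorms A R. q x \<le> B"
    and R: "R \<subseteq> carrier A"
  shows universal_seminorm_upper:
      "\<And>q x. q \<in> cstar_seminorms A R \<Longrightarrow> x \<in> carrier A \<Longrightarrow> q x \<le> universal_seminorm A R x"
    and universal_seminorm_cstar: "universal_seminorm A R \<in> cstar_seminorms A R"
proof -
  let ?S = "cstar_seminorms A R" and ?U = "universal_seminorm A R"
  have bdd': "bdd_above ((\<lambda>q. q x) ` ?S)" if "x \<in> carrier A" for x
    using bdd [OF that] by (auto intro: bdd_aboveI2)
  show upper: "q x \<le> ?U x" if "q \<in> ?S" "x \<in> carrier A" for q x
    unfolding universal_seminorm_def using that by (intro cSUP_upper bdd')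
  have least: "?U x \<le> B" if "\<And>q. q \<in> ?S \<Longrightarrow> q x \<le> B" for x B
    unfolding universal_seminorm_def using that zero_seminorm by (intro cSUP_least) auto
  have U0: "0 \<le> ?U x" if "x \<in> carrier A" for x
    using upper [OF zero_seminorm that] .
  have seminorm: "cstar_seminormed A q R" if "q \<in> ?S" for q
    by unfold_locales (rule that)
  note q_add = cstar_seminormed.q_add [OF seminorm]
    and q_smult = cstar_seminormed.q_smult [OF seminorm]
    and q_mult = cstar_seminormed.q_mult [OF seminorm]
    and q_star_mult = cstar_seminormed.q_star_mult [OF seminorm]
    and q_nonneg = cstar_seminormed.q_nonneg [OF seminorm]
  show "?U \<in> ?S"
    unfolding cstar_seminorms_def mem_Collect_eq
  proof (intro conjI ballI allI)
    fix x y assume xy: "x \<in> carrier A" "y \<in> carrier A"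
    show "?U (x \<oplus>\<^bsub>A\<^esub> y) \<le> ?U x + ?U y"
    proof (rule least)
      fix q assume "q \<in> ?S"
      then show "q (x \<oplus>\<^bsub>A\<^esub> y) \<le> ?U x + ?U y"
        using q_add [of q x y] upper [of q x] upper [of q y] xy by simp
    qed
    show "?U (x \<otimes>\<^bsub>A\<^esub> y) \<le> ?U x * ?U y"
    proof (rule least)
      fix q assume q: "q \<in> ?S"
      then have "q (x * y) \<le> q x * q y"
        using q_mult xy by blast
      also have "\<dots> \<le> ?U x * ?U y"
        using q xy by (intro mult_mono upper U0 q_nonneg)
      finally show "q (x \<otimes>\<^bsub>A\<^esub> y) \<le> ?U x * ?U y"
        by simp
    qed
  next
    fix c x assume x: "x \<in> carrier A"
    show "?U (c \<odot>\<^bsub>A\<^esub> x) = cmod c * ?U x"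
    proof (rule antisym)
      show "?U (c \<odot>\<^bsub>A\<^esub> x) \<le> cmod c * ?U x"
      proof (rule least)
        fix q assume q: "q \<in> ?S"
        then show "q (c \<odot>\<^bsub>A\<^esub> x) \<le> cmod c * ?U x"
          using upper [OF q x] q_smult [OF q x] by (simp add: mult_left_mono)
      qed
      show "cmod c * ?U x \<le> ?U (c \<odot>\<^bsub>A\<^esub> x)"
      proof (cases "c = 0")
        case True
        then show ?thesis
          using U0 [OF closed(5) [OF x]] by simp
      next
        case False
        have "?U x \<le> ?U (c \<odot>\<^bsub>A\<^esub> x) / cmod c"
        proof (rule least)
          fix q assume q: "q \<in> ?S"
          then have "cmod c * q x \<le> ?U (c \<odot>\<^bsub>A\<^esub> x)"
            using upper [OF q closed(5) [OF x], of c] q_smult x by simp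
          then show "q x \<le> ?U (c \<odot>\<^bsub>A\<^esub> x) / cmod c"
            using False by (simp add: field_simps)
        qed
        then show ?thesis
          using False by (simp add: field_simps)
      qed
    qed
  next
    fix x assume x: "x \<in> carrier A"
    show "?U (star A x \<otimes>\<^bsub>A\<^esub> x) = (?U x)\<^sup>2"
    proof (rule antisym)
      show "?U (star A x \<otimes>\<^bsub>A\<^esub> x) \<le> (?U x)\<^sup>2"
      proof (rule least)
        fix q assume q: "q \<in> ?S"
        then show "q (star A x \<otimes>\<^bsub>A\<^esub> x) \<le> (?U x)\<^sup>2"
          using upper [OF q x] q_star_mult [OF q x] q_nonneg [OF q x] by (simp add: power_mono)
      qed
      have "?U x \<le> sqrt (?U (star A x \<otimes>\<^bsub>A\<^esub> x))"
      proof (rule least)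
        fix q assume q: "q \<in> ?S"
        then have "(q x)\<^sup>2 \<le> ?U (star A x \<otimes>\<^bsub>A\<^esub> x)"
          using upper [OF q, of "star A x * x"] q_star_mult x by simp
        then show "q x \<le> sqrt (?U (star A x \<otimes>\<^bsub>A\<^esub> x))"
          by (rule real_le_rsqrt)
      qed
      then have "(?U x)\<^sup>2 \<le> (sqrt (?U (star A x \<otimes>\<^bsub>A\<^esub> x)))\<^sup>2"
        using U0 [OF x] by (rule power_mono)
      then show "(?U x)\<^sup>2 \<le> ?U (star A x \<otimes>\<^bsub>A\<^esub> x)"
        using U0 [of "star A x * x"] x by simp
    qed
  next
    fix r assume r: "r \<in> R"
    have "?U r \<le> 0"
      by (rule least) (use r in \<open>simp add: cstar_seminorms_def\<close>)
    then show "?U r = 0"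
      using U0 [of r] r R by auto
  qed
qed

end

section \<open>Calculus of words modulo a seminorm\<close>

context cstar_seminormed
begin

text \<open>Equality in the Hausdorff quotient of A by q, kept as a relation so that all
  computations stay in A itself.\<close>

definition eqv :: "'b \<Rightarrow> 'b \<Rightarrow> bool"  (infix "\<simeq>" 50)
  where "x \<simeq> y \<longleftrightarrow> x \<in> carrier A \<and> y \<in> carrier A \<and> q (x - y) = 0"

lemma eqv_carrier: "x \<simeq> y \<Longrightarrow> x \<in> carrier A" "x \<simeq> y \<Longrightarrow> y \<in> carrier A"
  by (simp_all add: eqv_def)

lemma eqv_refl [simp]: "x \<simeq> x \<longleftrightarrow> x \<in> carrier A"
  by (simp add: eqv_def)

lemma eqv_sym: "x \<simeq> y \<Longrightarrow> y \<simeq> x"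
  by (simp add: eqv_def q_diff_commute)

lemma q_zero_I: "x \<in> carrier A \<Longrightarrow> q x \<le> 0 \<Longrightarrow> q x = 0"
  using q_nonneg [of x] by simp

lemma eqv_trans [trans]: "x \<simeq> y \<Longrightarrow> y \<simeq> z \<Longrightarrow> x \<simeq> z"
  unfolding eqv_def using q_diff_triangle [of x y z] by (auto intro!: q_zero_I)

lemma eqv_add: "x \<simeq> y \<Longrightarrow> u \<simeq> v \<Longrightarrow> x + u \<simeq> y + v"
  unfolding eqv_def using q_add [of "x - y" "u - v"] by (auto simp: algebra_simps intro!: q_zero_I)

lemma eqv_smult: "x \<simeq> y \<Longrightarrow> smult A c x \<simeq> smult A c y"
  unfolding eqv_def by (auto simp: smult_diff [symmetric] q_smult)

lemma eqv_minus: "x \<simeq> y \<Longrightarrow> - x \<simeq> - y"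
  using eqv_smult [of x y "-1"] by (simp add: smult_minus eqv_carrier)

lemma eqv_diff: "x \<simeq> y \<Longrightarrow> u \<simeq> v \<Longrightarrow> x - u \<simeq> y - v"
  using eqv_add [of x y "- u" "- v"] eqv_minus [of u v] by simp

lemma eqv_star: "x \<simeq> y \<Longrightarrow> star A x \<simeq> star A y"
  unfolding eqv_def by (auto simp: star_diff [symmetric] q_star)

lemma eqv_mult: assumes "x \<simeq> y" "u \<simeq> v" shows "x * u \<simeq> y * v"
proof -
  have c: "x \<in> carrier A" "y \<in> carrier A" "u \<in> carrier A" "v \<in> carrier A"
    using assms by (auto simp: eqv_def)
  have "q (x * u - y * v) \<le> max (q x) (q v) * q (u - v) + q (x - y) * max (q x) (q v)"
    using c by (intro q_mult_diff) auto
  also have "\<dots> = 0"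
    using assms by (simp add: eqv_def)
  finally show ?thesis
    unfolding eqv_def using c by (auto intro: q_zero_I)
qed

lemma eqv_sum: "(\<And>i. i \<in> I \<Longrightarrow> f i \<simeq> g i) \<Longrightarrow> sum f I \<simeq> sum g I"
  by (induction I rule: infinite_finite_induct) (auto intro: eqv_add)

lemma eqv_q: "x \<simeq> y \<Longrightarrow> q x = q y"
  unfolding eqv_def using q_abs_diff [of x y] by simp

lemma eqv_0: "x \<simeq> 0 \<longleftrightarrow> x \<in> carrier A \<and> q x = 0"
  by (simp add: eqv_def)

lemma eqv_mult_0: "x \<simeq> 0 \<Longrightarrow> y \<in> carrier A \<Longrightarrow> y * x \<simeq> 0" "x \<simeq> 0 \<Longrightarrow> y \<in> carrier A \<Longrightarrow> x * y \<simeq> 0"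
  using eqv_mult [of y y x 0] eqv_mult [of x 0 y y] by simp_all

lemma cls_eqvI: "cls x = cls y" if "x \<in> CS" "y \<in> CS" "\<And>n. x n \<simeq> y n"
  using that by (simp add: cls_eq_iff eqv_def)

lemma projection_q: "q x = 0 \<or> q x = 1" if "star A x * x \<simeq> x"
proof -
  have "(q x)\<^sup>2 = q x"
    using eqv_q [OF that] eqv_carrier [OF that] by (simp add: q_star_mult)
  then show ?thesis
    by (simp add: power2_eq_square)
qed

end


text \<open>A letter is padded with the identity to a pair: p is read as e^{-1} p and its adjoint as
  p^{-1} e. By (T1) this changes nothing modulo the relations, so every monomial becomes a
  word.\<close>

fun letter_word :: "('g, 'm) monoid_scheme \<Rightarrow> 'g letter \<Rightarrow> 'g word"
  where "letter_word G (Gen p) = [(\<one>\<^bsub>G\<^esub>, p)]"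
  | "letter_word G (Gen_star p) = [(p, \<one>\<^bsub>G\<^esub>)]"

definition monomial_word :: "('g, 'm) monoid_scheme \<Rightarrow> 'g monomial \<Rightarrow> 'g word"
  where "monomial_word G w = concat (map (letter_word G) (letters w))"

section \<open>Seminorms that satisfy the Toeplitz relations\<close>

context group_submonoid
begin

abbreviation "A \<equiv> free_star_algebra P"
abbreviation "t \<equiv> word_prod A free_gen"
abbreviation "N \<equiv> neutral_words G P"

end

text \<open>The seminorm is arbitrary because the same calculus serves both the universal seminorm
  and the operator seminorms of the representations on cosets.\<close>

locale toeplitz_seminorm = group_submonoid G P
  for G :: "('g, 'm) monoid_scheme" (structure) and P :: "'g set" +
  fixes q :: "'g free_elem \<Rightarrow> real"
  assumes q: "q \<in> cstar_seminorms (free_star_algebra P) (toeplitz_relations G P)"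
begin

sublocale cstar_seminormed A q "toeplitz_relations G P"
proof -
  interpret star_alg A by (rule star_alg_free)
  show "cstar_seminormed A q (toeplitz_relations G P)"
    by unfold_locales (rule q)
qed

notation eqv (infix "\<simeq>" 50)

lemma free_gen_closed [simp]: "p \<in> P \<Longrightarrow> free_gen p \<in> carrier A"
  unfolding free_gen_def by (rule free_algebra_closed) auto

lemma t_simps [simp]: "t [] = 1" "t ((p, r) # \<alpha>) = star A (free_gen p) * free_gen r * t \<alpha>"
  by simp_all

lemma t_closed [simp]: "\<alpha> \<in> words P \<Longrightarrow> t \<alpha> \<in> carrier A"
  by (induction \<alpha> rule: word_induct) auto

lemma t_append: "t (\<alpha> @ \<beta>) = t \<alpha> * t \<beta>"
  by (induction \<alpha>) (auto simp: mult.assoc)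

lemma t_star: "star A (t \<alpha>) = t (word_tilde \<alpha>)" if "\<alpha> \<in> words P"
  using that by (induction \<alpha> rule: word_induct) (auto simp: t_append star mult.assoc)

lemma relation_T1: "free_gen \<one> \<simeq> 1"
  using q_relation [of "free_gen \<one> - 1"] by (simp add: eqv_def toeplitz_relations_def Let_def)

lemma relation_T2: "t \<alpha> \<simeq> 0" if "\<alpha> \<in> N" "K \<alpha> = {}"
proof -
  have "t \<alpha> \<in> toeplitz_relations G P"
    unfolding toeplitz_relations_def Let_def using that by blast
  then show ?thesis
    using that by (simp add: eqv_0 q_relation)
qed

lemma relation_T3: "t \<alpha> \<simeq> t \<beta>" if "\<alpha> \<in> N" "\<beta> \<in> N" "K \<alpha> = K \<beta>"
proof -
  have "t \<alpha> - t \<beta> \<in> toeplitz_relations G P"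
    unfolding toeplitz_relations_def Let_def using that by blast
  then show ?thesis
    using that by (simp add: eqv_def q_relation)
qed

lemma relation_T4: "prod_list (map (\<lambda>\<beta>. t \<alpha> - t \<beta>) \<beta>s) \<simeq> 0"
  if "\<alpha> \<in> N" "set \<beta>s \<subseteq> N" "distinct \<beta>s" "\<beta>s \<noteq> []" "K \<alpha> = (\<Union>\<beta>\<in>set \<beta>s. K \<beta>)"
proof -
  have "prod_list (map (\<lambda>\<beta>. t \<alpha> - t \<beta>) \<beta>s) \<in> toeplitz_relations G P"
    unfolding toeplitz_relations_def Let_def using that by blast
  moreover have "prod_list (map (\<lambda>\<beta>. t \<alpha> - t \<beta>) \<beta>s) \<in> carrier A"
    using that(2) by (induction \<beta>s) (use that(1) in auto)
  ultimately show ?thesis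
    by (simp add: eqv_0 q_relation)
qed

text \<open>(T3) for words of any common value, since \<open>t\<^sub>\<alpha> - t\<^sub>\<beta>\<close> is controlled by
  \<open>(t\<^sub>\<alpha> - t\<^sub>\<beta>)\<^sup>*(t\<^sub>\<alpha> - t\<^sub>\<beta>)\<close>, which involves neutral words only.\<close>

lemma word_eqv: "t \<alpha> \<simeq> t \<beta>"
  if w: "\<alpha> \<in> words P" "\<beta> \<in> words P" and v: "val \<alpha> = val \<beta>" and K: "K \<alpha> = K \<beta>"
proof -
  let ?d = "t \<alpha> - t \<beta>"
  \<comment> \<open>Expanding the product of ?d with its adjoint gives four words, one for each
    choice of \<gamma> and \<delta>. All are neutral with the ideal K(\<alpha>), so (T3) makes the
    four terms cancel.\<close>
  have K': "K (word_tilde \<gamma> @ \<delta>) = K \<alpha>" and N': "word_tilde \<gamma> @ \<delta> \<in> N"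
    if "\<gamma> \<in> {\<alpha>, \<beta>}" "\<delta> \<in> {\<alpha>, \<beta>}" for \<gamma> \<delta>
  proof -
    have \<gamma>\<delta>: "\<gamma> \<in> words P" "\<delta> \<in> words P" "val \<delta> = val \<gamma>" "K \<gamma> = K \<alpha>" "K \<delta> = K \<alpha>"
      using that w v K by fastforce+
    have "x \<in> K (word_tilde \<gamma> @ \<delta>) \<longleftrightarrow> x \<in> K \<alpha>" for x
    proof (cases "x \<in> P")
      case True
      then show ?thesis
        using \<gamma>\<delta> K_tilde [of \<gamma> x] by (simp add: K_append)
    next
      case False
      then show ?thesis
        using K_in_P [of x] by blast
    qed
    then show "K (word_tilde \<gamma> @ \<delta>) = K \<alpha>"
      by blast
    show "word_tilde \<gamma> @ \<delta> \<in> N"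
      using \<gamma>\<delta> by (intro neutralI) (simp_all add: val_append)
  qed
  have eq: "t (word_tilde \<gamma> @ \<delta>) \<simeq> t (word_tilde \<alpha> @ \<alpha>)"
    if "\<gamma> \<in> {\<alpha>, \<beta>}" "\<delta> \<in> {\<alpha>, \<beta>}" for \<gamma> \<delta>
    by (rule relation_T3) (use that N' K' in auto)
  have "star A ?d * ?d = (t (word_tilde \<alpha> @ \<alpha>) - t (word_tilde \<alpha> @ \<beta>))
      - (t (word_tilde \<beta> @ \<alpha>) - t (word_tilde \<beta> @ \<beta>))"
    using w by (simp add: star_diff t_star t_append algebra_simps)
  also have "\<dots> \<simeq> (t (word_tilde \<alpha> @ \<alpha>) - t (word_tilde \<alpha> @ \<alpha>))
      - (t (word_tilde \<alpha> @ \<alpha>) - t (word_tilde \<alpha> @ \<alpha>))"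
    by (intro eqv_diff eq) auto
  also have "\<dots> = 0"
    by simp
  finally have "q (star A ?d * ?d) = 0"
    by (simp add: eqv_0)
  then show ?thesis
    unfolding eqv_def using w q_star_mult [of ?d] by simp
qed

lemma monomial_word_words: "monomial_word G w \<in> words P" if "set (letters w) \<subseteq> alphabet P"
proof -
  have "concat (map (letter_word G) ls) \<in> words P" if "set ls \<subseteq> alphabet P" for ls
    using that by (induction ls) auto
  then show ?thesis
    using that by (simp add: monomial_word_def)
qed

lemma monomial_eqv_word: "Poly_Mapping.single w 1 \<simeq> t (monomial_word G w)"
  if "set (letters w) \<subseteq> alphabet P"
proof -
  have letter: "Poly_Mapping.single (Monomial [l]) 1 \<simeq> t (letter_word G l)" if l: "l \<in> alphabet P" for l
  proof (cases l)
    case (Gen p)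
    then have p: "p \<in> P"
      using l by auto
    have "1 * free_gen p \<simeq> star A (free_gen \<one>) * free_gen p"
      using eqv_star [OF relation_T1] p by (intro eqv_mult) (auto intro: eqv_sym)
    then show ?thesis
      using Gen by (simp add: free_gen_def)
  next
    case (Gen_star p)
    then have p: "p \<in> P"
      using l by auto
    have "star A (free_gen p) * 1 \<simeq> star A (free_gen p) * free_gen \<one>"
      using relation_T1 p by (intro eqv_mult) (auto intro: eqv_sym)
    then show ?thesis
      using Gen_star by (simp add: free_gen_def free_star_single monomial_star_def)
  qed
  have "Poly_Mapping.single (Monomial ls) 1 \<simeq> t (concat (map (letter_word G) ls))"
    if "set ls \<subseteq> alphabet P" for ls
    using that
  proof (induction ls)
    case Nil
    have "Poly_Mapping.single (Monomial []) (1::complex) = (1 :: 'g free_elem)"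
      by (simp flip: zero_monomial_def)
    then show ?case by simp
  next
    case (Cons l ls)
    have "Poly_Mapping.single (Monomial (l # ls)) (1::complex)
        = Poly_Mapping.single (Monomial [l]) 1 * Poly_Mapping.single (Monomial ls) 1"
      by (simp add: Poly_Mapping.mult_single plus_monomial_def)
    also have "\<dots> \<simeq> t (letter_word G l) * t (concat (map (letter_word G) ls))"
      using Cons letter by (intro eqv_mult) auto
    finally show ?case
      by (simp add: t_append)
  qed
  from this [OF that] show ?thesis
    by (simp add: monomial_word_def)
qed

section \<open>The algebraic part of the diagonal\<close>

inductive_set D0 :: "'g free_elem set"
  where D0_word: "\<alpha> \<in> N \<Longrightarrow> t \<alpha> \<in> D0"
  | D0_add: "x \<in> D0 \<Longrightarrow> y \<in> D0 \<Longrightarrow> x + y \<in> D0"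
  | D0_smult: "x \<in> D0 \<Longrightarrow> smult A c x \<in> D0"

lemma D0_carrier [simp]: "x \<in> D0 \<Longrightarrow> x \<in> carrier A"
  by (induction rule: D0.induct) auto

lemma D0_one [simp, intro]: "1 \<in> D0"
  using D0_word [of "[]"] by simp

lemma D0_zero [simp, intro]: "0 \<in> D0"
  using D0_smult [OF D0_one, of 0] by (simp add: smult_0)

lemma D0_minus: "x \<in> D0 \<Longrightarrow> - x \<in> D0"
  using D0_smult [of x "-1"] by (simp add: smult_minus)

lemma D0_diff: "x \<in> D0 \<Longrightarrow> y \<in> D0 \<Longrightarrow> x - y \<in> D0"
  using D0_add [of x "- y"] D0_minus by simp

lemma D0_mult: "x \<in> D0 \<Longrightarrow> y \<in> D0 \<Longrightarrow> x * y \<in> D0"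
proof (induction x rule: D0.induct)
  case (D0_word \<alpha>)
  from \<open>y \<in> D0\<close> show ?case
  proof (induction y rule: D0.induct)
    case (D0_word \<beta>)
    then show ?case
      using D0.D0_word [of "\<alpha> @ \<beta>"] \<open>\<alpha> \<in> N\<close> by (simp add: t_append)
  next
    case (D0_add x y)
    then show ?case by (simp add: distrib_left D0.D0_add)
  next
    case (D0_smult x c)
    then show ?case using \<open>\<alpha> \<in> N\<close> by (simp add: smult D0.D0_smult)
  qed
next
  case (D0_add x x')
  then show ?case by (simp add: distrib_right D0.D0_add)
next
  case (D0_smult x c)
  then show ?case by (simp add: smult D0.D0_smult)
qed

lemma D0_star: "x \<in> D0 \<Longrightarrow> star A x \<in> D0"
  by (induction rule: D0.induct) (auto simp: t_star star intro: D0.intros)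

text \<open>Concatenating neutral words intersects their ideals. Intersection is symmetric and
  idempotent, so by (T3) neutral words commute and, below, are idempotent modulo q.\<close>

lemma word_commute: "t \<alpha> * t \<beta> \<simeq> t \<beta> * t \<alpha>" if "\<alpha> \<in> N" "\<beta> \<in> N"
  unfolding t_append [symmetric] using that
  by (intro relation_T3) (auto simp: K_append_neutral)

lemma D0_commute: "x \<in> D0 \<Longrightarrow> y \<in> D0 \<Longrightarrow> x * y \<simeq> y * x"
proof (induction x rule: D0.induct)
  case (D0_word \<alpha>)
  from \<open>y \<in> D0\<close> show ?case
  proof (induction y rule: D0.induct)
    case (D0_word \<beta>)
    then show ?case
      using \<open>\<alpha> \<in> N\<close> by (simp add: word_commute)
  next
    case (D0_add x y)
    then show ?case by (simp add: distrib_left distrib_right eqv_add)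
  next
    case (D0_smult x c)
    then show ?case using \<open>\<alpha> \<in> N\<close> by (simp add: smult eqv_smult)
  qed
next
  case (D0_add x x')
  then show ?case by (simp add: distrib_left distrib_right eqv_add)
next
  case (D0_smult x c)
  then show ?case by (simp add: smult eqv_smult)
qed

lemma D0_left_commute: "x * (y * z) \<simeq> y * (x * z)" if "x \<in> D0" "y \<in> D0" "z \<in> carrier A"
  using eqv_mult [OF D0_commute [OF that(1,2)], of z z] that by (simp add: mult.assoc)

lemma word_idem: "t \<alpha> * t \<alpha> \<simeq> t \<alpha>" if "\<alpha> \<in> N"
  unfolding t_append [symmetric] using that
  by (intro relation_T3) (auto simp: K_append_neutral)

lemma word_self_adjoint: "star A (t \<alpha>) \<simeq> t \<alpha>" if "\<alpha> \<in> N"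
  using that by (simp add: t_star relation_T3 K_tilde_neutral)

text \<open>Modulo q, the projection onto the complement of the union of the K(\<gamma>). It runs
  along a list because its factors commute only modulo q.\<close>

definition cprod :: "'g word list \<Rightarrow> 'g free_elem"
  where "cprod \<gamma>s = prod_list (map (\<lambda>\<gamma>. 1 - t \<gamma>) \<gamma>s)"

lemma cprod_simps [simp]: "cprod [] = 1" "cprod (\<gamma> # \<gamma>s) = (1 - t \<gamma>) * cprod \<gamma>s"
  by (simp_all add: cprod_def)

lemma D0_compl [simp, intro]: "\<gamma> \<in> N \<Longrightarrow> 1 - t \<gamma> \<in> D0"
  by (simp add: D0_diff D0_word)

lemma D0_cprod [simp, intro]: "set \<gamma>s \<subseteq> N \<Longrightarrow> cprod \<gamma>s \<in> D0"
  by (induction \<gamma>s) (auto intro: D0_mult)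

lemma compl_idem: "(1 - t \<gamma>) * (1 - t \<gamma>) \<simeq> 1 - t \<gamma>" if "\<gamma> \<in> N"
proof -
  have "(1 - t \<gamma>) * (1 - t \<gamma>) = 1 - t \<gamma> - t \<gamma> + t \<gamma> * t \<gamma>"
    by (simp add: algebra_simps)
  also have "\<dots> \<simeq> 1 - t \<gamma> - t \<gamma> + t \<gamma>"
    using that by (intro eqv_add word_idem) auto
  finally show ?thesis by simp
qed

lemma word_compl: "t \<gamma> * (1 - t \<gamma>) \<simeq> 0" if "\<gamma> \<in> N"
proof -
  have "t \<gamma> - t \<gamma> * t \<gamma> \<simeq> t \<gamma> - t \<gamma>"
    using that by (intro eqv_diff word_idem) auto
  then show ?thesis
    by (simp add: right_diff_distrib)
qed

lemma cprod_idem: "cprod \<gamma>s * cprod \<gamma>s \<simeq> cprod \<gamma>s" if "set \<gamma>s \<subseteq> N"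
  using that
proof (induction \<gamma>s)
  case (Cons \<gamma> \<gamma>s)
  let ?u = "1 - t \<gamma>" and ?x = "cprod \<gamma>s"
  have u: "?u \<in> D0" and x: "?x \<in> D0"
    using Cons.prems by auto
  have "?u * (?x * (?u * ?x)) \<simeq> ?u * (?u * (?x * ?x))"
    using u x by (intro eqv_mult D0_left_commute) auto
  also have "\<dots> = ?u * ?u * (?x * ?x)"
    by (simp add: mult.assoc)
  also have "\<dots> \<simeq> ?u * ?x"
    using Cons by (intro eqv_mult compl_idem) auto
  finally show ?case
    by (simp add: mult.assoc)
qed simp

lemma cprod_self_adjoint: "star A (cprod \<gamma>s) \<simeq> cprod \<gamma>s" if "set \<gamma>s \<subseteq> N"
  using that
proof (induction \<gamma>s)
  case (Cons \<gamma> \<gamma>s)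
  have "star A (1 - t \<gamma>) \<simeq> 1 - t \<gamma>"
    using Cons.prems word_self_adjoint [of \<gamma>] by (auto simp: star_diff intro!: eqv_diff)
  then have "star A (cprod \<gamma>s) * star A (1 - t \<gamma>) \<simeq> cprod \<gamma>s * (1 - t \<gamma>)"
    using Cons by (intro eqv_mult) auto
  also have "\<dots> \<simeq> (1 - t \<gamma>) * cprod \<gamma>s"
    using Cons.prems by (intro D0_commute) auto
  finally show ?case
    using Cons.prems by (simp add: star)
qed simp

lemma word_cprod: "t \<gamma> * cprod \<gamma>s \<simeq> 0" if "set \<gamma>s \<subseteq> N" "\<gamma> \<in> set \<gamma>s"
  using that
proof (induction \<gamma>s)
  case (Cons \<delta> \<gamma>s)
  show ?case
  proof (cases "\<gamma> = \<delta>")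
    case True
    then show ?thesis
      using Cons.prems eqv_mult_0(2) [OF word_compl, of \<gamma> "cprod \<gamma>s"] by (simp add: mult.assoc)
  next
    case False
    have "t \<gamma> * ((1 - t \<delta>) * cprod \<gamma>s) \<simeq> (1 - t \<delta>) * (t \<gamma> * cprod \<gamma>s)"
      using Cons.prems by (intro D0_left_commute) (auto intro: D0_word)
    also have "\<dots> \<simeq> 0"
      by (rule eqv_mult_0(1)) (use Cons False in auto)
    finally show ?thesis by simp
  qed
qed simp

text \<open>(T4) is imposed for enumerations without repetition, whereas the lists of complements
  built later may repeat a word.\<close>

lemma cprod_remdups: "cprod (remdups \<gamma>s) \<simeq> cprod \<gamma>s" if "set \<gamma>s \<subseteq> N"
  using that
proof (induction \<gamma>s)
  case (Cons \<gamma> \<gamma>s)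
  show ?case
  proof (cases "\<gamma> \<in> set \<gamma>s")
    case True
    have "cprod \<gamma>s - 0 \<simeq> cprod \<gamma>s - t \<gamma> * cprod \<gamma>s"
      using Cons.prems True by (intro eqv_diff) (auto intro: eqv_sym word_cprod)
    then have "cprod \<gamma>s \<simeq> (1 - t \<gamma>) * cprod \<gamma>s"
      by (simp add: left_diff_distrib)
    moreover have "cprod (remdups \<gamma>s) \<simeq> cprod \<gamma>s"
      using Cons by simp
    ultimately show ?thesis
      using True eqv_trans by simp
  next
    case False
    then show ?thesis
      using Cons by (auto intro!: eqv_mult)
  qed
qed simp

text \<open>Multiplying t(\<alpha>) into each complement gives factors t(\<alpha>) - t(\<alpha> @
  \<gamma>), whose ideals K(\<alpha> @ \<gamma>) cover K(\<alpha>), so (T4) applies. With no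
  \<gamma> at all the hypothesis makes K(\<alpha>) empty and (T2) takes over, since (T4) is
  restricted to nonempty lists.\<close>

lemma empty_cell: "t \<alpha> * cprod \<gamma>s \<simeq> 0"
  if \<alpha>: "\<alpha> \<in> N" and \<gamma>s: "set \<gamma>s \<subseteq> N" and cover: "K \<alpha> \<subseteq> (\<Union>\<gamma>\<in>set \<gamma>s. K \<gamma>)"
proof (cases "\<gamma>s = []")
  case True
  then show ?thesis
    using relation_T2 [OF \<alpha>] cover by simp
next
  case False
  define \<delta>s where "\<delta>s = remdups \<gamma>s"
  have \<delta>s: "set \<delta>s \<subseteq> N" "\<delta>s \<noteq> []" "distinct \<delta>s" "K \<alpha> \<subseteq> (\<Union>\<gamma>\<in>set \<delta>s. K \<gamma>)"
    using \<gamma>s False cover by (auto simp: \<delta>s_def)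
  have prod: "prod_list (map (\<lambda>\<beta>. t \<alpha> - t \<beta>) (map (\<lambda>\<gamma>. \<alpha> @ \<gamma>) \<epsilon>s)) \<simeq> t \<alpha> * cprod \<epsilon>s"
    if "set \<epsilon>s \<subseteq> N" "\<epsilon>s \<noteq> []" for \<epsilon>s
    using that(2,1)
  proof (induction \<epsilon>s rule: list_nonempty_induct)
    case (single \<gamma>)
    then show ?case
      using \<alpha> by (simp add: t_append right_diff_distrib)
  next
    case (cons \<gamma> \<epsilon>s)
    let ?u = "1 - t \<gamma>" and ?x = "cprod \<epsilon>s"
    have u: "?u \<in> D0" and x: "?x \<in> D0" and a: "t \<alpha> \<in> D0"
      using cons.prems \<alpha> by (auto intro: D0_word)
    have "t \<alpha> - t (\<alpha> @ \<gamma>) = t \<alpha> * ?u"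
      by (simp add: t_append right_diff_distrib)
    then have "prod_list (map (\<lambda>\<beta>. t \<alpha> - t \<beta>) (map (\<lambda>\<gamma>. \<alpha> @ \<gamma>) (\<gamma> # \<epsilon>s)))
        \<simeq> (t \<alpha> * ?u) * (t \<alpha> * ?x)"
      using cons u a by (auto intro!: eqv_mult)
    also have "(t \<alpha> * ?u) * (t \<alpha> * ?x) = t \<alpha> * (?u * (t \<alpha> * ?x))"
      by (simp add: mult.assoc)
    also have "\<dots> \<simeq> t \<alpha> * (t \<alpha> * (?u * ?x))"
      using a u x by (intro eqv_mult D0_left_commute) auto
    also have "\<dots> = t \<alpha> * t \<alpha> * (?u * ?x)"
      by (simp add: mult.assoc)
    also have "\<dots> \<simeq> t \<alpha> * (?u * ?x)"
      using \<alpha> u x by (intro eqv_mult word_idem) auto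
    finally show ?case by simp
  qed
  have "prod_list (map (\<lambda>\<beta>. t \<alpha> - t \<beta>) (map (\<lambda>\<gamma>. \<alpha> @ \<gamma>) \<delta>s)) \<simeq> 0"
  proof (rule relation_T4 [OF \<alpha>])
    show "set (map ((@) \<alpha>) \<delta>s) \<subseteq> N"
      using \<delta>s \<alpha> by auto
    show "distinct (map ((@) \<alpha>) \<delta>s)"
      using \<delta>s by (simp add: distinct_map inj_on_def)
    have "K (\<alpha> @ \<gamma>) = K \<alpha> \<inter> K \<gamma>" if "\<gamma> \<in> set \<delta>s" for \<gamma>
      using that \<delta>s \<alpha> by (intro K_append_neutral) auto
    then show "K \<alpha> = (\<Union>\<beta>\<in>set (map ((@) \<alpha>) \<delta>s). K \<beta>)"
      using \<delta>s(4) by auto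
  qed (use \<delta>s in simp)
  then have "t \<alpha> * cprod \<delta>s \<simeq> 0"
    using eqv_trans [OF eqv_sym [OF prod]] \<delta>s by blast
  moreover have "t \<alpha> * cprod \<gamma>s \<simeq> t \<alpha> * cprod \<delta>s"
    unfolding \<delta>s_def using \<alpha> \<gamma>s by (intro eqv_mult eqv_sym [OF cprod_remdups]) auto
  ultimately show ?thesis
    using eqv_trans by blast
qed

section \<open>Norms of diagonal elements\<close>

definition lincomb :: "(complex \<times> 'g word) list \<Rightarrow> 'g free_elem"
  where "lincomb L = (\<Sum>(c, \<gamma>)\<leftarrow>L. smult A c (t \<gamma>))"

text \<open>The combination read as a function on P, each word standing for the indicator of its
  ideal. It takes the list as argument because an element of the diagonal has many such
  expressions.\<close>

definition lincomb_at :: "(complex \<times> 'g word) list \<Rightarrow> 'g \<Rightarrow> complex"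
  where "lincomb_at L p = (\<Sum>(c, \<gamma>)\<leftarrow>L. if p \<in> K \<gamma> then c else 0)"

lemma lincomb_simps [simp]:
  "lincomb [] = 0" "lincomb ((c, \<gamma>) # L) = smult A c (t \<gamma>) + lincomb L"
  "lincomb_at [] p = 0" "lincomb_at ((c, \<gamma>) # L) p = (if p \<in> K \<gamma> then c else 0) + lincomb_at L p"
  by (simp_all add: lincomb_def lincomb_at_def)

lemma D0_lincomb: "snd ` set L \<subseteq> N \<Longrightarrow> lincomb L \<in> D0"
  by (induction L) (auto intro!: D0_add D0_smult D0_word)

lemma D0_lincombE:
  assumes "x \<in> D0"
  obtains L where "snd ` set L \<subseteq> N" "x = lincomb L"
proof -
  have "\<exists>L. snd ` set L \<subseteq> N \<and> x = lincomb L"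
    using assms
  proof (induction rule: D0.induct)
    case (D0_word \<alpha>)
    then show ?case
      by (intro exI [of _ "[(1, \<alpha>)]"]) (simp add: smult)
  next
    case (D0_add x y)
    then obtain L M where "snd ` set L \<subseteq> N" "x = lincomb L" "snd ` set M \<subseteq> N" "y = lincomb M"
      by blast
    then show ?case
      by (intro exI [of _ "L @ M"]) (auto simp: lincomb_def)
  next
    case (D0_smult x c)
    then obtain L where L: "snd ` set L \<subseteq> N" "x = lincomb L"
      by blast
    have "smult A c (lincomb L) = lincomb (map (\<lambda>(d, \<gamma>). (c * d, \<gamma>)) L)"
      using L(1)
    proof (induction L)
      case Nil
      then show ?case using smult(1) [of 0 0 c] by simp
    next
      case (Cons l L)
      then show ?case
        by (cases l) (auto simp: smult D0_lincomb)
    qed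
    with L show ?case
      by (intro exI [of _ "map (\<lambda>(d, \<gamma>). (c * d, \<gamma>)) L"]) force
  qed
  with that show ?thesis by blast
qed

text \<open>On the cell \<open>K(\<alpha>) \<setminus> \<Union> K(\<gamma>)\<close> a combination of projections splits along the next
  projection into two orthogonal summands living on smaller cells.\<close>

lemma cell_bound:
  assumes "\<alpha> \<in> N" "set \<gamma>s \<subseteq> N" "snd ` set L \<subseteq> N" "0 \<le> M"
    and "\<And>p. p \<in> K \<alpha> - (\<Union>\<gamma>\<in>set \<gamma>s. K \<gamma>) \<Longrightarrow> cmod (k + lincomb_at L p) \<le> M"
  shows "q (t \<alpha> * cprod \<gamma>s * (smult A k 1 + lincomb L)) \<le> M"
  using assms
proof (induction L arbitrary: \<alpha> \<gamma>s k)
  case Nil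
  let ?f = "t \<alpha> * cprod \<gamma>s"
  have f: "?f \<in> D0" and a: "t \<alpha> \<in> D0" and d: "cprod \<gamma>s \<in> D0"
    using Nil.prems by (auto intro: D0_mult D0_word)
  have qf: "q (?f * (smult A k 1 + lincomb [])) = cmod k * q ?f"
    using f by (simp add: smult q_smult)
  \<comment> \<open>With no words left the element is k times the projection of the cell. A nonempty
    cell has a point, which bounds k; the projection of an empty cell vanishes by
    \<open>empty_cell\<close>.\<close>
  show ?case
  proof (cases "K \<alpha> \<subseteq> (\<Union>\<gamma>\<in>set \<gamma>s. K \<gamma>)")
    case True
    then show ?thesis
      using empty_cell [of \<alpha> \<gamma>s] Nil.prems qf by (simp add: eqv_0)
  next
    case False
    then have k: "cmod k \<le> M"
      using Nil.prems(5) by fastforce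
    have "star A ?f = star A (cprod \<gamma>s) * star A (t \<alpha>)"
      using a d by (simp add: star)
    also have "\<dots> \<simeq> cprod \<gamma>s * t \<alpha>"
      using Nil.prems by (intro eqv_mult cprod_self_adjoint word_self_adjoint)
    finally have "star A ?f * ?f \<simeq> (cprod \<gamma>s * t \<alpha>) * ?f"
      using a d by (intro eqv_mult) auto
    also have "(cprod \<gamma>s * t \<alpha>) * ?f = cprod \<gamma>s * (t \<alpha> * t \<alpha> * cprod \<gamma>s)"
      by (simp add: mult.assoc)
    also have "\<dots> \<simeq> cprod \<gamma>s * (t \<alpha> * cprod \<gamma>s)"
      using Nil.prems d by (intro eqv_mult word_idem) auto
    also have "\<dots> \<simeq> t \<alpha> * (cprod \<gamma>s * cprod \<gamma>s)"
      using a d by (intro D0_left_commute) auto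
    also have "\<dots> \<simeq> ?f"
      using Nil.prems a by (intro eqv_mult cprod_idem) auto
    finally have "q ?f \<le> 1"
      using projection_q by fastforce
    then have "cmod k * q ?f \<le> M * 1"
      using k Nil.prems(4) f by (intro mult_mono q_nonneg) auto
    then show ?thesis
      using qf by simp
  qed
next
  case (Cons l L)
  obtain c \<gamma> where l: "l = (c, \<gamma>)"
    by (cases l)
  have \<gamma>: "\<gamma> \<in> N" and L: "snd ` set L \<subseteq> N"
    using Cons.prems l by auto
  let ?D = "cprod \<gamma>s" and ?l = "lincomb L"
  \<comment> \<open>x lives on the part of the cell inside K(\<gamma>), where \<gamma> adds its
    coefficient to the constant, and y on the part outside. The constant k thus collects the words
    already processed and ends as the value of the combination on the final cell.\<close>
  define x where "x = t (\<alpha> @ \<gamma>) * ?D * (smult A (k + c) 1 + ?l)"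
  define y where "y = t \<alpha> * cprod (\<gamma> # \<gamma>s) * (smult A k 1 + ?l)"
  have D0: "t \<alpha> \<in> D0" "t \<gamma> \<in> D0" "1 - t \<gamma> \<in> D0" "?D \<in> D0" "?l \<in> D0"
      "smult A (k + c) 1 + ?l \<in> D0" "smult A k 1 + ?l \<in> D0"
    using Cons.prems \<gamma> L by (auto intro: D0.intros D0_lincomb)
  define a where "a = t \<alpha> * (?D * (smult A (k + c) 1 + ?l))"
  define b where "b = t \<alpha> * (?D * (smult A k 1 + ?l))"
  have ab: "a \<in> D0" "b \<in> D0"
    using D0 by (auto simp: a_def b_def intro!: D0_mult)
  have xa: "x \<simeq> t \<gamma> * a"
  proof -
    have "x = t \<alpha> * (t \<gamma> * (?D * (smult A (k + c) 1 + ?l)))"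
      by (simp add: x_def t_append mult.assoc)
    also have "\<dots> \<simeq> t \<gamma> * a"
      unfolding a_def using D0 by (intro D0_left_commute) (auto intro: D0_mult)
    finally show ?thesis .
  qed
  have yb: "y \<simeq> (1 - t \<gamma>) * b"
  proof -
    have "y = t \<alpha> * ((1 - t \<gamma>) * (?D * (smult A k 1 + ?l)))"
      by (simp add: y_def mult.assoc)
    also have "\<dots> \<simeq> (1 - t \<gamma>) * b"
      unfolding b_def using D0 by (intro D0_left_commute) (auto intro: D0_mult)
    finally show ?thesis .
  qed
  have star\<gamma>: "star A (t \<gamma>) \<simeq> t \<gamma>" "star A (1 - t \<gamma>) \<simeq> 1 - t \<gamma>"
    using word_self_adjoint [OF \<gamma>] D0 by (auto simp: star_diff intro!: eqv_diff)
  have "star A x * y \<simeq> 0"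
  proof -
    have "star A x * y \<simeq> star A (t \<gamma> * a) * ((1 - t \<gamma>) * b)"
      by (intro eqv_mult eqv_star xa yb)
    also have "\<dots> = star A a * (star A (t \<gamma>) * (1 - t \<gamma>)) * b"
      using ab D0 by (simp add: star mult.assoc)
    also have "\<dots> \<simeq> star A a * (t \<gamma> * (1 - t \<gamma>)) * b"
      using ab D0 star\<gamma> by (intro eqv_mult) auto
    also have "\<dots> \<simeq> 0"
      by (rule eqv_mult_0(2), rule eqv_mult_0(1)) (use ab word_compl [OF \<gamma>] in auto)
    finally show ?thesis .
  qed
  moreover have "x * star A y \<simeq> 0"
  proof -
    have "x * star A y \<simeq> (a * t \<gamma>) * star A ((1 - t \<gamma>) * b)"
      by (rule eqv_mult [OF eqv_trans [OF xa D0_commute [OF D0(2) ab(1)]] eqv_star [OF yb]])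
    also have "\<dots> = a * t \<gamma> * (star A b * star A (1 - t \<gamma>))"
      using ab D0 by (simp add: star)
    also have "\<dots> \<simeq> a * t \<gamma> * (star A (1 - t \<gamma>) * star A b)"
      using ab D0 by (intro eqv_mult D0_commute D0_star) auto
    also have "\<dots> \<simeq> a * t \<gamma> * ((1 - t \<gamma>) * star A b)"
      using ab D0 star\<gamma> by (intro eqv_mult) auto
    also have "\<dots> = a * (t \<gamma> * (1 - t \<gamma>)) * star A b"
      by (simp add: mult.assoc)
    also have "\<dots> \<simeq> 0"
      by (rule eqv_mult_0(2), rule eqv_mult_0(1)) (use ab word_compl [OF \<gamma>] in auto)
    finally show ?thesis .
  qed
  moreover have "q x \<le> M"
    unfolding x_def
  proof (rule Cons.IH)
    fix p assume p: "p \<in> K (\<alpha> @ \<gamma>) - \<Union> (K ` set \<gamma>s)"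
    then have "p \<in> K \<alpha>" "p \<in> K \<gamma>"
      using Cons.prems(1) \<gamma> by (auto simp: K_append_neutral)
    then show "cmod (k + c + lincomb_at L p) \<le> M"
      using Cons.prems(5) [of p] p by (simp add: l add.assoc)
  qed (use Cons.prems \<gamma> L in auto)
  moreover have "q y \<le> M"
    unfolding y_def
  proof (rule Cons.IH)
    fix p assume p: "p \<in> K \<alpha> - \<Union> (K ` set (\<gamma> # \<gamma>s))"
    then show "cmod (k + lincomb_at L p) \<le> M"
      using Cons.prems(5) [of p] by (simp add: l)
  qed (use Cons.prems \<gamma> L in auto)
  moreover have "t \<alpha> * ?D * (smult A k 1 + lincomb (l # L)) \<simeq> x + y"
  proof -
    have kc: "smult A (k + c) 1 = smult A k 1 + smult A c 1"
      by (simp add: smult)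
    have "t \<gamma> = smult A 1 (t \<gamma>)" "smult A c (t \<gamma>) = t \<gamma> * smult A c 1"
      using D0 by (simp_all add: smult)
    then have l': "smult A k 1 + lincomb (l # L) = smult A k 1 + ?l + t \<gamma> * smult A c 1"
      by (simp add: l)
    have "t \<alpha> * ?D * (smult A k 1 + lincomb (l # L))
        = t \<alpha> * (?D * (smult A k 1 + ?l)) + t \<alpha> * (?D * (t \<gamma> * smult A c 1))"
      unfolding l' by (simp add: algebra_simps)
    also have "\<dots> \<simeq> t \<alpha> * (?D * (smult A k 1 + ?l)) + t \<alpha> * (t \<gamma> * (?D * smult A c 1))"
      using D0 by (intro eqv_add eqv_mult D0_left_commute) auto
    also have "\<dots> = x + y"
      unfolding x_def y_def kc cprod_simps t_append by (simp add: algebra_simps)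
    finally show ?thesis .
  qed
  ultimately show ?case
    using q_orthogonal_sum [of x y] eqv_carrier(1) [OF xa] eqv_carrier(1) [OF yb] eqv_q
    by (fastforce simp: eqv_0)
qed

text \<open>P itself is the first cell: the empty word, no complements, constant 0. For the
  representations on cosets \<open>lincomb_at_bound\<close> gives the reverse estimate.\<close>

lemma D0_bound: "q (lincomb L) \<le> M"
  if "snd ` set L \<subseteq> N" "0 \<le> M" "\<And>p. p \<in> P \<Longrightarrow> cmod (lincomb_at L p) \<le> M"
  using cell_bound [of "[]" "[]" L M 0] that by (simp add: smult_0)

text \<open>The neutral word (p, p) has the ideal P, so (T3) makes each generator an isometry modulo
  q. The bound is the same for all q, which is what keeps the universal seminorm finite.\<close>

lemma q_free_gen: "q (free_gen p) \<le> 1" if "p \<in> P"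
proof -
  have "K [(p, p)] = K []"
    using that K_in_P by (auto simp: K_single)
  then have "t [(p, p)] \<simeq> t []"
    using that by (intro word_eqv) (simp_all add: val_single)
  then have "(q (free_gen p))\<^sup>2 \<le> 1\<^sup>2"
    using eqv_q [of "t [(p, p)]" 1] q_star_mult [of "free_gen p"] that q_one by simp
  then show ?thesis
    by (rule power2_le_imp_le) simp
qed

section \<open>Compression to a single point\<close>

abbreviation shift :: "'g \<Rightarrow> 'g free_elem"  where "shift s \<equiv> t [(\<one>, s)]"
abbreviation unshift :: "'g \<Rightarrow> 'g free_elem"  where "unshift s \<equiv> t [(s, \<one>)]"

text \<open>Conjugation by the isometry of s moves questions about the point s to the identity:
  whether \<alpha> is defined at s and returns into sP becomes membership of e in K of the
  conjugated word.\<close>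

lemma K_compress:
  assumes "\<alpha> \<in> words P" "s \<in> P"
  shows "x \<in> K ([(s, \<one>)] @ \<alpha> @ [(\<one>, s)]) \<longleftrightarrow>
      x \<in> P \<and> s \<otimes> x \<in> K \<alpha> \<and> inv s \<otimes> (val \<alpha> \<otimes> (s \<otimes> x)) \<in> P"
    and "val ([(s, \<one>)] @ \<alpha> @ [(\<one>, s)]) = inv s \<otimes> (val \<alpha> \<otimes> s)"
proof -
  have s1: "[(s, \<one>)] \<in> words P" "[(\<one>, s)] \<in> words P"
    using assms by auto
  show "val ([(s, \<one>)] @ \<alpha> @ [(\<one>, s)]) = inv s \<otimes> (val \<alpha> \<otimes> s)"
    using assms s1 by (simp only: val_append words_simps val_single P.one_closed) simp
  have "x \<in> K ((([(s, \<one>)] @ \<alpha>)) @ [(\<one>, s)]) \<longleftrightarrow> x \<in> K [(\<one>, s)] \<and> s \<otimes> x \<in> K ([(s, \<one>)] @ \<alpha>)"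
    using assms s1 by (subst K_append) (auto simp: val_single)
  also have "\<dots> \<longleftrightarrow> x \<in> P \<and> s \<otimes> x \<in> K \<alpha> \<and> inv s \<otimes> (val \<alpha> \<otimes> (s \<otimes> x)) \<in> P"
    using assms s1 K_val_in_P [of "s \<otimes> x" \<alpha>] K_in_P [of "s \<otimes> x"]
    by (subst K_append) (auto simp: K_single)
  finally show "x \<in> K ([(s, \<one>)] @ \<alpha> @ [(\<one>, s)]) \<longleftrightarrow>
      x \<in> P \<and> s \<otimes> x \<in> K \<alpha> \<and> inv s \<otimes> (val \<alpha> \<otimes> (s \<otimes> x)) \<in> P"
    by simp
qed

lemma compress_word: "unshift s * t \<alpha> * shift s = t ([(s, \<one>)] @ \<alpha> @ [(\<one>, s)])"
  unfolding t_append by (simp add: mult.assoc)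

lemma compress_good:
  assumes "\<alpha> \<in> N" "s \<in> K \<alpha>"
  shows "unshift s * t \<alpha> * shift s \<simeq> 1"
proof -
  have s: "s \<in> P"
    using assms K_in_P by blast
  have "K ([(s, \<one>)] @ \<alpha> @ [(\<one>, s)]) = P"
  proof -
    have "x \<in> K ([(s, \<one>)] @ \<alpha> @ [(\<one>, s)]) \<longleftrightarrow> x \<in> P" for x
      unfolding K_compress(1) [OF neutral_word(1) [OF assms(1)] s]
      using assms s K_right_ideal [of \<alpha> s x] by (cases "x \<in> P") simp_all
    then show ?thesis
      by blast
  qed
  then have "t ([(s, \<one>)] @ \<alpha> @ [(\<one>, s)]) \<simeq> t []"
    using assms s K_compress(2) [of \<alpha> s] by (intro word_eqv) simp_all
  then show ?thesis
    unfolding compress_word by (simp only: t_simps(1))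
qed

text \<open>Let \<beta> be the conjugated word. If e is outside K(\<beta>), the support projection
  of \<beta> is removed by a complement from the right. If e is inside, the value of \<alpha> is not
  trivial, and \<alpha> not being bad means that the inverse of the value of \<beta> is not in P. So
  e is outside K of the reversed word, and the range projection is removed from the left.\<close>

lemma compress_vanish:
  assumes \<alpha>: "\<alpha> \<in> words P" and s: "s \<in> P"
    and no: "val \<alpha> = \<one> \<Longrightarrow> s \<notin> K \<alpha>" "val \<alpha> \<noteq> \<one> \<Longrightarrow> \<not> bad \<alpha> s"
  obtains \<gamma> where "\<gamma> \<in> N" "\<one> \<notin> K \<gamma>"
    and "\<And>\<gamma>s. set \<gamma>s \<subseteq> N \<Longrightarrow> \<gamma> \<in> set \<gamma>s \<Longrightarrow>
      cprod \<gamma>s * (unshift s * t \<alpha> * shift s) * cprod \<gamma>s \<simeq> 0"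
proof -
  define \<beta> where "\<beta> = [(s, \<one>)] @ \<alpha> @ [(\<one>, s)]"
  have \<beta>: "\<beta> \<in> words P"
    using \<alpha> s by (simp add: \<beta>_def)
  have t\<beta>: "unshift s * t \<alpha> * shift s = t \<beta>"
    by (simp only: compress_word \<beta>_def)
  show ?thesis
  proof (cases "\<one> \<in> K \<beta>")
    case False
    let ?\<gamma> = "word_tilde \<beta> @ \<beta>"
    have N: "?\<gamma> \<in> N"
      using \<beta> by (rule neutralize_neutral)
    have K: "K ?\<gamma> = K \<beta>"
      using \<beta> by (rule K_neutralize)
    have "K (\<beta> @ ?\<gamma>) = K \<beta>"
      using \<beta> N K by (simp add: K_append_neutral)
    then have eq: "t \<beta> \<simeq> t \<beta> * t ?\<gamma>"
      unfolding t_append [symmetric] using \<beta> N by (intro word_eqv) (simp_all add: val_append)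
    show ?thesis
    proof (rule that [of ?\<gamma>])
      fix \<gamma>s assume \<gamma>s: "set \<gamma>s \<subseteq> N" "?\<gamma> \<in> set \<gamma>s"
      have "cprod \<gamma>s * t \<beta> * cprod \<gamma>s \<simeq> cprod \<gamma>s * (t \<beta> * t ?\<gamma>) * cprod \<gamma>s"
        using \<gamma>s eq by (intro eqv_mult) auto
      also have "\<dots> = cprod \<gamma>s * t \<beta> * (t ?\<gamma> * cprod \<gamma>s)"
        by (simp add: mult.assoc)
      also have "\<dots> \<simeq> 0"
        by (rule eqv_mult_0(1)) (use \<gamma>s \<beta> word_cprod [OF \<gamma>s] in auto)
      finally show "cprod \<gamma>s * (unshift s * t \<alpha> * shift s) * cprod \<gamma>s \<simeq> 0"
        by (simp only: t\<beta>)
    qed (use N K False in auto)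
  next
    case True
    let ?\<gamma> = "\<beta> @ word_tilde \<beta>"
    have one: "s \<in> K \<alpha>" "inv s \<otimes> (val \<alpha> \<otimes> s) \<in> P"
      using True K_compress(1) [OF \<alpha> s, of \<one>] s by (simp_all add: \<beta>_def)
    then have "val \<alpha> \<noteq> \<one>"
      using no by blast
    then have notP: "inv (inv s \<otimes> (val \<alpha> \<otimes> s)) \<notin> P"
      using no(2) one by (auto simp: bad_def unit_iff)
    have False': "\<one> \<notin> K (word_tilde \<beta>)"
    proof
      assume "\<one> \<in> K (word_tilde \<beta>)"
      then have "val (word_tilde \<beta>) \<otimes> \<one> \<in> P"
        using \<beta> by (intro K_val_in_P) simp_all
      then have "inv (val \<beta>) \<in> P"
        using \<beta> by simp
      then show False
        using notP unfolding \<beta>_def K_compress(2) [OF \<alpha> s] by blast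
    qed
    have N: "?\<gamma> \<in> N"
      using neutralize_neutral [of "word_tilde \<beta>"] \<beta> by simp
    have K: "K ?\<gamma> = K (word_tilde \<beta>)"
      using K_neutralize [of "word_tilde \<beta>"] \<beta> by simp
    have "x \<in> K (?\<gamma> @ \<beta>) \<longleftrightarrow> x \<in> K \<beta>" for x
    proof -
      have "x \<in> K (?\<gamma> @ \<beta>) \<longleftrightarrow> x \<in> K \<beta> \<and> val \<beta> \<otimes> x \<in> K (word_tilde \<beta>)"
        unfolding K [symmetric] by (rule K_append [OF neutral_word(1) [OF N] \<beta>])
      then show ?thesis
        using K_tilde [OF \<beta>, of x] K_in_P [of x \<beta>] P_carrier by blast
    qed
    then have "K (?\<gamma> @ \<beta>) = K \<beta>"
      by blast
    moreover have "val (?\<gamma> @ \<beta>) = val \<beta>"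
      unfolding val_append [OF neutral_word(1) [OF N] \<beta>] using N \<beta> by simp
    ultimately have eq: "t \<beta> \<simeq> t ?\<gamma> * t \<beta>"
      unfolding t_append [symmetric, of ?\<gamma>] using \<beta> by (intro word_eqv) simp_all
    show ?thesis
    proof (rule that [of ?\<gamma>])
      fix \<gamma>s assume \<gamma>s: "set \<gamma>s \<subseteq> N" "?\<gamma> \<in> set \<gamma>s"
      have 0: "cprod \<gamma>s * t ?\<gamma> \<simeq> 0"
        using eqv_trans [OF D0_commute word_cprod [OF \<gamma>s]] \<gamma>s N by (blast intro: D0_word)
      have "cprod \<gamma>s * t \<beta> * cprod \<gamma>s \<simeq> cprod \<gamma>s * (t ?\<gamma> * t \<beta>) * cprod \<gamma>s"
        using \<gamma>s eq by (intro eqv_mult) auto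
      also have "\<dots> = cprod \<gamma>s * t ?\<gamma> * (t \<beta> * cprod \<gamma>s)"
        by (simp add: mult.assoc)
      also have "\<dots> \<simeq> 0"
        by (rule eqv_mult_0(2) [OF 0]) (use \<gamma>s \<beta> in auto)
      finally show "cprod \<gamma>s * (unshift s * t \<alpha> * shift s) * cprod \<gamma>s \<simeq> 0"
        by (simp only: t\<beta>)
    qed (use N K False' in auto)
  qed
qed

lemma D0_shift: "x \<in> D0 \<Longrightarrow> shift s * x * unshift s \<in> D0" if "s \<in> P"
proof (induction x rule: D0.induct)
  case (D0_word \<alpha>)
  have "shift s * t \<alpha> * unshift s = t ([(\<one>, s)] @ \<alpha> @ [(s, \<one>)])"
    unfolding t_append by (simp add: mult.assoc)
  moreover have "[(\<one>, s)] @ \<alpha> @ [(s, \<one>)] \<in> N"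
  proof (rule neutralI)
    have w: "[(\<one>, s)] \<in> words P" "[(s, \<one>)] \<in> words P"
      using that by auto
    show "val ([(\<one>, s)] @ \<alpha> @ [(s, \<one>)]) = \<one>"
      using D0_word that w by (simp only: val_append words_simps val_single P.one_closed neutral_word) simp
  qed (use D0_word that in simp)
  ultimately show ?case
    using D0.D0_word by metis
next
  case (D0_add x y)
  then show ?case by (simp only: distrib_left distrib_right D0.D0_add)
next
  case (D0_smult x c)
  have w: "shift s \<in> carrier A" "unshift s \<in> carrier A"
    using that by (auto simp del: t_simps)
  have "shift s * smult A c x * unshift s = smult A c (shift s * x * unshift s)"
    using D0_smult w by (simp add: smult del: t_simps)
  then show ?case using D0_smult by (simp add: D0.D0_smult del: t_simps)
qed

text \<open>After conjugation by s, each monomial that should vanish is killed by a complement of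
  its own, and the neutral ones with s in their ideal become 1. The product of all complements does
  this at once; carried back by s it is f. The constant c is the diagonal matrix coefficient of b at
  s, by \<open>lam_delta_at\<close>.\<close>

lemma compression:
  assumes b: "b \<in> carrier A" and s: "s \<in> P"
    and not_bad: "\<And>w. w \<in> Poly_Mapping.keys b \<Longrightarrow> val (monomial_word G w) \<noteq> \<one> \<Longrightarrow>
      \<not> bad (monomial_word G w) s"
  defines "c \<equiv> \<Sum>w\<in>Poly_Mapping.keys b.
      if val (monomial_word G w) = \<one> \<and> s \<in> K (monomial_word G w) then Poly_Mapping.lookup b w else 0"
  obtains \<gamma>s f where "set \<gamma>s \<subseteq> N" "\<And>\<gamma>. \<gamma> \<in> set \<gamma>s \<Longrightarrow> \<one> \<notin> K \<gamma>"
    and "f = shift s * cprod \<gamma>s * unshift s" "f \<in> D0" "f * f \<simeq> f" "star A f \<simeq> f" "f * b * f \<simeq> smult A c f"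
proof -
  let ?W = "Poly_Mapping.keys b" and ?mw = "monomial_word G"
  let ?good = "\<lambda>w. val (?mw w) = \<one> \<and> s \<in> K (?mw w)"
  have W: "set (letters w) \<subseteq> alphabet P" if "w \<in> ?W" for w
    using b that by (auto simp: free_carrier_iff)
  have mw: "?mw w \<in> words P" if "w \<in> ?W" for w
    using monomial_word_words [OF W [OF that]] .
  have "\<exists>\<gamma>\<in>N. \<one> \<notin> K \<gamma> \<and> (\<forall>\<gamma>s. set \<gamma>s \<subseteq> N \<longrightarrow> \<gamma> \<in> set \<gamma>s \<longrightarrow>
      cprod \<gamma>s * (unshift s * t (?mw w) * shift s) * cprod \<gamma>s \<simeq> 0)" if "w \<in> ?W" "\<not> ?good w" for w
  proof (rule compress_vanish [OF mw [OF that(1)] s])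
    show "val (?mw w) = \<one> \<Longrightarrow> s \<notin> K (?mw w)"
      using that by blast
    show "val (?mw w) \<noteq> \<one> \<Longrightarrow> \<not> bad (?mw w) s"
      using not_bad that by blast
  qed blast
  then obtain \<gamma> where \<gamma>: "\<And>w. w \<in> ?W \<Longrightarrow> \<not> ?good w \<Longrightarrow> \<gamma> w \<in> N \<and> \<one> \<notin> K (\<gamma> w) \<and>
      (\<forall>\<gamma>s. set \<gamma>s \<subseteq> N \<longrightarrow> \<gamma> w \<in> set \<gamma>s \<longrightarrow>
        cprod \<gamma>s * (unshift s * t (?mw w) * shift s) * cprod \<gamma>s \<simeq> 0)"
    by metis
  obtain \<gamma>s where \<gamma>s: "set \<gamma>s = \<gamma> ` {w \<in> ?W. \<not> ?good w}"
    using finite_list [of "\<gamma> ` {w \<in> ?W. \<not> ?good w}"] by auto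
  have one: "\<one> \<notin> K \<delta>" if "\<delta> \<in> set \<gamma>s" for \<delta>
    using that \<gamma> unfolding \<gamma>s by (elim imageE) simp
  have N: "set \<gamma>s \<subseteq> N"
    using \<gamma> unfolding \<gamma>s by (intro image_subsetI) simp
  let ?D = "cprod \<gamma>s"
  define V V' where "V = shift s" and "V' = unshift s"
  note V_defs = this
  define f where "f = V * ?D * V'"
  have D: "?D \<in> D0"
    using N by blast
  have V: "V \<in> carrier A" "V' \<in> carrier A" and Dc: "?D \<in> carrier A"
    using s D by (auto simp: V_defs)
  have V'V: "V' * V \<simeq> 1"
    using compress_good [of "[]" s] s by (simp add: V_defs)
  have f0: "f \<in> D0"
    unfolding f_def V_defs using s D by (rule D0_shift)
  have "f * f = V * (?D * (V' * V) * ?D) * V'"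
    by (simp add: f_def mult.assoc)
  also have "\<dots> \<simeq> V * (?D * 1 * ?D) * V'"
    using V Dc V'V by (intro eqv_mult) auto
  also have "\<dots> \<simeq> V * ?D * V'"
    using V cprod_idem [OF N] by (intro eqv_mult) auto
  finally have ff: "f * f \<simeq> f"
    by (simp only: f_def)
  have "star A V = V'" "star A V' = V"
  proof -
    have w: "[(\<one>, s)] \<in> words P" "[(s, \<one>)] \<in> words P"
      using s by auto
    show "star A V = V'" "star A V' = V"
      unfolding V_defs t_star [OF w(1)] t_star [OF w(2)] by simp_all
  qed
  then have "star A f = V * (star A ?D) * V'"
    using V Dc by (simp add: f_def star mult.assoc)
  also have "\<dots> \<simeq> V * ?D * V'"
    using V cprod_self_adjoint [OF N] by (intro eqv_mult) auto
  finally have fstar: "star A f \<simeq> f"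
    by (simp only: f_def)
  have summand: "?D * (V' * Poly_Mapping.single w (Poly_Mapping.lookup b w) * V) * ?D
      \<simeq> smult A (if ?good w then Poly_Mapping.lookup b w else 0) ?D" if w: "w \<in> ?W" for w
  proof -
    let ?m = "Poly_Mapping.single w (1::complex)" and ?c = "Poly_Mapping.lookup b w"
    have m: "?m \<in> carrier A"
      using W [OF w] by (rule free_algebra_closed)
    have "Poly_Mapping.single w ?c = smult A ?c ?m"
      by (simp add: free_algebra_ops Poly_Mapping.mult_single)
    then have "?D * (V' * Poly_Mapping.single w ?c * V) * ?D = smult A ?c (?D * (V' * ?m * V) * ?D)"
      using V Dc m by (simp add: smult)
    also have "\<dots> \<simeq> smult A ?c (?D * (V' * t (?mw w) * V) * ?D)"
      using V Dc monomial_eqv_word [OF W [OF w]] by (intro eqv_smult eqv_mult) auto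
    also have "\<dots> \<simeq> smult A (if ?good w then ?c else 0) ?D"
    proof (cases "?good w")
      case True
      then have "?mw w \<in> N"
        using mw [OF w] by (intro neutralI) auto
      then have "V' * t (?mw w) * V \<simeq> 1"
        unfolding V_defs using True by (intro compress_good) auto
      then have "?D * (V' * t (?mw w) * V) * ?D \<simeq> ?D * 1 * ?D"
        using Dc by (intro eqv_mult) auto
      also have "\<dots> \<simeq> ?D"
        using cprod_idem [OF N] by simp
      finally show ?thesis
        using True by (auto intro: eqv_smult)
    next
      case False
      then have "?D * (V' * t (?mw w) * V) * ?D \<simeq> 0"
        using \<gamma> [OF w False] \<gamma>s N w False unfolding V_defs by blast
      then have "smult A ?c (?D * (V' * t (?mw w) * V) * ?D) \<simeq> smult A ?c 0"
        by (rule eqv_smult)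
      moreover have "smult A ?c 0 = 0" "smult A 0 ?D = 0"
        using smult(1) [of 0 0 ?c] Dc by (auto simp: smult_0)
      ultimately show ?thesis
        using False by auto
    qed
    finally show ?thesis .
  qed
  have "?D * (V' * b * V) * ?D = (\<Sum>w\<in>?W. ?D * (V' * Poly_Mapping.single w (Poly_Mapping.lookup b w) * V) * ?D)"
    by (subst free_elem_sum_singles [of b]) (simp only: sum_distrib_left sum_distrib_right)
  also have "\<dots> \<simeq> (\<Sum>w\<in>?W. smult A (if ?good w then Poly_Mapping.lookup b w else 0) ?D)"
    by (intro eqv_sum summand)
  also have "\<dots> = smult A c ?D"
  proof -
    have "(\<Sum>w\<in>I. smult A (h w) ?D) = smult A (\<Sum>w\<in>I. h w) ?D" for h and I :: "'g monomial set"
      by (induction I rule: infinite_finite_induct) (use Dc in \<open>auto simp: smult_0 smult\<close>)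
    then show ?thesis
      by (simp add: c_def)
  qed
  finally have core: "?D * (V' * b * V) * ?D \<simeq> smult A c ?D" .
  have "f * b * f = V * (?D * (V' * b * V) * ?D) * V'"
    by (simp add: f_def mult.assoc)
  also have "\<dots> \<simeq> V * smult A c ?D * V'"
    using V core by (intro eqv_mult) auto
  also have "\<dots> = smult A c f"
    using V Dc by (simp add: f_def smult)
  finally have "f * b * f \<simeq> smult A c f" .
  with N show ?thesis
    by (intro that [OF _ _ f_def [unfolded V_defs] f0 ff fstar] one)
qed

end

section \<open>Finiteness of the universal seminorm\<close>

context group_submonoid
begin

lemma toeplitz_seminormI:
  "q \<in> cstar_seminorms (free_star_algebra P) (toeplitz_relations G P) \<Longrightarrow> toeplitz_seminorm G P q"
  by unfold_locales

lemma toeplitz_relations_carrier: "toeplitz_relations G P \<subseteq> carrier (free_star_algebra P)"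
proof -
  \<comment> \<open>The zero seminorm satisfies every set of relations. It gives access to the
    closure properties of words before the universal seminorm is known to be one of these
    seminorms.\<close>
  interpret toeplitz_seminorm G P "\<lambda>_. 0"
    by (intro toeplitz_seminormI star_alg.zero_seminorm star_alg_free)
  have "prod_list (map (\<lambda>\<beta>. t \<alpha> - t \<beta>) \<beta>s) \<in> carrier A" if "\<alpha> \<in> N" "set \<beta>s \<subseteq> N" for \<alpha> \<beta>s
    using that(2) by (induction \<beta>s) (use that(1) in auto)
  then show ?thesis
    unfolding toeplitz_relations_def Let_def by auto
qed

abbreviation "U \<equiv> universal_seminorm (free_star_algebra P) (toeplitz_relations G P)"

lemma seminorm_bounded: "x \<in> carrier A \<Longrightarrow>
    \<exists>B. \<forall>q\<in>cstar_seminorms A (toeplitz_relations G P). q x \<le> B"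
proof (induction rule: free_algebra_induct)
  case one
  have "q 1 \<le> 1" if "q \<in> cstar_seminorms A (toeplitz_relations G P)" for q
  proof -
    interpret toeplitz_seminorm G P q by (rule toeplitz_seminormI [OF that])
    show ?thesis by (rule q_one)
  qed
  then show ?case by blast
next
  case (gen p)
  then show ?case
    using toeplitz_seminorm.q_free_gen [OF toeplitz_seminormI] by blast
next
  case (star a)
  then obtain B where B: "\<forall>q\<in>cstar_seminorms A (toeplitz_relations G P). q a \<le> B"
    by blast
  have "q (star A a) \<le> B" if "q \<in> cstar_seminorms A (toeplitz_relations G P)" for q
  proof -
    interpret toeplitz_seminorm G P q by (rule toeplitz_seminormI [OF that])
    show ?thesis
      using B that by (simp add: q_star star.hyps)
  qed
  then show ?case by blast
next
  case (mult a b)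
  then obtain B C where BC: "\<forall>q\<in>cstar_seminorms A (toeplitz_relations G P). q a \<le> B"
    "\<forall>q\<in>cstar_seminorms A (toeplitz_relations G P). q b \<le> C"
    by blast
  have "q (a * b) \<le> \<bar>B\<bar> * \<bar>C\<bar>" if q: "q \<in> cstar_seminorms A (toeplitz_relations G P)" for q
  proof -
    interpret toeplitz_seminorm G P q by (rule toeplitz_seminormI [OF q])
    have "q a \<le> \<bar>B\<bar>" "q b \<le> \<bar>C\<bar>"
      using BC q by fastforce+
    then have "q a * q b \<le> \<bar>B\<bar> * \<bar>C\<bar>"
      using mult.hyps by (intro mult_mono q_nonneg) auto
    then show ?thesis
      using q_mult [OF mult.hyps] by simp
  qed
  then show ?case by blast
next
  case (smult c a)
  then obtain B where "\<forall>q\<in>cstar_seminorms A (toeplitz_relations G P). q a \<le> B"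
    by blast
  then have "q (smult A c a) \<le> cmod c * B" if "q \<in> cstar_seminorms A (toeplitz_relations G P)" for q
    using that smult.hyps by (simp add: cstar_seminorms_def mult_left_mono)
  then show ?case by blast
next
  case (add a b)
  then obtain B C where "\<forall>q\<in>cstar_seminorms A (toeplitz_relations G P). q a \<le> B"
    "\<forall>q\<in>cstar_seminorms A (toeplitz_relations G P). q b \<le> C"
    by blast
  moreover have "q (a + b) \<le> q a + q b" if "q \<in> cstar_seminorms A (toeplitz_relations G P)" for q
    using that add by (simp add: cstar_seminorms_def free_algebra_ops)
  ultimately show ?case
    by (intro exI [of _ "B + C"]) (meson add_mono order_trans)
qed

lemma U_upper: "q \<in> cstar_seminorms (free_star_algebra P) (toeplitz_relations G P) \<Longrightarrow>
    x \<in> carrier (free_star_algebra P) \<Longrightarrow> q x \<le> U x"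
  by (rule star_alg.universal_seminorm_upper [OF star_alg_free seminorm_bounded
      toeplitz_relations_carrier])

lemma toeplitz_universal: "toeplitz_seminorm G P U"
  by (intro toeplitz_seminormI star_alg.universal_seminorm_cstar [OF star_alg_free seminorm_bounded
      toeplitz_relations_carrier])

end

section \<open>Representations on coset representatives\<close>

text \<open>
  \<open>\<nu>\<close> picks a representative of every coset \<open>pH\<close>; the monoid acts on the set of representatives
  by \<open>x \<mapsto> \<nu>(px)\<close>. The case of trivial \<open>H\<close> is the left regular representation, the case
  \<open>H = P\<^sup>*\<close> the representation on \<open>\<ell>\<^sup>2(P/P\<^sup>*)\<close>.
\<close>

locale toeplitz_rep = group_submonoid G P
  for G :: "('g, 'm) monoid_scheme" (structure) and P :: "'g set" +
  fixes H :: "'g set" and \<nu> :: "'g \<Rightarrow> 'g"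
  assumes H: "subgroup H G" "H \<subseteq> U\<^sub>P"
    and nu_coset: "p \<in> P \<Longrightarrow> \<exists>h\<in>H. \<nu> p = p \<otimes> h"
    and nu_absorb: "p \<in> P \<Longrightarrow> h \<in> H \<Longrightarrow> \<nu> (p \<otimes> h) = \<nu> p"
begin

definition "X = \<nu> ` P"

lemma H_P: "h \<in> H \<Longrightarrow> h \<in> P" "h \<in> H \<Longrightarrow> inv h \<in> P"
  using H(2) unit_iff by auto

lemma nu_P [simp]: "p \<in> P \<Longrightarrow> \<nu> p \<in> P"
  using nu_coset [of p] H_P by auto

lemma nu_X [simp]: "p \<in> P \<Longrightarrow> \<nu> p \<in> X"
  by (simp add: X_def)

lemma X_P [simp]: "x \<in> X \<Longrightarrow> x \<in> P"
  by (auto simp: X_def)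

lemma nu_id [simp]: "x \<in> X \<Longrightarrow> \<nu> x = x"
  using nu_coset nu_absorb by (auto simp: X_def) metis

lemma nu_mult_P: "g \<otimes> \<nu> z \<in> P \<longleftrightarrow> g \<otimes> z \<in> P" if "g \<in> carrier G" "z \<in> P"
proof -
  obtain h where h: "h \<in> H" "\<nu> z = z \<otimes> h"
    using nu_coset \<open>z \<in> P\<close> by blast
  have hP: "h \<in> P" "inv h \<in> P"
    using h H_P by auto
  have "g \<otimes> \<nu> z = g \<otimes> z \<otimes> h" "g \<otimes> z = g \<otimes> \<nu> z \<otimes> inv h"
    using that h hP by (simp_all add: m_assoc)
  then show ?thesis
    using hP P.m_closed by metis
qed

lemma nu_mult: "\<nu> (g \<otimes> \<nu> z) = \<nu> (g \<otimes> z)" if "g \<in> carrier G" "z \<in> P" "g \<otimes> z \<in> P"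
proof -
  obtain h where h: "h \<in> H" "\<nu> z = z \<otimes> h"
    using nu_coset \<open>z \<in> P\<close> by blast
  then have "g \<otimes> \<nu> z = g \<otimes> z \<otimes> h"
    using that H_P by (simp add: m_assoc)
  then show ?thesis
    using nu_absorb that h by simp
qed

lemma nu_K: "\<nu> z \<in> K \<alpha> \<longleftrightarrow> z \<in> K \<alpha>" if "z \<in> P" "\<alpha> \<in> words P"
proof -
  obtain h where h: "h \<in> H" "\<nu> z = z \<otimes> h"
    using nu_coset \<open>z \<in> P\<close> by blast
  have hP: "h \<in> P" "inv h \<in> P"
    using h H_P by auto
  have "z = \<nu> z \<otimes> inv h"
    using that h hP by (simp add: m_assoc)
  then show ?thesis
    using K_right_ideal [OF that(2), of z h] K_right_ideal [OF that(2), of "\<nu> z" "inv h"] h hP by auto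
qed

lemma nu_inverse:
  assumes "p \<in> P" "x \<in> P" "y \<in> P" "inv p \<otimes> y \<in> P"
  shows "\<nu> (inv p \<otimes> \<nu> (p \<otimes> x)) = \<nu> x" "\<nu> (p \<otimes> \<nu> (inv p \<otimes> y)) = \<nu> y"
  using nu_mult [of "inv p" "p \<otimes> x"] nu_mult [of p "inv p \<otimes> y"] assms by simp_all

text \<open>The letter p transports f along the injection of X that sends x to \<nu>(p x), and its
  adjoint composes f with that injection. Both are total on functions; the tests for X keep the
  support inside X.\<close>

fun lop :: "'g letter \<Rightarrow> ('g \<Rightarrow> complex) \<Rightarrow> 'g \<Rightarrow> complex"
  where "lop (Gen p) f = (\<lambda>y. if y \<in> X \<and> inv p \<otimes> y \<in> P then f (\<nu> (inv p \<otimes> y)) else 0)"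
  | "lop (Gen_star p) f = (\<lambda>x. if x \<in> X then f (\<nu> (p \<otimes> x)) else 0)"

lemma lop_add: "lop l (\<lambda>x. f x + g x) = (\<lambda>x. lop l f x + lop l g x)"
  and lop_scale: "lop l (\<lambda>x. c * f x) = (\<lambda>x. c * lop l f x)"
  by (cases l; auto)+

lemma substitution_bound:
  assumes f: "f \<in> ell2 X" and \<phi>: "inj_on \<phi> Y" "\<phi> ` Y \<subseteq> X" "Y \<subseteq> X"
  shows "(\<lambda>x. if x \<in> Y then f (\<phi> x) else 0) \<in> ell2 X"
    and "ell2_norm X (\<lambda>x. if x \<in> Y then f (\<phi> x) else 0) \<le> ell2_norm X f"
proof -
  let ?g = "\<lambda>x. if x \<in> Y then f (\<phi> x) else 0"
  have *: "(\<Sum>x\<in>F. (cmod (?g x))\<^sup>2) \<le> (ell2_norm X f)\<^sup>2" if F: "finite F" "F \<subseteq> X" for F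
  proof -
    have "(\<Sum>x\<in>F. (cmod (?g x))\<^sup>2) = (\<Sum>x\<in>F \<inter> Y. (cmod (f (\<phi> x)))\<^sup>2)"
      by (rule sum.mono_neutral_cong_right) (use F in auto)
    also have "\<dots> = (\<Sum>x\<in>\<phi> ` (F \<inter> Y). (cmod (f x))\<^sup>2)"
      by (subst sum.reindex) (use \<phi> in \<open>auto intro: inj_on_subset\<close>)
    also have "\<dots> \<le> (ell2_norm X f)\<^sup>2"
      using F \<phi> by (intro ell2_finite_sum_le [OF f]) auto
    finally show ?thesis .
  qed
  show g: "?g \<in> ell2 X"
    by (rule ell2I [OF _ *]) (use \<phi> in auto)
  show "ell2_norm X ?g \<le> ell2_norm X f"
    by (rule ell2_norm_leI [OF g _ *]) auto
qed

lemma bij_shift: "bij_betw (\<lambda>x. \<nu> (p \<otimes> x)) X {y \<in> X. inv p \<otimes> y \<in> P}"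
  and bij_unshift: "bij_betw (\<lambda>y. \<nu> (inv p \<otimes> y)) {y \<in> X. inv p \<otimes> y \<in> P} X"
  if p: "p \<in> P"
proof -
  have *: "\<nu> (p \<otimes> x) \<in> {y \<in> X. inv p \<otimes> y \<in> P}" if "x \<in> X" for x
    using that p nu_mult_P [of "inv p" "p \<otimes> x"] by simp
  show "bij_betw (\<lambda>x. \<nu> (p \<otimes> x)) X {y \<in> X. inv p \<otimes> y \<in> P}"
    by (rule bij_betw_byWitness [where f' = "\<lambda>y. \<nu> (inv p \<otimes> y)"])
      (use p * in \<open>auto simp: nu_inverse\<close>)
  show "bij_betw (\<lambda>y. \<nu> (inv p \<otimes> y)) {y \<in> X. inv p \<otimes> y \<in> P} X"
    by (rule bij_betw_byWitness [where f' = "\<lambda>x. \<nu> (p \<otimes> x)"])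
      (use p * in \<open>auto simp: nu_inverse\<close>)
qed

lemma lop_ell2: "lop l f \<in> ell2 X"
  and lop_norm: "ell2_norm X (lop l f) \<le> ell2_norm X f"
  if "l \<in> alphabet P" "f \<in> ell2 X"
proof -
  have "lop l f \<in> ell2 X \<and> ell2_norm X (lop l f) \<le> ell2_norm X f"
  proof (cases l)
    case (Gen p)
    then have "p \<in> P"
      using that by auto
    have "lop l f = (\<lambda>y. if y \<in> {y \<in> X. inv p \<otimes> y \<in> P} then f (\<nu> (inv p \<otimes> y)) else 0)"
      using Gen by auto
    then show ?thesis
      using substitution_bound [OF that(2), of "\<lambda>y. \<nu> (inv p \<otimes> y)" "{y \<in> X. inv p \<otimes> y \<in> P}"]
        bij_unshift [OF \<open>p \<in> P\<close>] unfolding bij_betw_def by auto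
  next
    case (Gen_star p)
    then have "p \<in> P"
      using that by auto
    show ?thesis
      using Gen_star substitution_bound [OF that(2), of "\<lambda>x. \<nu> (p \<otimes> x)" X]
        bij_shift [OF \<open>p \<in> P\<close>] unfolding bij_betw_def by auto
  qed
  then show "lop l f \<in> ell2 X" "ell2_norm X (lop l f) \<le> ell2_norm X f"
    by auto
qed

lemma inner_Gen: "ell2_inner X (lop (Gen p) f) g = ell2_inner X f (lop (Gen_star p) g)" if p: "p \<in> P"
proof -
  let ?Y = "{y \<in> X. inv p \<otimes> y \<in> P}"
  have "ell2_inner X (lop (Gen p) f) g = (\<Sum>\<^sub>\<infinity>y\<in>?Y. f (\<nu> (inv p \<otimes> y)) * cnj (g y))"
    unfolding ell2_inner_def by (rule infsum_cong_neutral) auto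
  also have "\<dots> = (\<Sum>\<^sub>\<infinity>x\<in>X. f (\<nu> (inv p \<otimes> \<nu> (p \<otimes> x))) * cnj (g (\<nu> (p \<otimes> x))))"
    by (rule infsum_reindex_bij_betw [OF bij_shift [OF p], symmetric])
  also have "\<dots> = ell2_inner X f (lop (Gen_star p) g)"
    unfolding ell2_inner_def by (rule infsum_cong) (use p nu_inverse(1) [of p _ p] in auto)
  finally show ?thesis .
qed

lemma inner_lop: "ell2_inner X (lop l f) g = ell2_inner X f (lop (letter_star l) g)"
  if "l \<in> alphabet P"
proof (cases l)
  case (Gen p)
  then show ?thesis
    using that inner_Gen by auto
next
  case (Gen_star p)
  then have "p \<in> P"
    using that by auto
  have "ell2_inner X (lop (Gen_star p) f) g = cnj (ell2_inner X g (lop (Gen_star p) f))"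
    by (rule ell2_inner_commute)
  also have "\<dots> = cnj (ell2_inner X (lop (Gen p) g) f)"
    using inner_Gen [OF \<open>p \<in> P\<close>] by simp
  also have "\<dots> = ell2_inner X f (lop (Gen p) g)"
    by (rule ell2_inner_commute [symmetric])
  finally show ?thesis
    using Gen_star by simp
qed

section \<open>Monomials and free elements as operators\<close>

definition mop :: "'g monomial \<Rightarrow> ('g \<Rightarrow> complex) \<Rightarrow> 'g \<Rightarrow> complex"
  where "mop w f = foldr lop (letters w) f"

lemma mop_0 [simp]: "mop 0 f = f"
  and mop_plus: "mop (v + w) f = mop v (mop w f)"
  by (simp_all add: mop_def)

lemma mop_add: "mop w (\<lambda>x. f x + g x) = (\<lambda>x. mop w f x + mop w g x)"
  and mop_scale: "mop w (\<lambda>x. c * f x) = (\<lambda>x. c * mop w f x)"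
proof -
  have "foldr lop ls (\<lambda>x. f x + g x) = (\<lambda>x. foldr lop ls f x + foldr lop ls g x)"
    "foldr lop ls (\<lambda>x. c * f x) = (\<lambda>x. c * foldr lop ls f x)" for ls
    by (induction ls) (simp_all add: lop_add lop_scale del: lop.simps)
  then show "mop w (\<lambda>x. f x + g x) = (\<lambda>x. mop w f x + mop w g x)"
    "mop w (\<lambda>x. c * f x) = (\<lambda>x. c * mop w f x)"
    by (simp_all add: mop_def)
qed

lemma mop_ell2: "mop w f \<in> ell2 X"
  and mop_norm: "ell2_norm X (mop w f) \<le> ell2_norm X f"
  if "set (letters w) \<subseteq> alphabet P" "f \<in> ell2 X"
proof -
  have "foldr lop ls f \<in> ell2 X \<and> ell2_norm X (foldr lop ls f) \<le> ell2_norm X f"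
    if "set ls \<subseteq> alphabet P" for ls
    using that
  proof (induction ls)
    case (Cons l ls)
    then have "foldr lop ls f \<in> ell2 X" "ell2_norm X (foldr lop ls f) \<le> ell2_norm X f" "l \<in> alphabet P"
      by auto
    then show ?case
      using lop_ell2 [of l "foldr lop ls f"] lop_norm [of l "foldr lop ls f"] by simp
  qed (use \<open>f \<in> ell2 X\<close> in simp)
  with that show "mop w f \<in> ell2 X" "ell2_norm X (mop w f) \<le> ell2_norm X f"
    by (simp_all add: mop_def)
qed

lemma inner_mop: "ell2_inner X (mop w f) g = ell2_inner X f (mop (monomial_star w) g)"
  if "set (letters w) \<subseteq> alphabet P"
proof -
  have "ell2_inner X (foldr lop ls f) g = ell2_inner X f (foldr lop (rev (map letter_star ls)) g)"
    if "set ls \<subseteq> alphabet P" for ls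
    using that
  proof (induction ls arbitrary: g)
    case (Cons l ls)
    then have "ell2_inner X (foldr lop (l # ls) f) g = ell2_inner X (foldr lop ls f) (lop (letter_star l) g)"
      by (simp add: inner_lop del: lop.simps)
    also have "\<dots> = ell2_inner X f (foldr lop (rev (map letter_star ls)) (lop (letter_star l) g))"
      using Cons by simp
    finally show ?case by simp
  qed simp
  with that show ?thesis
    by (simp add: mop_def monomial_star_def)
qed

definition rho :: "'g free_elem \<Rightarrow> ('g \<Rightarrow> complex) \<Rightarrow> 'g \<Rightarrow> complex"
  where "rho a f = (\<lambda>x. \<Sum>w\<in>Poly_Mapping.keys a. Poly_Mapping.lookup a w * mop w f x)"

lemma rho_superset: "rho a f x = (\<Sum>w\<in>W. Poly_Mapping.lookup a w * mop w f x)"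
  if "finite W" "Poly_Mapping.keys a \<subseteq> W"
  unfolding rho_def by (rule sum.mono_neutral_left) (use that in \<open>auto simp: in_keys_iff\<close>)

lemma rho_single: "rho (Poly_Mapping.single w c) f = (\<lambda>x. c * mop w f x)"
proof
  show "rho (Poly_Mapping.single w c) f x = c * mop w f x" for x
    by (subst rho_superset [of "{w}"]) auto
qed

lemma rho_0 [simp]: "rho 0 f = (\<lambda>_. 0)" and rho_1 [simp]: "rho 1 f = f"
  using rho_single [of 0 0 f] rho_single [of 0 1 f] by simp_all

lemma rho_plus: "rho (a + b) f = (\<lambda>x. rho a f x + rho b f x)"
proof
  fix x
  let ?W = "Poly_Mapping.keys a \<union> Poly_Mapping.keys b"
  have "Poly_Mapping.keys (a + b) \<subseteq> ?W"
    by (rule Poly_Mapping.keys_add)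
  then show "rho (a + b) f x = rho a f x + rho b f x"
    by (simp add: rho_superset [of ?W] lookup_add distrib_right sum.distrib)
qed

lemma rho_minus: "rho (- a) f = (\<lambda>x. - rho a f x)"
  using rho_plus [of a "- a" f] by (auto simp: fun_eq_iff eq_neg_iff_add_eq_0 add.commute)

lemma rho_diff: "rho (a - b) f = (\<lambda>x. rho a f x - rho b f x)"
  using rho_plus [of a "- b" f] by (simp add: rho_minus)

lemma rho_add: "rho a (\<lambda>x. f x + g x) = (\<lambda>x. rho a f x + rho a g x)"
  and rho_scale: "rho a (\<lambda>x. c * f x) = (\<lambda>x. c * rho a f x)"
  by (simp_all add: rho_def mop_add mop_scale distrib_left sum.distrib sum_distrib_left mult_ac)

lemma rho_times: "rho (a * b) f = rho a (rho b f)" if "a \<in> carrier A" "b \<in> carrier A"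
  using that(1)
proof (induction rule: free_induct)
  case (single v c)
  from that(2) show ?case
  proof (induction rule: free_induct)
    case (single w d)
    then show ?case
      by (simp add: Poly_Mapping.mult_single rho_single mop_plus mop_scale mult.assoc)
  next
    case (add a b)
    then show ?case
      by (simp add: distrib_left rho_plus rho_add)
  qed
next
  case (add a b)
  then show ?case
    by (simp add: distrib_right rho_plus)
qed

lemma rho_smult: "rho (smult A c a) f = (\<lambda>x. c * rho a f x)" if "a \<in> carrier A"
proof -
  have "Poly_Mapping.single 0 c \<in> carrier A"
    by (rule free_algebra_closed) simp
  then show ?thesis
    using that by (simp add: free_algebra_ops rho_times rho_single)
qed

lemma rho_bounded: "\<exists>C\<ge>0. \<forall>f\<in>ell2 X. rho a f \<in> ell2 X \<and> ell2_norm X (rho a f) \<le> C * ell2_norm X f"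
  if "a \<in> carrier A"
  using that
proof (induction rule: free_induct)
  case (single w c)
  show ?case
    using mop_ell2 [OF single] mop_norm [OF single]
    by (intro exI [of _ "cmod c"]) (auto simp: rho_single ell2_norm_scale mult_left_mono)
next
  case (add a b)
  then obtain C D where C: "C \<ge> 0" "\<forall>f\<in>ell2 X. rho a f \<in> ell2 X \<and> ell2_norm X (rho a f) \<le> C * ell2_norm X f"
    and D: "D \<ge> 0" "\<forall>f\<in>ell2 X. rho b f \<in> ell2 X \<and> ell2_norm X (rho b f) \<le> D * ell2_norm X f"
    by blast
  have "rho (a + b) f \<in> ell2 X \<and> ell2_norm X (rho (a + b) f) \<le> (C + D) * ell2_norm X f"
    if f: "f \<in> ell2 X" for f
  proof
    show "rho (a + b) f \<in> ell2 X"
      using C D f by (simp add: rho_plus)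
    have "ell2_norm X (rho (a + b) f) \<le> ell2_norm X (rho a f) + ell2_norm X (rho b f)"
      unfolding rho_plus using C D f by (intro ell2_norm_triangle) auto
    also have "\<dots> \<le> C * ell2_norm X f + D * ell2_norm X f"
      using C D f by (intro add_mono) auto
    finally show "ell2_norm X (rho (a + b) f) \<le> (C + D) * ell2_norm X f"
      by (simp add: distrib_right)
  qed
  then show ?case
    using C(1) D(1) by (intro exI [of _ "C + D"]) auto
qed

lemma rho_ell2 [simp]: "a \<in> carrier A \<Longrightarrow> f \<in> ell2 X \<Longrightarrow> rho a f \<in> ell2 X"
  using rho_bounded by blast

lemma inner_rho: "ell2_inner X (rho a f) g = ell2_inner X f (rho (star A a) g)"
  if "a \<in> carrier A" "f \<in> ell2 X" "g \<in> ell2 X"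
  using that(1)
proof (induction rule: free_induct)
  case (single w c)
  then show ?case
    by (simp add: rho_single free_star_single ell2_inner_scale_left ell2_inner_scale_right inner_mop)
next
  case (add a b)
  then show ?case
    using that by (simp add: rho_plus free_star_add ell2_inner_add_left ell2_inner_add_right
        free_algebra_closed)
qed

definition OP :: "'g free_elem \<Rightarrow> ('g \<Rightarrow> complex) \<Rightarrow> 'g \<Rightarrow> complex"
  where "OP a = (\<lambda>f\<in>ell2 X. rho a f)"

abbreviation "BX \<equiv> bounded_operators X"

lemma OP_closed [simp]: "OP a \<in> carrier BX" if a: "a \<in> carrier A"
proof -
  obtain C where "\<forall>f\<in>ell2 X. rho a f \<in> ell2 X \<and> ell2_norm X (rho a f) \<le> C * ell2_norm X f"
    using rho_bounded [OF a] by blast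
  then show ?thesis
    by (intro BO_I [where C = C]) (auto simp: OP_def rho_add rho_scale)
qed

lemma OP_plus: "OP (a + b) = OP a \<oplus>\<^bsub>BX\<^esub> OP b"
  by (auto simp: OP_def rho_plus fun_eq_iff)

lemma OP_times: "a \<in> carrier A \<Longrightarrow> b \<in> carrier A \<Longrightarrow> OP (a * b) = OP a \<otimes>\<^bsub>BX\<^esub> OP b"
  by (auto simp: OP_def rho_times fun_eq_iff)

lemma OP_smult: "a \<in> carrier A \<Longrightarrow> OP (smult A c a) = smult BX c (OP a)"
  by (auto simp: OP_def rho_smult fun_eq_iff)

lemma OP_one: "OP 1 = \<one>\<^bsub>BX\<^esub>" and OP_zero: "OP 0 = \<zero>\<^bsub>BX\<^esub>"
  by (auto simp: OP_def)

lemma OP_diff: "a \<in> carrier A \<Longrightarrow> b \<in> carrier A \<Longrightarrow> OP (a - b) = OP a \<ominus>\<^bsub>BX\<^esub> OP b"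
  by (simp add: BO_minus) (auto simp: OP_def rho_diff fun_eq_iff)

lemma OP_star: "OP (star A a) = star BX (OP a)" if "a \<in> carrier A"
  by (rule BO_star_unique [OF OP_closed, symmetric])
    (use that in \<open>auto simp: OP_def inner_rho free_algebra_closed\<close>)

text \<open>A word acts as the partial translation by its value, so only the value and K enter. For
  a neutral word this is multiplication by the indicator of K(\<alpha>), which is what makes (T2),
  (T3) and (T4) hold.\<close>

lemma rho_word: "rho (word_prod A free_gen \<alpha>) f = (\<lambda>x. if x \<in> X \<and> x \<in> K (word_tilde \<alpha>)
    then f (\<nu> (inv (val \<alpha>) \<otimes> x)) else 0)"
  if "\<alpha> \<in> words P" "f \<in> ell2 X"
  using that(1)
proof (induction \<alpha> rule: word_induct)
  case Nil
  show ?case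
  proof
    show "rho (word_prod A free_gen []) f x = (if x \<in> X \<and> x \<in> K (word_tilde [])
        then f (\<nu> (inv (val []) \<otimes> x)) else 0)" for x
      using that(2) by (cases "x \<in> X") (simp_all add: ell2_supp free_algebra_ops)
  qed
next
  case (Cons p r \<alpha>)
  interpret star_alg A by (rule star_alg_free)
  let ?h = "rho (word_prod A free_gen \<alpha>) f"
  have gen: "free_gen p \<in> carrier A" "free_gen r \<in> carrier A"
    unfolding free_gen_def using Cons by (auto intro!: free_algebra_closed)
  have w: "word_prod A free_gen \<alpha> \<in> carrier A"
    using Cons.hyps(3)
    by (induction \<alpha> rule: word_induct) (auto simp: free_gen_def intro!: free_algebra_closed)
  have "rho (word_prod A free_gen ((p, r) # \<alpha>)) f = lop (Gen_star p) (lop (Gen r) ?h)"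
    using gen w by (simp add: rho_times del: lop.simps)
      (simp add: free_gen_def free_star_single rho_single mop_def monomial_star_def)
  also have "\<dots> = (\<lambda>x. if x \<in> X \<and> x \<in> K (word_tilde ((p, r) # \<alpha>))
    then f (\<nu> (inv (val ((p, r) # \<alpha>)) \<otimes> x)) else 0)"
  proof
    fix x
    show "lop (Gen_star p) (lop (Gen r) ?h) x = (if x \<in> X \<and> x \<in> K (word_tilde ((p, r) # \<alpha>))
      then f (\<nu> (inv (val ((p, r) # \<alpha>)) \<otimes> x)) else 0)"
    proof (cases "x \<in> X")
      case False
      then show ?thesis by simp
    next
      case True
      then have x: "x \<in> P" "p \<otimes> x \<in> P"
        using Cons by auto
      \<comment> \<open>z is x moved by the inverse of the first pair. Representatives may be
        dropped until the end, since membership in K and the final representative depend only on the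
        coset.\<close>
      define z where "z = inv r \<otimes> (p \<otimes> x)"
      have zG: "z \<in> carrier G"
        using Cons x by (simp add: z_def)
      have iff: "x \<in> K (word_tilde ((p, r) # \<alpha>)) \<longleftrightarrow> z \<in> P \<and> z \<in> K (word_tilde \<alpha>)"
        using Cons x by (auto simp: K_append K_single val_single m_assoc z_def)
      have zP: "inv r \<otimes> \<nu> (p \<otimes> x) \<in> P \<longleftrightarrow> z \<in> P"
        unfolding z_def using Cons x by (intro nu_mult_P) auto
      have z\<nu>: "\<nu> (inv r \<otimes> \<nu> (p \<otimes> x)) = \<nu> z" if "z \<in> P"
        using nu_mult [of "inv r" "p \<otimes> x"] that Cons x by (simp add: z_def)
      have val: "inv (val ((p, r) # \<alpha>)) \<otimes> x = inv (val \<alpha>) \<otimes> z"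
        using Cons x by (simp add: word_val.simps(2) inv_mult_group m_assoc z_def)
      have last: "\<nu> (inv (val \<alpha>) \<otimes> \<nu> z) = \<nu> (inv (val \<alpha>) \<otimes> z)" if "z \<in> K (word_tilde \<alpha>)"
        using K_val_in_P [OF that] K_in_P [OF that] Cons by (intro nu_mult) auto
      have "lop (Gen_star p) (lop (Gen r) ?h) x = (if z \<in> P then ?h (\<nu> z) else 0)"
        using True Cons x zP z\<nu> by simp
      also have "\<dots> = (if z \<in> P \<and> z \<in> K (word_tilde \<alpha>) then f (\<nu> (inv (val \<alpha>) \<otimes> \<nu> z)) else 0)"
        using Cons nu_K [of z "word_tilde \<alpha>"] by simp
      finally show ?thesis
        using iff val last True by auto
    qed
  qed
  finally show ?case .
qed

lemma rho_neutral: "rho (word_prod A free_gen \<alpha>) f = (\<lambda>x. if x \<in> K \<alpha> then f x else 0)"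
  if "\<alpha> \<in> neutral_words G P" "f \<in> ell2 X"
proof
  show "rho (word_prod A free_gen \<alpha>) f x = (if x \<in> K \<alpha> then f x else 0)" for x
    using rho_word [OF neutral_word(1) [OF that(1)] that(2)] that ell2_supp [OF that(2), of x]
    by (cases "x \<in> X"; cases "x \<in> K \<alpha>") (simp_all add: K_tilde_neutral)
qed

lemma rho_prod_neutral: "rho (prod_list (map g \<beta>s)) f = (\<lambda>x. prod_list (map (\<lambda>\<beta>. h \<beta> x) \<beta>s) * f x)"
  if "\<And>\<beta>. \<beta> \<in> set \<beta>s \<Longrightarrow> g \<beta> \<in> carrier A" "f \<in> ell2 X"
    and "\<And>\<beta> f. \<beta> \<in> set \<beta>s \<Longrightarrow> f \<in> ell2 X \<Longrightarrow> rho (g \<beta>) f = (\<lambda>x. h \<beta> x * f x)"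
proof -
  have "prod_list (map g \<beta>s) \<in> carrier A \<and>
      rho (prod_list (map g \<beta>s)) f = (\<lambda>x. prod_list (map (\<lambda>\<beta>. h \<beta> x) \<beta>s) * f x)"
    using that(1,3)
  proof (induction \<beta>s)
    case (Cons \<beta> \<beta>s)
    then have IH: "prod_list (map g \<beta>s) \<in> carrier A"
      "rho (prod_list (map g \<beta>s)) f = (\<lambda>x. prod_list (map (\<lambda>\<beta>. h \<beta> x) \<beta>s) * f x)"
      by auto
    have "g \<beta> \<in> carrier A"
      using Cons.prems by simp
    moreover have "rho (g \<beta>) (rho (prod_list (map g \<beta>s)) f) = (\<lambda>x. h \<beta> x * rho (prod_list (map g \<beta>s)) f x)"
      using Cons.prems(2) [of \<beta> "rho (prod_list (map g \<beta>s)) f"] IH(1) that(2) by simp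
    ultimately show ?case
      using IH by (simp add: rho_times free_algebra_closed mult.assoc)
  qed (simp add: free_algebra_closed)
  then show ?thesis by blast
qed

section \<open>The operator seminorm of a representation\<close>

definition qr :: "'g free_elem \<Rightarrow> real"
  where "qr a = cnorm BX (OP a)"

lemma rho_relation: "rho r f = (\<lambda>_. 0)" if "r \<in> toeplitz_relations G P" "f \<in> ell2 X"
proof -
  let ?t = "word_prod A free_gen" and ?N = "neutral_words G P"
  have tN: "?t \<alpha> \<in> carrier A" if "\<alpha> \<in> ?N" for \<alpha>
    using neutral_word(1) [OF that] toeplitz_seminorm.t_closed [OF toeplitz_universal] by blast
  consider (T1) "r = free_gen \<one> - 1" | (T2) \<alpha> where "r = ?t \<alpha>" "\<alpha> \<in> ?N" "K \<alpha> = {}"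
    | (T3) \<alpha> \<beta> where "r = ?t \<alpha> - ?t \<beta>" "\<alpha> \<in> ?N" "\<beta> \<in> ?N" "K \<alpha> = K \<beta>"
    | (T4) \<alpha> \<beta>s where "r = prod_list (map (\<lambda>\<beta>. ?t \<alpha> - ?t \<beta>) \<beta>s)" "\<alpha> \<in> ?N" "set \<beta>s \<subseteq> ?N"
        "\<beta>s \<noteq> []" "K \<alpha> = (\<Union>\<beta>\<in>set \<beta>s. K \<beta>)"
    using \<open>r \<in> toeplitz_relations G P\<close> unfolding toeplitz_relations_def Let_def by blast
  then show ?thesis
  proof cases
    case T1
    have "rho (free_gen \<one>) f = f"
      using ell2_supp [OF that(2)] by (auto simp: free_gen_def rho_single mop_def)
    then show ?thesis
      using T1 by (simp add: rho_diff)
  next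
    case T2
    then show ?thesis
      using that by (simp add: rho_neutral)
  next
    case T3
    then show ?thesis
      using that by (simp add: rho_neutral rho_diff)
  next
    case T4
    define h :: "'g word \<Rightarrow> 'g \<Rightarrow> complex" where "h \<beta> x = of_bool (x \<in> K \<alpha>) - of_bool (x \<in> K \<beta>)" for \<beta> x
    have "rho r f = (\<lambda>x. prod_list (map (\<lambda>\<beta>. h \<beta> x) \<beta>s) * f x)"
      unfolding T4(1)
    proof (rule rho_prod_neutral [OF _ that(2)])
      show "?t \<alpha> - ?t \<beta> \<in> carrier A" if "\<beta> \<in> set \<beta>s" for \<beta>
        using that T4 tN by (intro star_alg.minus_closed [OF star_alg_free]) auto
      show "rho (?t \<alpha> - ?t \<beta>) f = (\<lambda>x. h \<beta> x * f x)" if "\<beta> \<in> set \<beta>s" "f \<in> ell2 X" for \<beta> f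
      proof -
        have "\<beta> \<in> ?N"
          using that T4(3) by blast
        then show ?thesis
          using rho_neutral [OF T4(2) that(2)] rho_neutral [OF _ that(2), of \<beta>]
          by (simp add: rho_diff h_def fun_eq_iff of_bool_def)
      qed
    qed
    moreover have "prod_list (map (\<lambda>\<beta>. h \<beta> x) \<beta>s) = 0" for x
    proof -
      \<comment> \<open>If x lies in K(\<alpha>), some K(\<beta>) of the cover contains it. If not,
        every factor is 0 at x, and there is one because the list is nonempty.\<close>
      have "\<exists>\<beta>\<in>set \<beta>s. h \<beta> x = 0"
        using T4(4,5) by (cases "x \<in> K \<alpha>") (auto simp: h_def neq_Nil_conv)
      then show ?thesis
        by (auto simp: prod_list_zero_iff)
    qed
    ultimately show ?thesis
      by simp
  qed
qed

lemma qr_cstar: "qr \<in> cstar_seminorms A (toeplitz_relations G P)"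
  unfolding cstar_seminorms_def mem_Collect_eq
proof (intro conjI ballI allI)
  fix a b assume ab: "a \<in> carrier A" "b \<in> carrier A"
  show "qr (a \<oplus>\<^bsub>A\<^esub> b) \<le> qr a + qr b"
    using ab by (simp add: qr_def free_algebra_ops OP_plus opnorm_add del: BO_simps)
  show "qr (a \<otimes>\<^bsub>A\<^esub> b) \<le> qr a * qr b"
    using ab by (simp add: qr_def free_algebra_ops OP_times opnorm_mult del: BO_simps)
next
  fix c a assume "a \<in> carrier A"
  then show "qr (smult A c a) = cmod c * qr a"
    by (simp add: qr_def OP_smult opnorm_smult del: BO_simps)
next
  fix a assume "a \<in> carrier A"
  then show "qr (star A a \<otimes>\<^bsub>A\<^esub> a) = (qr a)\<^sup>2"
    by (simp add: qr_def free_algebra_ops OP_times OP_star opnorm_star_mult free_algebra_closed del: BO_simps)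
next
  fix r assume r: "r \<in> toeplitz_relations G P"
  then have "OP r = \<zero>\<^bsub>BX\<^esub>"
    by (auto simp: OP_def rho_relation)
  moreover have "cnorm BX \<zero>\<^bsub>BX\<^esub> \<le> 0"
    by (rule opnorm_leI) auto
  ultimately show "qr r = 0"
    using opnorm_nonneg [OF BO_zero_closed, of X] by (simp add: qr_def)
qed

sublocale toeplitz_seminorm G P qr
  by (rule toeplitz_seminormI [OF qr_cstar])

lemma qr_bound: "ell2_norm X (rho a f) \<le> qr a * ell2_norm X f" if "a \<in> carrier A" "f \<in> ell2 X"
  using opnorm_bound [OF OP_closed [OF that(1)] that(2)] that by (simp add: qr_def OP_def)

lemma qr_0_iff: "qr a = 0 \<longleftrightarrow> (\<forall>f\<in>ell2 X. rho a f = (\<lambda>_. 0))" if "a \<in> carrier A"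
proof
  assume "qr a = 0"
  then show "\<forall>f\<in>ell2 X. rho a f = (\<lambda>_. 0)"
    using qr_bound [OF that] ell2_norm_eq_0 [of X] that by (metis antisym_conv ell2_norm_nonneg mult_zero_left rho_ell2)
next
  assume *: "\<forall>f\<in>ell2 X. rho a f = (\<lambda>_. 0)"
  have "qr a \<le> 0"
    unfolding qr_def by (rule opnorm_leI) (use * in \<open>auto simp: OP_def\<close>)
  then show "qr a = 0"
    using opnorm_nonneg [OF OP_closed [OF that]] by (simp add: qr_def)
qed

lemma rho_cprod: "rho (cprod \<gamma>s) g = (\<lambda>x. if x \<in> (\<Union>\<gamma>\<in>set \<gamma>s. K \<gamma>) then 0 else g x)"
  if "set \<gamma>s \<subseteq> N" "g \<in> ell2 X"
  using that(1)
proof (induction \<gamma>s)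
  case (Cons \<gamma> \<gamma>s)
  have c: "cprod \<gamma>s \<in> carrier A" "1 - t \<gamma> \<in> carrier A" "\<gamma> \<in> N"
    using Cons.prems by auto
  have "rho (cprod (\<gamma> # \<gamma>s)) g = rho (1 - t \<gamma>) (rho (cprod \<gamma>s) g)"
    using c rho_times by simp
  also have "\<dots> = (\<lambda>x. rho (cprod \<gamma>s) g x - (if x \<in> K \<gamma> then rho (cprod \<gamma>s) g x else 0))"
    using rho_neutral [OF c(3) rho_ell2 [OF c(1) that(2)]] by (simp add: rho_diff)
  finally show ?case
    using Cons by (auto simp: fun_eq_iff)
qed (use rho_1 in simp)

lemma rho_eqv: "rho a f = rho b f" if "eqv a b" "f \<in> ell2 X"
proof -
  have "qr (a - b) = 0" "a - b \<in> carrier A"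
    using that by (auto simp: eqv_def)
  then have "rho (a - b) f = (\<lambda>_. 0)"
    using qr_0_iff that(2) by blast
  then show ?thesis
    by (auto simp: rho_diff fun_eq_iff)
qed

lemma rho_lincomb_delta: "rho (lincomb L) (ell2_delta x) x = lincomb_at L x"
  if "snd ` set L \<subseteq> neutral_words G P" "x \<in> X"
  using that(1)
proof (induction L)
  case (Cons l L)
  obtain c \<gamma> where l: "l = (c, \<gamma>)"
    by (cases l)
  have \<gamma>: "\<gamma> \<in> N"
    using Cons.prems l by auto
  have "ell2_delta x x = 1"
    by (simp add: ell2_delta_def)
  then show ?case
    using Cons rho_neutral [OF \<gamma> ell2_delta(1) [OF that(2)]] \<gamma>
    by (simp add: l rho_plus rho_smult)
qed simp

text \<open>The value at p depends only on the coset of p, because each K(\<gamma>) is a right ideal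
  and H consists of units. At the representative it is a matrix coefficient of the operator.\<close>

lemma lincomb_at_bound: "cmod (lincomb_at L p) \<le> qr (lincomb L)"
  if L: "snd ` set L \<subseteq> neutral_words G P" and p: "p \<in> P"
proof -
  have "lincomb_at L p = lincomb_at L (\<nu> p)"
    using L by (induction L) (auto simp: nu_K p)
  also have "\<dots> = rho (lincomb L) (ell2_delta (\<nu> p)) (\<nu> p)"
    using L p by (simp add: rho_lincomb_delta)
  also have "cmod \<dots> \<le> ell2_norm X (rho (lincomb L) (ell2_delta (\<nu> p)))"
    using p D0_lincomb [OF L] by (intro ell2_bound rho_ell2 ell2_delta) auto
  also have "\<dots> \<le> qr (lincomb L) * 1"
    using qr_bound [of "lincomb L" "ell2_delta (\<nu> p)"] p D0_lincomb [OF L] by (simp add: ell2_delta)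
  finally show ?thesis by simp
qed

text \<open>This is \<open>D0_bound\<close> for the universal seminorm with the bound supplied by
  \<open>lincomb_at_bound\<close>. Together with \<open>U_upper\<close> it makes every
  representation on cosets isometric on the diagonal.\<close>

lemma U_le_qr: "U x \<le> qr x" if x: "x \<in> D0"
proof -
  interpret univ: toeplitz_seminorm G P U
    by (rule toeplitz_universal)
  obtain L where L: "snd ` set L \<subseteq> neutral_words G P" "x = lincomb L"
    using D0_lincombE [OF x] by blast
  have "0 \<le> qr (lincomb L)"
    using L D0_lincomb by (intro q_nonneg) simp
  then show ?thesis
    using univ.D0_bound [OF L(1), of "qr (lincomb L)"] lincomb_at_bound [OF L(1)] L(2) by simp
qed

end

section \<open>The left regular representation of the universal algebra\<close>

locale toeplitz_algebra = group_submonoid G P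
  for G :: "('g, 'm) monoid_scheme" (structure) and P :: "'g set"
begin

sublocale univ: toeplitz_seminorm G P U
  by (rule toeplitz_universal)

sublocale lam: toeplitz_rep G P "{\<one>}" "\<lambda>x. x"
  by (intro toeplitz_rep.intro toeplitz_rep_axioms.intro group_submonoid_axioms triv_subgroup)
    (auto simp: unit_iff)

declare lam.nu_P [simp del] lam.nu_X [simp del] lam.X_P [simp del] lam.nu_id [simp del]

abbreviation "TU \<equiv> Toeplitz_u G P"
abbreviation "TL \<equiv> Toeplitz_lambda G P"
abbreviation "BP \<equiv> bounded_operators P"

lemma TU_eq: "TU = univ.T"
  by (simp add: Toeplitz_u_def universal_cstar_def)

lemma toeplitz_gen_eq: "toeplitz_gen G P p = univ.cst (free_gen p)"
  by (simp add: toeplitz_gen_def universal_gen_def univ.cls_def)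

lemma lam_X [simp]: "lam.X = P"
  by (simp add: lam.X_def)

lemma left_regular_eq: "left_regular G P p = lam.OP (free_gen p)" if p: "p \<in> P"
proof -
  have "r \<in> p <# P \<longleftrightarrow> r \<in> P \<and> inv p \<otimes> r \<in> P" for r
  proof
    assume "r \<in> p <# P"
    then obtain s where "s \<in> P" "r = p \<otimes> s"
      by (auto simp: l_coset_def)
    then show "r \<in> P \<and> inv p \<otimes> r \<in> P"
      using p by simp
  next
    assume "r \<in> P \<and> inv p \<otimes> r \<in> P"
    then show "r \<in> p <# P"
      using p by (simp add: l_coset_iff P.subset)
  qed
  then show ?thesis
    by (simp add: left_regular_def lam.OP_def free_gen_def lam.rho_single lam.mop_def)
qed

lemma TL_simps [simp]:
  "mult TL = mult BP" "one TL = one BP" "add TL = add BP" "zero TL = zero BP" "smult TL = smult BP"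
  "star TL = star BP" "cnorm TL = cnorm BP"
  by (simp_all add: Toeplitz_lambda_def cstar_generated_def del: BO_simps)

definition subalgebras
  where "subalgebras = {B. star_subalgebra BP B \<and> norm_closed BP B \<and> left_regular G P ` P \<subseteq> B}"

lemma TL_carrier: "carrier TL = \<Inter> subalgebras"
  by (simp add: Toeplitz_lambda_def cstar_generated_def subalgebras_def)

lemma TL_subset: "carrier TL \<subseteq> carrier BP"
proof -
  have "carrier BP \<in> subalgebras"
    unfolding subalgebras_def star_subalgebra_def linear_subspace_def norm_closed_def norm_closure_def
    using BO_zero_closed BO_add_closed BO_smult_closed BO_mult_closed BO_star_closed
      lam.OP_closed left_regular_eq univ.free_gen_closed by auto
  then show ?thesis
    by (auto simp: TL_carrier)
qed

lemma OP_closed [simp]: "a \<in> carrier A \<Longrightarrow> lam.OP a \<in> carrier BP"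
  using lam.OP_closed [of a] by simp

lemma left_regular_one: "left_regular G P \<one> = \<one>\<^bsub>BP\<^esub>"
  by (auto simp: left_regular_def fun_eq_iff l_coset_iff P.subset ell2_supp)
    (auto simp: l_coset_def ell2_supp)

lemma OP_in_subalgebra: "lam.OP a \<in> B" if "B \<in> subalgebras" "a \<in> carrier A"
proof -
  have B: "\<And>x y. x \<in> B \<Longrightarrow> y \<in> B \<Longrightarrow> x \<otimes>\<^bsub>BP\<^esub> y \<in> B" "\<And>x y. x \<in> B \<Longrightarrow> y \<in> B \<Longrightarrow> x \<oplus>\<^bsub>BP\<^esub> y \<in> B"
      "\<And>x c. x \<in> B \<Longrightarrow> smult BP c x \<in> B" "\<And>x. x \<in> B \<Longrightarrow> star BP x \<in> B"
      "\<And>p. p \<in> P \<Longrightarrow> left_regular G P p \<in> B"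
    using \<open>B \<in> subalgebras\<close>
    unfolding subalgebras_def star_subalgebra_def linear_subspace_def by blast+
  from that(2) show ?thesis
  proof (induction rule: free_algebra_induct)
    case one
    then show ?case
      using B(5) [OF P.one_closed] left_regular_one lam.OP_one by (simp del: BO_simps)
  next
    case (gen p)
    then show ?case
      using B(5) left_regular_eq by simp
  next
    case (star a)
    then show ?case
      using B(4) lam.OP_star [of a] by simp
  next
    case (mult a b)
    then show ?case
      using B(1) lam.OP_times [of a b] by (simp del: BO_simps)
  next
    case (smult c a)
    then show ?case
      using B(3) lam.OP_smult [of a c] by (simp del: BO_simps)
  next
    case (add a b)
    then show ?case
      using B(2) lam.OP_plus [of a b] by (simp del: BO_simps)
  qed
qed

section \<open>Extending the left regular representation to the completion\<close>

definition op_limit :: "(nat \<Rightarrow> 'g free_elem) \<Rightarrow> ('g \<Rightarrow> complex) \<Rightarrow> 'g \<Rightarrow> complex"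
  where "op_limit x = (\<lambda>f\<in>ell2 P. \<lambda>y. lim (\<lambda>n. lam.OP (x n) f y))"

lemma OP_ell2 [simp]: "a \<in> carrier A \<Longrightarrow> f \<in> ell2 P \<Longrightarrow> lam.OP a f \<in> ell2 P"
  using BO_ell2 [OF OP_closed] by blast

lemma opnorm_OP_le: "cnorm BP (lam.OP a) \<le> U a" if "a \<in> carrier A"
  using U_upper [OF lam.qr_cstar that] by (simp add: lam.qr_def)

text \<open>The operator norm of \<open>lam.OP a\<close> is at most \<open>U a\<close>, so a Cauchy
  sequence for U yields a norm Cauchy sequence of operators. By \<open>BO_limit\<close> its norm
  limit is the coordinatewise limit used in the definition.\<close>

lemma op_limit:
  assumes x: "x \<in> univ.CS"
  shows op_limit_closed: "op_limit x \<in> carrier BP"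
    and op_limit_tendsto: "f \<in> ell2 P \<Longrightarrow> (\<lambda>n. lam.OP (x n) f y) \<longlonglongrightarrow> op_limit x f y"
    and op_limit_norm: "e > 0 \<Longrightarrow> \<exists>N. \<forall>n\<ge>N. cnorm BP (lam.OP (x n) \<ominus>\<^bsub>BP\<^esub> op_limit x) \<le> e"
proof -
  have T: "lam.OP (x n) \<in> carrier BP" for n
    using x by simp
  have Cauchy: "\<exists>N. \<forall>m\<ge>N. \<forall>n\<ge>N. cnorm BP (lam.OP (x m) \<ominus>\<^bsub>BP\<^esub> lam.OP (x n)) < e" if e: "e > 0" for e
  proof -
    obtain N where N: "\<forall>m\<ge>N. \<forall>n\<ge>N. U (x m - x n) < e"
      using x e unfolding univ.CS_iff by meson
    have "cnorm BP (lam.OP (x m) \<ominus>\<^bsub>BP\<^esub> lam.OP (x n)) \<le> U (x m - x n)" for m n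
      using opnorm_OP_le [of "x m - x n"] lam.OP_diff [of "x m" "x n"] x by simp
    with N show ?thesis
      by (meson le_less_trans)
  qed
  note lim = BO_limit [of "\<lambda>n. lam.OP (x n)", OF T Cauchy, folded op_limit_def]
  show "op_limit x \<in> carrier BP"
    by (rule lim(1))
  show "(\<lambda>n. lam.OP (x n) f y) \<longlonglongrightarrow> op_limit x f y" if "f \<in> ell2 P"
    by (rule lim(2) [OF _ that])
  show "\<exists>N. \<forall>n\<ge>N. cnorm BP (lam.OP (x n) \<ominus>\<^bsub>BP\<^esub> op_limit x) \<le> e" if "e > 0"
    by (rule lim(3) [OF _ that])
qed

lemma op_limit_ell2 [simp]: "x \<in> univ.CS \<Longrightarrow> f \<in> ell2 P \<Longrightarrow> op_limit x f \<in> ell2 P"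
  using op_limit_closed BO_ell2 by blast

lemma op_limit_strong:
  assumes x: "x \<in> univ.CS" and f: "f \<in> ell2 P"
  shows "(\<lambda>n. ell2_norm P (\<lambda>y. lam.OP (x n) f y - op_limit x f y)) \<longlonglongrightarrow> 0"
proof (rule LIMSEQ_I)
  fix e :: real assume "e > 0"
  define d where "d = e / (ell2_norm P f + 1)"
  have pos: "ell2_norm P f + 1 > 0"
    using ell2_norm_nonneg [of P f] by linarith
  have "d > 0"
    using \<open>e > 0\<close> pos by (simp add: d_def)
  then obtain N where N: "\<forall>n\<ge>N. cnorm BP (lam.OP (x n) \<ominus>\<^bsub>BP\<^esub> op_limit x) \<le> d"
    using op_limit_norm [OF x] by blast
  have "ell2_norm P (\<lambda>y. lam.OP (x n) f y - op_limit x f y) < e" if "n \<ge> N" for n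
  proof -
    have c: "lam.OP (x n) \<in> carrier BP" "op_limit x \<in> carrier BP"
      using x op_limit_closed by auto
    have "ell2_norm P ((lam.OP (x n) \<ominus>\<^bsub>BP\<^esub> op_limit x) f)
        \<le> cnorm BP (lam.OP (x n) \<ominus>\<^bsub>BP\<^esub> op_limit x) * ell2_norm P f"
      using c f by (intro opnorm_bound BO_minus_closed)
    also have "\<dots> \<le> d * ell2_norm P f"
      using N that by (intro mult_right_mono) auto
    also have "\<dots> < d * (ell2_norm P f + 1)"
      using \<open>d > 0\<close> by simp
    also have "\<dots> = e"
      using pos by (simp add: d_def)
    finally show ?thesis
      using c f by (simp add: BO_minus)
  qed
  then show "\<exists>N. \<forall>n\<ge>N. norm (ell2_norm P (\<lambda>y. lam.OP (x n) f y - op_limit x f y) - 0) < e"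
    by (intro exI [of _ N]) simp
qed

lemma op_limit_eqI:
  assumes "x \<in> univ.CS" "S \<in> extensional (ell2 P)"
    and "\<And>f y. f \<in> ell2 P \<Longrightarrow> (\<lambda>n. lam.OP (x n) f y) \<longlonglongrightarrow> S f y"
  shows "op_limit x = S"
proof (rule extensionalityI [OF _ assms(2)])
  show "op_limit x \<in> extensional (ell2 P)"
    by (simp add: op_limit_def)
  show "op_limit x f = S f" if "f \<in> ell2 P" for f
    using LIMSEQ_unique [OF op_limit_tendsto [OF assms(1) that] assms(3) [OF that]] by blast
qed

lemma op_limit_const: "op_limit (\<lambda>_. a) = lam.OP a" if "a \<in> carrier A"
  using that by (intro op_limit_eqI) (auto simp: lam.OP_def)

lemma op_limit_cong: "op_limit x = op_limit y"
  if xy: "x \<in> univ.CS" "y \<in> univ.CS" and eq: "univ.cls x = univ.cls y"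
proof (rule op_limit_eqI [OF xy(1)])
  show "op_limit y \<in> extensional (ell2 P)"
    by (simp add: op_limit_def)
  fix f z assume f: "f \<in> ell2 P"
  have "(\<lambda>n. U (x n - y n) * ell2_norm P f) \<longlonglongrightarrow> 0"
    using eq xy by (intro tendsto_mult_left_zero) (simp add: univ.cls_eq_iff)
  then have "(\<lambda>n. lam.OP (x n) f z - lam.OP (y n) f z) \<longlonglongrightarrow> 0"
  proof (rule Lim_null_comparison [rotated], intro always_eventually allI)
    fix n
    have c: "x n - y n \<in> carrier A"
      using xy by simp
    have "cmod (lam.OP (x n) f z - lam.OP (y n) f z) = cmod (lam.OP (x n - y n) f z)"
      using f by (simp add: lam.OP_def lam.rho_diff)
    also have "\<dots> \<le> ell2_norm P (lam.OP (x n - y n) f)"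
      using f c by (intro ell2_bound) simp
    also have "\<dots> \<le> cnorm BP (lam.OP (x n - y n)) * ell2_norm P f"
      using f c by (intro opnorm_bound OP_closed)
    also have "\<dots> \<le> U (x n - y n) * ell2_norm P f"
      using c by (intro mult_right_mono opnorm_OP_le) auto
    finally show "norm (lam.OP (x n) f z - lam.OP (y n) f z) \<le> U (x n - y n) * ell2_norm P f" .
  qed
  then have "(\<lambda>n. lam.OP (x n) f z - lam.OP (y n) f z + lam.OP (y n) f z) \<longlonglongrightarrow> 0 + op_limit y f z"
    using f xy by (intro tendsto_add op_limit_tendsto)
  then show "(\<lambda>n. lam.OP (x n) f z) \<longlonglongrightarrow> op_limit y f z"
    by simp
qed

lemma op_limit_TL: "op_limit x \<in> carrier TL" if x: "x \<in> univ.CS"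
  unfolding TL_carrier
proof
  fix B assume B: "B \<in> subalgebras"
  have "\<exists>y\<in>B. cnorm BP (op_limit x \<ominus>\<^bsub>BP\<^esub> y) < e" if e: "e > 0" for e
  proof -
    obtain N where "\<forall>n\<ge>N. cnorm BP (lam.OP (x n) \<ominus>\<^bsub>BP\<^esub> op_limit x) \<le> e / 2"
      using op_limit_norm [OF x, of "e / 2"] e by auto
    then have "cnorm BP (lam.OP (x N) \<ominus>\<^bsub>BP\<^esub> op_limit x) < e"
      using e by (auto intro: le_less_trans)
    moreover have "lam.OP (x N) \<in> B"
      using x by (intro OP_in_subalgebra [OF B]) simp
    moreover have "cnorm BP (op_limit x \<ominus>\<^bsub>BP\<^esub> lam.OP (x N))
        = cnorm BP (lam.OP (x N) \<ominus>\<^bsub>BP\<^esub> op_limit x)"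
      using x by (intro opnorm_minus_commute op_limit_closed OP_closed) simp_all
    ultimately show ?thesis
      by (intro bexI [of _ "lam.OP (x N)"]) simp_all
  qed
  then have "op_limit x \<in> norm_closure BP B"
    unfolding norm_closure_def using op_limit_closed [OF x] by blast
  then show "op_limit x \<in> B"
    using B by (auto simp: subalgebras_def norm_closed_def)
qed

lemma op_limit_mult: "op_limit (\<lambda>n. x n * y n) = op_limit x \<otimes>\<^bsub>BP\<^esub> op_limit y"
  if xy: "x \<in> univ.CS" "y \<in> univ.CS"
proof (rule op_limit_eqI)
  show "op_limit x \<otimes>\<^bsub>BP\<^esub> op_limit y \<in> extensional (ell2 P)"
    by (rule BO_ops_ext)
  fix f z assume f: "f \<in> ell2 P"
  obtain B where B: "B > 0" "\<And>n. U (x n) \<le> B"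
    using univ.CS_bounded [OF xy(1)] by blast
  \<comment> \<open>The operators of x n are uniformly bounded and carry the error ?d n of y n to 0.
    On the fixed vector \<open>op_limit y f\<close> only the operators of x n still vary.\<close>
  let ?d = "\<lambda>n z. lam.OP (y n) f z - op_limit y f z"
  have d: "?d n \<in> ell2 P" for n
    using f xy by (intro ell2_diff) auto
  have "(\<lambda>n. B * ell2_norm P (?d n)) \<longlonglongrightarrow> 0"
    using op_limit_strong [OF xy(2) f] by (rule tendsto_mult_right_zero)
  then have "(\<lambda>n. lam.OP (x n) (?d n) z) \<longlonglongrightarrow> 0"
  proof (rule Lim_null_comparison [rotated], intro always_eventually allI)
    fix n
    have "cmod (lam.OP (x n) (?d n) z) \<le> ell2_norm P (lam.OP (x n) (?d n))"
      using xy d by (intro ell2_bound) simp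
    also have "\<dots> \<le> cnorm BP (lam.OP (x n)) * ell2_norm P (?d n)"
      using xy d by (intro opnorm_bound) auto
    also have "\<dots> \<le> B * ell2_norm P (?d n)"
      using xy B(2) [of n] opnorm_OP_le [of "x n"] by (intro mult_right_mono) auto
    finally show "norm (lam.OP (x n) (?d n) z) \<le> B * ell2_norm P (?d n)" .
  qed
  moreover have "(\<lambda>n. lam.OP (x n) (op_limit y f) z) \<longlonglongrightarrow> op_limit x (op_limit y f) z"
    using f xy by (intro op_limit_tendsto) auto
  ultimately have "(\<lambda>n. lam.OP (x n) (?d n) z + lam.OP (x n) (op_limit y f) z)
      \<longlonglongrightarrow> 0 + op_limit x (op_limit y f) z"
    by (rule tendsto_add)
  moreover have "lam.OP (x n) (?d n) z + lam.OP (x n) (op_limit y f) z = lam.OP (x n * y n) f z" for n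
  proof -
    have "lam.OP (x n) (\<lambda>z. ?d n z + op_limit y f z)
        = (\<lambda>z. lam.OP (x n) (?d n) z + lam.OP (x n) (op_limit y f) z)"
      using xy d f by (intro BO_add [where X = P]) auto
    then show ?thesis
      using f xy by (simp add: lam.OP_times fun_eq_iff)
  qed
  ultimately show "(\<lambda>n. lam.OP (x n * y n) f z) \<longlonglongrightarrow> (op_limit x \<otimes>\<^bsub>BP\<^esub> op_limit y) f z"
    using f by simp
qed (use xy in simp)

lemma op_limit_add: "op_limit (\<lambda>n. x n + y n) = op_limit x \<oplus>\<^bsub>BP\<^esub> op_limit y"
  if xy: "x \<in> univ.CS" "y \<in> univ.CS"
proof (rule op_limit_eqI)
  show "op_limit x \<oplus>\<^bsub>BP\<^esub> op_limit y \<in> extensional (ell2 P)"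
    by (rule BO_ops_ext)
  fix f z assume f: "f \<in> ell2 P"
  show "(\<lambda>n. lam.OP (x n + y n) f z) \<longlonglongrightarrow> (op_limit x \<oplus>\<^bsub>BP\<^esub> op_limit y) f z"
    using tendsto_add [OF op_limit_tendsto [OF xy(1) f, of z] op_limit_tendsto [OF xy(2) f, of z]] f
    by (simp add: lam.OP_plus)
qed (use xy in simp)

lemma op_limit_smult: "op_limit (\<lambda>n. smult A c (x n)) = smult BP c (op_limit x)"
  if x: "x \<in> univ.CS"
proof (rule op_limit_eqI)
  show "smult BP c (op_limit x) \<in> extensional (ell2 P)"
    by (rule BO_ops_ext)
  fix f z assume f: "f \<in> ell2 P"
  show "(\<lambda>n. lam.OP (smult A c (x n)) f z) \<longlonglongrightarrow> smult BP c (op_limit x) f z"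
    using tendsto_mult_left [OF op_limit_tendsto [OF x f, of z], of c] f x
    by (simp add: lam.OP_smult)
qed (use x in simp)

lemma inner_tendsto: "(\<lambda>n. ell2_inner P (lam.OP (x n) f) g) \<longlonglongrightarrow> ell2_inner P (op_limit x f) g"
  if x: "x \<in> univ.CS" and f: "f \<in> ell2 P" and g: "g \<in> ell2 P"
proof -
  let ?d = "\<lambda>n z. lam.OP (x n) f z - op_limit x f z"
  have d: "?d n \<in> ell2 P" for n
    using f x by (intro ell2_diff) auto
  have "(\<lambda>n. ell2_norm P (?d n) * ell2_norm P g) \<longlonglongrightarrow> 0"
    using op_limit_strong [OF x f] by (rule tendsto_mult_left_zero)
  then have "(\<lambda>n. ell2_inner P (?d n) g) \<longlonglongrightarrow> 0"
    by (rule Lim_null_comparison [rotated])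
      (use ell2_Cauchy_Schwarz [OF d g] in \<open>auto intro: always_eventually\<close>)
  then have "(\<lambda>n. ell2_inner P (?d n) g + ell2_inner P (op_limit x f) g)
      \<longlonglongrightarrow> 0 + ell2_inner P (op_limit x f) g"
    by (intro tendsto_add) auto
  moreover have "ell2_inner P (?d n) g + ell2_inner P (op_limit x f) g = ell2_inner P (lam.OP (x n) f) g" for n
    using ell2_inner_add_left [OF d op_limit_ell2 [OF x f] g, of n] by simp
  ultimately show ?thesis
    by simp
qed

lemma op_limit_star: "op_limit (\<lambda>n. star A (x n)) = star BP (op_limit x)" if x: "x \<in> univ.CS"
proof (rule BO_star_unique [OF op_limit_closed [OF x], symmetric])
  show "op_limit (\<lambda>n. star A (x n)) \<in> extensional (ell2 P)"
    by (simp add: op_limit_def)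
  have sx: "(\<lambda>n. star A (x n)) \<in> univ.CS"
    using x by simp
  fix f g assume f: "f \<in> ell2 P" and g: "g \<in> ell2 P"
  show "op_limit (\<lambda>n. star A (x n)) g \<in> ell2 P"
    using sx g by simp
  have "(\<lambda>n. cnj (ell2_inner P (lam.OP (star A (x n)) g) f))
      \<longlonglongrightarrow> cnj (ell2_inner P (op_limit (\<lambda>n. star A (x n)) g) f)"
    by (intro tendsto_cnj inner_tendsto [OF sx g f])
  moreover have "cnj (ell2_inner P (lam.OP (star A (x n)) g) f) = ell2_inner P (lam.OP (x n) f) g" for n
    using lam.inner_rho [of "x n" f g] f g x
    by (simp add: lam.OP_def ell2_inner_commute [symmetric])
  ultimately have "ell2_inner P (op_limit x f) g = cnj (ell2_inner P (op_limit (\<lambda>n. star A (x n)) g) f)"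
    using LIMSEQ_unique [OF inner_tendsto [OF x f g]] by simp
  then show "ell2_inner P (op_limit x f) g = ell2_inner P f (op_limit (\<lambda>n. star A (x n)) g)"
    by (simp add: ell2_inner_commute [symmetric])
qed

section \<open>Existence and uniqueness of the homomorphism to the reduced algebra\<close>

definition lambda_hom :: "(nat \<Rightarrow> 'g free_elem) set \<Rightarrow> ('g \<Rightarrow> complex) \<Rightarrow> 'g \<Rightarrow> complex"
  where "lambda_hom = (\<lambda>C\<in>carrier TU. op_limit (SOME x. x \<in> univ.CS \<and> univ.cls x = C))"

lemma lambda_hom_cls: "lambda_hom (univ.cls x) = op_limit x" if x: "x \<in> univ.CS"
proof -
  let ?y = "SOME y. y \<in> univ.CS \<and> univ.cls y = univ.cls x"
  have "?y \<in> univ.CS \<and> univ.cls ?y = univ.cls x"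
    by (rule someI [of _ x]) (use x in simp)
  then show ?thesis
    using op_limit_cong [of ?y x] x by (simp add: lambda_hom_def TU_eq)
qed

lemma lambda_hom_star_hom: "lambda_hom \<in> star_homs TU TL"
proof -
  have "lambda_hom \<in> ring_hom univ.T TL"
  proof (rule ring_hom_memI)
    show "lambda_hom \<one>\<^bsub>univ.T\<^esub> = \<one>\<^bsub>TL\<^esub>"
      by (simp add: lambda_hom_cls op_limit_const lam.OP_one free_algebra_closed del: BO_simps)
  qed (auto elim!: univ.carrier_TE simp: lambda_hom_cls op_limit_TL op_limit_mult op_limit_add
      simp del: BO_simps)
  moreover have "lambda_hom (smult univ.T c C) = smult TL c (lambda_hom C)"
      "lambda_hom (star univ.T C) = star TL (lambda_hom C)" if "C \<in> carrier univ.T" for c C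
    using that by (auto elim!: univ.carrier_TE simp: lambda_hom_cls op_limit_smult op_limit_star
      simp del: BO_simps)
  ultimately show ?thesis
    by (simp add: star_homs_def TU_eq)
qed

text \<open>Automatic continuity, needed because \<open>lambda_plus\<close> is specified
  algebraically. If the image M of x had norm n larger than that of x, then 1 minus x* x / n^2 would
  be left invertible by the Neumann series, and so would its image. The image being bounded below
  keeps M away from its own norm n, which is absurd.\<close>

lemma star_hom_contractive:
  assumes h: "h \<in> star_homs TU TL" and x: "x \<in> univ.CS"
  shows "cnorm BP (h (univ.cls x)) \<le> cnorm univ.T (univ.cls x)"
proof (rule ccontr)
  define M where "M = h (univ.cls x)"
  define n where "n = cnorm BP M"
  assume "\<not> ?thesis"
  then have less: "cnorm univ.T (univ.cls x) < n"
    by (simp add: n_def M_def)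
  have n: "n > 0"
    using less univ.T_norm_nonneg [OF x] by simp
  have hom: "h \<in> ring_hom univ.T TL"
    "\<And>c C. C \<in> carrier univ.T \<Longrightarrow> h (smult univ.T c C) = smult BP c (h C)"
    "\<And>C. C \<in> carrier univ.T \<Longrightarrow> h (star univ.T C) = star BP (h C)"
    using h by (auto simp: star_homs_def TU_eq simp del: BO_simps)
  have hB: "h C \<in> carrier BP" if "C \<in> carrier univ.T" for C
    using ring_hom_closed [OF hom(1) that] TL_subset by blast
  have M: "M \<in> carrier BP"
    unfolding M_def using x by (intro hB) simp
  \<comment> \<open>Division by the square of n brings the norm of x* x below 1, so that the Neumann
    series gives a left inverse of 1 - s.\<close>
  define s where "s k = smult A (of_real (inverse (n\<^sup>2))) (star A (x k) * x k)" for k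
  have s: "s \<in> univ.CS"
    unfolding s_def [abs_def] using x by simp
  have "cnorm univ.T (univ.cls s) < 1"
  proof -
    have "(\<lambda>k. inverse (n\<^sup>2) * (U (x k))\<^sup>2) \<longlonglongrightarrow> inverse (n\<^sup>2) * (cnorm univ.T (univ.cls x))\<^sup>2"
      using univ.T_norm [OF x] by (intro tendsto_intros)
    moreover have "inverse (n\<^sup>2) * (U (x k))\<^sup>2 = U (s k)" for k
      using x n by (simp add: s_def univ.q_smult univ.q_star_mult norm_inverse norm_power)
    ultimately have "cnorm univ.T (univ.cls s) = inverse (n\<^sup>2) * (cnorm univ.T (univ.cls x))\<^sup>2"
      using univ.T_norm [OF s] LIMSEQ_unique by simp
    also have "(cnorm univ.T (univ.cls x))\<^sup>2 < n\<^sup>2"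
      using less univ.T_norm_nonneg [OF x] by (intro power_strict_mono) auto
    then have "inverse (n\<^sup>2) * (cnorm univ.T (univ.cls x))\<^sup>2 < 1"
      using n by (simp add: field_simps)
    finally show ?thesis .
  qed
  then obtain y where y: "y \<in> univ.CS" "univ.cls y \<otimes>\<^bsub>univ.T\<^esub> (\<one>\<^bsub>univ.T\<^esub> \<ominus>\<^bsub>univ.T\<^esub> univ.cls s) = \<one>\<^bsub>univ.T\<^esub>"
    using univ.T_neumann [OF s] by blast
  define Y where "Y = h (univ.cls y)"
  have Y: "Y \<in> carrier BP"
    unfolding Y_def using y by (intro hB) simp
  let ?c = "- complex_of_real (inverse (n\<^sup>2))"
  have one_s: "(\<lambda>k. 1 + smult A ?c (star A (x k) * x k)) \<in> univ.CS"
    using x free_algebra_closed by simp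
  have s_eq: "1 - s k = 1 + smult A ?c (star A (x k) * x k)" for k
    using univ.smult(3) [of "star A (x k) * x k" "-1"] univ.smult_minus [of "s k"] s x
    by (simp add: s_def)
  have M_eq: "h (univ.cls (\<lambda>k. 1 + smult A ?c (star A (x k) * x k)))
      = \<one>\<^bsub>BP\<^esub> \<oplus>\<^bsub>BP\<^esub> smult BP ?c (star BP M \<otimes>\<^bsub>BP\<^esub> M)"
  proof -
    have "univ.cls (\<lambda>k. 1 + smult A ?c (star A (x k) * x k))
        = \<one>\<^bsub>univ.T\<^esub> \<oplus>\<^bsub>univ.T\<^esub> smult univ.T ?c (star univ.T (univ.cls x) \<otimes>\<^bsub>univ.T\<^esub> univ.cls x)"
      using x by simp
    moreover have "star univ.T (univ.cls x) \<in> carrier univ.T"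
      "star univ.T (univ.cls x) \<otimes>\<^bsub>univ.T\<^esub> univ.cls x \<in> carrier univ.T"
      "smult univ.T ?c (star univ.T (univ.cls x) \<otimes>\<^bsub>univ.T\<^esub> univ.cls x) \<in> carrier univ.T"
      "\<one>\<^bsub>univ.T\<^esub> \<in> carrier univ.T" "univ.cls x \<in> carrier univ.T"
      using x free_algebra_closed by simp_all
    ultimately show ?thesis
      using ring_hom_add [OF hom(1)] ring_hom_mult [OF hom(1)] ring_hom_one [OF hom(1)] hom(2,3)
      unfolding M_def by (simp del: BO_simps univ.T_const univ.T_ops)
  qed
  have inverse: "Y \<otimes>\<^bsub>BP\<^esub> (\<one>\<^bsub>BP\<^esub> \<oplus>\<^bsub>BP\<^esub> smult BP ?c (star BP M \<otimes>\<^bsub>BP\<^esub> M)) = \<one>\<^bsub>BP\<^esub>"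
  proof -
    have "univ.cls y \<otimes>\<^bsub>univ.T\<^esub> univ.cls (\<lambda>k. 1 + smult A ?c (star A (x k) * x k)) = \<one>\<^bsub>univ.T\<^esub>"
      using y(2) s free_algebra_closed by (simp add: univ.T_minus s_eq)
    then have "h (univ.cls y) \<otimes>\<^bsub>BP\<^esub> h (univ.cls (\<lambda>k. 1 + smult A ?c (star A (x k) * x k))) = \<one>\<^bsub>BP\<^esub>"
      using ring_hom_mult [OF hom(1), of "univ.cls y" "univ.cls (\<lambda>k. 1 + smult A ?c (star A (x k) * x k))"]
        ring_hom_one [OF hom(1)] y(1) one_s by (simp del: BO_simps univ.T_const univ.T_ops)
    then show ?thesis
      by (simp only: M_eq Y_def)
  qed
  \<comment> \<open>The maximum with 1 makes 1 - 1 / C^2 nonnegative, so that r below is a genuine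
    square root.\<close>
  define C where "C = max 1 (cnorm BP Y)"
  have C: "C \<ge> 1" "C \<ge> cnorm BP Y"
    by (simp_all add: C_def)
  have key: "(ell2_norm P f)\<^sup>2 \<le> C\<^sup>2 * ((ell2_norm P f)\<^sup>2 - (ell2_norm P (M f))\<^sup>2 / n\<^sup>2)"
    if f: "f \<in> ell2 P" for f
  proof -
    let ?g = "\<lambda>z. ?c * star BP M (M f) z"
    have Mf: "M f \<in> ell2 P" "star BP M (M f) \<in> ell2 P"
      using BO_ell2 [OF M f] BO_star_ell2 [OF M BO_ell2 [OF M f]] by simp_all
    have "Y (\<lambda>z. f z + ?g z) = f"
      using fun_cong [OF inverse, of f] f by simp
    then have "ell2_norm P f \<le> cnorm BP Y * ell2_norm P (\<lambda>z. f z + ?g z)"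
      using opnorm_bound [OF Y, of "\<lambda>z. f z + ?g z"] f Mf by simp
    also have "\<dots> \<le> C * ell2_norm P (\<lambda>z. f z + ?g z)"
      using C by (intro mult_right_mono) auto
    finally have "(ell2_norm P f)\<^sup>2 \<le> (C * ell2_norm P (\<lambda>z. f z + ?g z))\<^sup>2"
      by (intro power_mono) auto
    \<comment> \<open>Expanding the square gives -2 times the squared norm of M f over n^2 from the
      inner product. The square of ?g gives back at most one such term, because the adjoint of M has
      norm at most n.\<close>
    moreover have "(ell2_norm P (\<lambda>z. f z + ?g z))\<^sup>2 \<le> (ell2_norm P f)\<^sup>2 - (ell2_norm P (M f))\<^sup>2 / n\<^sup>2"
    proof -
      have "ell2_inner P f (star BP M (M f)) = of_real ((ell2_norm P (M f))\<^sup>2)"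
        using BO_star_inner [OF M Mf(1) f] ell2_inner_self [OF Mf(1)] by simp
      then have "ell2_inner P f ?g = of_real (- inverse (n\<^sup>2) * (ell2_norm P (M f))\<^sup>2)"
        unfolding ell2_inner_scale_right by simp
      then have "Re (ell2_inner P f ?g) = - inverse (n\<^sup>2) * (ell2_norm P (M f))\<^sup>2"
        by (simp only: Re_complex_of_real)
      also have "\<dots> = - ((ell2_norm P (M f))\<^sup>2 / n\<^sup>2)"
        by (simp only: divide_inverse mult.commute minus_mult_left)
      finally have "Re (ell2_inner P f ?g) = - ((ell2_norm P (M f))\<^sup>2 / n\<^sup>2)" .
      then have "(ell2_norm P (\<lambda>z. f z + ?g z))\<^sup>2
          = (ell2_norm P f)\<^sup>2 - 2 * ((ell2_norm P (M f))\<^sup>2 / n\<^sup>2) + (ell2_norm P ?g)\<^sup>2"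
        using ell2_norm_add_sq [OF f ell2_scale [OF Mf(2)], of ?c] by simp
      moreover have "(ell2_norm P ?g)\<^sup>2 \<le> (ell2_norm P (M f))\<^sup>2 / n\<^sup>2"
      proof -
        have "ell2_norm P (star BP M (M f)) \<le> n * ell2_norm P (M f)"
          using opnorm_bound [OF BO_star_closed [OF M] Mf(1)] opnorm_star_le [OF M]
            mult_right_mono [of _ n "ell2_norm P (M f)"] unfolding n_def
          by (meson ell2_norm_nonneg mult_right_mono order_trans)
        then have "inverse (n\<^sup>2) * ell2_norm P (star BP M (M f)) \<le> inverse (n\<^sup>2) * (n * ell2_norm P (M f))"
          using n by (intro mult_left_mono) auto
        also have "\<dots> = ell2_norm P (M f) / n"
          using n by (simp add: power2_eq_square field_simps)
        also have "inverse (n\<^sup>2) * ell2_norm P (star BP M (M f)) = ell2_norm P ?g"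
          unfolding ell2_norm_scale norm_minus_cancel norm_of_real by simp
        finally have "(ell2_norm P ?g)\<^sup>2 \<le> (ell2_norm P (M f) / n)\<^sup>2"
          by (intro power_mono) auto
        then show ?thesis
          by (simp add: power_divide)
      qed
      ultimately show ?thesis by simp
    qed
    then have "C\<^sup>2 * (ell2_norm P (\<lambda>z. f z + ?g z))\<^sup>2 \<le> C\<^sup>2 * ((ell2_norm P f)\<^sup>2 - (ell2_norm P (M f))\<^sup>2 / n\<^sup>2)"
      by (intro mult_left_mono) auto
    ultimately show ?thesis
      by (simp add: power_mult_distrib)
  qed
  \<comment> \<open>Solving \<open>key\<close> for the norm of M f bounds it by n r times the norm
    of f, with r < 1 because C is finite.\<close>
  define r where "r = sqrt (1 - 1 / C\<^sup>2)"
  have r: "0 \<le> r" "r < 1" "r\<^sup>2 = 1 - 1 / C\<^sup>2"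
    using C(1) by (auto simp: r_def)
  have "ell2_norm P (M f) \<le> (n * r) * ell2_norm P f" if f: "f \<in> ell2 P" for f
  proof (rule power2_le_imp_le)
    have "(ell2_norm P f)\<^sup>2 / C\<^sup>2 \<le> (ell2_norm P f)\<^sup>2 - (ell2_norm P (M f))\<^sup>2 / n\<^sup>2"
      using key [OF f] C(1) by (simp add: field_simps)
    then have "(ell2_norm P (M f))\<^sup>2 / n\<^sup>2 \<le> r\<^sup>2 * (ell2_norm P f)\<^sup>2"
      unfolding r(3) by (simp add: left_diff_distrib)
    then show "(ell2_norm P (M f))\<^sup>2 \<le> ((n * r) * ell2_norm P f)\<^sup>2"
      using n by (simp add: field_simps power_mult_distrib)
  qed (use r n in simp)
  then have "n \<le> n * r"
    unfolding n_def using r n by (intro opnorm_leI) (auto simp: n_def)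
  then show False
    using n r by simp
qed

text \<open>Both maps agree on constant sequences, which are built algebraically from the
  generators. Constants are dense and h is contractive, so the values of h are the limits that
  define \<open>op_limit\<close>.\<close>

lemma star_hom_unique:
  assumes h: "h \<in> star_homs TU TL" "h \<in> extensional (carrier TU)"
    and gen: "\<And>p. p \<in> P \<Longrightarrow> h (toeplitz_gen G P p) = left_regular G P p"
  shows "h = lambda_hom"
proof -
  have hom: "h \<in> ring_hom univ.T TL"
    "\<And>c C. C \<in> carrier univ.T \<Longrightarrow> h (smult univ.T c C) = smult BP c (h C)"
    "\<And>C. C \<in> carrier univ.T \<Longrightarrow> h (star univ.T C) = star BP (h C)"
    using h by (auto simp: star_homs_def TU_eq simp del: BO_simps)
  have hB: "h C \<in> carrier BP" if "C \<in> carrier univ.T" for C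
    using ring_hom_closed [OF hom(1) that] TL_subset by blast
  have hmult: "h (univ.cst (a * b)) = h (univ.cst a) \<otimes>\<^bsub>BP\<^esub> h (univ.cst b)"
    and hadd: "h (univ.cst (a + b)) = h (univ.cst a) \<oplus>\<^bsub>BP\<^esub> h (univ.cst b)"
    and hsmult: "h (univ.cst (smult A c a)) = smult BP c (h (univ.cst a))"
    and hstar: "h (univ.cst (star A a)) = star BP (h (univ.cst a))"
    if "a \<in> carrier A" "b \<in> carrier A" for a b c
    using that ring_hom_mult [OF hom(1), of "univ.cst a" "univ.cst b"]
      ring_hom_add [OF hom(1), of "univ.cst a" "univ.cst b"]
      hom(2) [of "univ.cst a" c] hom(3) [of "univ.cst a"]
    by (simp_all del: BO_simps)
  have const: "h (univ.cst a) = lam.OP a" if "a \<in> carrier A" for a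
    using that
  proof (induction rule: free_algebra_induct)
    case one
    then show ?case
      using ring_hom_one [OF hom(1)] by (simp add: lam.OP_one del: BO_simps)
  next
    case (gen p)
    then show ?case
      using assms(3) [OF gen] left_regular_eq [OF gen] by (simp add: toeplitz_gen_eq)
  next
    case (star a)
    then show ?case
      using hstar [of a a] lam.OP_star [of a] by simp
  next
    case (mult a b)
    then show ?case
      using hmult [of a b] lam.OP_times [of a b] by (simp del: BO_simps)
  next
    case (smult c a)
    then show ?case
      using hsmult [of a a c] lam.OP_smult [of a c] by (simp del: BO_simps)
  next
    case (add a b)
    then show ?case
      using hadd [of a b] lam.OP_plus [of a b] by (simp del: BO_simps)
  qed
  show ?thesis
  proof (rule extensionalityI [OF h(2)])
    show "lambda_hom \<in> extensional (carrier TU)"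
      by (simp add: lambda_hom_def)
    fix C assume "C \<in> carrier TU"
    then obtain x where x: "x \<in> univ.CS" "C = univ.cls x"
      by (auto simp: TU_eq elim: univ.carrier_TE)
    have hC: "h C \<in> carrier BP"
      using x by (intro hB) simp
    have "op_limit x = h C"
    proof (rule op_limit_eqI [OF x(1) BO_ext [OF hC]])
      fix f z assume f: "f \<in> ell2 P"
      show "(\<lambda>n. lam.OP (x n) f z) \<longlonglongrightarrow> h C f z"
      proof (rule LIMSEQ_I)
        fix e :: real assume "e > 0"
        define d where "d = e / (ell2_norm P f + 1)"
        have pos: "ell2_norm P f + 1 > 0"
          using ell2_norm_nonneg [of P f] by linarith
        have "d > 0"
          using \<open>e > 0\<close> pos by (simp add: d_def)
        then obtain N where N: "\<And>n. n \<ge> N \<Longrightarrow> cnorm univ.T (univ.cls x \<ominus>\<^bsub>univ.T\<^esub> univ.cst (x n)) < d"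
          using univ.cst_dense [OF x(1)] by blast
        have "norm (lam.OP (x n) f z - h C f z) < e" if "n \<ge> N" for n
        proof -
          \<comment> \<open>The difference is written with the scalar -1 because h is known to
            respect sums and scalar multiples.\<close>
          let ?y = "\<lambda>k. x k + smult A (-1) (x n)"
          have y: "?y \<in> univ.CS"
            using x by simp
          have "univ.cls x \<ominus>\<^bsub>univ.T\<^esub> univ.cst (x n) = univ.cls ?y"
            using x by (simp add: univ.T_minus univ.smult_minus)
          then have less: "cnorm univ.T (univ.cls ?y) < d"
            using N [OF that] by simp
          have "univ.cls ?y = univ.cls x \<oplus>\<^bsub>univ.T\<^esub> univ.cst (smult A (-1) (x n))"
            using x by simp
          moreover have "univ.cst (smult A (-1) (x n)) \<in> carrier univ.T"
            using x by simp
          ultimately have "h (univ.cls ?y) = h C \<oplus>\<^bsub>BP\<^esub> h (univ.cst (smult A (-1) (x n)))"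
            using ring_hom_add [OF hom(1), of "univ.cls x" "univ.cst (smult A (-1) (x n))"] x
            by (simp del: BO_simps univ.T_ops)
          also have "h (univ.cst (smult A (-1) (x n))) = lam.OP (smult A (-1) (x n))"
            using x by (intro const) simp
          finally have "h (univ.cls ?y) f z = h C f z - lam.OP (x n) f z"
            using f x by (simp add: lam.OP_smult)
          then have "norm (lam.OP (x n) f z - h C f z) = cmod (h (univ.cls ?y) f z)"
            by (simp add: norm_minus_commute)
          also have "\<dots> \<le> ell2_norm P (h (univ.cls ?y) f)"
            using y f BO_ell2 [OF hB [OF univ.cls_carrier [OF y]] f] by (intro ell2_bound)
          also have "\<dots> \<le> cnorm BP (h (univ.cls ?y)) * ell2_norm P f"
            using y f hB by (intro opnorm_bound) auto
          also have "\<dots> \<le> d * ell2_norm P f"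
            using star_hom_contractive [OF h(1) y] less by (intro mult_right_mono) auto
          also have "\<dots> < d * (ell2_norm P f + 1)"
            using \<open>d > 0\<close> by simp
          also have "\<dots> = e"
            using pos by (simp add: d_def)
          finally show ?thesis .
        qed
        then show "\<exists>N. \<forall>n\<ge>N. norm (lam.OP (x n) f z - h C f z) < e"
          by blast
      qed
    qed
    then show "h C = lambda_hom C"
      using x by (simp add: lambda_hom_cls)
  qed
qed

lemma lambda_plus_eq: "lambda_plus G P = lambda_hom"
  unfolding lambda_plus_def
proof (rule the_equality)
  have "lambda_hom \<in> extensional (carrier TU)"
    by (simp add: lambda_hom_def)
  moreover have "lambda_hom (toeplitz_gen G P p) = left_regular G P p" if "p \<in> P" for p
    using that by (simp add: toeplitz_gen_eq lambda_hom_cls op_limit_const left_regular_eq)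
  ultimately show "lambda_hom \<in> star_homs TU TL \<and> lambda_hom \<in> extensional (carrier TU) \<and>
      (\<forall>p\<in>P. lambda_hom (toeplitz_gen G P p) = left_regular G P p)"
    using lambda_hom_star_hom by blast
qed (blast intro: star_hom_unique)

lemma lambda_kernel: "univ.cls x \<in> a_kernel TU TL (lambda_plus G P) \<longleftrightarrow> op_limit x = \<zero>\<^bsub>BP\<^esub>"
  if "x \<in> univ.CS"
  using that by (simp add: a_kernel_def kernel_def TU_eq lambda_plus_eq lambda_hom_cls del: BO_simps)

section \<open>Ideals with trivial intersection with the diagonal\<close>

lemma word_prod_TU: "word_prod TU (toeplitz_gen G P) \<alpha> = univ.cst (t \<alpha>)" if "\<alpha> \<in> words P"
  using that
  by (induction \<alpha> rule: word_induct) (simp_all add: TU_eq toeplitz_gen_eq free_algebra_ops)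

lemma D_u_eq: "D_u G P = norm_closure TU (univ.cst ` univ.D0)"
proof -
  let ?S = "word_prod TU (toeplitz_gen G P) ` N"
  have "linear_subspace TU (univ.cst ` univ.D0)"
    unfolding linear_subspace_def TU_eq
  proof (intro conjI ballI allI)
    show "\<zero>\<^bsub>univ.T\<^esub> \<in> univ.cst ` univ.D0"
      by auto
  qed (auto intro: univ.D0_add univ.D0_smult)
  moreover have "?S \<subseteq> univ.cst ` univ.D0"
    by (auto simp: word_prod_TU intro: univ.D0_word)
  moreover have "univ.cst x \<in> V" if V: "linear_subspace TU V" "?S \<subseteq> V" and x: "x \<in> univ.D0" for V x
    using x
  proof (induction rule: univ.D0.induct)
    case (D0_word \<alpha>)
    then show ?case
      using V(2) word_prod_TU [of \<alpha>] by auto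
  next
    case (D0_add x y)
    then have "univ.cst x \<oplus>\<^bsub>TU\<^esub> univ.cst y \<in> V"
      using V(1) by (simp add: linear_subspace_def)
    then show ?case
      using D0_add by (simp add: TU_eq)
  next
    case (D0_smult x c)
    then have "smult TU c (univ.cst x) \<in> V"
      using V(1) by (simp add: linear_subspace_def)
    then show ?case
      using D0_smult by (simp add: TU_eq)
  qed
  ultimately have "linear_span TU ?S = univ.cst ` univ.D0"
    unfolding linear_span_def by blast
  then show ?thesis
    by (simp add: D_u_def)
qed

lemma cst_D_u: "univ.cst x \<in> D_u G P" if x: "x \<in> univ.D0"
proof -
  have "cnorm univ.T (univ.cst x \<ominus>\<^bsub>univ.T\<^esub> univ.cst x) = 0"
    using x univ.T_norm_cst [of 0] by (simp add: univ.T_minus)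
  then show ?thesis
    using x unfolding D_u_eq norm_closure_def TU_eq by force
qed

text \<open>Diagonal matrix coefficients see only neutral words: a word sends the basis vector of p
  to that of its value times p, or to 0, and returns to p only if the value is trivial.\<close>

lemma lam_delta_at:
  assumes w: "set (letters w) \<subseteq> alphabet P" and p: "p \<in> P"
  shows "lam.mop w (ell2_delta p) p
    = of_bool (val (monomial_word G w) = \<one> \<and> p \<in> K (monomial_word G w))"
proof -
  let ?\<alpha> = "monomial_word G w"
  have \<alpha>: "?\<alpha> \<in> words P"
    using univ.monomial_word_words [OF w] .
  have \<delta>: "ell2_delta p \<in> ell2 P"
    using p by (rule ell2_delta)
  have "lam.mop w (ell2_delta p) = lam.rho (Poly_Mapping.single w 1) (ell2_delta p)"
    by (simp add: lam.rho_single)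
  also have "\<dots> = lam.rho (t ?\<alpha>) (ell2_delta p)"
    using \<delta> by (intro lam.rho_eqv lam.monomial_eqv_word w) simp
  finally have "lam.mop w (ell2_delta p) p
      = (if p \<in> K (word_tilde ?\<alpha>) then ell2_delta p (inv (val ?\<alpha>) \<otimes> p) else 0)"
    using lam.rho_word [OF \<alpha>, of "ell2_delta p"] \<delta> p by simp
  moreover have "inv (val ?\<alpha>) \<otimes> p = p \<longleftrightarrow> val ?\<alpha> = \<one>"
  proof
    assume "inv (val ?\<alpha>) \<otimes> p = p"
    then have "inv (val ?\<alpha>) = \<one>"
      using p \<alpha> by (metis P_carrier inv_closed r_cancel_one val_carrier)
    then show "val ?\<alpha> = \<one>"
      using \<alpha> by (metis inv_inv inv_one val_carrier)
  qed (use p in simp)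
  moreover have "p \<in> K (word_tilde ?\<alpha>) \<longleftrightarrow> p \<in> K ?\<alpha>" if "val ?\<alpha> = \<one>"
    using K_tilde_neutral [OF neutralI [OF \<alpha> that]] by simp
  ultimately show ?thesis
    by (auto simp: ell2_delta_def)
qed

lemma lam_shift_delta:
  assumes s: "s \<in> P"
  shows "lam.rho (t [(s, \<one>)]) (ell2_delta s) = ell2_delta \<one>"
    and "lam.rho (t [(\<one>, s)]) (ell2_delta \<one>) = ell2_delta s"
proof -
  have sG: "s \<in> carrier G"
    using s by simp
  show "lam.rho (t [(s, \<one>)]) (ell2_delta s) = ell2_delta \<one>"
  proof
    fix x
    have "x \<in> P \<Longrightarrow> s \<otimes> x = s \<longleftrightarrow> x = \<one>"
      using s by simp
    then show "lam.rho (t [(s, \<one>)]) (ell2_delta s) x = ell2_delta \<one> x"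
      using s lam.rho_word [of "[(s, \<one>)]" "ell2_delta s"] ell2_delta(1) [OF s]
      by (auto simp: val_single K_single ell2_delta_def simp del: word_prod.simps)
  qed
  show "lam.rho (t [(\<one>, s)]) (ell2_delta \<one>) = ell2_delta s"
  proof
    fix x
    have "x \<in> P \<Longrightarrow> inv s \<otimes> x = \<one> \<longleftrightarrow> x = s"
      using sG by (metis P_carrier inv_mult_cancel(2) l_inv r_one)
    then show "lam.rho (t [(\<one>, s)]) (ell2_delta \<one>) x = ell2_delta s x"
      using s lam.rho_word [of "[(\<one>, s)]" "ell2_delta \<one>"] ell2_delta(1) [OF P.one_closed]
      by (auto simp: val_single K_single ell2_delta_def simp del: word_prod.simps)
  qed
qed

lemma lam_cprod_delta: "lam.rho (univ.cprod \<gamma>s) (ell2_delta \<one>) = ell2_delta \<one>"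
  if "set \<gamma>s \<subseteq> N" "\<And>\<gamma>. \<gamma> \<in> set \<gamma>s \<Longrightarrow> \<one> \<notin> K \<gamma>"
proof -
  have "lam.rho (univ.cprod \<gamma>s) (ell2_delta \<one>) =
      (\<lambda>x. if x \<in> (\<Union>\<gamma>\<in>set \<gamma>s. K \<gamma>) then 0 else ell2_delta \<one> x)"
    using lam.rho_cprod [OF that(1), of "ell2_delta \<one>"] ell2_delta(1) [OF P.one_closed] by simp
  then show ?thesis
    using that(2) by (auto simp: fun_eq_iff ell2_delta_def)
qed

text \<open>The adjoint replaces an approximation of f by basis vectors. All coordinates of the
  adjoint applied to the basis vector of y vanish, and f paired with this zero vector is the
  coordinate of the image of f at y.\<close>

lemma op_limit_zeroI:
  assumes x: "x \<in> univ.CS" and zero: "\<And>p. p \<in> P \<Longrightarrow> op_limit x (ell2_delta p) = (\<lambda>_. 0)"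
  shows "op_limit x = \<zero>\<^bsub>BP\<^esub>"
proof (rule extensionalityI)
  let ?M = "op_limit x"
  have M: "?M \<in> carrier BP"
    using x by (rule op_limit_closed)
  show "op_limit x \<in> extensional (ell2 P)" "\<zero>\<^bsub>BP\<^esub> \<in> extensional (ell2 P)"
    using BO_ext [OF M] by simp_all
  fix f assume f: "f \<in> ell2 P"
  have "op_limit x f y = 0" for y
  proof (cases "y \<in> P")
    case False
    then show ?thesis
      using ell2_supp [OF BO_ell2 [OF M f]] by blast
  next
    case True
    note \<delta> = ell2_delta(1) [OF True]
    let ?k = "star BP ?M (ell2_delta y)"
    have k: "?k \<in> ell2 P"
      by (rule BO_star_ell2 [OF M \<delta>])
    have "?k p = 0" for p
    proof (cases "p \<in> P")
      case p: True
      have "cnj (?k p) = ell2_inner P (ell2_delta p) ?k"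
        using p by (simp add: ell2_inner_delta)
      also have "\<dots> = ell2_inner P (?M (ell2_delta p)) (ell2_delta y)"
        using BO_star_inner [OF M \<delta> ell2_delta(1) [OF p]] by simp
      also have "\<dots> = 0"
        using True by (simp add: zero [OF p] ell2_inner_delta)
      finally show ?thesis by simp
    qed (use ell2_supp [OF k] in blast)
    then have "?k = (\<lambda>_. 0)"
      by blast
    moreover have "?M f y = ell2_inner P f ?k"
      using BO_star_inner [OF M \<delta> f] True by (simp add: ell2_inner_delta)
    ultimately show ?thesis
      by (simp add: ell2_inner_def)
  qed
  then show "op_limit x f = \<zero>\<^bsub>BP\<^esub> f"
    using f by auto
qed

text \<open>
  If \<open>f\<close> is a projection and \<open>y\<close> in a closed ideal is close to \<open>f\<close> and lives in the corner of
  \<open>f\<close>, then \<open>f = lim (f - (f - y)\<^sup>n)\<close> lies in the ideal.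
\<close>

lemma corner_in_ideal:
  assumes I: "ideal I TU" "norm_closed TU I" and f: "f \<in> carrier A" "univ.eqv (f * f) f"
    and y: "y \<in> univ.CS" "univ.cls y \<in> I" "\<And>k. univ.eqv (y k * f) (y k)"
    and less: "cnorm univ.T (univ.cls (\<lambda>k. f - y k)) < 1"
  shows "univ.cst f \<in> I"
proof -
  interpret I: ideal I univ.T
    using I(1) by (simp add: TU_eq)
  define z where "z k = f - y k" for k
  have z: "z \<in> univ.CS"
    unfolding z_def [abs_def] using f(1) y(1) by simp
  have zf: "univ.eqv (z k * f) (z k)" for k
    unfolding z_def left_diff_distrib by (rule univ.eqv_diff [OF f(2) y(3)])
  have zn: "(\<lambda>k. z k ^ n) \<in> univ.CS" for n
    by (induction n) (use z free_algebra_closed in simp_all)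
  \<comment> \<open>The exponent starts at 1, where the difference is y. For exponent 0 it would be
    f - 1, which need not lie in the ideal.\<close>
  have in_I: "univ.cls (\<lambda>k. f - z k ^ Suc n) \<in> I" for n
  proof (induction n)
    case 0
    then show ?case
      using y(2) by (simp add: z_def)
  next
    case (Suc n)
    \<comment> \<open>Since f acts as a right unit on z, the next difference exceeds the present one
      by a multiple of y, modulo U.\<close>
    have "univ.eqv (f - z k ^ Suc (Suc n)) (f - z k ^ Suc n + z k ^ Suc n * y k)" for k
    proof -
      have zk: "z k \<in> carrier A"
        using z by simp
      have "univ.eqv (z k ^ Suc n * f) (z k ^ Suc n)"
      proof -
        have "z k ^ Suc n * f = z k ^ n * (z k * f)"
          by (simp only: power_Suc2 mult.assoc)
        also have "univ.eqv \<dots> (z k ^ n * z k)"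
          using zf zk by (intro univ.eqv_mult) auto
        finally show ?thesis
          by (simp only: power_Suc2)
      qed
      then have "univ.eqv (f - z k ^ Suc n + z k ^ Suc n * f - z k ^ Suc n * z k)
          (f - z k ^ Suc n + z k ^ Suc n - z k ^ Suc n * z k)"
        using f(1) zk by (intro univ.eqv_diff univ.eqv_add) auto
      moreover have "f - z k ^ Suc n + z k ^ Suc n * f - z k ^ Suc n * z k
          = f - z k ^ Suc n + z k ^ Suc n * y k"
        by (simp add: z_def right_diff_distrib algebra_simps)
      moreover have "f - z k ^ Suc n + z k ^ Suc n - z k ^ Suc n * z k = f - z k ^ Suc (Suc n)"
        by (simp only: diff_add_cancel power_Suc2)
      ultimately show ?thesis
        using univ.eqv_sym by metis
    qed
    then have "univ.cls (\<lambda>k. f - z k ^ Suc (Suc n))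
        = univ.cls (\<lambda>k. f - z k ^ Suc n + z k ^ Suc n * y k)"
      using f(1) y(1) zn by (intro univ.cls_eqvI univ.CS_minus univ.CS_add univ.CS_mult univ.CS_const)
    also have "\<dots> = univ.cls (\<lambda>k. f - z k ^ Suc n)
        \<oplus>\<^bsub>univ.T\<^esub> (univ.cls (\<lambda>k. z k ^ Suc n) \<otimes>\<^bsub>univ.T\<^esub> univ.cls y)"
      using f(1) y(1) zn [of "Suc n"] univ.CS_minus [OF univ.CS_const [OF f(1)] zn [of "Suc n"]]
      by (simp del: power_Suc)
    also have "\<dots> \<in> I"
      using Suc I.I_l_closed [OF y(2)] zn [of "Suc n"]
      by (intro additive_subgroup.a_closed [OF I.additive_subgroup_axioms]) auto
    finally show ?case .
  qed
  have "univ.cst f \<in> norm_closure TU I"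
    unfolding norm_closure_def TU_eq mem_Collect_eq
  proof (intro conjI allI impI)
    show "univ.cst f \<in> carrier univ.T"
      using f by simp
    fix e :: real assume "e > 0"
    obtain r where r: "cnorm univ.T (univ.cls z) < r" "r < 1"
      using dense [OF less] unfolding z_def [abs_def] by blast
    have r0: "0 < r"
      using univ.T_norm_nonneg [OF z] r(1) by simp
    obtain n where n: "r ^ Suc n < e"
    proof -
      have "(\<lambda>n. r ^ Suc n) \<longlonglongrightarrow> 0"
        using r r0 by (intro LIMSEQ_Suc LIMSEQ_realpow_zero) auto
      then have "\<forall>\<^sub>F n in sequentially. r ^ Suc n < e"
        using \<open>e > 0\<close> by (rule order_tendstoD)
      then show ?thesis
        using that by (auto simp: eventually_sequentially)
    qed
    have "cnorm univ.T (univ.cls (\<lambda>k. z k ^ Suc n)) \<le> cnorm univ.T (univ.cls z) ^ Suc n"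
    proof (rule LIMSEQ_le [OF univ.T_norm [OF zn] tendsto_power [OF univ.T_norm [OF z]]])
      show "\<exists>N. \<forall>k\<ge>N. U (z k ^ Suc n) \<le> U (z k) ^ Suc n"
        by (intro exI allI impI univ.q_power univ.CS_carrier z)
    qed
    also have "\<dots> \<le> r ^ Suc n"
      using r univ.T_norm_nonneg [OF z] by (intro power_mono) auto
    finally have "cnorm univ.T (univ.cls (\<lambda>k. z k ^ Suc n)) < e"
      using n by simp
    moreover have "univ.cst f \<ominus>\<^bsub>univ.T\<^esub> univ.cls (\<lambda>k. f - z k ^ Suc n) = univ.cls (\<lambda>k. z k ^ Suc n)"
      using f(1) zn [of "Suc n"] univ.CS_minus [OF univ.CS_const [OF f(1)] zn [of "Suc n"]]
      by (simp add: univ.T_minus del: power_Suc)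
    ultimately show "\<exists>w\<in>I. cnorm univ.T (univ.cst f \<ominus>\<^bsub>univ.T\<^esub> w) < e"
      using in_I by (intro bexI [of _ "univ.cls (\<lambda>k. f - z k ^ Suc n)"]) auto
  qed
  then show ?thesis
    using I(2) by (auto simp: norm_closed_def)
qed

section \<open>From (3) to (4)\<close>

lemma ideal_in_kernel:
  assumes c3: "\<And>u \<C>. u \<in> U\<^sub>P - {\<one>} \<Longrightarrow> finite \<C> \<Longrightarrow> \<C> \<subseteq> J - {P} \<Longrightarrow>
      \<exists>t\<in>P - \<Union>\<C>. inv t \<otimes> (u \<otimes> t) \<notin> U\<^sub>P"
    and I: "ideal I TU" "norm_closed TU I" "I \<inter> D_u G P = {\<zero>\<^bsub>TU\<^esub>}"
  shows "I \<subseteq> a_kernel TU TL (lambda_plus G P)"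
proof
  interpret I: ideal I univ.T
    using I(1) by (simp add: TU_eq)
  fix C assume C: "C \<in> I"
  then have "C \<in> carrier univ.T"
    using I.a_subset by blast
  then obtain a where a: "a \<in> univ.CS" "C = univ.cls a"
    by (rule univ.carrier_TE)
  have "op_limit a (ell2_delta p) = (\<lambda>_. 0)" if p: "p \<in> P" for p
  proof (rule ccontr)
    note \<delta> = ell2_delta(1) [OF p]
    assume "op_limit a (ell2_delta p) \<noteq> (\<lambda>_. 0)"
    \<comment> \<open>The squared norm of the image of the basis vector of p is the diagonal
      coefficient of a* a at p. So the element of the ideal represented by b below has a positive
      diagonal coefficient.\<close>
    define c0 where "c0 = (ell2_norm P (op_limit a (ell2_delta p)))\<^sup>2"
    have "ell2_norm P (op_limit a (ell2_delta p)) \<noteq> 0"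
      using \<open>op_limit a (ell2_delta p) \<noteq> (\<lambda>_. 0)\<close> ell2_norm_eq_0 op_limit_ell2 [OF a(1) \<delta>] by blast
    then have "c0 > 0"
      by (simp add: c0_def)
    define b where "b k = star A (a k) * a k" for k
    have b: "b \<in> univ.CS"
      unfolding b_def [abs_def] using a by simp
    have bI: "univ.cls b \<in> I"
    proof -
      have "star univ.T C \<otimes>\<^bsub>univ.T\<^esub> C \<in> I"
        using C a by (intro I.I_l_closed) auto
      then show ?thesis
        using a by (simp add: b_def [abs_def])
    qed
    have b_at: "(\<lambda>k. lam.OP (b k) (ell2_delta p) p) \<longlonglongrightarrow> of_real c0"
    proof -
      have "(\<lambda>k. lam.OP (b k) (ell2_delta p) p) \<longlonglongrightarrow> op_limit b (ell2_delta p) p"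
        by (rule op_limit_tendsto [OF b \<delta>])
      moreover have "op_limit b (ell2_delta p) p = of_real c0"
      proof -
        have "op_limit b = star BP (op_limit a) \<otimes>\<^bsub>BP\<^esub> op_limit a"
          unfolding b_def [abs_def] using a by (simp only: op_limit_mult univ.CS_star op_limit_star)
        then have "op_limit b (ell2_delta p) = star BP (op_limit a) (op_limit a (ell2_delta p))"
          using \<delta> by simp
        then have "cnj (op_limit b (ell2_delta p) p)
            = ell2_inner P (ell2_delta p) (star BP (op_limit a) (op_limit a (ell2_delta p)))"
          using p by (simp add: ell2_inner_delta)
        also have "\<dots> = ell2_inner P (op_limit a (ell2_delta p)) (op_limit a (ell2_delta p))"
          using BO_star_inner [OF op_limit_closed [OF a(1)] op_limit_ell2 [OF a(1) \<delta>] \<delta>] by simp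
        also have "\<dots> = of_real c0"
          unfolding c0_def using a \<delta> by (intro ell2_inner_self) simp
        finally show ?thesis
          by (metis complex_cnj_cnj complex_cnj_complex_of_real)
      qed
      ultimately show ?thesis by simp
    qed
    \<comment> \<open>A quarter of c0 is spent twice: on the coefficient, so that the modulus of c
      exceeds 3 c0 / 4, and on the distance from b to B. The second divided by the modulus of c is
      then below 1, as \<open>corner_in_ideal\<close> requires.\<close>
    have "c0 / 4 > 0"
      using \<open>c0 > 0\<close> by simp
    then obtain N1 where N1: "\<And>k. k \<ge> N1 \<Longrightarrow> cmod (lam.OP (b k) (ell2_delta p) p - of_real c0) < c0 / 4"
      using LIMSEQ_D [OF b_at] by blast
    obtain N2 where N2: "\<And>k. k \<ge> N2 \<Longrightarrow> cnorm univ.T (univ.cls b \<ominus>\<^bsub>univ.T\<^esub> univ.cst (b k)) < c0 / 4"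
      using univ.cst_dense [OF b \<open>c0 / 4 > 0\<close>] by blast
    define B where "B = b (max N1 N2)"
    have BA: "B \<in> carrier A"
      using b by (simp add: B_def)
    have dist: "cnorm univ.T (univ.cls (\<lambda>k. b k - B)) < c0 / 4"
      using N2 [of "max N1 N2"] b BA by (simp add: B_def univ.T_minus)
    define c where "c = lam.rho B (ell2_delta p) p"
    have c: "cmod (c - of_real c0) < c0 / 4"
      using N1 [of "max N1 N2"] \<delta> by (simp add: c_def B_def lam.OP_def)
    then have c_big: "cmod c > 3 * c0 / 4"
      using norm_triangle_ineq2 [of "of_real c0" c] \<open>c0 > 0\<close> by (simp add: norm_minus_commute)
    let ?mw = "monomial_word G"
    define W where "W = ?mw ` Poly_Mapping.keys B"
    have letters: "set (letters w) \<subseteq> alphabet P" if "w \<in> Poly_Mapping.keys B" for w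
      using BA that by (auto simp: free_carrier_iff)
    have W: "finite W" "W \<subseteq> words P"
      using univ.monomial_word_words [OF letters] by (auto simp: W_def)
    \<comment> \<open>Besides not being bad for the non-neutral words, the new point must avoid
      every K(\<alpha>) that misses p. Then it lies in the same ideals K(\<alpha>) as p, and the
      diagonal coefficient c is the same at both points.\<close>
    have "\<exists>r\<in>P. p \<otimes> r \<notin> \<Union>(K ` {\<alpha> \<in> W. p \<notin> K \<alpha>}) \<and>
        (\<forall>\<alpha>\<in>{\<alpha> \<in> W. val \<alpha> \<noteq> \<one>}. \<not> bad \<alpha> (p \<otimes> r))"
    proof (rule avoid_bad [OF c3, of "{\<alpha> \<in> W. val \<alpha> \<noteq> \<one>}" p "K ` {\<alpha> \<in> W. p \<notin> K \<alpha>}"])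
      show "K ` {\<alpha> \<in> W. p \<notin> K \<alpha>} \<subseteq> J"
        using W by auto
      show "finite {\<alpha> \<in> W. val \<alpha> \<noteq> \<one>}" "finite (K ` {\<alpha> \<in> W. p \<notin> K \<alpha>})"
        using W by simp_all
    qed (use W p in blast)+
    then obtain r where r: "r \<in> P" "\<And>\<alpha>. \<alpha> \<in> W \<Longrightarrow> p \<notin> K \<alpha> \<Longrightarrow> p \<otimes> r \<notin> K \<alpha>"
      "\<And>\<alpha>. \<alpha> \<in> W \<Longrightarrow> val \<alpha> \<noteq> \<one> \<Longrightarrow> \<not> bad \<alpha> (p \<otimes> r)"
      by blast
    define s where "s = p \<otimes> r"
    have s: "s \<in> P"
      using p r by (simp add: s_def)
    have sK: "s \<in> K \<alpha> \<longleftrightarrow> p \<in> K \<alpha>" if "\<alpha> \<in> W" for \<alpha>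
      using r(2) [OF that] K_right_ideal [of \<alpha> p r] W r(1) that by (auto simp: s_def)
    have c_eq: "c = (\<Sum>w\<in>Poly_Mapping.keys B.
        if val (?mw w) = \<one> \<and> s \<in> K (?mw w) then Poly_Mapping.lookup B w else 0)"
      unfolding c_def lam.rho_def
    proof (rule sum.cong [OF refl])
      fix w assume w: "w \<in> Poly_Mapping.keys B"
      then have "?mw w \<in> W"
        by (simp add: W_def)
      then show "Poly_Mapping.lookup B w * lam.mop w (ell2_delta p) p
          = (if val (?mw w) = \<one> \<and> s \<in> K (?mw w) then Poly_Mapping.lookup B w else 0)"
        using lam_delta_at [OF letters [OF w] p] sK by simp
    qed
    obtain \<gamma>s f where \<gamma>s: "set \<gamma>s \<subseteq> N" "\<And>\<gamma>. \<gamma> \<in> set \<gamma>s \<Longrightarrow> \<one> \<notin> K \<gamma>"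
      and f_def: "f = t [(\<one>, s)] * univ.cprod \<gamma>s * t [(s, \<one>)]" and f: "f \<in> univ.D0"
      and ff: "univ.eqv (f * f) f" and fstar: "univ.eqv (star A f) f"
      and fBf: "univ.eqv (f * B * f) (smult A c f)"
    proof (rule univ.compression [OF BA s])
      show "\<not> bad (?mw w) s" if "w \<in> Poly_Mapping.keys B" "val (?mw w) \<noteq> \<one>" for w
        using r(3) [of "?mw w"] that by (simp add: W_def s_def)
    qed (unfold c_eq, blast)
    have fA: "f \<in> carrier A"
      using f by simp
    have "U f = 0 \<or> U f = 1"
    proof (rule univ.projection_q)
      have "univ.eqv (star A f * f) (f * f)"
        using fstar fA by (intro univ.eqv_mult) auto
      then show "univ.eqv (star A f * f) f"
        using ff univ.eqv_trans by blast
    qed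
    \<comment> \<open>f fixes the basis vector of s in the left regular representation, because the
      ideals removed by the complements do not contain e. So f cannot vanish.\<close>
    moreover have "1 \<le> U f"
    proof -
      have words: "t [(\<one>, s)] \<in> carrier A" "t [(s, \<one>)] \<in> carrier A" "univ.cprod \<gamma>s \<in> carrier A"
        using s \<gamma>s univ.t_closed [of "[(\<one>, s)]"] univ.t_closed [of "[(s, \<one>)]"] by auto
      have "lam.rho f (ell2_delta s) = ell2_delta s"
        unfolding f_def using words free_algebra_closed(4) [of _ P]
        by (simp only: lam.rho_times lam_shift_delta [OF s] lam_cprod_delta [OF \<gamma>s])
      then have "lam.rho f (ell2_delta s) s = 1"
        by (simp add: ell2_delta_def)
      then have "1 \<le> ell2_norm P (lam.rho f (ell2_delta s))"
        using ell2_bound [OF OP_ell2 [OF fA ell2_delta(1) [OF s]], of s] ell2_delta(1) [OF s]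
        by (simp add: lam.OP_def)
      also have "\<dots> \<le> lam.qr f"
        using lam.qr_bound [OF fA, of "ell2_delta s"] ell2_delta [OF s] by simp
      also have "\<dots> \<le> U f"
        by (rule U_upper [OF lam.qr_cstar fA])
      finally show ?thesis .
    qed
    ultimately have Uf: "U f = 1"
      by linarith
    have c0': "c \<noteq> 0"
      using c_big \<open>c0 > 0\<close> by auto
    \<comment> \<open>The compression of b divided by c. Since f B f is c f modulo U, the difference
      f - y is f (B - b) f divided by c, which is small by the choice of B.\<close>
    define y where "y k = smult A (inverse c) (f * b k * f)" for k
    have y: "y \<in> univ.CS"
      unfolding y_def [abs_def] using fA b by simp
    have "univ.cst f \<in> I"
    proof (rule corner_in_ideal [OF I(1,2) fA ff y])
      have "univ.cst (smult A (inverse c) 1) \<otimes>\<^bsub>univ.T\<^esub>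
          (univ.cst f \<otimes>\<^bsub>univ.T\<^esub> univ.cls b \<otimes>\<^bsub>univ.T\<^esub> univ.cst f) \<in> I"
        using bI fA free_algebra_closed by (intro I.I_l_closed I.I_r_closed) simp_all
      moreover have "univ.cst (smult A (inverse c) 1) \<otimes>\<^bsub>univ.T\<^esub>
          (univ.cst f \<otimes>\<^bsub>univ.T\<^esub> univ.cls b \<otimes>\<^bsub>univ.T\<^esub> univ.cst f) = univ.cls y"
        using fA b free_algebra_closed by (simp add: y_def [abs_def] univ.smult)
      ultimately show "univ.cls y \<in> I"
        by simp
      show "univ.eqv (y k * f) (y k)" for k
      proof -
        have "y k * f = smult A (inverse c) (f * b k * (f * f))"
          using fA b by (simp add: y_def univ.smult mult.assoc)
        also have "univ.eqv \<dots> (smult A (inverse c) (f * b k * f))"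
          using ff fA b by (intro univ.eqv_smult univ.eqv_mult) auto
        finally show ?thesis
          by (simp only: y_def)
      qed
      have Uy: "U (f - y k) \<le> inverse (cmod c) * U (b k - B)" for k
      proof -
        have bk: "b k \<in> carrier A"
          using b by simp
        have "univ.eqv (smult A (inverse c) (f * B * f)) (smult A (inverse c) (smult A c f))"
          by (rule univ.eqv_smult [OF fBf])
        then have "univ.eqv (smult A (inverse c) (f * B * f)) f"
          using c0' fA by (simp add: univ.smult)
        then have "univ.eqv (smult A (inverse c) (f * B * f) - y k) (f - y k)"
          using y by (intro univ.eqv_diff) auto
        moreover have "smult A (inverse c) (f * B * f) - y k = smult A (inverse c) (f * (B - b k) * f)"
          using fA BA bk by (simp add: y_def univ.smult_diff [symmetric] algebra_simps)
        ultimately have "U (f - y k) = U (smult A (inverse c) (f * (B - b k) * f))"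
          using univ.eqv_q by metis
        also have "\<dots> = inverse (cmod c) * U (f * (B - b k) * f)"
          using fA BA bk by (simp add: univ.q_smult norm_inverse)
        also have "U (f * (B - b k) * f) \<le> U (f * (B - b k)) * U f"
          using fA BA bk by (intro univ.q_mult) auto
        also have "\<dots> \<le> U f * U (B - b k) * U f"
          using fA BA bk Uf by (intro mult_right_mono univ.q_mult) auto
        also have "\<dots> = U (b k - B)"
          using Uf BA bk univ.q_diff_commute by simp
        finally show ?thesis
          by (simp add: mult_left_mono)
      qed
      have "cnorm univ.T (univ.cls (\<lambda>k. f - y k)) \<le> inverse (cmod c) * cnorm univ.T (univ.cls (\<lambda>k. b k - B))"
        by (rule LIMSEQ_le [OF univ.T_norm tendsto_mult_left [OF univ.T_norm]])
          (use Uy fA y b BA in auto)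
      also have "\<dots> \<le> inverse (cmod c) * (c0 / 4)"
        using dist by (intro mult_left_mono) auto
      also have "\<dots> < 1"
      proof -
        have "c0 / 4 < cmod c" "cmod c > 0"
          using c_big \<open>c0 > 0\<close> by linarith+
        then show ?thesis
          by (simp add: field_simps)
      qed
      finally show "cnorm univ.T (univ.cls (\<lambda>k. f - y k)) < 1" .
    qed
    then have "univ.cst f = \<zero>\<^bsub>univ.T\<^esub>"
      using I(3) cst_D_u [OF f] by (auto simp: TU_eq)
    then have "U f = 0"
      using univ.T_norm_eq_0 [of "\<lambda>_. f"] univ.T_norm_cst [OF fA] fA by simp
    then show False
      using Uf by simp
  qed
  then show "C \<in> a_kernel TU TL (lambda_plus G P)"
    using lambda_kernel [OF a(1)] op_limit_zeroI [OF a(1)] a(2) by blast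
qed

section \<open>Ideals of elements null for a smaller seminorm\<close>

definition null_ideal :: "('g free_elem \<Rightarrow> real) \<Rightarrow> (nat \<Rightarrow> 'g free_elem) set set"
  where "null_ideal q = univ.cls ` {x \<in> univ.CS. (\<lambda>n. q (x n)) \<longlonglongrightarrow> 0}"

text \<open>This is the kernel of the extension of q to the completion. Everything rests on q \<le>
  U: sequences null for U are null for q, so membership does not depend on the representative, and
  sequences that are Cauchy for U are bounded for q, which gives absorption under products.\<close>

lemma null_ideal:
  assumes q: "q \<in> cstar_seminorms A (toeplitz_relations G P)"
  shows cls_null_ideal: "x \<in> univ.CS \<Longrightarrow> univ.cls x \<in> null_ideal q \<longleftrightarrow> (\<lambda>n. q (x n)) \<longlonglongrightarrow> 0"
    and null_ideal_ideal: "ideal (null_ideal q) TU"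
    and null_ideal_closed: "norm_closed TU (null_ideal q)"
proof -
  interpret Q: toeplitz_seminorm G P q
    using q by (rule toeplitz_seminormI)
  have qU: "q z \<le> U z" if "z \<in> carrier A" for z
    by (rule U_upper [OF q that])
  have mem: "univ.cls x \<in> null_ideal q \<longleftrightarrow> (\<lambda>n. q (x n)) \<longlonglongrightarrow> 0" if x: "x \<in> univ.CS" for x
  proof
    assume "univ.cls x \<in> null_ideal q"
    then obtain y where y: "y \<in> univ.CS" "(\<lambda>n. q (y n)) \<longlonglongrightarrow> 0" "univ.cls x = univ.cls y"
      by (auto simp: null_ideal_def)
    have "(\<lambda>n. U (x n - y n) + q (y n)) \<longlonglongrightarrow> 0"
      using y x by (intro tendsto_add_zero) (auto simp: univ.cls_eq_iff)
    then show "(\<lambda>n. q (x n)) \<longlonglongrightarrow> 0"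
    proof (rule Q.tendsto_0_le)
      show "q (x n) \<le> U (x n - y n) + q (y n)" for n
        using Q.q_add [of "x n - y n" "y n"] qU [of "x n - y n"] x y by simp
    qed (use x Q.q_nonneg in simp)
  qed (use x in \<open>auto simp: null_ideal_def\<close>)
  then show "x \<in> univ.CS \<Longrightarrow> univ.cls x \<in> null_ideal q \<longleftrightarrow> (\<lambda>n. q (x n)) \<longlonglongrightarrow> 0" for x
    by blast
  have sub: "null_ideal q \<subseteq> carrier univ.T"
    by (auto simp: null_ideal_def)
  have E: "\<exists>x. x \<in> univ.CS \<and> C = univ.cls x \<and> (\<lambda>n. q (x n)) \<longlonglongrightarrow> 0" if "C \<in> null_ideal q" for C
    using that by (auto simp: null_ideal_def)
  have mult0: "(\<lambda>n. q (x n * y n)) \<longlonglongrightarrow> 0" "(\<lambda>n. q (y n * x n)) \<longlonglongrightarrow> 0"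
    if x: "x \<in> univ.CS" "(\<lambda>n. q (x n)) \<longlonglongrightarrow> 0" and y: "y \<in> univ.CS" for x y
  proof -
    obtain B where B: "\<And>n. U (y n) \<le> B"
      using univ.CS_bounded [OF y] by blast
    have qB: "q (y n) \<le> B" for n
      using qU [of "y n"] B [of n] y by simp
    have xB: "(\<lambda>n. q (x n) * B) \<longlonglongrightarrow> 0"
      using x(2) by (rule tendsto_mult_left_zero)
    show "(\<lambda>n. q (x n * y n)) \<longlonglongrightarrow> 0"
    proof (rule Q.tendsto_0_le [OF xB])
      show "q (x n * y n) \<le> q (x n) * B" for n
        using Q.q_mult [of "x n" "y n"] mult_left_mono [OF qB [of n] Q.q_nonneg [of "x n"]] x y by simp
    qed (use x y Q.q_nonneg in simp)
    show "(\<lambda>n. q (y n * x n)) \<longlonglongrightarrow> 0"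
    proof (rule Q.tendsto_0_le [OF xB])
      show "q (y n * x n) \<le> q (x n) * B" for n
        using Q.q_mult [of "y n" "x n"] mult_left_mono [OF qB [of n] Q.q_nonneg [of "x n"]] x y
        by (simp add: mult.commute)
    qed (use x y Q.q_nonneg in simp)
  qed
  interpret T: ring univ.T
    by (rule univ.T_ring)
  show "ideal (null_ideal q) TU"
    unfolding TU_eq
  proof (rule idealI [OF univ.T_ring])
    show "subgroup (null_ideal q) (add_monoid univ.T)"
    proof (rule group.subgroupI [OF T.a_group])
      show "null_ideal q \<subseteq> carrier (add_monoid univ.T)"
        using sub by simp
      have "univ.cst 0 \<in> null_ideal q"
        by (subst mem) (auto simp: free_algebra_closed)
      then show "null_ideal q \<noteq> {}"
        by blast
    next
      fix C assume "C \<in> null_ideal q"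
      then obtain x where x: "x \<in> univ.CS" "C = univ.cls x" "(\<lambda>n. q (x n)) \<longlonglongrightarrow> 0"
        using E by blast
      then have "univ.cls (\<lambda>n. - x n) \<in> null_ideal q"
        by (subst mem) simp_all
      then show "inv\<^bsub>add_monoid univ.T\<^esub> C \<in> null_ideal q"
        using univ.T_uminus [OF x(1)] x(2) by (simp add: a_inv_def)
    next
      fix C D assume "C \<in> null_ideal q" "D \<in> null_ideal q"
      then obtain x y where x: "x \<in> univ.CS" "C = univ.cls x" "(\<lambda>n. q (x n)) \<longlonglongrightarrow> 0"
        and y: "y \<in> univ.CS" "D = univ.cls y" "(\<lambda>n. q (y n)) \<longlonglongrightarrow> 0"
        using E by meson
      have "(\<lambda>n. q (x n + y n)) \<longlonglongrightarrow> 0"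
        by (rule Q.tendsto_0_le [OF tendsto_add_zero [OF x(3) y(3)]])
          (use x y Q.q_nonneg Q.q_add in auto)
      then show "C \<otimes>\<^bsub>add_monoid univ.T\<^esub> D \<in> null_ideal q"
        using x y mem by simp
    qed
  next
    fix C D assume "C \<in> null_ideal q" "D \<in> carrier univ.T"
    then obtain x y where xy: "x \<in> univ.CS" "C = univ.cls x" "(\<lambda>n. q (x n)) \<longlonglongrightarrow> 0"
      "y \<in> univ.CS" "D = univ.cls y"
      using E univ.carrier_TE by metis
    show "D \<otimes>\<^bsub>univ.T\<^esub> C \<in> null_ideal q" "C \<otimes>\<^bsub>univ.T\<^esub> D \<in> null_ideal q"
      using xy mult0 [OF xy(1,3,4)] mem by simp_all
  qed
  show "norm_closed TU (null_ideal q)"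
    unfolding norm_closed_def TU_eq
  proof (intro conjI sub subsetI)
    fix C assume C: "C \<in> norm_closure univ.T (null_ideal q)"
    then have "C \<in> carrier univ.T"
      by (simp add: norm_closure_def)
    then obtain x where x: "x \<in> univ.CS" "C = univ.cls x"
      by (rule univ.carrier_TE)
    have "(\<lambda>n. q (x n)) \<longlonglongrightarrow> 0"
    proof (rule LIMSEQ_I)
      fix e :: real assume "e > 0"
      have "\<exists>D\<in>null_ideal q. cnorm univ.T (C \<ominus>\<^bsub>univ.T\<^esub> D) < e / 2"
        using C half_gt_zero [OF \<open>e > 0\<close>] unfolding norm_closure_def by blast
      then obtain D where D: "D \<in> null_ideal q" "cnorm univ.T (C \<ominus>\<^bsub>univ.T\<^esub> D) < e / 2"
        by blast
      then obtain y where y: "y \<in> univ.CS" "(\<lambda>n. q (y n)) \<longlonglongrightarrow> 0" "D = univ.cls y"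
        using E by blast
      then have less: "cnorm univ.T (univ.cls (\<lambda>n. x n - y n)) < e / 2"
        using D(2) x univ.T_minus [OF x(1) y(1)] by (simp only:)
      have "\<forall>\<^sub>F n in sequentially. U (x n - y n) < e / 2"
        using univ.T_norm [OF univ.CS_minus [OF x(1) y(1)]] less by (rule order_tendstoD)
      moreover have "\<forall>\<^sub>F n in sequentially. q (y n) < e / 2"
        using y(2) \<open>e > 0\<close> by (intro order_tendstoD) auto
      ultimately have "\<forall>\<^sub>F n in sequentially. norm (q (x n) - 0) < e"
      proof eventually_elim
        case (elim n)
        have "q (x n) \<le> q (x n - y n) + q (y n)"
          using Q.q_add [of "x n - y n" "y n"] x y by simp
        then show ?case
          using elim qU [of "x n - y n"] Q.q_nonneg [of "x n"] x y by simp
      qed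
      then show "\<exists>N. \<forall>n\<ge>N. norm (q (x n) - 0) < e"
        by (simp only: eventually_sequentially)
    qed
    then show "C \<in> null_ideal q"
      using x mem by simp
  qed
qed

text \<open>If an element of the ideal is close to y in the algebraic diagonal, then q y is small,
  hence U y is small by hypothesis, hence the element itself is small. The accuracy is arbitrary, so
  the element vanishes.\<close>

lemma null_ideal_D_u:
  assumes q: "q \<in> cstar_seminorms A (toeplitz_relations G P)" and Uq: "\<And>x. x \<in> univ.D0 \<Longrightarrow> U x \<le> q x"
  shows "null_ideal q \<inter> D_u G P = {\<zero>\<^bsub>TU\<^esub>}"
proof -
  interpret Q: toeplitz_seminorm G P q
    using q by (rule toeplitz_seminormI)
  have "C = \<zero>\<^bsub>univ.T\<^esub>" if C: "C \<in> null_ideal q" "C \<in> D_u G P" for C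
  proof -
    obtain x where x: "x \<in> univ.CS" "C = univ.cls x" "(\<lambda>n. q (x n)) \<longlonglongrightarrow> 0"
      using C(1) by (auto simp: null_ideal_def)
    have "cnorm univ.T C \<le> e" if e: "e > 0" for e
    proof -
      have "\<exists>D\<in>univ.cst ` univ.D0. cnorm univ.T (C \<ominus>\<^bsub>univ.T\<^esub> D) < e / 2"
        using C(2) half_gt_zero [OF e] unfolding D_u_eq norm_closure_def TU_eq by blast
      then obtain y where y: "y \<in> univ.D0" and Cy: "cnorm univ.T (C \<ominus>\<^bsub>univ.T\<^esub> univ.cst y) < e / 2"
        by blast
      have yA: "y \<in> carrier A"
        using y by simp
      have less: "cnorm univ.T (univ.cls (\<lambda>n. x n - y)) < e / 2"
        using Cy x univ.T_minus [OF x(1) univ.CS_const [OF yA]] by (simp only:)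
      have lim: "(\<lambda>n. U (x n - y)) \<longlonglongrightarrow> cnorm univ.T (univ.cls (\<lambda>n. x n - y))"
        using x yA by (intro univ.T_norm univ.CS_minus univ.CS_const)
      have "q y \<le> q (x n) + U (x n - y)" for n
        using Q.q_diff [of "x n" "x n - y"] U_upper [OF q, of "x n - y"] x yA by simp
      then have "q y \<le> 0 + cnorm univ.T (univ.cls (\<lambda>n. x n - y))"
        using tendsto_add [OF x(3) lim] by (intro LIMSEQ_le_const) auto
      then have Uy: "U y < e / 2"
        using Uq [OF y] less by simp
      have "U (x n) \<le> U (x n - y) + U y" for n
        using univ.q_add [of "x n - y" y] x yA by simp
      then have "cnorm univ.T C \<le> cnorm univ.T (univ.cls (\<lambda>n. x n - y)) + U y"
        unfolding x(2)
        by (intro LIMSEQ_le [OF univ.T_norm [OF x(1)] tendsto_add [OF lim tendsto_const]]) blast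
      then show ?thesis
        using Uy less by simp
    qed
    then have "cnorm univ.T C \<le> 0"
      by (rule field_le_epsilon) simp
    then have "cnorm univ.T (univ.cls x) = 0"
      using univ.T_norm_nonneg [OF x(1)] x(2) by simp
    then show ?thesis
      using univ.T_norm_eq_0 [OF x(1)] x(2) by simp
  qed
  moreover have "\<zero>\<^bsub>univ.T\<^esub> \<in> null_ideal q"
    by (simp add: cls_null_ideal [OF q] free_algebra_closed)
  moreover have "\<zero>\<^bsub>univ.T\<^esub> \<in> D_u G P"
    using cst_D_u [of 0] by simp
  ultimately show ?thesis
    unfolding TU_eq by blast
qed

section \<open>From (4) to (3)\<close>

lemma unit_representatives:
  obtains \<nu> where "toeplitz_rep G P U\<^sub>P \<nu>"
proof -
  \<comment> \<open>The predicate depends on p only through its coset, so the choice operator picks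
    the same representative for all elements of a coset.\<close>
  define \<nu> where "\<nu> p = (SOME x. inv p \<otimes> x \<in> U\<^sub>P \<and> x \<in> P)" for p
  have "toeplitz_rep G P U\<^sub>P \<nu>"
  proof (intro toeplitz_rep.intro toeplitz_rep_axioms.intro group_submonoid_axioms unit_subgroup subset_refl)
    fix p assume p: "p \<in> P"
    have "inv p \<otimes> \<nu> p \<in> U\<^sub>P \<and> \<nu> p \<in> P"
      unfolding \<nu>_def by (rule someI [of _ p]) (use p in \<open>simp add: unit_iff\<close>)
    then show "\<exists>h\<in>U\<^sub>P. \<nu> p = p \<otimes> h"
      using p by (intro bexI [of _ "inv p \<otimes> \<nu> p"]) auto
    fix h assume h: "h \<in> U\<^sub>P"
    then have hP: "h \<in> P" "inv h \<in> P"
      by (auto simp: unit_iff)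
    have "inv (p \<otimes> h) \<otimes> x \<in> U\<^sub>P \<longleftrightarrow> inv p \<otimes> x \<in> U\<^sub>P" if "x \<in> P" for x
    proof -
      have "inv (p \<otimes> h) \<otimes> x = inv h \<otimes> (inv p \<otimes> x)" "inv p \<otimes> x = h \<otimes> (inv (p \<otimes> h) \<otimes> x)"
        using p hP that by (simp_all add: inv_mult_group m_assoc)
      then show ?thesis
        using h subgroup.m_closed [OF unit_subgroup] subgroup.m_inv_closed [OF unit_subgroup] by metis
    qed
    then have "(\<lambda>x. inv (p \<otimes> h) \<otimes> x \<in> U\<^sub>P \<and> x \<in> P) = (\<lambda>x. inv p \<otimes> x \<in> U\<^sub>P \<and> x \<in> P)"
      by blast
    then show "\<nu> (p \<otimes> h) = \<nu> p"
      by (simp add: \<nu>_def)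
  qed
  then show ?thesis
    by (rule that)
qed

lemma moves_if_ideals_in_kernel:
  assumes c4: "\<And>I. ideal I TU \<Longrightarrow> norm_closed TU I \<Longrightarrow> I \<inter> D_u G P = {\<zero>\<^bsub>TU\<^esub>} \<Longrightarrow>
      I \<subseteq> a_kernel TU TL (lambda_plus G P)"
    and u: "u \<in> U\<^sub>P - {\<one>}" and \<C>: "finite \<C>" "\<C> \<subseteq> J - {P}"
  shows "\<exists>t\<in>P - \<Union>\<C>. inv t \<otimes> (u \<otimes> t) \<notin> U\<^sub>P"
proof (rule ccontr)
  assume "\<not> ?thesis"
  then have fixed: "inv t \<otimes> (u \<otimes> t) \<in> U\<^sub>P" if "t \<in> P" "t \<notin> \<Union>\<C>" for t
    using that by blast
  obtain \<nu> where "toeplitz_rep G P U\<^sub>P \<nu>"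
    by (rule unit_representatives)
  then interpret R: toeplitz_rep G P U\<^sub>P \<nu> .
  have uP: "u \<in> P" "inv u \<in> P" "u \<noteq> \<one>"
    using u by (auto simp: unit_iff)
  have "\<exists>\<gamma>. \<gamma> \<in> N \<and> K \<gamma> = S" if "S \<in> \<C>" for S
    using that \<C> constructible_neutral by (metis Diff_iff subsetD)
  then obtain \<gamma> where \<gamma>: "\<And>S. S \<in> \<C> \<Longrightarrow> \<gamma> S \<in> N \<and> K (\<gamma> S) = S"
    by metis
  obtain Cs where Cs: "set Cs = \<C>"
    using finite_list [OF \<C>(1)] by blast
  define \<gamma>s where "\<gamma>s = map \<gamma> Cs"
  have \<gamma>s: "set \<gamma>s \<subseteq> N" "(\<Union>\<gamma>\<in>set \<gamma>s. K \<gamma>) = \<Union>\<C>"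
    using \<gamma> Cs by (auto simp: \<gamma>s_def)
  have one: "\<one> \<notin> K \<delta>" if "\<delta> \<in> set \<gamma>s" for \<delta>
  proof -
    have "K \<delta> \<in> \<C>"
      using that \<gamma> Cs by (auto simp: \<gamma>s_def)
    then show ?thesis
      using \<C>(2) constructible_no_one by blast
  qed
  define x where "x = (t [(\<one>, u)] - 1) * univ.cprod \<gamma>s"
  have w: "[(\<one>, u)] \<in> words P"
    using uP by simp
  have c: "t [(\<one>, u)] \<in> carrier A" "t [(\<one>, u)] - 1 \<in> carrier A" "univ.cprod \<gamma>s \<in> carrier A"
    using univ.t_closed [OF w] univ.minus_closed [OF univ.t_closed [OF w] free_algebra_closed(1)] \<gamma>s(1)
    by auto
  have xA: "x \<in> carrier A"
    unfolding x_def using c by (intro free_algebra_closed)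
  have "R.rho x g = (\<lambda>_. 0)" if g: "g \<in> ell2 R.X" for g
  proof -
    define h where "h = R.rho (univ.cprod \<gamma>s) g"
    have h: "h \<in> ell2 R.X"
      unfolding h_def using c g by simp
    have h_eq: "h = (\<lambda>y. if y \<in> \<Union>\<C> then 0 else g y)"
      using R.rho_cprod [OF \<gamma>s(1) g] unfolding h_def \<gamma>s(2) .
    have "R.rho (t [(\<one>, u)]) h y = h y" for y
    proof (cases "y \<in> R.X")
      case False
      then show ?thesis
        using ell2_supp [OF h] ell2_supp [OF R.rho_ell2 [OF c(1) h]] by simp
    next
      case True
      have y: "y \<in> P" "inv u \<otimes> y \<in> P"
        using True uP by auto
      have "R.rho (t [(\<one>, u)]) h y = h (\<nu> (inv u \<otimes> y))"
        using R.rho_word [OF w h] True uP y by (simp add: K_single val_single del: word_prod.simps)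
      \<comment> \<open>Outside \<C> the assumption at y puts u^{-1} y into the coset of y. Inside
        \<C> both sides are 0, provided the translate z stays inside the union of \<C>.\<close>
      also have "\<dots> = h y"
      proof (cases "y \<in> \<Union>\<C>")
        case False
        define v where "v = inv y \<otimes> (u \<otimes> y)"
        have v: "v \<in> U\<^sub>P"
          unfolding v_def by (rule fixed [OF y(1) False])
        have "inv v \<in> U\<^sub>P"
          using v by (rule subgroup.m_inv_closed [OF unit_subgroup])
        moreover have "inv u \<otimes> y = y \<otimes> inv v"
          using y uP by (simp add: v_def inv_mult_group m_assoc)
        ultimately have "\<nu> (inv u \<otimes> y) = y"
          using R.nu_absorb [OF y(1)] True by simp
        then show ?thesis by simp
      next
        case y\<C>: True
        define z where "z = \<nu> (inv u \<otimes> y)"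
        \<comment> \<open>If z were outside, the assumption at z would place z in the coset of y
          under the units. A right ideal of \<C> containing y would then contain z.\<close>
        have "z \<in> \<Union>\<C>"
        proof (rule ccontr)
          assume z\<C>: "z \<notin> \<Union>\<C>"
          have zP: "z \<in> P"
            unfolding z_def using y by simp
          obtain k where k: "k \<in> U\<^sub>P" "z = inv u \<otimes> y \<otimes> k"
            using R.nu_coset [OF y(2)] by (auto simp: z_def)
          define v where "v = inv z \<otimes> (u \<otimes> z)"
          have v: "v \<in> U\<^sub>P"
            unfolding v_def by (rule fixed [OF zP z\<C>])
          have kP: "k \<in> P" "inv v \<in> P"
            using k v by (auto simp: unit_iff)
          have "u \<otimes> z = y \<otimes> k"
            using k kP y uP by (simp add: m_assoc)
          moreover have "(u \<otimes> z) \<otimes> inv v = z"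
            using zP uP by (simp add: v_def inv_mult_group m_assoc)
          ultimately have "z = y \<otimes> (k \<otimes> inv v)"
            using y kP by (simp add: m_assoc)
          moreover obtain S where "S \<in> \<C>" "y \<in> S"
            using y\<C> by blast
          ultimately have "z \<in> S"
            using constructible_right_ideal [of S y "k \<otimes> inv v"] \<C>(2) kP by auto
          then show False
            using z\<C> \<open>S \<in> \<C>\<close> by blast
        qed
        then show ?thesis
          using y\<C> unfolding h_eq z_def by simp
      qed
      finally show ?thesis .
    qed
    then have "R.rho (t [(\<one>, u)]) h = h"
      by blast
    moreover have "R.rho x g = (\<lambda>y. R.rho (t [(\<one>, u)]) h y - h y)"
      unfolding x_def R.rho_times [OF c(2,3)] h_def [symmetric] R.rho_diff by simp
    ultimately show ?thesis
      by simp
  qed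
  then have "R.qr x = 0"
    using R.qr_0_iff [OF xA] by blast
  then have "univ.cst x \<in> null_ideal R.qr"
    using cls_null_ideal [OF R.qr_cstar, of "\<lambda>_. x"] xA by simp
  moreover have "null_ideal R.qr \<subseteq> a_kernel TU TL (lambda_plus G P)"
    by (intro c4 null_ideal_ideal null_ideal_closed null_ideal_D_u R.qr_cstar R.U_le_qr)
  ultimately have "lam.OP x = \<zero>\<^bsub>BP\<^esub>"
    using lambda_kernel [of "\<lambda>_. x"] op_limit_const [OF xA] xA by auto
  then have "lam.OP x (ell2_delta \<one>) = \<zero>\<^bsub>BP\<^esub> (ell2_delta \<one>)"
    by (rule fun_cong)
  then have "lam.rho x (ell2_delta \<one>) = (\<lambda>_. 0)"
    using ell2_delta(1) [OF P.one_closed] by (simp add: lam.OP_def)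
  \<comment> \<open>Proper ideals do not contain e, so the product of complements fixes the basis
    vector of e. The remaining factor sends it to the difference of the basis vectors of u and e,
    which is nonzero.\<close>
  moreover have "lam.rho x (ell2_delta \<one>) = (\<lambda>y. ell2_delta u y - ell2_delta \<one> y)"
  proof -
    have "lam.rho (univ.cprod \<gamma>s) (ell2_delta \<one>) = ell2_delta \<one>"
      by (rule lam_cprod_delta [OF \<gamma>s(1)]) (rule one)
    then show ?thesis
      unfolding x_def lam.rho_times [OF c(2,3)] lam.rho_diff
      by (simp only: lam_shift_delta(2) [OF uP(1)] lam.rho_1)
  qed
  ultimately have "ell2_delta u u - ell2_delta \<one> u = (0::complex)"
    by metis
  then show False
    using uP(3) by (simp add: ell2_delta_def)
qed

end

theorem theorem5p9:
  fixes G :: "('g, 'm) monoid_scheme" and P :: "'g set"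
  assumes "group G" and "submonoid P G"
  shows
    "let c1 = topologically_free G (Omega_topology G P) (gamma_dom G P) (gamma_hat G P);
         c2 = topologically_free (G\<lparr>carrier := unit_group G P\<rparr>) (Omega_topology G P)
                (gamma_dom G P) (gamma_hat G P);
         c3 = (\<forall>u\<in>unit_group G P - {\<one>\<^bsub>G\<^esub>}. \<forall>\<C>.
                finite \<C> \<and> \<C> \<subseteq> constructible G P - {P} \<longrightarrow>
                (\<exists>t\<in>P - \<Union>\<C>. (u \<otimes>\<^bsub>G\<^esub> t) <#\<^bsub>G\<^esub> P \<noteq> t <#\<^bsub>G\<^esub> P));
         c3' = (\<forall>u\<in>unit_group G P - {\<one>\<^bsub>G\<^esub>}. \<forall>\<C>.
                finite \<C> \<and> \<C> \<subseteq> constructible G P - {P} \<longrightarrow>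
                (\<exists>t\<in>P - \<Union>\<C>. u \<otimes>\<^bsub>G\<^esub> t \<notin> t <#\<^bsub>G\<^esub> unit_group G P));
         c4 = (\<forall>I. ideal I (Toeplitz_u G P) \<and> norm_closed (Toeplitz_u G P) I \<and>
                I \<inter> D_u G P = {\<zero>\<^bsub>Toeplitz_u G P\<^esub>} \<longrightarrow>
                I \<subseteq> a_kernel (Toeplitz_u G P) (Toeplitz_lambda G P) (lambda_plus G P))
     in (c1 \<longleftrightarrow> c2) \<and> (c2 \<longleftrightarrow> c3) \<and> (c3 \<longleftrightarrow> c3') \<and> (c3 \<longleftrightarrow> c4)"
proof -
  interpret toeplitz_algebra G P
    using assms by (simp add: toeplitz_algebra_def group_submonoid_def)
  \<comment> \<open>Both forms of (3) say that t^{-1} u t is not a unit; \<open>c\<close> is this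
    common form, through which every implication passes.\<close>
  define c where "c \<longleftrightarrow> (\<forall>u\<in>U\<^sub>P - {\<one>\<^bsub>G\<^esub>}. \<forall>\<C>. finite \<C> \<and> \<C> \<subseteq> J - {P} \<longrightarrow>
    (\<exists>t\<in>P - \<Union>\<C>. inv\<^bsub>G\<^esub> t \<otimes>\<^bsub>G\<^esub> (u \<otimes>\<^bsub>G\<^esub> t) \<notin> U\<^sub>P))"
  have c3: "(\<forall>u\<in>U\<^sub>P - {\<one>\<^bsub>G\<^esub>}. \<forall>\<C>. finite \<C> \<and> \<C> \<subseteq> J - {P} \<longrightarrow>
      (\<exists>t\<in>P - \<Union>\<C>. (u \<otimes>\<^bsub>G\<^esub> t) <#\<^bsub>G\<^esub> P \<noteq> t <#\<^bsub>G\<^esub> P)) \<longleftrightarrow> c"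
    unfolding c_def
    by (intro ball_cong iff_allI imp_cong bex_cong refl) (use coset_neq_iff in auto)
  have c3': "(\<forall>u\<in>U\<^sub>P - {\<one>\<^bsub>G\<^esub>}. \<forall>\<C>. finite \<C> \<and> \<C> \<subseteq> J - {P} \<longrightarrow>
      (\<exists>t\<in>P - \<Union>\<C>. u \<otimes>\<^bsub>G\<^esub> t \<notin> t <#\<^bsub>G\<^esub> U\<^sub>P)) \<longleftrightarrow> c"
    unfolding c_def
    by (intro ball_cong iff_allI imp_cong bex_cong refl) (use coset_neq_iff in auto)
  have c1: "topologically_free G (Omega_topology G P) (gamma_dom G P) (gamma_hat G P)" if c
    using that unfolding c_def by (intro topologically_free_if) blast
  have c2: c if "topologically_free (G\<lparr>carrier := U\<^sub>P\<rparr>) (Omega_topology G P) (gamma_dom G P) (gamma_hat G P)"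
    unfolding c_def using moves_if_topologically_free [OF that] by blast
  have c4: "I \<subseteq> a_kernel TU TL (lambda_plus G P)"
    if c "ideal I TU" "norm_closed TU I" "I \<inter> D_u G P = {\<zero>\<^bsub>TU\<^esub>}" for I
    using that(1) unfolding c_def by (intro ideal_in_kernel that(2-4)) blast
  have c4': c if "\<forall>I. ideal I TU \<and> norm_closed TU I \<and> I \<inter> D_u G P = {\<zero>\<^bsub>TU\<^esub>} \<longrightarrow>
      I \<subseteq> a_kernel TU TL (lambda_plus G P)"
    unfolding c_def using moves_if_ideals_in_kernel that by blast
  show ?thesis
    unfolding Let_def c3 c3' using c1 c2 topologically_free_units c4 c4' by blast
qed

end
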